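(* Let $(\bar y,\bar p,\bar u)\in H_0^1(\Omega)\times H_0^1(\Omega)\times L^2(\Omega)$ be the solution of the continuous optimality system (OS) and let $(\bar y_{\mathcal T},\bar p_{\mathcal T},\bar u_{\mathcal T})\in\mathbb V(\mathcal T)\times\mathbb V(\mathcal T)\times\mathbb U_{ad}(\mathcal T)$ be its numerical approximation obtained as the solution of the stabilized discrete system (DS) (SUPG or CIP stabilization), both described in the context. If the stabilization parameters satisfy $$\|\boldsymbol b\|_{L^\infty(K)}\tau_K\le Ch_K,\quad \|\boldsymbol b\|_{L^\infty(K)}\tau_K^*\le Ch_K\quad\forall K\in\mathcal T\qquad\text{(for SUPG)}$$ and $$\tau_\gamma\le Ch_\gamma^2,\quad \tau_\gamma^*\le Ch_\gamma^2\quad\forall\gamma\in\mathcal F_I\qquad\text{(for CIP)},$$ where $C$ is independent of the size of the elements in the mesh and of the physical parameters, then $$\mathcal E_{st}^2+\mathcal E_{ad}^2+\eta_{ct}^2\le \mathrm C_2\Big(\|\bar y-\bar y_{\mathcal T}\|_{\mathsf R}^2+\|\bar p-\bar p_{\mathcal T}\|_{\mathsf R}^2+\|\bar u-\bar u_{\mathcal T}\|_{L^2(\Omega)}^2+\|\mathrm{osc}^{st}\|_{L^2(\Omega)}^2+\|\mathrm{osc}^{ad}\|_{L^2(\Omega)}^2\Big),$$ where the positive constant $\mathrm C_2$ is independent of the size of the elements in the mesh, of $\nu$ and of $\boldsymbol b$.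
   Context: Setting. $\Omega\subset\mathbb R^d$, $d\in\{2,3\}$, is an open bounded polytopal domain with Lipschitz boundary; $\nu,\kappa>0$ are real constants with $0<\nu\ll1$ (convection-dominated regime); $\boldsymbol b\in W^{1,\infty}(\Omega)^d$ with $\operatorname{div}\boldsymbol b=0$; $f,y_\Omega\in L^2(\Omega)$; $\vartheta>0$; $\mathsf a<\mathsf b$ are real numbers; $\mathbb U_{ad}:=\{v\in L^2(\Omega):\mathsf a\le v(\boldsymbol x)\le\mathsf b\text{ for a.e. }\boldsymbol x\in\Omega\}$. $(\cdot,\cdot)_{L^2(G)}$ is the $L^2(G)$ inner product. For $w,v\in H_0^1(\Omega)$, $$\mathcal B(w,v):=\nu(\nabla w,\nabla v)_{L^2(\Omega)}+(\boldsymbol b\cdot\nabla w+\kappa w,v)_{L^2(\Omega)},\quad\mathcal B^*(w,v):=\nu(\nabla w,\nabla v)_{L^2(\Omega)}+(\kappa w-\boldsymbol b\cdot\nabla w,v)_{L^2(\Omega)}.$$ Norms: $|||v|||_\Omega:=(\nu\|\nabla v\|_{L^2(\Omega)}^2+\kappa\|v\|_{L^2(\Omega)}^2)^{1/2}$ and, for $v\in H_0^1(\Omega)$, $\|v\|_{\mathsf R}:=|||v|||_\Omega+\|\boldsymbol b\cdot\nabla v\|_*$ with $\|\boldsymbol b\cdot\nabla v\|_*:=\sup_{\phi\in H_0^1(\Omega)\setminus\{0\}}\langle\boldsymbol b\cdot\nabla v,\phi\rangle/|||\phi|||_\Omega$, $\langle\cdot,\cdot\rangle$ being the duality pairing of $H^{-1}(\Omega)$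 and $H_0^1(\Omega)$. (OS): $\bar y,\bar p\in H_0^1(\Omega)$, $\bar u\in\mathbb U_{ad}$ with $\mathcal B(\bar y,v)=(f+\bar u,v)_{L^2(\Omega)}$ for all $v\in H_0^1(\Omega)$; $\mathcal B^*(\bar p,w)=(\bar y-y_\Omega,w)_{L^2(\Omega)}$ for all $w\in H_0^1(\Omega)$; $(\bar p+\vartheta\bar u,u-\bar u)_{L^2(\Omega)}\ge0$ for all $u\in\mathbb U_{ad}$. Mesh. $\mathcal T$ is a conforming partition of $\bar\Omega$ into simplices, belonging to a family of conforming, shape regular meshes that are refinements of an initial mesh. $\mathcal F_I$ is the set of interior edges ($d=2$)/faces ($d=3$), $\mathcal F_K$ the set of edges/faces of $K$; $h_K,h_\gamma$ are diameters; $\boldsymbol n_\gamma^K$ is the unit exterior normal to $\gamma\in\mathcal F_K$; $K^\gamma$ is the element sharing $\gamma\in\mathcal F_K\cap\mathcal F_I$ with $K$. $\Pi_K:L^2(K)\to\mathbb P_1(K)$ is the $L^2(K)$-orthogonal projection onto polynomials of degree at most 1. $\mathbb V(\mathcal T):=\{v\in C^0(\bar\Omega):v_{|K}\in\mathbb P_1(K)\ \forall K\in\mathcal T,\ v_{|\partial\Omega}=0\}$; $\mathbb U_{ad}(\mathcal T):=\{u\in L^\infty(\Omega):u_{|K}\in\mathbb P_0(K)\ \forall K\in\mathcal T\}\cap\mathbb U_{ad}$. (DS): $\mathcal B(\bar y_{\mathcal T},v)+\sum_K\mathcal S_K(v_{|K})=(f+\bar u_{\mathcal T},v)_{L^2(\Omega)}$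 and $\mathcal B^*(\bar p_{\mathcal T},w)+\sum_K\mathcal S^*_K(w_{|K})=(\bar y_{\mathcal T}-y_\Omega,w)_{L^2(\Omega)}$ for all $v,w\in\mathbb V(\mathcal T)$, and $(\bar p_{\mathcal T}+\vartheta\bar u_{\mathcal T},u-\bar u_{\mathcal T})_{L^2(\Omega)}\ge0$ for all $u\in\mathbb U_{ad}(\mathcal T)$. (DS) is assumed to have a unique solution. For the state equation $\mathcal S_K$ is one of - SUPG: $\mathcal S_K(v)=\tau_K(\boldsymbol b\cdot\nabla\bar y_{\mathcal T}+\kappa\bar y_{\mathcal T}-f-\bar u_{\mathcal T},\boldsymbol b\cdot\nabla v)_{L^2(K)}$, - CIP: $\mathcal S_K(v)=\sum_{\gamma\in\mathcal F_K\cap\mathcal F_I}\tau_\gamma(\boldsymbol b\cdot\nabla(\bar y_{\mathcal T|K}-\bar y_{\mathcal T|K^\gamma}),\boldsymbol b\cdot\nabla v)_{L^2(\gamma)}$, and for the adjoint equation $\mathcal S^*_K$ is one of - SUPG: $\mathcal S^*_K(w)=\tau_K^*(-\boldsymbol b\cdot\nabla\bar p_{\mathcal T}+\kappa\bar p_{\mathcal T}-\bar y_{\mathcal T}+y_\Omega,-\boldsymbol b\cdot\nabla w)_{L^2(K)}$, - CIP: $\mathcal S^*_K(w)=\sum_{\gamma\in\mathcal F_K\cap\mathcal F_I}\tau_\gamma^*(\boldsymbol b\cdot\nabla(\bar p_{\mathcal T|K}-\bar p_{\mathcal T|K^\gamma}),\boldsymbol b\cdot\nabla w)_{L^2(\gamma)}$,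 with nonnegative parameters $\tau_K,\tau_\gamma,\tau_K^*,\tau_\gamma^*$. Estimators. $\hslash_\omega:=\min\{h_\omega\nu^{-1/2},\kappa^{-1/2}\}$ for $\omega=K$ or $\omega=\gamma$. For $\varrho\in\{st,ad\}$: $$\mathcal E_\varrho^2:=\sum_{K\in\mathcal T}\Big(\hslash_K^2\|\mathscr R_K^\varrho\|_{L^2(K)}^2+\sum_{\gamma\in\mathcal F_K\cap\mathcal F_I}\nu^{-1/2}\hslash_\gamma\|[\![J_\gamma^\varrho]\!]\|_{L^2(\gamma)}^2\Big),\quad \|\mathrm{osc}^\varrho\|_{L^2(\Omega)}:=\Big(\sum_{K\in\mathcal T}\hslash_K^2\|\mathrm{osc}_K^\varrho\|_{L^2(K)}^2\Big)^{1/2},$$ where $\mathscr R_K^{st}:=\Pi_K(f)+\bar u_{\mathcal T|K}-\Pi_K(\boldsymbol b\cdot\nabla\bar y_{\mathcal T})-\kappa\bar y_{\mathcal T|K}$, $\mathrm{osc}_K^{st}:=f-\Pi_K(f)-(\boldsymbol b\cdot\nabla\bar y_{\mathcal T|K}-\Pi_K(\boldsymbol b\cdot\nabla\bar y_{\mathcal T}))$, $\mathscr R_K^{ad}:=\bar y_{\mathcal T|K}-\Pi_K(y_\Omega)+\Pi_K(\boldsymbol b\cdot\nabla\bar p_{\mathcal T})-\kappa\bar p_{\mathcal T|K}$, $\mathrm{osc}_K^{ad}:=-(y_\Omega-\Pi_K(y_\Omega))+\boldsymbol b\cdot\nabla\bar p_{\mathcal T|K}-\Pi_K(\boldsymbol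 b\cdot\nabla\bar p_{\mathcal T})$, and for $\gamma\in\mathcal F_K\cap\mathcal F_{K'}$, $K\ne K'$, $[\![J^\varrho_\gamma]\!]:=\frac12(J^\varrho_{\gamma,K}+J^\varrho_{\gamma,K'})$ with $J^{st}_{\gamma,K}:=\nu\nabla\bar y_{\mathcal T|K}\cdot\boldsymbol n_\gamma^K$, $J^{ad}_{\gamma,K}:=\nu\nabla\bar p_{\mathcal T|K}\cdot\boldsymbol n_\gamma^K$. $\eta_{ct}:=\|\bar u_{\mathcal T}-\Pi(-\frac1\vartheta\bar p_{\mathcal T})\|_{L^2(\Omega)}$ with $(\Pi(w))(\boldsymbol x):=\min\{\mathsf b,\max\{\mathsf a,w(\boldsymbol x)\}\}$. *)

theory Defs
  imports "HOL-Analysis.Analysis" "HOL-Probability.Essential_Supremum"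
begin

section \<open>Lebesgue spaces\<close>

text \<open>
  Elements of Lebesgue and Sobolev spaces are represented by functions; two functions that agree
  almost everywhere stand for the same element.
\<close>

definition l2_inner :: "'a measure \<Rightarrow> ('a \<Rightarrow> 'b::euclidean_space) \<Rightarrow> ('a \<Rightarrow> 'b) \<Rightarrow> real"
  where "l2_inner M f g = (\<integral>x. f x \<bullet> g x \<partial>M)"

definition l2_norm :: "'a measure \<Rightarrow> ('a \<Rightarrow> 'b::euclidean_space) \<Rightarrow> real"
  where "l2_norm M f = sqrt (l2_inner M f f)"

definition L2 :: "'a measure \<Rightarrow> ('a \<Rightarrow> 'b::euclidean_space) set"
  where "L2 M = {f \<in> borel_measurable M. integrable M (\<lambda>x. (norm (f x))\<^sup>2)}"

definition linf_norm :: "'a measure \<Rightarrow> ('a \<Rightarrow> 'b::euclidean_space) \<Rightarrow> ereal"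
  where "linf_norm M f = esssup M (\<lambda>x. ereal (norm (f x)))"

definition Linf :: "'a measure \<Rightarrow> ('a \<Rightarrow> 'b::euclidean_space) set"
  where "Linf M = {f \<in> borel_measurable M. linf_norm M f < \<infinity>}"

section \<open>Sobolev spaces\<close>

text \<open>\<open>Ck k f\<close>: all partial derivatives of \<open>f\<close> up to order \<open>k\<close> exist and are continuous.\<close>

primrec Ck :: "nat \<Rightarrow> ('a::euclidean_space \<Rightarrow> real) \<Rightarrow> bool"
  where
    "Ck 0 f \<longleftrightarrow> continuous_on UNIV f"
  | "Ck (Suc k) f \<longleftrightarrow> f differentiable_on UNIV \<and>
       (\<forall>e\<in>Basis. Ck k (\<lambda>x. frechet_derivative f (at x) e))"

definition test_functions :: "'a::euclidean_space set \<Rightarrow> ('a \<Rightarrow> real) set"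
  where "test_functions \<Omega> =
    {\<phi>. (\<forall>k. Ck k \<phi>) \<and> compact (closure {x. \<phi> x \<noteq> 0}) \<and> closure {x. \<phi> x \<noteq> 0} \<subseteq> \<Omega>}"

definition grad :: "('a::euclidean_space \<Rightarrow> real) \<Rightarrow> 'a \<Rightarrow> 'a"
  where "grad f x = (THE D. GDERIV f x :> D)"

definition locally_integrable :: "'a::euclidean_space set \<Rightarrow> ('a \<Rightarrow> 'b::euclidean_space) \<Rightarrow> bool"
  where "locally_integrable \<Omega> f \<longleftrightarrow>
    (\<forall>K. compact K \<and> K \<subseteq> \<Omega> \<longrightarrow> integrable (lebesgue_on K) f)"

definition is_weak_grad :: "'a::euclidean_space set \<Rightarrow> ('a \<Rightarrow> real) \<Rightarrow> ('a \<Rightarrow> 'a) \<Rightarrow> bool"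
  where "is_weak_grad \<Omega> v g \<longleftrightarrow> locally_integrable \<Omega> v \<and> locally_integrable \<Omega> g \<and>
    (\<forall>\<phi>\<in>test_functions \<Omega>. \<forall>e\<in>Basis.
      (\<integral>x. v x * (grad \<phi> x \<bullet> e) \<partial>lebesgue_on \<Omega>) = - (\<integral>x. (g x \<bullet> e) * \<phi> x \<partial>lebesgue_on \<Omega>))"

text \<open>The weak gradient is determined up to null sets; one representative is chosen.\<close>

definition wgrad :: "'a::euclidean_space set \<Rightarrow> ('a \<Rightarrow> real) \<Rightarrow> 'a \<Rightarrow> 'a"
  where "wgrad \<Omega> v = (SOME g. is_weak_grad \<Omega> v g)"

definition H1 :: "'a::euclidean_space set \<Rightarrow> ('a \<Rightarrow> real) set"
  where "H1 \<Omega> = {v \<in> L2 (lebesgue_on \<Omega>). \<exists>g\<in>L2 (lebesgue_on \<Omega>). is_weak_grad \<Omega> v g}"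

definition H10 :: "'a::euclidean_space set \<Rightarrow> ('a \<Rightarrow> real) set"
  where "H10 \<Omega> = {v \<in> H1 \<Omega>. \<exists>\<phi>. (\<forall>n::nat. \<phi> n \<in> test_functions \<Omega>) \<and>
    (\<lambda>n. l2_norm (lebesgue_on \<Omega>) (\<lambda>x. v x - \<phi> n x)) \<longlonglongrightarrow> 0 \<and>
    (\<lambda>n. l2_norm (lebesgue_on \<Omega>) (\<lambda>x. wgrad \<Omega> v x - grad (\<phi> n) x)) \<longlonglongrightarrow> 0}"

definition W1inf :: "'a::euclidean_space set \<Rightarrow> ('a \<Rightarrow> real) set"
  where "W1inf \<Omega> = {v \<in> Linf (lebesgue_on \<Omega>). \<exists>g\<in>Linf (lebesgue_on \<Omega>). is_weak_grad \<Omega> v g}"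

definition weak_div :: "'a::euclidean_space set \<Rightarrow> ('a \<Rightarrow> 'a) \<Rightarrow> 'a \<Rightarrow> real"
  where "weak_div \<Omega> b x = (\<Sum>e\<in>Basis. wgrad \<Omega> (\<lambda>z. b z \<bullet> e) x \<bullet> e)"

definition convection_field :: "'a::euclidean_space set \<Rightarrow> ('a \<Rightarrow> 'a) \<Rightarrow> bool"
  where "convection_field \<Omega> b \<longleftrightarrow>
    (\<forall>e\<in>Basis. (\<lambda>x. b x \<bullet> e) \<in> W1inf \<Omega>) \<and> (AE x in lebesgue_on \<Omega>. weak_div \<Omega> b x = 0)"

text \<open>
  On a Lipschitz domain a \<open>W\<^sup>1\<^sup>,\<^sup>\<infinity>\<close> field has a representative that is continuous up to the boundary.
  Its values are the ones meant in integrals over faces, which are null sets of the domain.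
\<close>

definition continuous_rep :: "'a::euclidean_space set \<Rightarrow> ('a \<Rightarrow> 'a) \<Rightarrow> 'a \<Rightarrow> 'a"
  where "continuous_rep \<Omega> b =
    (SOME c. continuous_on (closure \<Omega>) c \<and> (AE x in lebesgue_on \<Omega>. c x = b x))"

section \<open>Domain and meshes\<close>

definition lipschitz_boundary :: "'a::euclidean_space set \<Rightarrow> bool"
  where "lipschitz_boundary \<Omega> \<longleftrightarrow>
    (\<forall>x\<in>frontier \<Omega>. \<exists>r>0. \<exists>e L. \<exists>g :: 'a \<Rightarrow> real. norm e = 1 \<and> L-lipschitz_on UNIV g \<and>
      \<Omega> \<inter> ball x r = {z \<in> ball x r. z \<bullet> e < g (z - (z \<bullet> e) *\<^sub>R e)})"

definition polytopal :: "'a::euclidean_space set \<Rightarrow> bool"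
  where "polytopal \<Omega> \<longleftrightarrow> (\<exists>P. finite P \<and> (\<forall>Q\<in>P. polytope Q) \<and> closure \<Omega> = \<Union>P)"

definition polytopal_lipschitz_domain :: "'a::euclidean_space set \<Rightarrow> bool"
  where "polytopal_lipschitz_domain \<Omega> \<longleftrightarrow>
    open \<Omega> \<and> connected \<Omega> \<and> \<Omega> \<noteq> {} \<and> bounded \<Omega> \<and> polytopal \<Omega> \<and> lipschitz_boundary \<Omega>"

text \<open>Conformity is the face-to-face condition contained in \<^const>\<open>triangulation\<close>.\<close>

definition mesh :: "'a::euclidean_space set \<Rightarrow> 'a set set \<Rightarrow> bool"
  where "mesh \<Omega> T \<longleftrightarrow> triangulation T \<and> (\<forall>K\<in>T. int DIM('a) simplex K) \<and> \<Union>T = closure \<Omega>"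

definition refines :: "'a set set \<Rightarrow> 'a set set \<Rightarrow> bool"
  where "refines T T0 \<longleftrightarrow> (\<forall>K\<in>T. \<exists>K0\<in>T0. K \<subseteq> K0)"

definition inball_diameter :: "'a::euclidean_space set \<Rightarrow> real"
  where "inball_diameter K = Sup {2 * r | r. 0 \<le> r \<and> (\<exists>x. cball x r \<subseteq> K)}"

definition shape_regular :: "'a::euclidean_space set set set \<Rightarrow> bool"
  where "shape_regular TT \<longleftrightarrow> (\<exists>\<sigma>. \<forall>T\<in>TT. \<forall>K\<in>T. diameter K \<le> \<sigma> * inball_diameter K)"

definition mesh_family :: "'a::euclidean_space set \<Rightarrow> 'a set set \<Rightarrow> 'a set set set \<Rightarrow> bool"
  where "mesh_family \<Omega> T0 TT \<longleftrightarrow>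
    mesh \<Omega> T0 \<and> (\<forall>T\<in>TT. mesh \<Omega> T \<and> refines T T0) \<and> shape_regular TT"

definition faces :: "'a::euclidean_space set \<Rightarrow> 'a set set"
  where "faces K = {\<gamma>. \<gamma> facet_of K}"

definition interior_faces :: "'a::euclidean_space set set \<Rightarrow> 'a set set"
  where "interior_faces T = {\<gamma>. \<exists>K\<in>T. \<exists>K'\<in>T. K \<noteq> K' \<and> \<gamma> \<in> faces K \<inter> faces K'}"

definition neighbour :: "'a::euclidean_space set set \<Rightarrow> 'a set \<Rightarrow> 'a set \<Rightarrow> 'a set"
  where "neighbour T K \<gamma> = (THE K'. K' \<in> T \<and> K' \<noteq> K \<and> \<gamma> \<in> faces K')"

definition outer_normal :: "'a::euclidean_space set \<Rightarrow> 'a set \<Rightarrow> 'a"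
  where "outer_normal K \<gamma> = (THE n. norm n = 1 \<and> (\<forall>x\<in>\<gamma>. \<forall>z\<in>K. n \<bullet> (z - x) \<le> 0))"

text \<open>
  Surface measure on a flat face: the measure of a part \<open>A\<close> of the face is the Lebesgue measure of
  the right cylinder of height 1 over \<open>A\<close>. It does not depend on the choice of the unit normal.
\<close>

definition face_normal :: "'a::euclidean_space set \<Rightarrow> 'a"
  where "face_normal \<gamma> = (SOME n. norm n = 1 \<and> (\<forall>x\<in>\<gamma>. \<forall>z\<in>\<gamma>. n \<bullet> (z - x) = 0))"

definition face_measure :: "'a::euclidean_space set \<Rightarrow> 'a measure"
  where "face_measure \<gamma> =
    distr (lebesgue_on {x + t *\<^sub>R face_normal \<gamma> | x t. x \<in> \<gamma> \<and> 0 \<le> t \<and> t \<le> 1})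
      (restrict_space borel \<gamma>) (closest_point (affine hull \<gamma>))"

section \<open>Discrete spaces\<close>

definition P1 :: "('a::euclidean_space \<Rightarrow> real) set"
  where "P1 = {q. \<exists>c g. q = (\<lambda>x. c + g \<bullet> x)}"

definition proj_P1 :: "'a::euclidean_space set \<Rightarrow> ('a \<Rightarrow> real) \<Rightarrow> 'a \<Rightarrow> real"
  where "proj_P1 K f =
    (THE q. q \<in> P1 \<and> (\<forall>r\<in>P1. l2_inner (lebesgue_on K) (\<lambda>x. f x - q x) r = 0))"

definition elem_grad :: "('a::euclidean_space \<Rightarrow> real) \<Rightarrow> 'a set \<Rightarrow> 'a" \<comment> \<open>for \<open>v\<close> affine on \<open>K\<close>\<close>
  where "elem_grad v K = (THE g. \<exists>c. \<forall>x\<in>K. v x = c + g \<bullet> x)"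

definition VT :: "'a::euclidean_space set \<Rightarrow> 'a set set \<Rightarrow> ('a \<Rightarrow> real) set"
  where "VT \<Omega> T = {v. continuous_on (closure \<Omega>) v \<and>
    (\<forall>K\<in>T. \<exists>q\<in>P1. \<forall>x\<in>K. v x = q x) \<and> (\<forall>x\<in>frontier \<Omega>. v x = 0)}"

definition Uad :: "'a::euclidean_space set \<Rightarrow> real \<Rightarrow> real \<Rightarrow> ('a \<Rightarrow> real) set"
  where "Uad \<Omega> lo hi = {v \<in> L2 (lebesgue_on \<Omega>). AE x in lebesgue_on \<Omega>. lo \<le> v x \<and> v x \<le> hi}"

definition UadT :: "'a::euclidean_space set \<Rightarrow> 'a set set \<Rightarrow> real \<Rightarrow> real \<Rightarrow> ('a \<Rightarrow> real) set"
  where "UadT \<Omega> T lo hi =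
    {u \<in> Linf (lebesgue_on \<Omega>). \<forall>K\<in>T. \<exists>c. AE x in lebesgue_on K. u x = c} \<inter> Uad \<Omega> lo hi"

section \<open>Bilinear forms and norms\<close>

definition form_B :: "'a::euclidean_space set \<Rightarrow> real \<Rightarrow> real \<Rightarrow> ('a \<Rightarrow> 'a) \<Rightarrow>
    ('a \<Rightarrow> real) \<Rightarrow> ('a \<Rightarrow> real) \<Rightarrow> real"
  where "form_B \<Omega> \<nu> \<kappa> b w v =
    \<nu> * l2_inner (lebesgue_on \<Omega>) (wgrad \<Omega> w) (wgrad \<Omega> v)
    + l2_inner (lebesgue_on \<Omega>) (\<lambda>x. b x \<bullet> wgrad \<Omega> w x + \<kappa> * w x) v"

definition form_B_adj :: "'a::euclidean_space set \<Rightarrow> real \<Rightarrow> real \<Rightarrow> ('a \<Rightarrow> 'a) \<Rightarrow>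
    ('a \<Rightarrow> real) \<Rightarrow> ('a \<Rightarrow> real) \<Rightarrow> real"
  where "form_B_adj \<Omega> \<nu> \<kappa> b w v =
    \<nu> * l2_inner (lebesgue_on \<Omega>) (wgrad \<Omega> w) (wgrad \<Omega> v)
    + l2_inner (lebesgue_on \<Omega>) (\<lambda>x. \<kappa> * w x - b x \<bullet> wgrad \<Omega> w x) v"

definition energy_norm :: "'a::euclidean_space set \<Rightarrow> real \<Rightarrow> real \<Rightarrow> ('a \<Rightarrow> real) \<Rightarrow> real"
  where "energy_norm \<Omega> \<nu> \<kappa> v =
    sqrt (\<nu> * (l2_norm (lebesgue_on \<Omega>) (wgrad \<Omega> v))\<^sup>2 + \<kappa> * (l2_norm (lebesgue_on \<Omega>) v)\<^sup>2)"

text \<open>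
  For \<open>v\<close> in \<open>H\<^sub>0\<^sup>1\<close> the function \<open>b \<bullet> \<nabla>v\<close> is square integrable, so its duality pairing with
  \<open>\<phi>\<close> is their \<open>L\<^sup>2\<close> inner product.
\<close>

definition dual_conv_norm :: "'a::euclidean_space set \<Rightarrow> real \<Rightarrow> real \<Rightarrow> ('a \<Rightarrow> 'a) \<Rightarrow>
    ('a \<Rightarrow> real) \<Rightarrow> real"
  where "dual_conv_norm \<Omega> \<nu> \<kappa> b v =
    (SUP \<phi>\<in>{\<phi> \<in> H10 \<Omega>. \<not> (AE x in lebesgue_on \<Omega>. \<phi> x = 0)}.
      l2_inner (lebesgue_on \<Omega>) (\<lambda>x. b x \<bullet> wgrad \<Omega> v x) \<phi> / energy_norm \<Omega> \<nu> \<kappa> \<phi>)"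

definition R_norm :: "'a::euclidean_space set \<Rightarrow> real \<Rightarrow> real \<Rightarrow> ('a \<Rightarrow> 'a) \<Rightarrow> ('a \<Rightarrow> real) \<Rightarrow> real"
  where "R_norm \<Omega> \<nu> \<kappa> b v = energy_norm \<Omega> \<nu> \<kappa> v + dual_conv_norm \<Omega> \<nu> \<kappa> b v"

section \<open>Optimality systems\<close>

definition os_solution :: "'a::euclidean_space set \<Rightarrow> real \<Rightarrow> real \<Rightarrow> ('a \<Rightarrow> 'a) \<Rightarrow>
    ('a \<Rightarrow> real) \<Rightarrow> ('a \<Rightarrow> real) \<Rightarrow> real \<Rightarrow> real \<Rightarrow> real \<Rightarrow>
    ('a \<Rightarrow> real) \<Rightarrow> ('a \<Rightarrow> real) \<Rightarrow> ('a \<Rightarrow> real) \<Rightarrow> bool"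
  where "os_solution \<Omega> \<nu> \<kappa> b f yd \<theta> lo hi y p u \<longleftrightarrow>
    y \<in> H10 \<Omega> \<and> p \<in> H10 \<Omega> \<and> u \<in> Uad \<Omega> lo hi \<and>
    (\<forall>v\<in>H10 \<Omega>. form_B \<Omega> \<nu> \<kappa> b y v = l2_inner (lebesgue_on \<Omega>) (\<lambda>x. f x + u x) v) \<and>
    (\<forall>w\<in>H10 \<Omega>. form_B_adj \<Omega> \<nu> \<kappa> b p w = l2_inner (lebesgue_on \<Omega>) (\<lambda>x. y x - yd x) w) \<and>
    (\<forall>u'\<in>Uad \<Omega> lo hi.
      l2_inner (lebesgue_on \<Omega>) (\<lambda>x. p x + \<theta> * u x) (\<lambda>x. u' x - u x) \<ge> 0)"

datatype stabilization = SUPG | CIP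

text \<open>\<open>cip T br \<tau>\<gamma> v K w\<close>: the CIP term of \<open>v\<close> on \<open>K\<close>, tested with \<open>w\<close>.\<close>

definition cip :: "'a::euclidean_space set set \<Rightarrow> ('a \<Rightarrow> 'a) \<Rightarrow> ('a set \<Rightarrow> real) \<Rightarrow>
    ('a \<Rightarrow> real) \<Rightarrow> 'a set \<Rightarrow> ('a \<Rightarrow> real) \<Rightarrow> real"
  where "cip T br \<tau>\<gamma> v K w =
    (\<Sum>\<gamma>\<in>faces K \<inter> interior_faces T. \<tau>\<gamma> \<gamma> *
      l2_inner (face_measure \<gamma>) (\<lambda>x. br x \<bullet> (elem_grad v K - elem_grad v (neighbour T K \<gamma>)))
        (\<lambda>x. br x \<bullet> elem_grad w K))"

definition stab_state :: "stabilization \<Rightarrow> 'a::euclidean_space set \<Rightarrow> 'a set set \<Rightarrow> real \<Rightarrow>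
    ('a \<Rightarrow> 'a) \<Rightarrow> ('a \<Rightarrow> real) \<Rightarrow> ('a set \<Rightarrow> real) \<Rightarrow> ('a set \<Rightarrow> real) \<Rightarrow>
    ('a \<Rightarrow> real) \<Rightarrow> ('a \<Rightarrow> real) \<Rightarrow> 'a set \<Rightarrow> ('a \<Rightarrow> real) \<Rightarrow> real"
  where "stab_state s \<Omega> T \<kappa> b f \<tau>K \<tau>\<gamma> y u K v = (case s of
      SUPG \<Rightarrow> \<tau>K K * l2_inner (lebesgue_on K)
        (\<lambda>x. b x \<bullet> elem_grad y K + \<kappa> * y x - f x - u x) (\<lambda>x. b x \<bullet> elem_grad v K)
    | CIP \<Rightarrow> cip T (continuous_rep \<Omega> b) \<tau>\<gamma> y K v)"

definition stab_adjoint :: "stabilization \<Rightarrow> 'a::euclidean_space set \<Rightarrow> 'a set set \<Rightarrow> real \<Rightarrow>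
    ('a \<Rightarrow> 'a) \<Rightarrow> ('a \<Rightarrow> real) \<Rightarrow> ('a set \<Rightarrow> real) \<Rightarrow> ('a set \<Rightarrow> real) \<Rightarrow>
    ('a \<Rightarrow> real) \<Rightarrow> ('a \<Rightarrow> real) \<Rightarrow> 'a set \<Rightarrow> ('a \<Rightarrow> real) \<Rightarrow> real"
  where "stab_adjoint s \<Omega> T \<kappa> b yd \<tau>K \<tau>\<gamma> y p K w = (case s of
      SUPG \<Rightarrow> \<tau>K K * l2_inner (lebesgue_on K)
        (\<lambda>x. - (b x \<bullet> elem_grad p K) + \<kappa> * p x - y x + yd x) (\<lambda>x. - (b x \<bullet> elem_grad w K))
    | CIP \<Rightarrow> cip T (continuous_rep \<Omega> b) \<tau>\<gamma> p K w)"

definition ds_solution :: "stabilization \<Rightarrow> stabilization \<Rightarrow> 'a::euclidean_space set \<Rightarrow> 'a set set \<Rightarrow>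
    real \<Rightarrow> real \<Rightarrow> ('a \<Rightarrow> 'a) \<Rightarrow> ('a \<Rightarrow> real) \<Rightarrow> ('a \<Rightarrow> real) \<Rightarrow> real \<Rightarrow> real \<Rightarrow> real \<Rightarrow>
    ('a set \<Rightarrow> real) \<Rightarrow> ('a set \<Rightarrow> real) \<Rightarrow> ('a set \<Rightarrow> real) \<Rightarrow> ('a set \<Rightarrow> real) \<Rightarrow>
    ('a \<Rightarrow> real) \<Rightarrow> ('a \<Rightarrow> real) \<Rightarrow> ('a \<Rightarrow> real) \<Rightarrow> bool"
  where "ds_solution s s' \<Omega> T \<nu> \<kappa> b f yd \<theta> lo hi \<tau>K \<tau>\<gamma> \<tau>K' \<tau>\<gamma>' y p u \<longleftrightarrow>
    y \<in> VT \<Omega> T \<and> p \<in> VT \<Omega> T \<and> u \<in> UadT \<Omega> T lo hi \<and>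
    (\<forall>v\<in>VT \<Omega> T.
      form_B \<Omega> \<nu> \<kappa> b y v + (\<Sum>K\<in>T. stab_state s \<Omega> T \<kappa> b f \<tau>K \<tau>\<gamma> y u K v)
      = l2_inner (lebesgue_on \<Omega>) (\<lambda>x. f x + u x) v) \<and>
    (\<forall>w\<in>VT \<Omega> T.
      form_B_adj \<Omega> \<nu> \<kappa> b p w + (\<Sum>K\<in>T. stab_adjoint s' \<Omega> T \<kappa> b yd \<tau>K' \<tau>\<gamma>' y p K w)
      = l2_inner (lebesgue_on \<Omega>) (\<lambda>x. y x - yd x) w) \<and>
    (\<forall>u'\<in>UadT \<Omega> T lo hi.
      l2_inner (lebesgue_on \<Omega>) (\<lambda>x. p x + \<theta> * u x) (\<lambda>x. u' x - u x) \<ge> 0)"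

definition ds_unique_solution :: "stabilization \<Rightarrow> stabilization \<Rightarrow> 'a::euclidean_space set \<Rightarrow>
    'a set set \<Rightarrow> real \<Rightarrow> real \<Rightarrow> ('a \<Rightarrow> 'a) \<Rightarrow> ('a \<Rightarrow> real) \<Rightarrow> ('a \<Rightarrow> real) \<Rightarrow> real \<Rightarrow> real \<Rightarrow> real \<Rightarrow>
    ('a set \<Rightarrow> real) \<Rightarrow> ('a set \<Rightarrow> real) \<Rightarrow> ('a set \<Rightarrow> real) \<Rightarrow> ('a set \<Rightarrow> real) \<Rightarrow>
    ('a \<Rightarrow> real) \<Rightarrow> ('a \<Rightarrow> real) \<Rightarrow> ('a \<Rightarrow> real) \<Rightarrow> bool"
  where "ds_unique_solution s s' \<Omega> T \<nu> \<kappa> b f yd \<theta> lo hi \<tau>K \<tau>\<gamma> \<tau>K' \<tau>\<gamma>' y p u \<longleftrightarrow>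
    ds_solution s s' \<Omega> T \<nu> \<kappa> b f yd \<theta> lo hi \<tau>K \<tau>\<gamma> \<tau>K' \<tau>\<gamma>' y p u \<and>
    (\<forall>y' p' u'. ds_solution s s' \<Omega> T \<nu> \<kappa> b f yd \<theta> lo hi \<tau>K \<tau>\<gamma> \<tau>K' \<tau>\<gamma>' y' p' u' \<longrightarrow>
      (\<forall>x\<in>closure \<Omega>. y' x = y x \<and> p' x = p x) \<and> (AE x in lebesgue_on \<Omega>. u' x = u x))"

text \<open>
  The bounds on the stabilization parameters (\<open>\<tau>K\<close> on elements, \<open>\<tau>\<gamma>\<close> on faces) are only imposed
  for the scheme in use.
\<close>

definition stab_params :: "stabilization \<Rightarrow> real \<Rightarrow> 'a::euclidean_space set set \<Rightarrow> ('a \<Rightarrow> 'a) \<Rightarrow>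
    ('a set \<Rightarrow> real) \<Rightarrow> ('a set \<Rightarrow> real) \<Rightarrow> bool"
  where "stab_params s C T b \<tau>K \<tau>\<gamma> \<longleftrightarrow> (case s of
      SUPG \<Rightarrow> (\<forall>K\<in>T. 0 \<le> \<tau>K K \<and>
        linf_norm (lebesgue_on K) b * ereal (\<tau>K K) \<le> ereal (C * diameter K))
    | CIP \<Rightarrow> (\<forall>\<gamma>\<in>interior_faces T. 0 \<le> \<tau>\<gamma> \<gamma> \<and> \<tau>\<gamma> \<gamma> \<le> C * (diameter \<gamma>)\<^sup>2))"

section \<open>Error estimators\<close>

definition hbar :: "real \<Rightarrow> real \<Rightarrow> 'a::euclidean_space set \<Rightarrow> real"
  where "hbar \<nu> \<kappa> \<omega> = min (diameter \<omega> * \<nu> powr (-1/2)) (\<kappa> powr (-1/2))"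

definition res_state :: "real \<Rightarrow> ('a::euclidean_space \<Rightarrow> 'a) \<Rightarrow> ('a \<Rightarrow> real) \<Rightarrow>
    ('a \<Rightarrow> real) \<Rightarrow> ('a \<Rightarrow> real) \<Rightarrow> 'a set \<Rightarrow> 'a \<Rightarrow> real"
  where "res_state \<kappa> b f y u K x =
    proj_P1 K f x + u x - proj_P1 K (\<lambda>z. b z \<bullet> elem_grad y K) x - \<kappa> * y x"

definition osc_state :: "('a::euclidean_space \<Rightarrow> 'a) \<Rightarrow> ('a \<Rightarrow> real) \<Rightarrow>
    ('a \<Rightarrow> real) \<Rightarrow> 'a set \<Rightarrow> 'a \<Rightarrow> real"
  where "osc_state b f y K x =
    f x - proj_P1 K f x - (b x \<bullet> elem_grad y K - proj_P1 K (\<lambda>z. b z \<bullet> elem_grad y K) x)"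

definition res_adjoint :: "real \<Rightarrow> ('a::euclidean_space \<Rightarrow> 'a) \<Rightarrow> ('a \<Rightarrow> real) \<Rightarrow>
    ('a \<Rightarrow> real) \<Rightarrow> ('a \<Rightarrow> real) \<Rightarrow> 'a set \<Rightarrow> 'a \<Rightarrow> real"
  where "res_adjoint \<kappa> b yd y p K x =
    y x - proj_P1 K yd x + proj_P1 K (\<lambda>z. b z \<bullet> elem_grad p K) x - \<kappa> * p x"

definition osc_adjoint :: "('a::euclidean_space \<Rightarrow> 'a) \<Rightarrow> ('a \<Rightarrow> real) \<Rightarrow>
    ('a \<Rightarrow> real) \<Rightarrow> 'a set \<Rightarrow> 'a \<Rightarrow> real"
  where "osc_adjoint b yd p K x =
    - (yd x - proj_P1 K yd x) + b x \<bullet> elem_grad p K - proj_P1 K (\<lambda>z. b z \<bullet> elem_grad p K) x"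

definition flux :: "real \<Rightarrow> ('a::euclidean_space \<Rightarrow> real) \<Rightarrow> 'a set \<Rightarrow> 'a set \<Rightarrow> real"
  where "flux \<nu> v \<gamma> K = \<nu> * (elem_grad v K \<bullet> outer_normal K \<gamma>)"

definition flux_jump :: "'a::euclidean_space set set \<Rightarrow> real \<Rightarrow> ('a \<Rightarrow> real) \<Rightarrow> 'a set \<Rightarrow> 'a set \<Rightarrow> real"
  where "flux_jump T \<nu> v K \<gamma> = 1/2 * (flux \<nu> v \<gamma> K + flux \<nu> v \<gamma> (neighbour T K \<gamma>))"

text \<open>\<open>r K\<close> is the element residual and \<open>v\<close> the function whose flux jumps are measured.\<close>

definition estimator :: "'a::euclidean_space set set \<Rightarrow> real \<Rightarrow> real \<Rightarrow>
    ('a set \<Rightarrow> 'a \<Rightarrow> real) \<Rightarrow> ('a \<Rightarrow> real) \<Rightarrow> real"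
  where "estimator T \<nu> \<kappa> r v = sqrt (\<Sum>K\<in>T.
    (hbar \<nu> \<kappa> K)\<^sup>2 * (l2_norm (lebesgue_on K) (r K))\<^sup>2
    + (\<Sum>\<gamma>\<in>faces K \<inter> interior_faces T.
        \<nu> powr (-1/2) * hbar \<nu> \<kappa> \<gamma> * (l2_norm (face_measure \<gamma>) (\<lambda>_. flux_jump T \<nu> v K \<gamma>))\<^sup>2))"

definition osc_norm :: "'a::euclidean_space set set \<Rightarrow> real \<Rightarrow> real \<Rightarrow> ('a set \<Rightarrow> 'a \<Rightarrow> real) \<Rightarrow> real"
  where "osc_norm T \<nu> \<kappa> osc =
    sqrt (\<Sum>K\<in>T. (hbar \<nu> \<kappa> K)\<^sup>2 * (l2_norm (lebesgue_on K) (osc K))\<^sup>2)"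

definition proj_box :: "real \<Rightarrow> real \<Rightarrow> ('a \<Rightarrow> real) \<Rightarrow> 'a \<Rightarrow> real"
  where "proj_box lo hi w x = min hi (max lo (w x))"

definition eta_ct :: "'a::euclidean_space set \<Rightarrow> real \<Rightarrow> real \<Rightarrow> real \<Rightarrow>
    ('a \<Rightarrow> real) \<Rightarrow> ('a \<Rightarrow> real) \<Rightarrow> real"
  where "eta_ct \<Omega> \<theta> lo hi p u =
    l2_norm (lebesgue_on \<Omega>) (\<lambda>x. u x - proj_box lo hi (\<lambda>z. - (1/\<theta>) * p z) x)"

end

theory Submission
  imports Defs
begin

text \<open>
  The proof is Verfuerth's bubble function argument. Write \<open>y\<close> for one of the exact solutions, \<open>v\<close> for its
  finite element approximation and \<open>\<hh>\<close> for the local scale \<open>hbar \<nu> \<kappa>\<close>. Testing the exact equation with a smooth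
  function \<open>w\<close> of compact support and integrating elementwise (\<open>residual_identity\<close>) gives

    \<open>(\<Sum>K. \<integral> (res K + osc K) * w over K) - \<nu> * \<integral> \<nabla>v \<bullet> \<nabla>w = (functional of the error)(w)\<close>,

  and the norm \<open>R_norm\<close> is made for the right-hand side: its energy part bounds the diffusion and reaction terms,
  its dual part the convection term, both by the energy norm of \<open>w\<close> with constants that see neither \<open>\<nu>\<close> nor the
  convection field (\<open>error_functional_bound\<close>). An error in the data, the control for the state equation and the
  state for the adjoint equation, enters in the \<open>L2\<close> norm at the price of \<open>1 / sqrt \<kappa>\<close>. So the discrete
  residual is a functional whose dual energy norm is at most a number \<open>E\<close> made of the quantities on the
  right-hand side of the theorem, and it remains to bound the estimator by \<open>E\<close> and the oscillation. This is
  \<open>estimator_bound\<close>, with two choices of \<open>w\<close>.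

  On each element \<open>w\<close> is the affine residual times \<open>\<hh>\<^sup>2\<close> and a bump on an inscribed ball. The discrete gradient
  is constant on the support, hence orthogonal to \<open>\<nabla>w\<close>, and the affine residual times itself remains
  (\<open>element_residual_bound\<close>). At each interior facet \<open>w\<close> is a multiple of the jump times a bump of radius
  proportional to the diameter of the facet and width proportional to \<open>\<hh> * sqrt \<nu>\<close> around the centre of the facet.
  As the discrete gradient jumps only in the normal direction, pairing it with \<open>\<nabla>w\<close> gives the squared jump
  (\<open>jump_bound\<close>). The width is the thickness of the layers of the problem: a wider bump has too large an \<open>L2\<close>
  norm against the element residuals, a narrower one too large a gradient. In both cases the energy of \<open>w\<close> is bounded
  by the part of the estimator that is tested, with a constant that depends on the dimension and the shape
  regularity only, because boundedly many supports overlap (\<open>localized_family\<close>); dividing by the square root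
  of this part gives the claim.

  The bound for the control estimator rests on two facts: the optimal control is the pointwise projection of
  \<open>- p / \<theta>\<close> to the interval of admissible values, and this projection does not increase distances
  (\<open>eta_ct_bound\<close>).

  The remaining lemmas make this rigorous for the Sobolev spaces, meshes and projections at hand: smooth bumps are
  built from \<open>exp (- 1 / t)\<close>, weak gradients are unique almost everywhere (\<open>weak_grad_unique\<close>), test functions and
  finite element functions have the expected weak gradients (\<open>lipschitz_integration_by_parts\<close>), a half ball of
  size comparable to the facet lies in the element at the centre of each facet (\<open>facet_half_ball\<close>), and the
  \<open>L2\<close> projection onto affine functions exists (\<open>proj_P1_in_P1\<close>).
\<close>

section \<open>Smooth functions with compact support\<close>

text \<open>The functions \<open>exp (- 1 / t) / t^j\<close>, continued by zero, include the classical flat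
  function \<open>flat 0\<close>. The powers are there because their span is closed under differentiation.\<close>

definition flat :: "nat \<Rightarrow> real \<Rightarrow> real"
  where "flat j t = (if t > 0 then exp (- 1 / t) / t ^ j else 0)"

lemma flat_nonneg: "0 \<le> flat j t"
  by (simp add: flat_def)

lemma flat_pos: "t > 0 \<Longrightarrow> 0 < flat j t"
  by (simp add: flat_def)

lemma flat_nonpos_arg: "t \<le> 0 \<Longrightarrow> flat j t = 0"
  by (simp add: flat_def)

text \<open>One term of the exponential series bounds \<open>exp (1 / t)\<close> from below.\<close>

lemma exp_neg_inverse_le:
  assumes "t > (0::real)"
  shows "exp (- 1 / t) \<le> fact k * t ^ k"
proof -
  have "(1/t) ^ k / fact k \<le> exp (1/t)"
  proof -
    have s: "(\<lambda>n. (1/t) ^ n /\<^sub>R fact n) sums exp (1/t)"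
      by (rule exp_converges)
    have "(\<Sum>n\<in>{k}. (1/t) ^ n /\<^sub>R fact n) \<le> exp (1/t)"
      unfolding sums_unique[OF s]
      by (rule sum_le_suminf[OF sums_summable[OF s]]) (use assms in auto)
    then show ?thesis by (simp add: divide_inverse mult.commute)
  qed
  then have "1 \<le> exp (1/t) * (fact k * t ^ k)"
    using assms by (simp add: field_simps power_divide)
  then have "exp (- (1/t)) * 1 \<le> exp (- (1/t)) * (exp (1/t) * (fact k * t ^ k))"
    by (intro mult_left_mono) auto
  also have "\<dots> = fact k * t ^ k"
    by (simp add: exp_minus)
  finally show ?thesis by simp
qed

lemma flat_le_power: "flat j t \<le> fact (j + k) * \<bar>t\<bar> ^ k"
proof (cases "t > 0")
  case True
  then have "flat j t \<le> fact (j + k) * t ^ (j + k) / t ^ j"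
    unfolding flat_def using exp_neg_inverse_le[OF True, of "j + k"] by (simp add: divide_right_mono)
  also have "\<dots> = fact (j + k) * \<bar>t\<bar> ^ k"
    using True by (simp add: power_add)
  finally show ?thesis .
qed (simp add: flat_def)

lemma flat_le_fact: "flat j t \<le> fact j"
  using flat_le_power[of j t 0] by simp

text \<open>Off the origin this is the quotient rule; at the origin the quadratic bound
  \<open>flat_le_power\<close> takes over.\<close>

lemma flat_deriv: "(flat j has_real_derivative (flat (j + 2) t - real j * flat (j + 1) t)) (at t)"
proof -
  consider "t > 0" | "t < 0" | "t = 0" by linarith
  then show ?thesis
  proof cases
    case 1
    have "((\<lambda>t. exp (- 1 / t) / t ^ j) has_real_derivative
        (flat (j + 2) t - real j * flat (j + 1) t)) (at t)"
    proof -
      have "exp (- (1 / t)) * (real j * t ^ (j - 1)) / (t ^ j * t ^ j) = real j * exp (- (1 / t)) / t ^ (j + 1)"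
        using 1 by (cases j) (auto simp: field_simps)
      moreover have "((\<lambda>t. exp (- 1 / t) / t ^ j) has_real_derivative
          (exp (- 1 / t) / t\<^sup>2 * t ^ j - exp (- 1 / t) * (real j * t ^ (j - 1))) / (t ^ j * t ^ j)) (at t)"
        using 1 by (auto intro!: derivative_eq_intros simp: power2_eq_square)
      ultimately show ?thesis
        using 1 by (simp add: flat_def diff_divide_distrib power_add power2_eq_square mult.commute)
    qed
    then show ?thesis
      by (rule has_field_derivative_transform_within[where d = t])
         (use 1 in \<open>auto simp: flat_def dist_real_def\<close>)
  next
    case 2
    have "((\<lambda>t. 0) has_real_derivative (flat (j + 2) t - real j * flat (j + 1) t)) (at t)"
      using 2 by (simp add: flat_def)
    then show ?thesis
      by (rule has_field_derivative_transform_within[where d = "-t"])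
         (use 2 in \<open>auto simp: flat_def dist_real_def\<close>)
  next
    case 3
    have "(\<lambda>h. flat j h / h) \<midarrow>0\<rightarrow> 0"
    proof (rule Lim_null_comparison)
      show "\<forall>\<^sub>F h in at 0. norm (flat j h / h) \<le> fact (j + 2) * \<bar>h\<bar>"
      proof (rule eventually_at_topological[THEN iffD2], intro exI[of _ UNIV] conjI ballI impI)
        fix h :: real assume "h \<noteq> 0"
        have "flat j h \<le> (fact (j + 2) * \<bar>h\<bar>) * \<bar>h\<bar>"
          using flat_le_power[of j h 2] by (simp only: power2_eq_square mult.assoc)
        with \<open>h \<noteq> 0\<close> have "flat j h / \<bar>h\<bar> \<le> fact (j + 2) * \<bar>h\<bar>"
          by (subst pos_divide_le_eq) auto
        then show "norm (flat j h / h) \<le> fact (j + 2) * \<bar>h\<bar>"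
          by (simp only: real_norm_def abs_divide abs_of_nonneg[OF flat_nonneg])
      qed auto
      show "((\<lambda>h. fact (j + 2) * \<bar>h\<bar>) \<longlongrightarrow> 0) (at (0::real))"
        by (rule tendsto_eq_intros | simp)+
    qed
    then show ?thesis using 3
      by (simp add: DERIV_def flat_nonpos_arg)
  qed
qed

text \<open>An algebra of functions that contains all the bumps used below and the directional derivatives of its
  members, so that smoothness of any order follows by one induction.\<close>

inductive_set smooth_alg :: "('a::euclidean_space \<Rightarrow> real) set" where
  smooth_const: "(\<lambda>_. c) \<in> smooth_alg"
| smooth_inner: "(\<lambda>x. x \<bullet> a) \<in> smooth_alg"
| smooth_add: "f \<in> smooth_alg \<Longrightarrow> g \<in> smooth_alg \<Longrightarrow> (\<lambda>x. f x + g x) \<in> smooth_alg"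
| smooth_mult: "f \<in> smooth_alg \<Longrightarrow> g \<in> smooth_alg \<Longrightarrow> (\<lambda>x. f x * g x) \<in> smooth_alg"
| smooth_flat: "f \<in> smooth_alg \<Longrightarrow> (\<lambda>x. flat j (f x)) \<in> smooth_alg"

lemma smooth_cmult: "f \<in> smooth_alg \<Longrightarrow> (\<lambda>x. c * f x) \<in> smooth_alg"
  by (rule smooth_mult[OF smooth_const])

lemma smooth_diff: "f \<in> smooth_alg \<Longrightarrow> g \<in> smooth_alg \<Longrightarrow> (\<lambda>x. f x - g x) \<in> smooth_alg"
  using smooth_add[OF _ smooth_cmult[of g "-1"], of f] by simp

lemma smooth_sum: "(\<And>i. i \<in> I \<Longrightarrow> f i \<in> smooth_alg) \<Longrightarrow> (\<lambda>x. \<Sum>i\<in>I. f i x) \<in> smooth_alg"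
  by (induction I rule: infinite_finite_induct) (auto intro: smooth_const smooth_add)

lemma smooth_prod: "(\<And>i. i \<in> I \<Longrightarrow> f i \<in> smooth_alg) \<Longrightarrow> (\<lambda>x. \<Prod>i\<in>I. f i x) \<in> smooth_alg"
  by (induction I rule: infinite_finite_induct) (auto intro: smooth_const smooth_mult)

lemma smooth_power: "f \<in> smooth_alg \<Longrightarrow> (\<lambda>x. f x ^ n) \<in> smooth_alg"
  by (induction n) (auto intro: smooth_const smooth_mult)

lemma smooth_norm_squared: "(\<lambda>x. (norm (x - m))\<^sup>2) \<in> smooth_alg"
proof -
  have "(\<lambda>x. (norm (x - m))\<^sup>2) = (\<lambda>x. \<Sum>e\<in>Basis. (x \<bullet> e - m \<bullet> e)\<^sup>2)"
    unfolding power2_norm_eq_inner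
    by (subst euclidean_inner) (simp add: inner_diff_left power2_eq_square)
  then show ?thesis
    by (auto intro!: smooth_sum smooth_power smooth_diff smooth_inner smooth_const)
qed

lemma smooth_alg_derivative:
  "f \<in> smooth_alg \<Longrightarrow>
    \<exists>D. (\<forall>x. (f has_derivative D x) (at x)) \<and> (\<forall>e. (\<lambda>x. D x e) \<in> smooth_alg)"
proof (induction rule: smooth_alg.induct)
  case (smooth_const c)
  show ?case
    by (intro exI[of _ "\<lambda>_ _. 0"]) (auto intro: smooth_alg.smooth_const)
next
  case (smooth_inner a)
  show ?case
    by (intro exI[of _ "\<lambda>_ h. h \<bullet> a"])
       (auto intro!: smooth_alg.smooth_const bounded_linear_imp_has_derivative bounded_linear_inner_left)
next
  case (smooth_add f g)
  then obtain D E where "\<forall>x. (f has_derivative D x) (at x)" "\<forall>e. (\<lambda>x. D x e) \<in> smooth_alg"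
    "\<forall>x. (g has_derivative E x) (at x)" "\<forall>e. (\<lambda>x. E x e) \<in> smooth_alg"
    by blast
  then show ?case
    by (intro exI[of _ "\<lambda>x h. D x h + E x h"])
       (auto intro!: has_derivative_add smooth_alg.smooth_add)
next
  case (smooth_mult f g)
  then obtain D E where "\<forall>x. (f has_derivative D x) (at x)" "\<forall>e. (\<lambda>x. D x e) \<in> smooth_alg"
    "\<forall>x. (g has_derivative E x) (at x)" "\<forall>e. (\<lambda>x. E x e) \<in> smooth_alg"
    by blast
  with smooth_mult.hyps show ?case
    by (intro exI[of _ "\<lambda>x h. f x * E x h + D x h * g x"])
       (auto intro!: has_derivative_mult smooth_alg.smooth_add smooth_alg.smooth_mult)
next
  case (smooth_flat f j)
  then obtain D where D: "\<forall>x. (f has_derivative D x) (at x)" "\<forall>e. (\<lambda>x. D x e) \<in> smooth_alg"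
    by blast
  let ?d = "\<lambda>x. flat (j + 2) (f x) - real j * flat (j + 1) (f x)"
  have "?d \<in> smooth_alg"
    using smooth_flat.hyps by (intro smooth_diff smooth_cmult smooth_alg.smooth_flat)
  moreover have "((\<lambda>x. flat j (f x)) has_derivative (\<lambda>h. ?d x * D x h)) (at x)" for x
    using has_derivative_compose[OF spec[OF D(1)] flat_deriv[of j "f x", unfolded has_field_derivative_def]]
    by simp
  ultimately show ?case using D(2)
    by (intro exI[of _ "\<lambda>x h. ?d x * D x h"]) (auto intro!: smooth_alg.smooth_mult)
qed

lemma smooth_alg_Ck: "f \<in> smooth_alg \<Longrightarrow> Ck k f"
proof (induction k arbitrary: f)
  case 0
  then show ?case
    using smooth_alg_derivative[OF 0]
    by (auto simp: continuous_on_eq_continuous_at intro: has_derivative_continuous)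
next
  case (Suc k)
  then obtain D where D: "\<And>x. (f has_derivative D x) (at x)" "\<And>e. (\<lambda>x. D x e) \<in> smooth_alg"
    using smooth_alg_derivative by blast
  have "frechet_derivative f (at x) = D x" for x
    using D(1) frechet_derivative_at by metis
  then show ?case
    using D Suc.IH by (auto simp: differentiable_on_def differentiable_def)
qed

subsection \<open>Gradients\<close>

lemma GDERIV_unique:
  assumes "GDERIV f x :> D" "GDERIV f x :> E"
  shows "D = E"
proof -
  have "(\<lambda>h. h \<bullet> D) = (\<lambda>h. h \<bullet> E)"
    using assms unfolding gderiv_def by (rule has_derivative_unique)
  then show ?thesis by (metis vector_eq_ldot)
qed

lemma GDERIV_grad: "GDERIV f x :> D \<Longrightarrow> grad f x = D"
  unfolding grad_def by (blast intro: GDERIV_unique)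

lemma has_derivative_GDERIV:
  fixes f :: "'a::euclidean_space \<Rightarrow> real"
  assumes "(f has_derivative D) (at x)"
  shows "GDERIV f x :> (\<Sum>e\<in>Basis. D e *\<^sub>R e)"
proof -
  interpret bounded_linear D using assms by (rule has_derivative_bounded_linear)
  have "D h = h \<bullet> (\<Sum>e\<in>Basis. D e *\<^sub>R e)" for h
  proof -
    have "D h = D (\<Sum>e\<in>Basis. (h \<bullet> e) *\<^sub>R e)" by (simp add: euclidean_representation)
    also have "\<dots> = (\<Sum>e\<in>Basis. (h \<bullet> e) * D e)" by (simp add: sum scaleR)
    also have "\<dots> = h \<bullet> (\<Sum>e\<in>Basis. D e *\<^sub>R e)"
      by (simp add: inner_sum_right mult.commute)
    finally show ?thesis .
  qed
  then have "D = (\<lambda>h. h \<bullet> (\<Sum>e\<in>Basis. D e *\<^sub>R e))" by (rule ext)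
  then show ?thesis using assms unfolding gderiv_def by metis
qed

lemma Ck_continuous: "Ck k f \<Longrightarrow> continuous_on UNIV f"
  by (cases k) (auto intro: differentiable_imp_continuous_on)

lemma Ck1_grad:
  assumes "\<forall>k. Ck k f"
  shows "GDERIV f x :> grad f x" "continuous_on UNIV (grad f)"
proof -
  have C: "Ck (Suc 0) f" using assms by blast
  have G: "GDERIV f x :> (\<Sum>e\<in>Basis. frechet_derivative f (at x) e *\<^sub>R e)" for x
    using C by (intro has_derivative_GDERIV)
      (auto simp: differentiable_on_def frechet_derivative_works[symmetric])
  then show "GDERIV f x :> grad f x" using GDERIV_grad[OF G] by simp
  have "grad f = (\<lambda>x. \<Sum>e\<in>Basis. frechet_derivative f (at x) e *\<^sub>R e)"
    using G by (auto simp: GDERIV_grad)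
  then show "continuous_on UNIV (grad f)"
    using C by (auto intro!: continuous_intros)
qed

lemma smooth_alg_grad:
  assumes "f \<in> smooth_alg"
  shows "GDERIV f x :> grad f x" "continuous_on UNIV (grad f)" "continuous_on UNIV f"
  using Ck1_grad[of f] smooth_alg_Ck[OF assms] Ck_continuous[of 0 f] by blast+

subsection \<open>Test functions\<close>

lemma test_functionsI:
  assumes "w \<in> smooth_alg" "compact C" "C \<subseteq> \<Omega>" "\<And>x. x \<notin> C \<Longrightarrow> w x = 0"
  shows "w \<in> test_functions \<Omega>"
proof -
  have "closure {x. w x \<noteq> 0} \<subseteq> C"
    using assms by (intro closure_minimal compact_imp_closed) auto
  moreover from this have "compact (closure {x. w x \<noteq> 0})"
    using assms(2) by (meson bounded_subset compact_eq_bounded_closed closed_closure)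
  moreover have "\<forall>k. Ck k w"
    using smooth_alg_Ck[OF assms(1)] by blast
  ultimately show ?thesis
    using assms(3) unfolding test_functions_def by blast
qed

lemma test_functionsE:
  assumes "w \<in> test_functions \<Omega>"
  obtains C where "compact C" "C \<subseteq> \<Omega>" "\<And>x. x \<notin> C \<Longrightarrow> w x = 0" "\<And>x. x \<notin> C \<Longrightarrow> grad w x = 0"
proof
  let ?C = "closure {x. w x \<noteq> 0}"
  show "compact ?C" "?C \<subseteq> \<Omega>" using assms unfolding test_functions_def by blast+
  show "w x = 0" if "x \<notin> ?C" for x
    using that closure_subset[of "{x. w x \<noteq> 0}"] by auto
  show "grad w x = 0" if x: "x \<notin> ?C" for x
  proof (rule GDERIV_grad)
    have "((\<lambda>_. 0) has_derivative (\<lambda>h. h \<bullet> 0)) (at x)" by simp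
    then have "(w has_derivative (\<lambda>h. h \<bullet> 0)) (at x)"
    proof (rule has_derivative_transform_within_open[where s = "- ?C"])
      show "open (- ?C)" by auto
      show "x \<in> - ?C" using x by simp
      show "0 = w z" if "z \<in> - ?C" for z
        using that closure_subset[of "{x. w x \<noteq> 0}"] by auto
    qed
    then show "GDERIV w x :> 0" by (simp add: gderiv_def)
  qed
qed

lemma test_functions_grad:
  assumes "w \<in> test_functions \<Omega>"
  shows "GDERIV w x :> grad w x" "continuous_on UNIV (grad w)" "continuous_on UNIV w"
proof -
  have "\<forall>k. Ck k w" using assms unfolding test_functions_def by blast
  then show "GDERIV w x :> grad w x" "continuous_on UNIV (grad w)" "continuous_on UNIV w"
    using Ck1_grad[of w] Ck_continuous[of 0 w] by blast+
qed

lemma continuous_compact_support_bounded: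
  fixes f :: "'a::euclidean_space \<Rightarrow> 'b::real_normed_vector"
  assumes "continuous_on UNIV f" "compact C" "\<And>x. x \<notin> C \<Longrightarrow> f x = 0"
  obtains M where "0 \<le> M" "\<And>x. norm (f x) \<le> M"
proof -
  have "compact (f ` C)"
    using assms by (intro compact_continuous_image) (auto intro: continuous_on_subset)
  then obtain M where "\<And>x. x \<in> C \<Longrightarrow> norm (f x) \<le> M"
    using compact_imp_bounded bounded_iff by (metis imageI)
  then have "norm (f x) \<le> max M 0" for x
    using assms(3)[of x] by (cases "x \<in> C") (auto simp: max.coboundedI1)
  then show ?thesis using that[of "max M 0"] by auto
qed

lemma test_functions_bounded:
  assumes "w \<in> test_functions \<Omega>"
  obtains M where "0 \<le> M" "\<And>x. \<bar>w x\<bar> \<le> M" "\<And>x. norm (grad w x) \<le> M"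
proof -
  obtain C where C: "compact C" "\<And>x. x \<notin> C \<Longrightarrow> w x = 0" "\<And>x. x \<notin> C \<Longrightarrow> grad w x = 0"
    using test_functionsE[OF assms] by metis
  obtain M1 where M1: "0 \<le> M1" "\<And>x. norm (w x) \<le> M1"
    using continuous_compact_support_bounded[OF test_functions_grad(3)[OF assms] C(1,2)] by blast
  obtain M2 where M2: "0 \<le> M2" "\<And>x. norm (grad w x) \<le> M2"
    using continuous_compact_support_bounded[OF test_functions_grad(2)[OF assms] C(1,3)] by blast
  show ?thesis
    by (rule that[of "max M1 M2"]) (use M1 M2 in \<open>auto simp: le_max_iff_disj\<close>)
qed

lemma test_functions_lipschitz:
  assumes "w \<in> test_functions \<Omega>"
  obtains M where "M-lipschitz_on UNIV w"
proof -
  obtain M where M: "0 \<le> M" "\<And>x. norm (grad w x) \<le> M"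
    using test_functions_bounded[OF assms] by metis
  have "norm (w x - w z) \<le> M * norm (x - z)" for x z
  proof (rule differentiable_bound[where S = UNIV and f' = "\<lambda>x h. h \<bullet> grad w x"])
    show "(w has_derivative (\<lambda>h. h \<bullet> grad w x)) (at x within UNIV)" for x
      using test_functions_grad(1)[OF assms] by (simp add: gderiv_def)
    show "onorm (\<lambda>h. h \<bullet> grad w x) \<le> M" for x
    proof (rule onorm_bound)
      show "norm (h \<bullet> grad w x) \<le> M * norm h" for h
        using Cauchy_Schwarz_ineq2[of h "grad w x"] M(2)[of x]
          mult_left_mono[OF M(2)[of x], of "norm h"] by (simp add: mult.commute)
    qed (use M in auto)
  qed auto
  then have "M-lipschitz_on UNIV w"
    using M by (auto intro!: lipschitz_onI simp: dist_norm)
  then show ?thesis by (rule that)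
qed

section \<open>Lebesgue integrals over sets\<close>

lemma integrable_lebesgue_on_iff:
  fixes f :: "'a::euclidean_space \<Rightarrow> 'b::euclidean_space"
  assumes "S \<in> sets lebesgue"
  shows "integrable (lebesgue_on S) f \<longleftrightarrow> integrable lebesgue (\<lambda>x. if x \<in> S then f x else 0)"
proof -
  have "(\<lambda>x. indicator S x *\<^sub>R f x) = (\<lambda>x. if x \<in> S then f x else 0)"
    by (auto simp: indicator_def)
  then show ?thesis using integrable_restrict_space[of S lebesgue f] assms by simp
qed

lemma integral_lebesgue_on_eq:
  fixes f :: "'a::euclidean_space \<Rightarrow> 'b::euclidean_space"
  assumes "S \<in> sets lebesgue"
  shows "integral\<^sup>L (lebesgue_on S) f = (\<integral>x. (if x \<in> S then f x else 0) \<partial>lebesgue)"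
proof -
  have "(\<lambda>x. indicator S x *\<^sub>R f x) = (\<lambda>x. if x \<in> S then f x else 0)"
    by (auto simp: indicator_def)
  then show ?thesis using integral_restrict_space[of S lebesgue f] assms by simp
qed

lemma AE_lebesgue_on_iff:
  assumes "S \<in> sets lebesgue"
  shows "(AE x in lebesgue_on S. P x) \<longleftrightarrow> (AE x in lebesgue. x \<in> S \<longrightarrow> P x)"
  using AE_restrict_space_iff[of S lebesgue P] assms by simp

lemma AE_lebesgue_negligible:
  assumes "negligible N"
  shows "AE x in lebesgue. x \<notin> N"
  using assms by (intro AE_not_in) (simp add: negligible_iff_null_sets)

lemma measurable_lebesgue_on_AE:
  fixes f :: "'a::euclidean_space \<Rightarrow> 'b::euclidean_space"
  assumes "S \<in> sets lebesgue" "f \<in> borel_measurable (lebesgue_on S)" "AE x in lebesgue_on S. f x = g x"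
  shows "g \<in> borel_measurable (lebesgue_on S)"
proof -
  have "(\<lambda>x. if x \<in> S then f x else 0) \<in> borel_measurable lebesgue"
    using assms by (simp add: borel_measurable_if)
  moreover have "AE x in lebesgue. (if x \<in> S then f x else 0) = (if x \<in> S then g x else 0)"
    using assms(3) unfolding AE_lebesgue_on_iff[OF assms(1)] by eventually_elim auto
  ultimately have "(\<lambda>x. if x \<in> S then g x else 0) \<in> borel_measurable lebesgue"
    by (rule borel_measurable_AE)
  then show ?thesis using assms by (simp add: borel_measurable_if)
qed

lemma integral_lebesgue_on_cong_AE:
  fixes f :: "'a::euclidean_space \<Rightarrow> 'b::euclidean_space"
  assumes "S \<in> sets lebesgue" "f \<in> borel_measurable (lebesgue_on S)" "AE x in lebesgue_on S. f x = g x"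
  shows "integral\<^sup>L (lebesgue_on S) g = integral\<^sup>L (lebesgue_on S) f"
    and "integrable (lebesgue_on S) g \<longleftrightarrow> integrable (lebesgue_on S) f"
proof -
  have g: "g \<in> borel_measurable (lebesgue_on S)" by (rule measurable_lebesgue_on_AE[OF assms])
  have "AE x in lebesgue_on S. g x = f x" using assms(3) by eventually_elim auto
  then show "integral\<^sup>L (lebesgue_on S) g = integral\<^sup>L (lebesgue_on S) f"
    and "integrable (lebesgue_on S) g \<longleftrightarrow> integrable (lebesgue_on S) f"
    using g assms(2) integral_cong_AE[of g _ f] integrable_cong_AE[of g _ f] by blast+
qed

lemma lebesgue_on_null_difference:
  fixes f :: "'a::euclidean_space \<Rightarrow> 'b::euclidean_space"
  assumes S: "S \<in> sets lebesgue" and T: "T \<in> sets lebesgue"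
    and ST: "AE x in lebesgue. x \<in> S \<longleftrightarrow> x \<in> T"
  shows "f \<in> borel_measurable (lebesgue_on S) \<longleftrightarrow> f \<in> borel_measurable (lebesgue_on T)" (is ?M)
    and "integrable (lebesgue_on S) f \<longleftrightarrow> integrable (lebesgue_on T) f" (is ?I)
    and "integral\<^sup>L (lebesgue_on S) f = integral\<^sup>L (lebesgue_on T) f" (is ?E)
proof -
  let ?f = "\<lambda>S x. if x \<in> S then f x else 0"
  have ae: "AE x in lebesgue. ?f S x = ?f T x" "AE x in lebesgue. ?f T x = ?f S x"
    using ST by (eventually_elim, simp)+
  have m: "?f S \<in> borel_measurable lebesgue \<longleftrightarrow> ?f T \<in> borel_measurable lebesgue"
    using borel_measurable_AE[OF _ ae(1)] borel_measurable_AE[OF _ ae(2)] by blast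
  then show ?M using S T by (simp add: borel_measurable_if)
  have i: "integrable lebesgue (?f S) \<longleftrightarrow> integrable lebesgue (?f T)"
    using m ae integrable_cong_AE[of "?f S" lebesgue "?f T"] borel_measurable_integrable by blast
  then show ?I using S T by (simp add: integrable_lebesgue_on_iff)
  show ?E
  proof (cases "integrable lebesgue (?f S)")
    case True
    with i have "integrable lebesgue (?f T)" by simp
    with True have "integral\<^sup>L lebesgue (?f S) = integral\<^sup>L lebesgue (?f T)"
      using ae(1) by (intro integral_cong_AE) auto
    then show ?thesis using S T by (simp add: integral_lebesgue_on_eq)
  next
    case False
    with i show ?thesis
      using S T by (simp add: integral_lebesgue_on_eq not_integrable_integral_eq)
  qed
qed

lemma integrable_lebesgue_on_subset:
  fixes f :: "'a::euclidean_space \<Rightarrow> 'b::euclidean_space"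
  assumes "integrable (lebesgue_on T) f" "S \<in> sets lebesgue" "T \<in> sets lebesgue" "S \<subseteq> T"
  shows "integrable (lebesgue_on S) f"
proof -
  have i: "integrable lebesgue (\<lambda>x. if x \<in> T then f x else 0)"
    using assms integrable_lebesgue_on_iff by blast
  have "integrable lebesgue (\<lambda>x. indicator S x *\<^sub>R (if x \<in> T then f x else 0))"
    using i assms(2) by (intro integrable_mult_indicator) auto
  moreover have "(\<lambda>x. indicator S x *\<^sub>R (if x \<in> T then f x else 0)) = (\<lambda>x. if x \<in> S then f x else 0)"
    using assms(4) by (intro ext) (auto split: split_indicator)
  ultimately show ?thesis using assms(2) by (simp add: integrable_lebesgue_on_iff)
qed

section \<open>Uniqueness of weak gradients\<close>

lemma locally_integrable_test:
  fixes g :: "'a::euclidean_space \<Rightarrow> real"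
  assumes "locally_integrable \<Omega> g" "open \<Omega>" "compact C" "C \<subseteq> \<Omega>"
    and \<phi>: "continuous_on UNIV \<phi>" "\<And>x. x \<notin> C \<Longrightarrow> \<phi> x = (0::real)"
  shows "integrable (lebesgue_on \<Omega>) (\<lambda>x. g x * \<phi> x)"
proof -
  obtain M where M: "0 \<le> M" "\<And>x. norm (\<phi> x) \<le> M"
    using continuous_compact_support_bounded[OF \<phi>(1) assms(3) \<phi>(2)] by blast
  have C: "C \<in> sets lebesgue" and O: "\<Omega> \<in> sets lebesgue"
    using assms lmeasurable_compact by (auto intro: fmeasurableD)
  have "integrable (lebesgue_on C) g"
    using assms by (auto simp: locally_integrable_def)
  then have "integrable (lebesgue_on C) (\<lambda>x. \<phi> x * g x)"
  proof (rule Bochner_Integration.integrable_bound[OF integrable_mult_right[of M]])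
    show "(\<lambda>x. \<phi> x * g x) \<in> borel_measurable (lebesgue_on C)"
      using borel_measurable_integrable[OF \<open>integrable (lebesgue_on C) g\<close>]
        continuous_imp_measurable_on_sets_lebesgue[OF continuous_on_subset[OF \<phi>(1)] C]
      by (intro borel_measurable_times) auto
    show "AE x in lebesgue_on C. norm (\<phi> x * g x) \<le> norm (M * g x)"
      using M by (intro AE_I2) (auto simp: abs_mult intro!: mult_right_mono)
  qed
  moreover have "(\<lambda>x. if x \<in> C then \<phi> x * g x else 0) = (\<lambda>x. if x \<in> \<Omega> then g x * \<phi> x else 0)"
    using \<phi>(2) assms(4) by (intro ext) auto
  ultimately show ?thesis
    unfolding integrable_lebesgue_on_iff[OF C] integrable_lebesgue_on_iff[OF O] by (simp only:)
qed

text \<open>The powers \<open>1 - (1 - \<beta>)^n\<close> of one smooth function \<open>\<beta>\<close>, positive exactly on a box,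
  increase to the indicator of the box; so test functions see the integral over each box.\<close>

lemma box_integral_test_functions:
  fixes g :: "'a::euclidean_space \<Rightarrow> real"
  assumes O: "open \<Omega>" and g: "locally_integrable \<Omega> g"
    and z: "\<And>\<phi>. \<phi> \<in> test_functions \<Omega> \<Longrightarrow> (\<integral>x. g x * \<phi> x \<partial>lebesgue_on \<Omega>) = 0"
    and ab: "cbox a b \<subseteq> \<Omega>" "\<And>i. i \<in> Basis \<Longrightarrow> a \<bullet> i < b \<bullet> i"
  shows "integral (cbox a b) g = 0"
proof -
  define \<beta> where "\<beta> x = 1/2 * (\<Prod>i\<in>Basis. flat 0 ((x \<bullet> i - a \<bullet> i) * (b \<bullet> i - x \<bullet> i)))" for x
  define \<phi> where "\<phi> n x = 1 - (1 - \<beta> x) ^ n" for n :: nat and x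
  have pos: "0 < (x \<bullet> i - a \<bullet> i) * (b \<bullet> i - x \<bullet> i) \<longleftrightarrow> a \<bullet> i < x \<bullet> i \<and> x \<bullet> i < b \<bullet> i"
    if "i \<in> Basis" for x i
    using ab(2)[OF that] by (auto simp: zero_less_mult_iff)
  have in_box: "0 < \<beta> x" if "x \<in> box a b" for x
    using that pos by (auto simp: \<beta>_def mem_box intro!: prod_pos flat_pos)
  have out_box: "\<beta> x = 0" if nb: "x \<notin> box a b" for x
  proof -
    obtain i where i: "i \<in> Basis" "\<not> (a \<bullet> i < x \<bullet> i \<and> x \<bullet> i < b \<bullet> i)"
      using nb by (auto simp: mem_box)
    then have "flat 0 ((x \<bullet> i - a \<bullet> i) * (b \<bullet> i - x \<bullet> i)) = 0"
      using pos[OF i(1)] by (intro flat_nonpos_arg) (meson not_le)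
    then have "(\<Prod>i\<in>Basis. flat 0 ((x \<bullet> i - a \<bullet> i) * (b \<bullet> i - x \<bullet> i))) = 0"
      using i(1) by (intro prod_zero) auto
    then show ?thesis by (simp add: \<beta>_def)
  qed
  have nn: "0 \<le> \<beta> x" for x
    by (auto simp: \<beta>_def intro!: prod_nonneg flat_nonneg)
  have le: "\<beta> x \<le> 1/2" for x
  proof -
    have "(\<Prod>i\<in>Basis. flat 0 ((x \<bullet> i - a \<bullet> i) * (b \<bullet> i - x \<bullet> i))) \<le> 1"
      using flat_le_fact[of 0] flat_nonneg[of 0] by (intro prod_le_1) auto
    then show ?thesis by (simp add: \<beta>_def)
  qed
  have sm: "\<phi> n \<in> smooth_alg" for n
    unfolding \<phi>_def \<beta>_def
    by (intro smooth_diff smooth_const smooth_power smooth_cmult smooth_prod smooth_flat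
        smooth_mult smooth_inner)
  have \<phi>0: "\<phi> n x = 0" if "x \<notin> cbox a b" for n x
  proof -
    have "x \<notin> box a b" using that box_subset_cbox[of a b] by blast
    then show ?thesis using out_box by (simp add: \<phi>_def)
  qed
  have test: "\<phi> n \<in> test_functions \<Omega>" for n
    by (rule test_functionsI[OF sm compact_cbox ab(1) \<phi>0])
  have bd: "\<bar>\<phi> n x\<bar> \<le> 1" for n x
    using nn[of x] le[of x] by (auto simp: \<phi>_def abs_le_iff power_le_one)
  have lim: "(\<lambda>n. \<phi> n x) \<longlonglongrightarrow> (if x \<in> box a b then 1 else 0)" for x
  proof (cases "x \<in> box a b")
    case True
    have "(\<lambda>n. (1 - \<beta> x) ^ n) \<longlonglongrightarrow> 0"
      by (rule LIMSEQ_realpow_zero) (use in_box[OF True] le[of x] in linarith)+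
    then have "(\<lambda>n. 1 - (1 - \<beta> x) ^ n) \<longlonglongrightarrow> 1 - 0" by (rule tendsto_diff[OF tendsto_const])
    then show ?thesis using True by (simp add: \<phi>_def)
  next
    case False
    then show ?thesis using out_box[OF False] by (simp add: \<phi>_def)
  qed
  have OL: "\<Omega> \<in> sets lebesgue" using O by auto
  have gc: "integrable (lebesgue_on (cbox a b)) g"
    using g ab(1) by (auto simp: locally_integrable_def)
  let ?G = "\<lambda>x. if x \<in> cbox a b then g x else 0"
  have G: "integrable lebesgue ?G" using gc integrable_lebesgue_on_iff[of "cbox a b" g] by simp
  have e1: "(\<integral>x. ?G x * \<phi> n x \<partial>lebesgue) = 0" for n
  proof -
    have "(\<integral>x. ?G x * \<phi> n x \<partial>lebesgue) = (\<integral>x. (if x \<in> \<Omega> then g x * \<phi> n x else 0) \<partial>lebesgue)"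
      by (rule Bochner_Integration.integral_cong) (use \<phi>0 ab(1) in auto)
    then show ?thesis using z[OF test, of n] unfolding integral_lebesgue_on_eq[OF OL] by (simp only:)
  qed
  have "(\<lambda>n. \<integral>x. ?G x * \<phi> n x \<partial>lebesgue) \<longlonglongrightarrow> (\<integral>x. ?G x * (if x \<in> box a b then 1 else 0) \<partial>lebesgue)"
  proof (rule integral_dominated_convergence[where w = "\<lambda>x. norm (?G x)"])
    show "(\<lambda>x. ?G x * (if x \<in> box a b then 1 else 0)) \<in> borel_measurable lebesgue"
      using G by (intro borel_measurable_times) (auto intro!: measurable_If_set)
    show "(\<lambda>x. ?G x * \<phi> n x) \<in> borel_measurable lebesgue" for n
      using borel_measurable_integrable[OF G]
        borel_measurable_continuous_onI[OF smooth_alg_grad(3)[OF sm], of n]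
      by (intro borel_measurable_times) (auto intro: measurable_completion)
    show "AE x in lebesgue. (\<lambda>n. ?G x * \<phi> n x) \<longlonglongrightarrow> ?G x * (if x \<in> box a b then 1 else 0)"
      using lim by (intro AE_I2 tendsto_mult tendsto_const)
    show "AE x in lebesgue. norm (?G x * \<phi> n x) \<le> norm (?G x)" for n
      using bd by (intro AE_I2) (auto simp: abs_mult intro!: mult_left_le)
  qed (use G in auto)
  then have "(\<integral>x. ?G x * (if x \<in> box a b then 1 else 0) \<partial>lebesgue) = 0"
    by (simp add: e1 LIMSEQ_const_iff)
  moreover have "(\<lambda>x. ?G x * (if x \<in> box a b then 1 else 0)) = (\<lambda>x. if x \<in> box a b then g x else 0)"
    using box_subset_cbox[of a b] by (intro ext) auto
  ultimately have "integral\<^sup>L (lebesgue_on (box a b)) g = 0"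
    by (simp add: integral_lebesgue_on_eq)
  moreover have "integrable (lebesgue_on (box a b)) g"
    by (rule integrable_lebesgue_on_subset[OF gc]) (auto simp: box_subset_cbox)
  ultimately have "integral (box a b) g = 0"
    using lebesgue_integral_eq_integral[of "box a b" g] by simp
  then show ?thesis by (simp add: integral_open_interval)
qed

text \<open>A locally integrable function that no test function sees vanishes: its integrals over boxes
  are zero, and almost every value is a limit of means over cubes.\<close>

lemma test_functions_separate:
  fixes g :: "'a::euclidean_space \<Rightarrow> real"
  assumes O: "open \<Omega>" and g: "locally_integrable \<Omega> g"
    and z: "\<And>\<phi>. \<phi> \<in> test_functions \<Omega> \<Longrightarrow> (\<integral>x. g x * \<phi> x \<partial>lebesgue_on \<Omega>) = 0"
  shows "AE x in lebesgue_on \<Omega>. g x = 0"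
proof -
  have "negligible {x \<in> \<Omega>. g x \<noteq> 0}"
  proof (rule locally_negligible_alt[THEN iffD2], rule ballI)
    fix x0 assume "x0 \<in> {x \<in> \<Omega>. g x \<noteq> 0}"
    then have x0: "x0 \<in> \<Omega>" "g x0 \<noteq> 0" by auto
    then obtain c d where cd: "cbox c d \<subseteq> \<Omega>" "x0 \<in> box c d"
      using open_contains_cbox[of \<Omega>] O by (metis)
    define f where "f x = (if x \<in> cbox c d then g x else 0)" for x
    have "integrable (lebesgue_on (cbox c d)) g"
      using g cd(1) by (auto simp: locally_integrable_def)
    then have "integrable lebesgue f"
      using integrable_lebesgue_on_iff[of "cbox c d" g] by (simp add: f_def[abs_def])
    then have fU: "f integrable_on UNIV"
      using integrable_on_lebesgue by blast
    then have "f integrable_on cbox a b" for a b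
      using integrable_on_subcbox by blast
    then obtain N where N: "negligible N"
      "\<And>x e. \<lbrakk>x \<notin> N; 0 < e\<rbrakk> \<Longrightarrow> \<exists>\<delta>>0. \<forall>h. 0 < h \<and> h < \<delta> \<longrightarrow>
         norm (integral (cbox x (x + h *\<^sub>R One)) f /\<^sub>R h ^ DIM('a) - f x) < e"
      using integrable_ccontinuous_explicit by blast
    have zero: "g x = 0" if x: "x \<in> box c d" "x \<notin> N" for x
    proof (rule ccontr)
      assume "g x \<noteq> 0"
      then obtain \<delta> where \<delta>: "\<delta> > 0" "\<forall>h. 0 < h \<and> h < \<delta> \<longrightarrow>
         norm (integral (cbox x (x + h *\<^sub>R One)) f /\<^sub>R h ^ DIM('a) - f x) < norm (g x)"
        using N(2)[OF x(2), of "norm (g x)"] by auto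
      \<comment> \<open>A cube at \<open>x\<close> so small that it stays in the box and that its mean is close to \<open>g x\<close>.\<close>
      obtain r where r: "r > 0" "ball x r \<subseteq> box c d"
        using x(1) open_box open_contains_ball by metis
      define h where "h = min (\<delta>/2) (r / (2 * norm (One::'a)))"
      have nO: "norm (One::'a) > 0" by simp
      have h: "0 < h" "h < \<delta>" "h * norm (One::'a) < r"
        using \<delta>(1) r(1) nO
        by (auto simp: h_def min_less_iff_disj min_def field_simps mult_less_cancel_right)
      have sub: "cbox x (x + h *\<^sub>R One) \<subseteq> box c d"
      proof
        fix y assume y: "y \<in> cbox x (x + h *\<^sub>R One)"
        have "norm (y - x) \<le> norm (h *\<^sub>R (One::'a))"
          by (rule norm_le_componentwise) (use y h in \<open>auto simp: mem_box inner_simps\<close>)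
        then have "y \<in> ball x r" using h by (simp add: dist_norm norm_minus_commute)
        then show "y \<in> box c d" using r by auto
      qed
      then have sub': "cbox x (x + h *\<^sub>R One) \<subseteq> cbox c d" using box_subset_cbox by blast
      have "integral (cbox x (x + h *\<^sub>R One)) f = integral (cbox x (x + h *\<^sub>R One)) g"
        using sub' by (intro Henstock_Kurzweil_Integration.integral_cong) (auto simp: f_def)
      also have "\<dots> = 0"
        by (rule box_integral_test_functions[OF O g z])
           (use sub' cd h in \<open>auto simp: inner_simps\<close>)
      finally have "norm (f x) < norm (g x)" using \<delta>(2) h by auto
      moreover have "f x = g x" using x(1) box_subset_cbox by (auto simp: f_def)
      ultimately show False by simp
    qed
    \<comment> \<open>Negligibility is a local property, so one box around each point suffices.\<close>
    show "\<exists>U. openin (top_of_set {x \<in> \<Omega>. g x \<noteq> 0}) U \<and> x0 \<in> U \<and> negligible U"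
    proof (intro exI[of _ "{x \<in> \<Omega>. g x \<noteq> 0} \<inter> box c d"] conjI)
      show "openin (top_of_set {x \<in> \<Omega>. g x \<noteq> 0}) ({x \<in> \<Omega>. g x \<noteq> 0} \<inter> box c d)"
        by (auto intro: openin_open_Int open_box)
      show "negligible ({x \<in> \<Omega>. g x \<noteq> 0} \<inter> box c d)"
        by (rule negligible_subset[OF N(1)]) (use zero in auto)
    qed (use x0 cd in auto)
  qed
  then have "AE x in lebesgue. x \<notin> {x \<in> \<Omega>. g x \<noteq> 0}"
    by (rule AE_lebesgue_negligible)
  then show ?thesis using O by (simp add: AE_lebesgue_on_iff)
qed

lemma weak_grad_unique:
  assumes O: "open \<Omega>" and "is_weak_grad \<Omega> v g" "is_weak_grad \<Omega> v g'"
  shows "AE x in lebesgue_on \<Omega>. g x = g' x"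
proof -
  have L: "locally_integrable \<Omega> g" "locally_integrable \<Omega> g'"
    using assms by (auto simp: is_weak_grad_def)
  have Li: "locally_integrable \<Omega> (\<lambda>x. g x \<bullet> e)" "locally_integrable \<Omega> (\<lambda>x. g' x \<bullet> e)" for e
    using L by (auto simp: locally_integrable_def)
  have "AE x in lebesgue_on \<Omega>. (g x - g' x) \<bullet> e = 0" if e: "e \<in> Basis" for e
  proof (rule test_functions_separate[OF O])
    show "locally_integrable \<Omega> (\<lambda>x. (g x - g' x) \<bullet> e)"
      using L by (auto simp: locally_integrable_def)
    fix \<phi> assume \<phi>: "\<phi> \<in> test_functions \<Omega>"
    then obtain C where C: "compact C" "C \<subseteq> \<Omega>" "\<And>x. x \<notin> C \<Longrightarrow> \<phi> x = 0"
      using test_functionsE by metis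
    note c = test_functions_grad(3)[OF \<phi>]
    have "(\<integral>x. (g x \<bullet> e) * \<phi> x \<partial>lebesgue_on \<Omega>) = (\<integral>x. (g' x \<bullet> e) * \<phi> x \<partial>lebesgue_on \<Omega>)"
      using assms(2,3) \<phi> e by (fastforce simp: is_weak_grad_def)
    then have "(\<integral>x. (g x \<bullet> e) * \<phi> x - (g' x \<bullet> e) * \<phi> x \<partial>lebesgue_on \<Omega>) = 0"
      using locally_integrable_test[OF Li(1) O C(1,2) c C(3)]
        locally_integrable_test[OF Li(2) O C(1,2) c C(3)]
      by (subst Bochner_Integration.integral_diff) auto
    then show "(\<integral>x. ((g x - g' x) \<bullet> e) * \<phi> x \<partial>lebesgue_on \<Omega>) = 0"
      by (simp add: inner_diff_left left_diff_distrib)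
  qed
  then have "AE x in lebesgue_on \<Omega>. \<forall>e\<in>Basis. (g x - g' x) \<bullet> e = 0"
    by (intro AE_finite_allI) auto
  then show ?thesis
    by eventually_elim (auto simp: euclidean_eq_iff[where 'a='a] inner_diff_left)
qed

lemma wgrad_is_weak_grad: "is_weak_grad \<Omega> v g \<Longrightarrow> is_weak_grad \<Omega> v (wgrad \<Omega> v)"
  unfolding wgrad_def by (rule someI[of "is_weak_grad \<Omega> v"])

text \<open>The choice made in \<open>wgrad\<close> is immaterial up to null sets.\<close>

lemma wgrad_AE:
  assumes "open \<Omega>" "is_weak_grad \<Omega> v g"
  shows "AE x in lebesgue_on \<Omega>. wgrad \<Omega> v x = g x"
  using weak_grad_unique[OF assms(1) wgrad_is_weak_grad[OF assms(2)] assms(2)] .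

section \<open>Integration by parts with Lipschitz functions\<close>

lemma continuous_lebesgue_measurable:
  fixes f :: "'a::euclidean_space \<Rightarrow> 'b::euclidean_space"
  shows "continuous_on UNIV f \<Longrightarrow> f \<in> borel_measurable lebesgue"
  by (intro measurable_completion) (simp add: borel_measurable_continuous_onI)

lemma continuous_compact_support_integrable:
  fixes f :: "'a::euclidean_space \<Rightarrow> real"
  assumes f: "continuous_on UNIV f" and C: "compact C" "\<And>x. x \<notin> C \<Longrightarrow> f x = 0"
  shows "integrable lebesgue f"
proof -
  have "integrable lborel (\<lambda>x. indicator C x *\<^sub>R f x)"
    using C f by (intro borel_integrable_compact) (auto intro: continuous_on_subset)
  moreover have "(\<lambda>x. indicator C x *\<^sub>R f x) = f"
    using C by (intro ext) (auto simp: indicator_def)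
  ultimately have "integrable lborel f" by simp
  then show ?thesis
    using integrable_completion[of f lborel] borel_measurable_integrable by blast
qed

lemma lebesgue_integral_translate:
  fixes f :: "'a::euclidean_space \<Rightarrow> real"
  assumes "continuous_on UNIV f"
  shows "(\<integral>x. f (c + x) \<partial>lebesgue) = (\<integral>x. f x \<partial>lebesgue)"
proof -
  have f: "f \<in> borel_measurable borel" using assms by (rule borel_measurable_continuous_onI)
  have f': "(\<lambda>x. f (c + x)) \<in> borel_measurable borel" using f by measurable
  have "(\<integral>x. f x \<partial>lborel) = (\<integral>x. f x \<partial>distr lborel borel ((+) c))"
    by (simp add: lborel_distr_plus)
  also have "\<dots> = (\<integral>x. f (c + x) \<partial>lborel)"
    using f by (subst integral_distr) auto
  finally show ?thesis
    using f f' by (simp add: integral_completion)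
qed

text \<open>The difference quotient is moved from one factor to the other by a translation, and both sides
  converge dominatedly.\<close>

lemma lipschitz_integration_by_parts:
  fixes v :: "'a::euclidean_space \<Rightarrow> real"
  assumes O: "open \<Omega>" and \<phi>: "\<phi> \<in> test_functions \<Omega>" and v: "L-lipschitz_on UNIV v"
    and g: "g \<in> borel_measurable (lebesgue_on \<Omega>)"
    and d: "AE x in lebesgue_on \<Omega>. (v has_derivative (\<lambda>h. h \<bullet> g x)) (at x)"
  shows "(\<integral>x. v x * (grad \<phi> x \<bullet> e) \<partial>lebesgue_on \<Omega>) = - (\<integral>x. (g x \<bullet> e) * \<phi> x \<partial>lebesgue_on \<Omega>)"
proof -
  obtain C where C: "compact C" "C \<subseteq> \<Omega>" "\<And>x. x \<notin> C \<Longrightarrow> \<phi> x = 0" "\<And>x. x \<notin> C \<Longrightarrow> grad \<phi> x = 0"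
    using test_functionsE[OF \<phi>] by metis
  obtain M where M: "M-lipschitz_on UNIV \<phi>" using test_functions_lipschitz[OF \<phi>] .
  have M0: "0 \<le> M" and L0: "0 \<le> L" using M v lipschitz_on_nonneg by auto
  have OL: "\<Omega> \<in> sets lebesgue" using O by auto
  have cv: "continuous_on UNIV v" using v by (rule lipschitz_on_continuous_on)
  note c\<phi> = test_functions_grad(3)[OF \<phi>]
  define t where "t n = 1 / real (Suc n)" for n
  have t: "0 < t n" "t n \<le> 1" "t n \<noteq> 0" for n by (auto simp: t_def)
  have t0: "t \<longlonglongrightarrow> 0" unfolding t_def using LIMSEQ_inverse_real_of_nat by (simp add: inverse_eq_divide)
  have ft: "filterlim t (at 0) sequentially"
    using t0 t(3) by (simp add: filterlim_at)
  have dq: "(\<lambda>n. (u (x + t n *\<^sub>R s) - u x) / t n) \<longlonglongrightarrow> s \<bullet> D"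
    if "(u has_derivative (\<lambda>h. h \<bullet> D)) (at x)" for u :: "'a \<Rightarrow> real" and x s D
  proof -
    have "((\<lambda>r. u (x + r *\<^sub>R s)) has_derivative (\<lambda>r. (r *\<^sub>R s) \<bullet> D)) (at 0)"
      by (rule has_derivative_compose[of "\<lambda>r. x + r *\<^sub>R s" "\<lambda>r. r *\<^sub>R s" 0 UNIV u, simplified])
         (use that in \<open>auto intro!: derivative_eq_intros\<close>)
    then have "((\<lambda>r. u (x + r *\<^sub>R s)) has_real_derivative (s \<bullet> D)) (at 0)"
      by (simp add: has_field_derivative_def mult.commute[of _ "s \<bullet> D"] mult_commute_abs)
    then have "((\<lambda>r. (u (x + r *\<^sub>R s) - u x) / r) \<longlongrightarrow> s \<bullet> D) (at 0)"
      by (simp add: DERIV_def)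
    then show ?thesis using ft by (rule filterlim_compose)
  qed
  obtain R0 where R0: "\<And>x. x \<in> C \<Longrightarrow> norm x \<le> R0"
    using compact_imp_bounded[OF C(1)] by (auto simp: bounded_iff)
  define K where "K = cball (0::'a) (R0 + norm e)"
  have K: "compact K" by (simp add: K_def)
  have outK: "x \<notin> C" "x + t n *\<^sub>R e \<notin> C" if "x \<notin> K" for x n
  proof -
    have n: "norm x > R0 + norm e" using that by (simp add: K_def)
    have "norm x \<le> norm (x + t n *\<^sub>R e) + norm (t n *\<^sub>R e)"
      by (metis add_diff_cancel norm_triangle_ineq4)
    moreover have "norm (t n *\<^sub>R e) \<le> norm e"
      using t[of n] by (simp add: mult_left_le_one_le)
    ultimately show "x + t n *\<^sub>R e \<notin> C" using R0[of "x + t n *\<^sub>R e"] n by auto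
    show "x \<notin> C" using R0[of x] n norm_ge_zero[of e] by auto
  qed
  have "compact (v ` K)" using K cv by (intro compact_continuous_image) (auto intro: continuous_on_subset)
  then obtain B where B: "\<And>x. x \<in> K \<Longrightarrow> \<bar>v x\<bar> \<le> B"
    using compact_imp_bounded[of "v ` K"] unfolding bounded_iff by auto
  have lip: "\<bar>u (x + t n *\<^sub>R s) - u x\<bar> / t n \<le> N * norm s" if "N-lipschitz_on UNIV u"
    for u :: "'a \<Rightarrow> real" and N x s n
  proof -
    have "\<bar>u (x + t n *\<^sub>R s) - u x\<bar> \<le> N * norm (t n *\<^sub>R s)"
      using lipschitz_onD[OF that, of "x + t n *\<^sub>R s" x] by (simp add: dist_norm)
    also have "\<dots> = N * norm s * t n" using t[of n] by simp
    finally show ?thesis using t[of n] by (simp add: pos_divide_le_eq)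
  qed
  let ?P = "\<lambda>n x. v x * ((\<phi> (x + t n *\<^sub>R e) - \<phi> x) / t n)"
  let ?Q = "\<lambda>n x. ((v (x + t n *\<^sub>R (- e)) - v x) / t n) * \<phi> x"
  have cs: "continuous_on UNIV (\<lambda>x. u (x + y))" if "continuous_on UNIV u" for u :: "'a \<Rightarrow> real" and y
    using that by (intro continuous_on_compose2[OF that]) (auto intro: continuous_intros)
  have cP: "continuous_on UNIV (?P n)" for n
    using t by (intro continuous_intros cv c\<phi> cs) auto
  have cQ: "continuous_on UNIV (?Q n)" for n
    using t by (intro continuous_intros cv c\<phi> cs) auto
  \<comment> \<open>The compact set \<open>K\<close> contains the supports of all the translates of \<open>\<phi>\<close>, so it carries an integrable majorant.\<close>
  have lP: "(\<lambda>n. \<integral>x. ?P n x \<partial>lebesgue) \<longlonglongrightarrow> (\<integral>x. v x * (grad \<phi> x \<bullet> e) \<partial>lebesgue)"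
  proof (rule integral_dominated_convergence[where w = "\<lambda>x. indicator K x *\<^sub>R (B * (M * norm e))"])
    show "(\<lambda>x. v x * (grad \<phi> x \<bullet> e)) \<in> borel_measurable lebesgue"
      by (intro continuous_lebesgue_measurable continuous_intros cv test_functions_grad(2)[OF \<phi>])
    show "?P n \<in> borel_measurable lebesgue" for n
      by (rule continuous_lebesgue_measurable[OF cP])
    have "integrable lborel (\<lambda>x. indicator K x *\<^sub>R (B * (M * norm e)))"
      using K by (intro borel_integrable_compact) auto
    then show "integrable lebesgue (\<lambda>x. indicator K x *\<^sub>R (B * (M * norm e)))"
      using integrable_completion borel_measurable_integrable by blast
    show "AE x in lebesgue. (\<lambda>n. ?P n x) \<longlonglongrightarrow> v x * (grad \<phi> x \<bullet> e)"
    proof (intro AE_I2 tendsto_mult tendsto_const)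
      show "(\<lambda>n. (\<phi> (x + t n *\<^sub>R e) - \<phi> x) / t n) \<longlonglongrightarrow> grad \<phi> x \<bullet> e" for x
        using dq[where s = e, OF test_functions_grad(1)[OF \<phi>, of x, unfolded gderiv_def]]
        by (simp add: inner_commute)
    qed
    show "AE x in lebesgue. norm (?P n x) \<le> indicator K x *\<^sub>R (B * (M * norm e))" for n
    proof (intro AE_I2)
      fix x
      show "norm (?P n x) \<le> indicator K x *\<^sub>R (B * (M * norm e))"
      proof (cases "x \<in> K")
        case True
        have "\<bar>v x\<bar> * (\<bar>\<phi> (x + t n *\<^sub>R e) - \<phi> x\<bar> / t n) \<le> B * (M * norm e)"
          using B[OF True] lip[OF M, of x n e] t[of n]
          by (intro mult_mono) (auto intro: order_trans[OF abs_ge_zero])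
        then show ?thesis using True t[of n] by (simp add: abs_mult)
      next
        case False
        then show ?thesis using outK(1)[OF False] outK(2)[OF False, of n] C(3) by simp
      qed
    qed
  qed
  define G where "G x = (if x \<in> \<Omega> then g x \<bullet> e else 0)" for x
  have Gm: "G \<in> borel_measurable lebesgue"
    unfolding G_def[abs_def] using g by (intro borel_measurable_if_I[OF _ OL]) simp
  have lQ: "(\<lambda>n. \<integral>x. ?Q n x \<partial>lebesgue) \<longlonglongrightarrow> (\<integral>x. - G x * \<phi> x \<partial>lebesgue)"
  proof (rule integral_dominated_convergence[where w = "\<lambda>x. (L * norm e) * \<bar>\<phi> x\<bar>"])
    show "(\<lambda>x. - G x * \<phi> x) \<in> borel_measurable lebesgue"
      using Gm continuous_lebesgue_measurable[OF c\<phi>] by (intro borel_measurable_times borel_measurable_uminus)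
    show "?Q n \<in> borel_measurable lebesgue" for n
      by (rule continuous_lebesgue_measurable[OF cQ])
    show "integrable lebesgue (\<lambda>x. (L * norm e) * \<bar>\<phi> x\<bar>)"
      by (intro integrable_mult_right integrable_abs continuous_compact_support_integrable[OF c\<phi> C(1,3)])
    show "AE x in lebesgue. (\<lambda>n. ?Q n x) \<longlonglongrightarrow> - G x * \<phi> x"
      using d unfolding AE_lebesgue_on_iff[OF OL]
    proof eventually_elim
      case (elim x)
      show ?case
      proof (cases "x \<in> \<Omega>")
        case True
        then have "(\<lambda>n. (v (x + t n *\<^sub>R (- e)) - v x) / t n) \<longlonglongrightarrow> (- e) \<bullet> g x"
          using elim by (intro dq) auto
        then show ?thesis using True by (intro tendsto_mult tendsto_const) (simp add: G_def inner_commute)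
      next
        case False
        then have "\<phi> x = 0" using C(2,3) by blast
        then show ?thesis by simp
      qed
    qed
    show "AE x in lebesgue. norm (?Q n x) \<le> L * norm e * \<bar>\<phi> x\<bar>" for n
    proof (intro AE_I2)
      fix x
      have "\<bar>v (x + t n *\<^sub>R (- e)) - v x\<bar> / t n * \<bar>\<phi> x\<bar> \<le> (L * norm e) * \<bar>\<phi> x\<bar>"
        using lip[OF v, of x n "- e"] by (intro mult_right_mono) auto
      then show "norm (?Q n x) \<le> L * norm e * \<bar>\<phi> x\<bar>"
        using t[of n] by (simp add: abs_mult)
    qed
  qed
  have PQ: "(\<integral>x. ?P n x \<partial>lebesgue) = (\<integral>x. ?Q n x \<partial>lebesgue)" for n
  proof -
    have i1: "integrable lebesgue (\<lambda>x. v x * \<phi> (x + t n *\<^sub>R e))"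
      using outK C(3) by (intro continuous_compact_support_integrable[OF _ K] continuous_intros cv c\<phi> cs) auto
    have i2: "integrable lebesgue (\<lambda>x. v x * \<phi> x)"
      using C by (intro continuous_compact_support_integrable[OF _ C(1)] continuous_intros cv c\<phi>) auto
    have i3: "integrable lebesgue (\<lambda>x. v (x - t n *\<^sub>R e) * \<phi> x)"
      using C cs[OF cv, of "- (t n *\<^sub>R e)"]
      by (intro continuous_compact_support_integrable[OF _ C(1)] continuous_intros c\<phi>) auto
    have "(\<integral>x. v x * \<phi> (x + t n *\<^sub>R e) \<partial>lebesgue)
        = (\<integral>x. v ((- (t n *\<^sub>R e)) + x) * \<phi> (((- (t n *\<^sub>R e)) + x) + t n *\<^sub>R e) \<partial>lebesgue)"
      by (rule lebesgue_integral_translate[symmetric, where f = "\<lambda>x. v x * \<phi> (x + t n *\<^sub>R e)"])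
         (intro continuous_intros cv c\<phi> cs)
    also have "\<dots> = (\<integral>x. v (x - t n *\<^sub>R e) * \<phi> x \<partial>lebesgue)"
      by (simp add: algebra_simps)
    finally have eq: "(\<integral>x. v x * \<phi> (x + t n *\<^sub>R e) \<partial>lebesgue) = (\<integral>x. v (x - t n *\<^sub>R e) * \<phi> x \<partial>lebesgue)" .
    have "(\<integral>x. ?P n x \<partial>lebesgue) = (\<integral>x. (v x * \<phi> (x + t n *\<^sub>R e) - v x * \<phi> x) / t n \<partial>lebesgue)"
      by (simp add: right_diff_distrib)
    also have "\<dots> = (\<integral>x. (v (x - t n *\<^sub>R e) * \<phi> x - v x * \<phi> x) / t n \<partial>lebesgue)"
      using i1 i2 i3 eq by (simp del: times_divide_eq_right)
    also have "\<dots> = (\<integral>x. ?Q n x \<partial>lebesgue)"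
      by (simp add: left_diff_distrib)
    finally show ?thesis .
  qed
  have "(\<integral>x. v x * (grad \<phi> x \<bullet> e) \<partial>lebesgue) = (\<integral>x. - G x * \<phi> x \<partial>lebesgue)"
    using lP lQ unfolding PQ by (rule LIMSEQ_unique)
  moreover have "(\<lambda>x. if x \<in> \<Omega> then v x * (grad \<phi> x \<bullet> e) else 0) = (\<lambda>x. v x * (grad \<phi> x \<bullet> e))"
  proof
    show "(if x \<in> \<Omega> then v x * (grad \<phi> x \<bullet> e) else 0) = v x * (grad \<phi> x \<bullet> e)" for x
      using C(2) C(4)[of x] by (cases "x \<in> C") auto
  qed
  moreover have "(\<lambda>x. if x \<in> \<Omega> then (g x \<bullet> e) * \<phi> x else 0) = (\<lambda>x. G x * \<phi> x)"
    by (auto simp: G_def)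
  ultimately show ?thesis
    using integral_lebesgue_on_eq[OF OL, of "\<lambda>x. v x * (grad \<phi> x \<bullet> e)"]
      integral_lebesgue_on_eq[OF OL, of "\<lambda>x. (g x \<bullet> e) * \<phi> x"] by simp
qed

subsection \<open>Test functions as Sobolev functions\<close>

lemma continuous_locally_integrable:
  fixes f :: "'a::euclidean_space \<Rightarrow> 'b::euclidean_space"
  assumes "continuous_on S f" "\<Omega> \<subseteq> S"
  shows "locally_integrable \<Omega> f"
  unfolding locally_integrable_def
proof (intro allI impI)
  fix K assume K: "compact K \<and> K \<subseteq> \<Omega>"
  have "integrable lborel (\<lambda>x. indicator K x *\<^sub>R f x)"
    using K assms by (intro borel_integrable_compact) (auto intro: continuous_on_subset)
  then have "integrable lebesgue (\<lambda>x. indicator K x *\<^sub>R f x)"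
    using integrable_completion borel_measurable_integrable by blast
  moreover have "(\<lambda>x. indicator K x *\<^sub>R f x) = (\<lambda>x. if x \<in> K then f x else 0)"
    by (auto simp: indicator_def)
  ultimately show "integrable (lebesgue_on K) f"
    using K by (simp add: integrable_lebesgue_on_iff lmeasurable_compact fmeasurableD)
qed

lemma test_function_square_integrable:
  fixes f :: "'a::euclidean_space \<Rightarrow> 'b::euclidean_space"
  assumes "continuous_on UNIV f" "compact C" "\<And>x. x \<notin> C \<Longrightarrow> f x = 0" "open \<Omega>"
  shows "f \<in> L2 (lebesgue_on \<Omega>)"
proof -
  have "integrable lebesgue (\<lambda>x. (norm (f x))\<^sup>2)"
    using assms by (intro continuous_compact_support_integrable[OF _ assms(2)] continuous_intros) auto
  then have "integrable (lebesgue_on UNIV) (\<lambda>x. (norm (f x))\<^sup>2)"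
    by (simp add: lebesgue_on_UNIV_eq)
  then have "integrable (lebesgue_on \<Omega>) (\<lambda>x. (norm (f x))\<^sup>2)"
    by (rule integrable_lebesgue_on_subset) (use assms(4) in auto)
  moreover have "f \<in> borel_measurable (lebesgue_on \<Omega>)"
    using assms by (intro continuous_imp_measurable_on_sets_lebesgue) (auto intro: continuous_on_subset)
  ultimately show ?thesis by (simp add: L2_def)
qed

lemma test_function_weak_grad:
  fixes w :: "'a::euclidean_space \<Rightarrow> real"
  assumes O: "open \<Omega>" and w: "w \<in> test_functions \<Omega>'"
  shows "is_weak_grad \<Omega> w (grad w)"
proof -
  obtain M where M: "M-lipschitz_on UNIV w" using test_functions_lipschitz[OF w] .
  have "grad w \<in> borel_measurable (lebesgue_on \<Omega>)"
    using test_functions_grad(2)[OF w] O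
    by (intro continuous_imp_measurable_on_sets_lebesgue) (auto intro: continuous_on_subset)
  then show ?thesis
    unfolding is_weak_grad_def
    using test_functions_grad[OF w, unfolded gderiv_def]
    by (auto intro!: lipschitz_integration_by_parts[OF O _ M] continuous_locally_integrable[of UNIV] AE_I2)
qed

text \<open>A test function is the limit of the constant sequence of itself; its classical gradient is its weak one.\<close>

lemma test_function_H10:
  fixes w :: "'a::euclidean_space \<Rightarrow> real"
  assumes O: "open \<Omega>" and w: "w \<in> test_functions \<Omega>"
  shows "w \<in> H10 \<Omega>" "AE x in lebesgue_on \<Omega>. wgrad \<Omega> w x = grad w x"
    "w \<in> L2 (lebesgue_on \<Omega>)" "grad w \<in> L2 (lebesgue_on \<Omega>)"
proof -
  obtain C where C: "compact C" "C \<subseteq> \<Omega>" "\<And>x. x \<notin> C \<Longrightarrow> w x = 0" "\<And>x. x \<notin> C \<Longrightarrow> grad w x = 0"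
    using test_functionsE[OF w] by metis
  show L: "w \<in> L2 (lebesgue_on \<Omega>)" "grad w \<in> L2 (lebesgue_on \<Omega>)"
    using test_functions_grad[OF w] C O by (auto intro: test_function_square_integrable)
  note W = test_function_weak_grad[OF O w]
  show ae: "AE x in lebesgue_on \<Omega>. wgrad \<Omega> w x = grad w x"
    by (rule wgrad_AE[OF O W])
  have "l2_norm (lebesgue_on \<Omega>) (\<lambda>x. wgrad \<Omega> w x - grad w x) = 0"
  proof -
    have "(\<integral>x. (wgrad \<Omega> w x - grad w x) \<bullet> (wgrad \<Omega> w x - grad w x) \<partial>lebesgue_on \<Omega>) = 0"
    proof (rule integral_eq_zero_AE)
      show "AE x in lebesgue_on \<Omega>. (wgrad \<Omega> w x - grad w x) \<bullet> (wgrad \<Omega> w x - grad w x) = 0"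
        using ae by eventually_elim simp
    qed
    then show ?thesis by (simp add: l2_norm_def l2_inner_def)
  qed
  moreover have "l2_norm (lebesgue_on \<Omega>) (\<lambda>x. w x - w x) = 0"
    by (simp add: l2_norm_def l2_inner_def)
  ultimately show "w \<in> H10 \<Omega>"
    using L W w by (auto simp: H10_def H1_def intro!: exI[of _ "\<lambda>_. w"])
qed

section \<open>Meshes\<close>

lemma full_simplex:
  fixes K :: "'a::euclidean_space set"
  assumes "int DIM('a) simplex K"
  shows "compact K" "convex K" "interior K \<noteq> {}" "rel_interior K = interior K"
    "negligible (frontier K)" "closure (interior K) = K"
proof -
  show c: "compact K" "convex K"
    using assms by (auto simp: simplex_def intro: finite_imp_compact_convex_hull aff_independent_finite)
  have "affine hull K = UNIV"
    using aff_dim_simplex[OF assms] aff_dim_eq_full by blast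
  then show r: "rel_interior K = interior K" by (rule rel_interior_interior)
  have "K \<noteq> {}" using \<open>affine hull K = UNIV\<close> by auto
  then show i: "interior K \<noteq> {}" using r rel_interior_eq_empty[OF c(2)] by auto
  show "negligible (frontier K)" using c(2) by (rule negligible_convex_frontier)
  show "closure (interior K) = K"
    using convex_closure_interior[OF c(2) i] c(1) by (simp add: compact_imp_closed)
qed

text \<open>A proper face lies in the relative boundary.\<close>

lemma face_meets_interior:
  assumes "F face_of K" "int DIM('a) simplex (K::'a::euclidean_space set)" "x \<in> F" "x \<in> interior K"
  shows "F = K"
proof
  show "F \<subseteq> K" using assms(1) by (rule face_of_imp_subset)
  show "K \<subseteq> F"
    using assms full_simplex(4)[OF assms(2)] by (intro subset_of_face_of[OF assms(1)]) auto
qed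

text \<open>The condition \<open>interior (closure \<Omega>) = \<Omega>\<close> excludes slits: a ball covered by two elements lies in the domain,
  and so may carry a test function.\<close>

locale simplicial_mesh =
  fixes \<Omega> :: "'a::euclidean_space set" and T :: "'a set set"
  assumes mesh: "mesh \<Omega> T" and regular_domain: "open \<Omega>" "bounded \<Omega>" "interior (closure \<Omega>) = \<Omega>"
begin

lemma finite_T: "finite T"
  using mesh by (simp add: mesh_def triangulation_def)

lemma simplex_T: "K \<in> T \<Longrightarrow> int DIM('a) simplex K"
  using mesh by (simp add: mesh_def)

lemma Union_T: "\<Union>T = closure \<Omega>"
  using mesh by (simp add: mesh_def)

lemma element_sets: "K \<in> T \<Longrightarrow> K \<in> sets lebesgue" "K \<in> T \<Longrightarrow> interior K \<in> sets lebesgue" "\<Omega> \<in> sets lebesgue"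
  using full_simplex(1)[OF simplex_T] regular_domain
  by (auto intro: fmeasurableD lmeasurable_compact)

text \<open>The intersection of two elements is a common face; a face that meets the interior is the whole element.\<close>

lemma interior_elements_disjoint:
  assumes "K \<in> T" "K' \<in> T" "x \<in> interior K" "x \<in> K'"
  shows "K = K'"
proof -
  have F: "(K \<inter> K') face_of K" "(K' \<inter> K) face_of K'"
    using mesh assms by (auto simp: mesh_def triangulation_def)
  have "x \<in> K" using assms(3) interior_subset by blast
  then have "K \<inter> K' = K"
    using face_meets_interior[OF F(1) simplex_T[OF assms(1)]] assms by auto
  then have sub: "K \<subseteq> K'" by auto
  obtain z where "z \<in> interior K" using full_simplex(3)[OF simplex_T[OF assms(1)]] by auto
  then have "z \<in> interior K'" "z \<in> K' \<inter> K"
    using sub interior_mono interior_subset by blast+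
  then have "K' \<inter> K = K'"
    using face_meets_interior[OF F(2) simplex_T[OF assms(2)]] by auto
  with sub show ?thesis by auto
qed

lemma interior_element_subset: "K \<in> T \<Longrightarrow> interior K \<subseteq> \<Omega>"
  using Union_T regular_domain(3) by (metis Union_upper interior_mono)

lemma AE_interior_element: "AE x in lebesgue. x \<in> \<Omega> \<longrightarrow> (\<exists>K\<in>T. x \<in> interior K)"
proof -
  have "negligible (\<Union>K\<in>T. frontier K)"
    using finite_T full_simplex(5)[OF simplex_T] by (intro negligible_Union) auto
  then show ?thesis
  proof (rule eventually_mono[OF AE_lebesgue_negligible], intro impI)
    fix x assume x: "x \<notin> (\<Union>K\<in>T. frontier K)" "x \<in> \<Omega>"
    then obtain K where "K \<in> T" "x \<in> K"
      using Union_T closure_subset[of \<Omega>] by blast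
    then show "\<exists>K\<in>T. x \<in> interior K"
      using x full_simplex(1)[OF simplex_T[OF \<open>K \<in> T\<close>]]
      by (auto simp: frontier_def compact_imp_closed)
  qed
qed

lemma AE_element_interior:
  assumes "K \<in> T"
  shows "AE x in lebesgue. x \<in> K \<longleftrightarrow> x \<in> interior K"
proof -
  have "AE x in lebesgue. x \<notin> frontier K"
    using full_simplex(5)[OF simplex_T[OF assms]] by (rule AE_lebesgue_negligible)
  then show ?thesis
  proof eventually_elim
    case (elim x)
    then show ?case
      using full_simplex(1)[OF simplex_T[OF assms]] interior_subset
      by (auto simp: frontier_def compact_imp_closed)
  qed
qed

lemma measurable_element:
  fixes f :: "'a \<Rightarrow> 'b::euclidean_space"
  assumes "K \<in> T" "f \<in> borel_measurable (lebesgue_on \<Omega>)"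
  shows "f \<in> borel_measurable (lebesgue_on K)"
proof -
  have "f \<in> borel_measurable (lebesgue_on (interior K))"
    using assms interior_element_subset[OF assms(1)] by (meson measurable_restrict_mono)
  then show ?thesis
    using lebesgue_on_null_difference(1)[OF element_sets(1)[OF assms(1)] element_sets(2)[OF assms(1)] AE_element_interior[OF assms(1)]]
    by blast
qed

lemma integrable_element:
  fixes f :: "'a \<Rightarrow> 'b::euclidean_space"
  assumes "K \<in> T" "integrable (lebesgue_on \<Omega>) f"
  shows "integrable (lebesgue_on K) f"
proof -
  have "integrable (lebesgue_on (interior K)) f"
    by (rule integrable_lebesgue_on_subset[OF assms(2) element_sets(2)[OF assms(1)] element_sets(3)
          interior_element_subset[OF assms(1)]])
  then show ?thesis
    using lebesgue_on_null_difference(2)[OF element_sets(1)[OF assms(1)] element_sets(2)[OF assms(1)] AE_element_interior[OF assms(1)]]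
    by blast
qed

lemma L2_element: "K \<in> T \<Longrightarrow> f \<in> L2 (lebesgue_on \<Omega>) \<Longrightarrow> f \<in> L2 (lebesgue_on K)"
  using measurable_element integrable_element by (auto simp: L2_def)

text \<open>Element boundaries are null sets, and almost every point of the domain lies in exactly one element.\<close>

lemma mesh_sum_eq:
  fixes f :: "'a \<Rightarrow> real"
  shows "AE x in lebesgue. (\<Sum>K\<in>T. if x \<in> K then f x else 0) = (if x \<in> \<Omega> then f x else 0)"
proof -
  have "AE x in lebesgue. \<forall>K\<in>T. x \<in> K \<longleftrightarrow> x \<in> interior K"
    using finite_T AE_element_interior by (intro AE_finite_allI) auto
  with AE_interior_element show ?thesis
  proof eventually_elim
    case (elim x)
    show ?case
    proof (cases "x \<in> \<Omega>")
      case True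
      then obtain K0 where K0: "K0 \<in> T" "x \<in> interior K0" using elim by auto
      have "x \<in> K \<longleftrightarrow> K = K0" if "K \<in> T" for K
        using interior_elements_disjoint[OF K0(1) that K0(2)] elim that K0 by auto
      then have "(\<Sum>K\<in>T. if x \<in> K then f x else 0) = (\<Sum>K\<in>T. if K = K0 then f x else 0)"
        by (intro sum.cong) auto
      then show ?thesis using True K0 finite_T by simp
    next
      case False
      have "x \<notin> K" if "K \<in> T" for K using elim that False interior_element_subset[OF that] by auto
      then show ?thesis using False by simp
    qed
  qed
qed

lemma mesh_integral:
  fixes f :: "'a \<Rightarrow> real"
  assumes "\<And>K. K \<in> T \<Longrightarrow> integrable (lebesgue_on K) f"
  shows "integrable (lebesgue_on \<Omega>) f"
    "integral\<^sup>L (lebesgue_on \<Omega>) f = (\<Sum>K\<in>T. integral\<^sup>L (lebesgue_on K) f)"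
proof -
  have i: "integrable lebesgue (\<lambda>x. if x \<in> K then f x else 0)" if "K \<in> T" for K
    using assms[OF that] integrable_lebesgue_on_iff[OF element_sets(1)[OF that]] by blast
  have s: "integrable lebesgue (\<lambda>x. \<Sum>K\<in>T. if x \<in> K then f x else 0)"
    using i by (rule Bochner_Integration.integrable_sum)
  have m: "(\<lambda>x. if x \<in> \<Omega> then f x else 0) \<in> borel_measurable lebesgue"
    using borel_measurable_integrable[OF s] mesh_sum_eq by (rule borel_measurable_AE)
  have "integrable lebesgue (\<lambda>x. if x \<in> \<Omega> then f x else 0)"
    using s m mesh_sum_eq[of f] borel_measurable_integrable[OF s]
      integrable_cong_AE[of "\<lambda>x. \<Sum>K\<in>T. if x \<in> K then f x else 0" lebesgue "\<lambda>x. if x \<in> \<Omega> then f x else 0"]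
    by blast
  then show "integrable (lebesgue_on \<Omega>) f"
    using integrable_lebesgue_on_iff[OF element_sets(3)] by blast
  have "(\<integral>x. (if x \<in> \<Omega> then f x else 0) \<partial>lebesgue) = (\<integral>x. (\<Sum>K\<in>T. if x \<in> K then f x else 0) \<partial>lebesgue)"
    by (rule integral_cong_AE[OF m borel_measurable_integrable[OF s]])
       (use mesh_sum_eq[of f] in \<open>eventually_elim, simp\<close>)
  also have "\<dots> = (\<Sum>K\<in>T. \<integral>x. (if x \<in> K then f x else 0) \<partial>lebesgue)"
    using i by (rule Bochner_Integration.integral_sum)
  finally show "integral\<^sup>L (lebesgue_on \<Omega>) f = (\<Sum>K\<in>T. integral\<^sup>L (lebesgue_on K) f)"
    using element_sets by (simp add: integral_lebesgue_on_eq)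
qed

subsection \<open>Piecewise affine functions\<close>

text \<open>An affine function on a set with interior points determines its gradient, so the definite description in
  \<open>elem_grad\<close> denotes.\<close>

lemma VT_elem_grad:
  assumes "v \<in> VT \<Omega> T" "K \<in> T"
  obtains c where "\<And>x. x \<in> K \<Longrightarrow> v x = c + elem_grad v K \<bullet> x"
proof -
  obtain c g where cg: "\<And>x. x \<in> K \<Longrightarrow> v x = c + g \<bullet> x"
    using assms by (fastforce simp: VT_def P1_def)
  have "g' = g" if ex: "\<exists>c'. \<forall>x\<in>K. v x = c' + g' \<bullet> x" for g'
  proof -
    obtain c' where c': "\<And>x. x \<in> K \<Longrightarrow> v x = c' + g' \<bullet> x" using ex by auto
    obtain z r where z: "0 < r" "cball z r \<subseteq> K"
      using full_simplex(3)[OF simplex_T[OF assms(2)]] by (meson all_not_in_conv mem_interior_cball)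
    have "(g' - g) \<bullet> h = 0" if "norm h \<le> r" for h
    proof -
      have "z + h \<in> K" "z \<in> K" using z that by (auto simp: subset_iff dist_norm)
      then show ?thesis using cg[of z] cg[of "z+h"] c'[of z] c'[of "z+h"]
        by (auto simp: algebra_simps inner_simps)
    qed
    note this[of "(r / norm (g' - g)) *\<^sub>R (g' - g)"]
    then show "g' = g" using z(1) by (cases "g' - g = 0") auto
  qed
  then have "elem_grad v K = g"
    unfolding elem_grad_def using cg by (intro the_equality) blast+
  then show ?thesis using that[of c] cg by simp
qed

text \<open>Interiors make the sum have at most one nonzero term; on the null set of element boundaries the value is zero.\<close>

definition pw_grad :: "('a \<Rightarrow> real) \<Rightarrow> 'a \<Rightarrow> 'a"
  where "pw_grad v x = (\<Sum>K\<in>T. indicator (interior K) x *\<^sub>R elem_grad v K)"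

lemma pw_grad_eq:
  assumes "K \<in> T" "x \<in> interior K"
  shows "pw_grad v x = elem_grad v K"
proof -
  have "pw_grad v x = (\<Sum>K'\<in>T. if K' = K then elem_grad v K else 0)"
    unfolding pw_grad_def
  proof (intro sum.cong refl)
    fix K' assume "K' \<in> T"
    then show "indicator (interior K') x *\<^sub>R elem_grad v K' = (if K' = K then elem_grad v K else 0)"
      using interior_elements_disjoint[OF \<open>K' \<in> T\<close> assms(1), of x] assms interior_subset[of K]
      by (auto simp: indicator_def)
  qed
  then show ?thesis using assms finite_T by simp
qed

lemma pw_grad_measurable: "pw_grad v \<in> borel_measurable (lebesgue_on S)"
proof -
  have "pw_grad v \<in> borel_measurable lebesgue"
    unfolding pw_grad_def by (intro borel_measurable_sum borel_measurable_scaleR borel_measurable_indicator) auto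
  then show ?thesis by (rule measurable_restrict_space1)
qed

lemma pw_grad_bounded: "norm (pw_grad v x) \<le> (\<Sum>K\<in>T. norm (elem_grad v K))"
  unfolding pw_grad_def
  by (rule order_trans[OF norm_sum]) (auto intro!: sum_mono simp: indicator_def)

text \<open>Continued by zero, a finite element function is Lipschitz on the whole space: along a segment it
  is Lipschitz on each of finitely many closed pieces that cover the segment.\<close>

lemma VT_lipschitz:
  assumes v: "v \<in> VT \<Omega> T"
  shows "(\<Sum>K\<in>T. norm (elem_grad v K))-lipschitz_on UNIV (\<lambda>x. if x \<in> \<Omega> then v x else 0)"
proof -
  define v0 where "v0 x = (if x \<in> \<Omega> then v x else 0)" for x
  define L where "L = (\<Sum>K\<in>T. norm (elem_grad v K))"
  have L0: "0 \<le> L" by (auto simp: L_def sum_nonneg)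
  have fr: "v x = 0" if "x \<in> frontier \<Omega>" for x using v that by (auto simp: VT_def)
  have v0K: "v0 x = v x" if "K \<in> T" "x \<in> K" for x K
    using that Union_T fr[of x] regular_domain(1) by (auto simp: v0_def frontier_def interior_open)
  have "dist (v0 x) (v0 z) \<le> L * dist x z" for x z
  proof -
    define p where "p t = x + t *\<^sub>R (z - x)" for t :: real
    have pc: "continuous_on S p" for S unfolding p_def by (intro continuous_intros)
    \<comment> \<open>The empty set, which is not an element, serves as the index of the piece outside the domain.\<close>
    define U where "U K = (if K \<in> T then p -` K else p -` (- \<Omega>))" for K
    have "(L * dist x z)-lipschitz_on {0..1} (v0 \<circ> p)"
    proof (rule lipschitz_on_closed_Union[where I = "insert {} T" and U = U])
      have ne: "{} \<notin> T" using full_simplex(3)[OF simplex_T] by fastforce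
      fix K assume K: "K \<in> insert {} T"
      show "closed (U K)"
      proof (cases "K \<in> T")
        case True
        then show ?thesis using compact_imp_closed[OF full_simplex(1)[OF simplex_T[OF True]]]
          by (simp add: U_def closed_vimage[OF _ pc])
      next
        case False
        then show ?thesis using regular_domain(1) by (simp add: U_def closed_vimage[OF _ pc] closed_Compl)
      qed
      show "(L * dist x z)-lipschitz_on (U K) (v0 \<circ> p)"
      proof (cases "K \<in> T")
        case True
        then obtain c where c: "\<And>x. x \<in> K \<Longrightarrow> v x = c + elem_grad v K \<bullet> x"
          using VT_elem_grad[OF v] by blast
        have e: "norm (elem_grad v K) \<le> L"
          unfolding L_def using True finite_T by (intro member_le_sum) auto
        show ?thesis
        proof (rule lipschitz_onI)
          fix s t assume "s \<in> U K" "t \<in> U K"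
          then have "v0 (p s) - v0 (p t) = elem_grad v K \<bullet> (p s - p t)"
            using True v0K[OF True] c by (auto simp: U_def inner_diff_right)
          also have "p s - p t = (s - t) *\<^sub>R (z - x)" by (simp add: p_def algebra_simps)
          finally have "\<bar>v0 (p s) - v0 (p t)\<bar> \<le> norm (elem_grad v K) * norm ((s - t) *\<^sub>R (z - x))"
            using Cauchy_Schwarz_ineq2 by metis
          also have "\<dots> \<le> L * norm ((s - t) *\<^sub>R (z - x))"
            using e by (intro mult_right_mono) auto
          finally show "dist ((v0 \<circ> p) s) ((v0 \<circ> p) t) \<le> L * dist x z * dist s t"
            by (simp add: dist_norm norm_minus_commute[of z x] mult_ac)
        qed (use L0 in auto)
      next
        case False
        then show ?thesis using L0 by (intro lipschitz_onI) (auto simp: U_def v0_def)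
      qed
    next
      show "{0..1} \<subseteq> (\<Union>K\<in>insert {} T. U K)"
      proof
        fix t :: real assume "t \<in> {0..1}"
        have ne: "{} \<notin> T" using full_simplex(3)[OF simplex_T] by fastforce
        show "t \<in> (\<Union>K\<in>insert {} T. U K)"
        proof (cases "p t \<in> \<Omega>")
          case True
          then obtain K where "K \<in> T" "p t \<in> K" using Union_T closure_subset[of \<Omega>] by blast
          then show ?thesis by (auto simp: U_def)
        next
          case False
          then show ?thesis using ne by (auto simp: U_def)
        qed
      qed
    qed (use finite_T L0 in auto)
    then have "dist ((v0 \<circ> p) 0) ((v0 \<circ> p) 1) \<le> L * dist x z * dist 0 (1::real)"
      by (rule lipschitz_onD) auto
    then show ?thesis by (simp add: p_def)
  qed
  then show ?thesis unfolding v0_def[abs_def] L_def[symmetric]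
    using L0 by (intro lipschitz_onI) (auto simp: v0_def)
qed

text \<open>The continuation by zero is Lipschitz and differentiable off the element boundaries, which suffices for
  integration by parts.\<close>

lemma VT_weak_grad:
  assumes v: "v \<in> VT \<Omega> T"
  shows "is_weak_grad \<Omega> v (pw_grad v)"
proof -
  let ?v = "\<lambda>x. if x \<in> \<Omega> then v x else 0"
  have li: "locally_integrable \<Omega> v"
    using v by (intro continuous_locally_integrable[of "closure \<Omega>"]) (auto simp: VT_def closure_subset)
  have lg: "locally_integrable \<Omega> (pw_grad v)"
    unfolding locally_integrable_def
  proof (intro allI impI)
    fix K assume "compact K \<and> K \<subseteq> \<Omega>"
    then have "emeasure lebesgue K < \<infinity>" "K \<in> sets lebesgue"
      using lmeasurable_compact[of K] by (auto simp: fmeasurable_def)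
    then have "finite_measure (lebesgue_on K)"
      by (auto intro!: finite_measureI simp: emeasure_restrict_space)
    then show "integrable (lebesgue_on K) (pw_grad v)"
      using pw_grad_bounded by (intro finite_measure.integrable_const_bound[OF _ _ pw_grad_measurable]) auto
  qed
  have "AE x in lebesgue_on \<Omega>. (?v has_derivative (\<lambda>h. h \<bullet> pw_grad v x)) (at x)"
    using AE_interior_element unfolding AE_lebesgue_on_iff[OF element_sets(3)]
  proof eventually_elim
    case (elim x)
    show ?case
    proof
      assume "x \<in> \<Omega>"
      then obtain K where K: "K \<in> T" "x \<in> interior K" using elim by auto
      obtain c where c: "\<And>x. x \<in> K \<Longrightarrow> v x = c + elem_grad v K \<bullet> x"
        using VT_elem_grad[OF v K(1)] by blast
      have "((\<lambda>z. c + z \<bullet> elem_grad v K) has_derivative (\<lambda>h. h \<bullet> elem_grad v K)) (at x)"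
        by (auto intro!: derivative_eq_intros)
      then have "(?v has_derivative (\<lambda>h. h \<bullet> elem_grad v K)) (at x)"
      proof (rule has_derivative_transform_within_open[OF _ open_interior K(2)])
        fix z assume z: "z \<in> interior K"
        then show "c + z \<bullet> elem_grad v K = ?v z"
          using c[of z] interior_subset[of K] interior_element_subset[OF K(1)] by (auto simp: inner_commute)
      qed
      then show "(?v has_derivative (\<lambda>h. h \<bullet> pw_grad v x)) (at x)"
        using pw_grad_eq[OF K] by simp
    qed
  qed
  note ibp = lipschitz_integration_by_parts[OF regular_domain(1) _ VT_lipschitz[OF v] pw_grad_measurable this]
  have "(\<integral>x. v x * (grad \<phi> x \<bullet> e) \<partial>lebesgue_on \<Omega>) = (\<integral>x. ?v x * (grad \<phi> x \<bullet> e) \<partial>lebesgue_on \<Omega>)" for \<phi> e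
    by (rule Bochner_Integration.integral_cong) auto
  then show ?thesis using li lg ibp by (simp add: is_weak_grad_def)
qed

end

section \<open>Geometry of simplices\<close>

text \<open>In a chart around a boundary point the domain is the part below a Lipschitz graph. The open part above the graph
  misses the domain and comes arbitrarily close to the point, so the point is not interior to the closure.\<close>

lemma polytopal_lipschitz_domain_regular:
  assumes "polytopal_lipschitz_domain \<Omega>"
  shows "interior (closure \<Omega>) = \<Omega>"
proof
  have O: "open \<Omega>" using assms by (simp add: polytopal_lipschitz_domain_def)
  then show "\<Omega> \<subseteq> interior (closure \<Omega>)"
    by (simp add: closure_subset interior_maximal)
  show "interior (closure \<Omega>) \<subseteq> \<Omega>"
  proof (rule ccontr)
    assume "\<not> interior (closure \<Omega>) \<subseteq> \<Omega>"
    then obtain x where x: "x \<in> interior (closure \<Omega>)" "x \<notin> \<Omega>" by auto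
    then have "x \<in> frontier \<Omega>"
      using O interior_subset by (auto simp: frontier_def interior_open)
    then obtain r e L g where r: "r > 0" and e: "norm e = 1" and g: "L-lipschitz_on UNIV (g :: _ \<Rightarrow> real)"
      and loc: "\<Omega> \<inter> ball x r = {z \<in> ball x r. z \<bullet> e < g (z - (z \<bullet> e) *\<^sub>R e)}"
      using assms unfolding polytopal_lipschitz_domain_def lipschitz_boundary_def by meson
    obtain s where s: "s > 0" "ball x s \<subseteq> closure \<Omega>"
      using x(1) by (auto simp: mem_interior)
    define t where "t = min r s / 2"
    have t: "0 < t" "t < r" "t < s" using r s by (auto simp: t_def)
    have ee: "e \<bullet> e = 1" using e by (simp add: dot_square_norm)
    \<comment> \<open>A point above the graph, within the chart and within the ball that is supposed to lie in the closure.\<close>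
    define y where "y = x + t *\<^sub>R e"
    have cg: "continuous_on UNIV g" using g by (rule lipschitz_on_continuous_on)
    define W where "W = ball x r \<inter> {z. g (z - (z \<bullet> e) *\<^sub>R e) < z \<bullet> e}"
    have "open W"
      unfolding W_def
      by (intro open_Int open_ball open_Collect_less continuous_intros
          continuous_on_compose2[OF cg]) auto
    moreover have "W \<inter> \<Omega> = {}"
    proof (rule ccontr)
      assume "W \<inter> \<Omega> \<noteq> {}"
      then obtain z where z: "z \<in> W" "z \<in> \<Omega>" by blast
      then have "z \<in> \<Omega> \<inter> ball x r" unfolding W_def by blast
      then have "z \<bullet> e < g (z - (z \<bullet> e) *\<^sub>R e)" unfolding loc by blast
      then show False using z(1) by (simp add: W_def)
    qed
    ultimately have "W \<inter> closure \<Omega> = {}" by (simp add: open_Int_closure_eq_empty)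
    moreover have "y \<in> W"
    proof -
      have "\<not> x \<bullet> e < g (x - (x \<bullet> e) *\<^sub>R e)"
      proof
        assume "x \<bullet> e < g (x - (x \<bullet> e) *\<^sub>R e)"
        moreover have "x \<in> ball x r" using r by simp
        ultimately have "x \<in> \<Omega> \<inter> ball x r" unfolding loc by blast
        then show False using x(2) by blast
      qed
      moreover have "y - (y \<bullet> e) *\<^sub>R e = x - (x \<bullet> e) *\<^sub>R e" "y \<bullet> e = x \<bullet> e + t"
        using ee by (auto simp: y_def inner_simps algebra_simps)
      moreover have "y \<in> ball x r" using t e by (auto simp: y_def dist_norm)
      ultimately show ?thesis using t by (auto simp: W_def)
    qed
    moreover have "y \<in> closure \<Omega>" using s t e by (auto simp: y_def dist_norm subset_iff)
    ultimately show False by auto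
  qed
qed

text \<open>The affine functions that are one at one vertex and zero at the others. They exist since the edges from a vertex are
  linearly independent, and their values are the coefficients of the affine combination.\<close>

lemma barycentric_coordinates:
  fixes C :: "'a::euclidean_space set"
  assumes indep: "\<not> affine_dependent C" and card: "card C = DIM('a) + 1"
  obtains k G where
    "\<And>a b. a \<in> C \<Longrightarrow> b \<in> C \<Longrightarrow> k a + G a \<bullet> b = (if a = b then 1 else (0::real))"
    "\<And>x. x \<in> convex hull C \<longleftrightarrow> (\<forall>a\<in>C. 0 \<le> k a + G a \<bullet> x)"
    "\<And>x. (\<Sum>a\<in>C. k a + G a \<bullet> x) = 1"
proof -
  have fin: "finite C" using card card.infinite by fastforce
  have "\<exists>k g. \<forall>b\<in>C. k + g \<bullet> b = (if a = b then 1 else (0::real))" if a: "a \<in> C" for a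
  proof -
    have "\<not> affine_dependent (insert a (C - {a}))" using indep a by (simp add: insert_absorb)
    then have ind: "independent ((\<lambda>x. -a + x) ` (C - {a}))"
      using affine_dependent_iff_dependent[of a "C - {a}"] by simp
    obtain h :: "'a \<Rightarrow> real" where h: "linear h" "\<And>x. x \<in> (\<lambda>x. -a + x) ` (C - {a}) \<Longrightarrow> h x = -1"
      using linear_independent_extend[OF ind, of "\<lambda>_. -1"] by blast
    interpret linear h by (rule h(1))
    define g where "g = adjoint h 1"
    have g: "g \<bullet> x = h x" for x
      using adjoint_works[OF h(1), of x 1] by (simp add: g_def inner_commute)
    have "(1 - g \<bullet> a) + g \<bullet> b = (if a = b then 1 else 0)" if "b \<in> C" for b
    proof (cases "a = b")
      case False
      then have "h (- a + b) = -1" using h(2) that by auto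
      then show ?thesis using False g using diff[of b a] by simp
    qed simp
    then show ?thesis by blast
  qed
  then obtain k G where kG: "\<And>a b. a \<in> C \<Longrightarrow> b \<in> C \<Longrightarrow> k a + G a \<bullet> b = (if a = b then 1 else (0::real))"
    by metis
  have bary: "k a + G a \<bullet> (\<Sum>b\<in>C. u b *\<^sub>R b) = u a" if "sum u C = 1" "a \<in> C" for u a
  proof -
    have "k a + G a \<bullet> (\<Sum>b\<in>C. u b *\<^sub>R b) = (\<Sum>b\<in>C. u b * (k a + G a \<bullet> b))"
      using that(1) by (simp add: inner_sum_right distrib_left sum.distrib sum_distrib_right[symmetric])
    also have "\<dots> = (\<Sum>b\<in>C. if a = b then u a else 0)"
      using kG that(2) by (intro sum.cong) auto
    also have "\<dots> = u a" using that(2) fin by simp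
    finally show ?thesis .
  qed
  have "aff_dim C = int (card C) - 1" using indep aff_dim_affine_independent[of C] by simp
  then have UN: "affine hull C = UNIV" using card aff_dim_eq_full[of C] by simp
  have rep: "\<exists>u. sum u C = 1 \<and> x = (\<Sum>b\<in>C. u b *\<^sub>R b)" for x
  proof -
    have "x \<in> affine hull C" using UN by simp
    then show ?thesis unfolding affine_hull_finite[OF fin] by auto
  qed
  show ?thesis
  proof (rule that[OF kG])
    show "(\<Sum>a\<in>C. k a + G a \<bullet> x) = 1" for x
    proof -
      obtain u where u: "sum u C = 1" "x = (\<Sum>b\<in>C. u b *\<^sub>R b)" using rep by blast
      have "(\<Sum>a\<in>C. k a + G a \<bullet> x) = sum u C" using bary[OF u(1)] u(2) by (intro sum.cong) auto
      then show ?thesis using u(1) by simp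
    qed
    show "x \<in> convex hull C \<longleftrightarrow> (\<forall>a\<in>C. 0 \<le> k a + G a \<bullet> x)" for x
    proof
      assume "x \<in> convex hull C"
      then obtain u where "\<forall>a\<in>C. 0 \<le> u a" "sum u C = 1" "(\<Sum>b\<in>C. u b *\<^sub>R b) = x"
        using convex_hull_finite[OF fin] by auto
      then show "\<forall>a\<in>C. 0 \<le> k a + G a \<bullet> x" using bary by metis
    next
      assume *: "\<forall>a\<in>C. 0 \<le> k a + G a \<bullet> x"
      obtain u where u: "sum u C = 1" "x = (\<Sum>b\<in>C. u b *\<^sub>R b)" using rep by blast
      then have "\<forall>a\<in>C. 0 \<le> u a" using * bary[OF u(1)] by auto
      then show "x \<in> convex hull C" using u convex_hull_finite[OF fin] by auto
    qed
  qed
qed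

text \<open>The centre is defined from the facet alone, so that the two elements which share the facet agree on it.\<close>

definition facet_center :: "'a::euclidean_space set \<Rightarrow> 'a"
  where "facet_center \<gamma> = (let V = {v. v extreme_point_of \<gamma>} in (1 / real (card V)) *\<^sub>R \<Sum>V)"

text \<open>Barycentric coordinates have gradients of norm at most \<open>1 / (2 * r)\<close>. At the centre of the facet all but one of them
  equal \<open>1 / DIM('a)\<close>, so they stay nonnegative up to distance \<open>2 * r / DIM('a)\<close>; the sign of the remaining one
  decides on which side of the facet a point lies.\<close>

lemma facet_half_ball_exists:
  fixes K :: "'a::euclidean_space set"
  assumes K: "int DIM('a) simplex K" and ball: "cball z r \<subseteq> K" "0 < r" and \<gamma>: "\<gamma> facet_of K"
  obtains n where "norm n = 1" "facet_center \<gamma> \<in> \<gamma>"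
    "\<And>x. x \<in> K \<Longrightarrow> n \<bullet> (x - facet_center \<gamma>) \<le> 0"
    "\<And>x. x \<in> \<gamma> \<Longrightarrow> n \<bullet> (x - facet_center \<gamma>) = 0"
    "\<And>x. norm (x - facet_center \<gamma>) \<le> 2 * r / real DIM('a) \<Longrightarrow> n \<bullet> (x - facet_center \<gamma>) \<le> 0 \<Longrightarrow> x \<in> K"
proof -
  obtain C where C: "\<not> affine_dependent C" "int (card C) = int DIM('a) + 1" "K = convex hull C"
    using K by (auto simp: simplex_def)
  then have card: "card C = DIM('a) + 1" by simp
  then have fin: "finite C" using card.infinite by fastforce
  obtain k G where kG: "\<And>a b. a \<in> C \<Longrightarrow> b \<in> C \<Longrightarrow> k a + G a \<bullet> b = (if a = b then 1 else (0::real))"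
    and hull: "\<And>x. x \<in> convex hull C \<longleftrightarrow> (\<forall>a\<in>C. 0 \<le> k a + G a \<bullet> x)"
    and one: "\<And>x. (\<Sum>a\<in>C. k a + G a \<bullet> x) = 1"
    using barycentric_coordinates[OF C(1) card] by blast
  obtain a where a: "a \<in> C" "\<gamma> = convex hull (C - {a})"
    using \<gamma> facet_of_convex_hull_affine_independent[OF C(1)] C(3) by auto
  define V where "V = C - {a}"
  have Vi: "\<not> affine_dependent V" using C(1) affine_dependent_subset V_def by blast
  have V: "card V = DIM('a)" "finite V"
    using card a fin by (auto simp: V_def)
  define m where "m = facet_center \<gamma>"
  have m: "m = (\<Sum>b\<in>V. (1 / real DIM('a)) *\<^sub>R b)"
  proof -
    have "{v. v extreme_point_of \<gamma>} = V"
      using extreme_point_of_convex_hull_affine_independent[OF Vi] a(2) V_def by auto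
    then show ?thesis using V(1) by (simp add: m_def facet_center_def Let_def scaleR_sum_right)
  qed
  have m\<gamma>: "m \<in> \<gamma>"
    unfolding m a(2) V_def[symmetric] using V
    by (intro convex_sum convex_convex_hull) (auto intro: hull_inc)
  have at_m: "k b + G b \<bullet> m = (if b = a then 0 else 1 / real DIM('a))" if "b \<in> C" for b
  proof -
    have "k b + G b \<bullet> m = (\<Sum>c\<in>V. (1 / real DIM('a)) * (k b + G b \<bullet> c))"
      using V by (simp add: m inner_sum_right distrib_left sum.distrib)
    also have "\<dots> = (\<Sum>c\<in>V. if b = c then 1 / real DIM('a) else 0)"
      using kG[OF that] by (intro sum.cong) (auto simp: V_def)
    also have "\<dots> = (if b = a then 0 else 1 / real DIM('a))"
      using V(2) that by (auto simp: V_def)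
    finally show ?thesis .
  qed
  \<comment> \<open>A barycentric coordinate takes values in the unit interval on the diameter of the ball along its gradient.\<close>
  have Gb: "norm (G b) * (2 * r) \<le> 1" if b: "b \<in> C" for b
  proof (cases "G b = 0")
    case False
    define u where "u = (r / norm (G b)) *\<^sub>R G b"
    have nu: "norm u = r" using False ball(2) by (simp add: u_def)
    have Gu: "G b \<bullet> u = norm (G b) * r"
      using False by (simp add: u_def dot_square_norm power2_eq_square)
    have "z + u \<in> K" "z - u \<in> K" using nu ball(1) by (auto simp: subset_iff dist_norm)
    then have h: "\<forall>a\<in>C. 0 \<le> k a + G a \<bullet> (z + u)" "\<forall>a\<in>C. 0 \<le> k a + G a \<bullet> (z - u)"
      using hull C(3) by auto
    have "k b + G b \<bullet> (z + u) \<le> (\<Sum>a\<in>C. k a + G a \<bullet> (z + u))"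
      using h(1) fin b by (intro member_le_sum) auto
    then have "k b + G b \<bullet> (z + u) \<le> 1" using one by simp
    moreover have "0 \<le> k b + G b \<bullet> (z - u)" using h(2) b by auto
    ultimately show ?thesis using Gu by (simp add: inner_simps)
  qed simp
  have Ga: "G a \<noteq> 0"
    using kG[OF a(1) a(1)] at_m[OF a(1)] by auto
  define n where "n = - (1 / norm (G a)) *\<^sub>R G a"
  have n: "norm n = 1" using Ga by (simp add: n_def)
  have nx: "n \<bullet> (x - m) = - ((k a + G a \<bullet> x) / norm (G a))" for x
    using at_m[OF a(1)] Ga by (simp add: n_def inner_simps field_simps)
  show ?thesis
  proof (rule that[OF n])
    show "facet_center \<gamma> \<in> \<gamma>" using m\<gamma> m_def by simp
    show "n \<bullet> (x - facet_center \<gamma>) \<le> 0" if "x \<in> K" for x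
    proof -
      have "0 \<le> k a + G a \<bullet> x" using that hull[of x] C(3) a(1) by blast
      then show ?thesis using nx[of x] by (simp add: m_def divide_nonneg_nonneg)
    qed
    show "n \<bullet> (x - facet_center \<gamma>) = 0" if "x \<in> \<gamma>" for x
    proof -
      have "x \<in> convex hull V" using that a(2) V_def by simp
      then obtain u where u: "sum u V = 1" "(\<Sum>b\<in>V. u b *\<^sub>R b) = x"
        using convex_hull_finite[OF V(2)] by auto
      have "k a + G a \<bullet> x = (\<Sum>b\<in>V. u b * (k a + G a \<bullet> b))"
        using u by (simp add: u(2)[symmetric] inner_sum_right distrib_left sum.distrib sum_distrib_right[symmetric])
      also have "\<dots> = 0" using kG[OF a(1)] by (intro sum.neutral) (auto simp: V_def)
      finally show ?thesis using nx[of x] by (simp add: m_def)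
    qed
    show "x \<in> K" if x: "norm (x - facet_center \<gamma>) \<le> 2 * r / real DIM('a)" "n \<bullet> (x - facet_center \<gamma>) \<le> 0" for x
    proof -
      have "0 \<le> k b + G b \<bullet> x" if b: "b \<in> C" for b
      proof (cases "b = a")
        case True
        have "0 \<le> (k a + G a \<bullet> x) / norm (G a)" using x(2) nx[of x] by (simp add: m_def)
        then show ?thesis using True Ga by (simp add: zero_le_divide_iff)
      next
        case False
        have "\<bar>G b \<bullet> (x - m)\<bar> \<le> norm (G b) * norm (x - m)" by (rule Cauchy_Schwarz_ineq2)
        also have "\<dots> \<le> norm (G b) * (2 * r / real DIM('a))"
          using x(1) by (intro mult_left_mono) (auto simp: m_def)
        also have "\<dots> \<le> 1 / real DIM('a)" using Gb[OF b] by (simp add: divide_right_mono)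
        finally show ?thesis using at_m[OF b] False by (simp add: inner_diff_right)
      qed
      then show ?thesis using hull C(3) by simp
    qed
  qed
qed

text \<open>The half ball pins down the outer normal: a unit vector that makes an obtuse angle with every direction into the
  half ball is orthogonal to its flat side and points away from it.\<close>

lemma facet_half_ball:
  fixes K :: "'a::euclidean_space set"
  assumes K: "int DIM('a) simplex K" and ball: "cball z r \<subseteq> K" "0 < r" and \<gamma>: "\<gamma> facet_of K"
  shows "norm (outer_normal K \<gamma>) = 1" "facet_center \<gamma> \<in> \<gamma>"
    "\<And>x. x \<in> \<gamma> \<Longrightarrow> outer_normal K \<gamma> \<bullet> (x - facet_center \<gamma>) = 0"
    "\<And>x. norm (x - facet_center \<gamma>) \<le> 2 * r / real DIM('a) \<Longrightarrow>
      outer_normal K \<gamma> \<bullet> (x - facet_center \<gamma>) \<le> 0 \<Longrightarrow> x \<in> K"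
proof -
  define m where "m = facet_center \<gamma>"
  define \<rho> where "\<rho> = 2 * r / real DIM('a)"
  have \<rho>: "\<rho> > 0" using ball by (simp add: \<rho>_def)
  obtain n where n: "norm n = 1" "m \<in> \<gamma>" "\<And>x. x \<in> K \<Longrightarrow> n \<bullet> (x - m) \<le> 0"
    "\<And>x. x \<in> \<gamma> \<Longrightarrow> n \<bullet> (x - m) = 0" "\<And>x. norm (x - m) \<le> \<rho> \<Longrightarrow> n \<bullet> (x - m) \<le> 0 \<Longrightarrow> x \<in> K"
    using facet_half_ball_exists[OF assms] unfolding m_def \<rho>_def by metis
  have uniq: "n' = n" if n': "norm n' = 1" "\<forall>x\<in>\<gamma>. \<forall>z\<in>K. n' \<bullet> (z - x) \<le> 0" for n'
  proof -
    have small: "n' \<bullet> v \<le> 0" if "norm v \<le> \<rho>" "n \<bullet> v \<le> 0" for v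
      using n'(2) n(2) n(5)[of "m + v"] that by force
    define w where "w = n' - (n' \<bullet> n) *\<^sub>R n"
    have nn: "n \<bullet> n = 1" "n' \<bullet> n' = 1" using n(1) n'(1) by (simp_all add: dot_square_norm)
    have w1: "n \<bullet> w = 0" using nn by (simp add: w_def inner_simps inner_commute)
    moreover have "w \<bullet> w = n' \<bullet> w - (n' \<bullet> n) * (n \<bullet> w)"
      by (subst (1) w_def) (simp add: inner_diff_left)
    ultimately have w2: "n' \<bullet> w = w \<bullet> w" by simp
    have "w = 0"
    proof (rule ccontr)
      assume "w \<noteq> 0"
      moreover have "n' \<bullet> ((\<rho> / norm w) *\<^sub>R w) \<le> 0"
        using \<rho> w1 by (intro small) auto
      ultimately show False using \<rho> w2 inner_gt_zero_iff[of w]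
        by (simp del: inner_gt_zero_iff add: mult_le_0_iff divide_le_0_iff)
    qed
    then have eq: "n' = (n' \<bullet> n) *\<^sub>R n" by (simp add: w_def)
    then have "\<bar>n' \<bullet> n\<bar> = 1" using n(1) n'(1) by (metis norm_scaleR mult.right_neutral)
    moreover have "n' \<bullet> (- \<rho> *\<^sub>R n) \<le> 0" using \<rho> n(1) nn by (intro small) auto
    then have "0 \<le> n' \<bullet> n" using \<rho> by (simp add: zero_le_mult_iff)
    ultimately show "n' = n" using eq by simp
  qed
  have out: "\<forall>x\<in>\<gamma>. \<forall>z\<in>K. n \<bullet> (z - x) \<le> 0"
  proof (intro ballI)
    fix x z assume "x \<in> \<gamma>" "z \<in> K"
    moreover have "n \<bullet> (z - x) = n \<bullet> (z - m) - n \<bullet> (x - m)" by (simp add: inner_diff_right)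
    ultimately show "n \<bullet> (z - x) \<le> 0" using n(3)[of z] n(4)[of x] by simp
  qed
  have "outer_normal K \<gamma> = n"
    unfolding outer_normal_def
  proof (rule the_equality)
    show "norm n = 1 \<and> (\<forall>x\<in>\<gamma>. \<forall>z\<in>K. n \<bullet> (z - x) \<le> 0)" using n(1) out by (rule conjI)
    show "n' = n" if "norm n' = 1 \<and> (\<forall>x\<in>\<gamma>. \<forall>z\<in>K. n' \<bullet> (z - x) \<le> 0)" for n'
      using uniq[OF conjunct1[OF that] conjunct2[OF that]] .
  qed
  then show "norm (outer_normal K \<gamma>) = 1" "facet_center \<gamma> \<in> \<gamma>"
    "\<And>x. x \<in> \<gamma> \<Longrightarrow> outer_normal K \<gamma> \<bullet> (x - facet_center \<gamma>) = 0"
    "\<And>x. norm (x - facet_center \<gamma>) \<le> 2 * r / real DIM('a) \<Longrightarrow>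
      outer_normal K \<gamma> \<bullet> (x - facet_center \<gamma>) \<le> 0 \<Longrightarrow> x \<in> K"
    using n unfolding m_def \<rho>_def by auto
qed

lemma faces_finite:
  fixes K :: "'a::euclidean_space set"
  assumes "int DIM('a) simplex K"
  shows "finite (faces K)" "card (faces K) \<le> DIM('a) + 1"
proof -
  obtain C where C: "\<not> affine_dependent C" "int (card C) = int DIM('a) + 1" "K = convex hull C"
    using assms by (auto simp: simplex_def)
  then have fin: "finite C" by (auto intro: aff_independent_finite)
  have sub: "faces K \<subseteq> (\<lambda>u. convex hull (C - {u})) ` C"
    using facet_of_convex_hull_affine_independent[OF C(1)] C(3) by (auto simp: faces_def)
  then show "finite (faces K)" using fin finite_surj by blast
  have "card (faces K) \<le> card C" using surj_card_le[OF fin sub] .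
  then show "card (faces K) \<le> DIM('a) + 1" using C(2) by simp
qed

text \<open>A quarter of the diameter over \<open>\<sigma>\<close>, in place of a half, because the supremum that defines the inball diameter
  is approached only.\<close>

lemma inball_exists:
  fixes K :: "'a::euclidean_space set"
  assumes K: "int DIM('a) simplex K" and reg: "diameter K \<le> \<sigma> * inball_diameter K" and \<sigma>: "1 \<le> \<sigma>"
  obtains z where "cball z (diameter K / (4 * \<sigma>)) \<subseteq> K" "0 < diameter K"
proof -
  let ?S = "{2 * r | r. 0 \<le> r \<and> (\<exists>x. cball x r \<subseteq> K)}"
  obtain y e where e: "0 < e" "cball y e \<subseteq> K"
    using full_simplex(3)[OF K] by (meson all_not_in_conv mem_interior_cball)
  have b: "bounded K" using full_simplex(1)[OF K] by (rule compact_imp_bounded)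
  have d: "2 * s \<le> diameter K" if "cball x s \<subseteq> K" "0 \<le> s" for x s
    using diameter_subset[OF that(1) b] that(2) by (simp add: diameter_cball)
  have pos: "0 < diameter K" using d[OF e(2)] e(1) by simp
  have "0 < inball_diameter K"
    using pos reg \<sigma> by (smt (verit) mult_nonneg_nonpos)
  then have "diameter K / (2 * \<sigma>) < Sup ?S"
    using reg \<sigma> pos unfolding inball_diameter_def[symmetric]
    by (simp add: field_simps)
  then obtain s x where s: "diameter K / (2 * \<sigma>) < 2 * s" "cball x s \<subseteq> K"
    using less_cSupD[of ?S "diameter K / (2 * \<sigma>)"] e by (auto intro: less_imp_le)
  have "cball x (diameter K / (4 * \<sigma>)) \<subseteq> cball x s" using s(1) \<sigma> by (intro subset_cball) (simp add: field_simps)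
  then show ?thesis using that[of x] s(2) pos by blast
qed

text \<open>In dimension one facets are points, of diameter zero.\<close>

lemma facet_diameter_pos:
  fixes K :: "'a::euclidean_space set"
  assumes K: "int DIM('a) simplex K" and \<gamma>: "\<gamma> facet_of K" and dim: "2 \<le> DIM('a)"
  shows "0 < diameter \<gamma>" "diameter \<gamma> \<le> diameter K" "bounded \<gamma>"
proof -
  have b: "bounded K" using full_simplex(1)[OF K] by (rule compact_imp_bounded)
  have sub: "\<gamma> \<subseteq> K" using \<gamma> by (simp add: facet_of_imp_subset)
  then show bg: "bounded \<gamma>" using b bounded_subset by blast
  show "diameter \<gamma> \<le> diameter K" using sub b by (rule diameter_subset)
  have "aff_dim \<gamma> = int DIM('a) - 1" using \<gamma> aff_dim_simplex[OF K] by (simp add: facet_of_def)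
  then have "1 \<le> aff_dim \<gamma>" using dim by simp
  then have "\<not> (\<exists>x. \<gamma> \<subseteq> {x})" using aff_dim_subset aff_dim_sing by (metis less_irrefl order_less_le_trans zero_less_one)
  moreover have "\<gamma> \<noteq> {}" using \<open>1 \<le> aff_dim \<gamma>\<close> by auto
  ultimately obtain x y where "x \<in> \<gamma>" "y \<in> \<gamma>" "x \<noteq> y" by blast
  then show "0 < diameter \<gamma>"
    using diameter_bounded_bound[OF bg, of x y] by (smt (verit) zero_less_dist_iff)
qed

section \<open>Shape regular meshes\<close>

locale regular_mesh = simplicial_mesh +
  fixes \<sigma> :: real
  assumes \<sigma>: "1 \<le> \<sigma>" and shape: "\<And>K. K \<in> T \<Longrightarrow> diameter K \<le> \<sigma> * inball_diameter K"
    and dim: "2 \<le> DIM('a)"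
begin

lemma element_inball:
  assumes "K \<in> T"
  obtains z where "cball z (diameter K / (4 * \<sigma>)) \<subseteq> K" "0 < diameter K"
  using inball_exists[OF simplex_T[OF assms] shape[OF assms] \<sigma>] by blast

text \<open>The radius \<open>2 * r / DIM('a)\<close> of the half ball of \<open>facet_half_ball\<close> for \<open>r = diameter K / (4 * \<sigma>)\<close>, with the diameter of
  the element replaced by the smaller one of the facet. So it is the same for both neighbours.\<close>

definition patch_radius :: "'a set \<Rightarrow> real"
  where "patch_radius \<gamma> = diameter \<gamma> / (2 * \<sigma> * real DIM('a))"

lemma face_facts:
  assumes K: "K \<in> T" and \<gamma>: "\<gamma> \<in> faces K"
  shows "norm (outer_normal K \<gamma>) = 1" "facet_center \<gamma> \<in> \<gamma>"
    "\<And>x. x \<in> \<gamma> \<Longrightarrow> outer_normal K \<gamma> \<bullet> (x - facet_center \<gamma>) = 0"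
    "\<And>x. norm (x - facet_center \<gamma>) \<le> patch_radius \<gamma> \<Longrightarrow>
      outer_normal K \<gamma> \<bullet> (x - facet_center \<gamma>) \<le> 0 \<Longrightarrow> x \<in> K"
    "0 < patch_radius \<gamma>" "0 < diameter \<gamma>" "diameter \<gamma> \<le> diameter K" "bounded \<gamma>"
proof -
  obtain z where z: "cball z (diameter K / (4 * \<sigma>)) \<subseteq> K" "0 < diameter K" using element_inball[OF K] .
  have f: "\<gamma> facet_of K" using \<gamma> by (simp add: faces_def)
  have pos: "0 < diameter K / (4 * \<sigma>)" using z(2) \<sigma> by simp
  note h = facet_half_ball[OF simplex_T[OF K] z(1) pos f]
  note d = facet_diameter_pos[OF simplex_T[OF K] f dim]
  show "norm (outer_normal K \<gamma>) = 1" "facet_center \<gamma> \<in> \<gamma>"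
    "\<And>x. x \<in> \<gamma> \<Longrightarrow> outer_normal K \<gamma> \<bullet> (x - facet_center \<gamma>) = 0" using h by auto
  show "0 < diameter \<gamma>" "diameter \<gamma> \<le> diameter K" "bounded \<gamma>" by (rule d)+
  show "0 < patch_radius \<gamma>" using d \<sigma> dim by (simp add: patch_radius_def)
  have "patch_radius \<gamma> \<le> 2 * (diameter K / (4 * \<sigma>)) / real DIM('a)"
    using d(2) \<sigma> dim by (simp add: patch_radius_def divide_right_mono)
  then show "\<And>x. norm (x - facet_center \<gamma>) \<le> patch_radius \<gamma> \<Longrightarrow>
      outer_normal K \<gamma> \<bullet> (x - facet_center \<gamma>) \<le> 0 \<Longrightarrow> x \<in> K"
    using h(4) order_trans by blast
qed

text \<open>Two elements on the same side of a common facet would overlap near its centre.\<close>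

lemma opposite_normals:
  assumes K: "K \<in> T" "K' \<in> T" "K \<noteq> K'" and \<gamma>: "\<gamma> \<in> faces K" "\<gamma> \<in> faces K'"
  shows "outer_normal K' \<gamma> = - outer_normal K \<gamma>"
proof (rule ccontr)
  define n where "n = outer_normal K \<gamma>"
  define n' where "n' = outer_normal K' \<gamma>"
  define m where "m = facet_center \<gamma>"
  note f = face_facts[OF K(1) \<gamma>(1), folded n_def m_def] and f' = face_facts[OF K(2) \<gamma>(2), folded n'_def m_def]
  assume "outer_normal K' \<gamma> \<noteq> - outer_normal K \<gamma>"
  then have ne: "n + n' \<noteq> 0" by (simp add: n_def n'_def add_eq_0_iff)
  have nn: "n \<bullet> n = 1" "n' \<bullet> n' = 1" using f(1) f'(1) by (simp_all add: dot_square_norm)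
  have "0 < (n + n') \<bullet> (n + n')" using ne by simp
  then have nn': "0 < 1 + n \<bullet> n'" using nn by (simp add: inner_simps inner_commute)
  \<comment> \<open>The direction \<open>- (n + n')\<close> points into both half balls.\<close>
  define y where "y = m - (patch_radius \<gamma> / (2 * norm (n + n'))) *\<^sub>R (n + n')"
  define t where "t = patch_radius \<gamma> / (2 * norm (n + n'))"
  have t: "0 < t" using f(5) ne by (simp add: t_def)
  have nym: "norm (y - m) = patch_radius \<gamma> / 2" using ne f(5) by (simp add: y_def)
  have ym: "y - m = - t *\<^sub>R (n + n')" by (simp add: y_def t_def)
  have "n \<bullet> (y - m) = - t * (1 + n \<bullet> n')" "n' \<bullet> (y - m) = - t * (1 + n \<bullet> n')"
    unfolding ym using nn by (simp_all add: inner_simps inner_commute algebra_simps)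
  then have neg: "n \<bullet> (y - m) < 0" "n' \<bullet> (y - m) < 0" using t nn' by (simp_all add: mult_pos_pos)
  define W where "W = ball m (patch_radius \<gamma>) \<inter> {x. n \<bullet> (x - m) < 0}"
  have "open W" unfolding W_def by (intro open_Int open_ball open_Collect_less continuous_intros)
  moreover have "W \<subseteq> K" using f(4) by (auto simp: W_def dist_norm norm_minus_commute)
  moreover have "y \<in> W" using neg nym f(5) by (simp add: W_def dist_norm norm_minus_commute)
  ultimately have "y \<in> interior K" by (auto simp: interior_def)
  moreover have "y \<in> K'" using f'(4)[of y] neg nym f(5) by simp
  ultimately show False using interior_elements_disjoint[OF K(1,2)] K(3) by blast
qed

text \<open>Three elements at one facet would have pairwise opposite normals there.\<close>

lemma neighbour_facts:
  assumes K: "K \<in> T" and \<gamma>: "\<gamma> \<in> faces K \<inter> interior_faces T"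
  shows "neighbour T K \<gamma> \<in> T" "neighbour T K \<gamma> \<noteq> K" "\<gamma> \<in> faces (neighbour T K \<gamma>)"
    "outer_normal (neighbour T K \<gamma>) \<gamma> = - outer_normal K \<gamma>"
    "\<And>K'. K' \<in> T \<Longrightarrow> K' \<noteq> K \<Longrightarrow> \<gamma> \<in> faces K' \<Longrightarrow> neighbour T K \<gamma> = K'"
proof -
  have uniq: "K1 = K2" if "K1 \<in> T \<and> K1 \<noteq> K \<and> \<gamma> \<in> faces K1" "K2 \<in> T \<and> K2 \<noteq> K \<and> \<gamma> \<in> faces K2" for K1 K2
  proof (rule ccontr)
    assume "K1 \<noteq> K2"
    then have "outer_normal K2 \<gamma> = - outer_normal K1 \<gamma>" using that by (intro opposite_normals) auto
    moreover have "outer_normal K1 \<gamma> = - outer_normal K \<gamma>" "outer_normal K2 \<gamma> = - outer_normal K \<gamma>"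
      using that K \<gamma> by (auto intro!: opposite_normals)
    ultimately have "outer_normal K \<gamma> = - outer_normal K \<gamma>" by simp
    then have "outer_normal K \<gamma> + outer_normal K \<gamma> = 0" by (metis add.right_inverse)
    then have "2 *\<^sub>R outer_normal K \<gamma> = 0" by (simp add: scaleR_2)
    then have "outer_normal K \<gamma> = 0" by simp
    then show False using face_facts(1)[OF K, of \<gamma>] \<gamma> by auto
  qed
  obtain K' where K': "K' \<in> T" "K' \<noteq> K" "\<gamma> \<in> faces K'"
  proof -
    obtain K1 K2 where "K1 \<in> T" "K2 \<in> T" "K1 \<noteq> K2" "\<gamma> \<in> faces K1" "\<gamma> \<in> faces K2"
      using \<gamma> unfolding interior_faces_def by blast
    then show ?thesis using that[of K1] that[of K2] by (cases "K1 = K") auto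
  qed
  then have eq: "neighbour T K \<gamma> = K'"
    unfolding neighbour_def using uniq by (intro the_equality) blast+
  then show "neighbour T K \<gamma> \<in> T" "neighbour T K \<gamma> \<noteq> K" "\<gamma> \<in> faces (neighbour T K \<gamma>)"
    using K' by auto
  then show "outer_normal (neighbour T K \<gamma>) \<gamma> = - outer_normal K \<gamma>"
    using K \<gamma> by (intro opposite_normals) auto
  show "neighbour T K \<gamma> = K''" if "K'' \<in> T" "K'' \<noteq> K" "\<gamma> \<in> faces K''" for K''
    using uniq[of K' K''] that K' eq by auto
qed

lemma face_patch:
  assumes K: "K \<in> T" and \<gamma>: "\<gamma> \<in> faces K \<inter> interior_faces T" and x: "norm (x - facet_center \<gamma>) \<le> patch_radius \<gamma>"
  shows "outer_normal K \<gamma> \<bullet> (x - facet_center \<gamma>) \<le> 0 \<Longrightarrow> x \<in> K"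
    "0 \<le> outer_normal K \<gamma> \<bullet> (x - facet_center \<gamma>) \<Longrightarrow> x \<in> neighbour T K \<gamma>"
proof -
  note nb = neighbour_facts[OF K \<gamma>]
  show "outer_normal K \<gamma> \<bullet> (x - facet_center \<gamma>) \<le> 0 \<Longrightarrow> x \<in> K"
    using face_facts(4)[OF K] \<gamma> x by auto
  show "0 \<le> outer_normal K \<gamma> \<bullet> (x - facet_center \<gamma>) \<Longrightarrow> x \<in> neighbour T K \<gamma>"
    using face_facts(4)[OF nb(1,3) x] nb(4) by auto
qed

text \<open>A finite element function is continuous across the facet, so its gradient jumps in the normal
  direction only.\<close>

lemma gradient_jump:
  assumes v: "v \<in> VT \<Omega> T" and K: "K \<in> T" and \<gamma>: "\<gamma> \<in> faces K \<inter> interior_faces T"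
  shows "elem_grad v K - elem_grad v (neighbour T K \<gamma>)
    = ((elem_grad v K - elem_grad v (neighbour T K \<gamma>)) \<bullet> outer_normal K \<gamma>) *\<^sub>R outer_normal K \<gamma>"
    and "\<nu> * ((elem_grad v K - elem_grad v (neighbour T K \<gamma>)) \<bullet> outer_normal K \<gamma>) = 2 * flux_jump T \<nu> v K \<gamma>"
proof -
  define n where "n = outer_normal K \<gamma>"
  define m where "m = facet_center \<gamma>"
  define K' where "K' = neighbour T K \<gamma>"
  define g where "g = elem_grad v K - elem_grad v K'"
  note nb = neighbour_facts[OF K \<gamma>, folded K'_def n_def]
  have f: "norm n = 1" "0 < patch_radius \<gamma>" using face_facts[OF K] \<gamma> n_def by auto
  have nn: "n \<bullet> n = 1" using f(1) by (simp add: dot_square_norm)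
  obtain c where c: "\<And>x. x \<in> K \<Longrightarrow> v x = c + elem_grad v K \<bullet> x" using VT_elem_grad[OF v K] by blast
  obtain c' where c': "\<And>x. x \<in> K' \<Longrightarrow> v x = c' + elem_grad v K' \<bullet> x" using VT_elem_grad[OF v nb(1)] by blast
  have gw: "g \<bullet> w = 0" if "norm w \<le> patch_radius \<gamma>" "n \<bullet> w = 0" for w
  proof -
    have "m + w \<in> K" "m + w \<in> K'" "m \<in> K" "m \<in> K'"
      using face_patch[OF K \<gamma>, folded n_def m_def K'_def] that f(2) by auto
    then show ?thesis using c[of m] c[of "m+w"] c'[of m] c'[of "m+w"] by (simp add: g_def inner_simps)
  qed
  define w where "w = g - (g \<bullet> n) *\<^sub>R n"
  have w: "n \<bullet> w = 0" using nn by (simp add: w_def inner_simps inner_commute)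
  moreover have "w \<bullet> w = g \<bullet> w - (g \<bullet> n) * (n \<bullet> w)"
    by (subst (1) w_def) (simp add: inner_diff_left)
  ultimately have w2: "g \<bullet> w = w \<bullet> w" by simp
  have "w = 0"
  proof (rule ccontr)
    assume "w \<noteq> 0"
    moreover have "g \<bullet> ((patch_radius \<gamma> / norm w) *\<^sub>R w) = 0" using f w by (intro gw) auto
    ultimately show False using f w2 by simp
  qed
  then show "elem_grad v K - elem_grad v (neighbour T K \<gamma>)
    = ((elem_grad v K - elem_grad v (neighbour T K \<gamma>)) \<bullet> outer_normal K \<gamma>) *\<^sub>R outer_normal K \<gamma>"
    by (simp add: w_def g_def K'_def n_def)
  show "\<nu> * ((elem_grad v K - elem_grad v (neighbour T K \<gamma>)) \<bullet> outer_normal K \<gamma>) = 2 * flux_jump T \<nu> v K \<gamma>"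
    using nb(4) by (simp add: flux_jump_def flux_def K'_def[symmetric] n_def[symmetric] inner_simps algebra_simps)
qed

end

section \<open>Bump functions\<close>

text \<open>A bump on the intersection of a ball of radius \<open>\<rho>\<close> with a layer of half width \<open>t\<close> around the hyperplane through \<open>m\<close>
  normal to \<open>n\<close>. With \<open>n = 0\<close> it is radial.\<close>

definition bump :: "'a::euclidean_space \<Rightarrow> real \<Rightarrow> real \<Rightarrow> 'a \<Rightarrow> 'a \<Rightarrow> real"
  where "bump m \<rho> t n x = flat 0 (1 - ((norm (x - m))\<^sup>2 / \<rho>\<^sup>2 + ((x - m) \<bullet> n)\<^sup>2 / t\<^sup>2))"

definition slab :: "'a::euclidean_space \<Rightarrow> real \<Rightarrow> real \<Rightarrow> 'a \<Rightarrow> 'a set"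
  where "slab m \<rho> t n = {x. norm (x - m) \<le> \<rho> \<and> \<bar>(x - m) \<bullet> n\<bar> \<le> t}"

text \<open>At \<open>s = 1/4\<close> the exponential equals \<open>exp (- 4)\<close>, and the denominator \<open>s^j\<close> is at most one. This is where the
  constant \<open>exp (- 4)\<close> of all lower bounds comes from.\<close>

lemma flat_ge:
  assumes "1/4 \<le> s" "s \<le> 1"
  shows "exp (- 4) \<le> flat j s"
proof -
  have "1 / s \<le> 4" using assms by (simp add: field_simps)
  then have "exp (- 4) \<le> exp (- 1 / s)" by simp
  also have "\<dots> \<le> exp (- 1 / s) / s ^ j"
    using assms by (simp add: pos_le_divide_eq power_le_one mult_left_le)
  finally show ?thesis using assms by (simp add: flat_def)
qed

lemma bump_smooth: "bump m \<rho> t n \<in> smooth_alg"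
proof -
  have "bump m \<rho> t n = (\<lambda>x. flat 0 (1 - ((1 / \<rho>\<^sup>2) * (norm (x - m))\<^sup>2 + (1 / t\<^sup>2) * (x \<bullet> n - m \<bullet> n)\<^sup>2)))"
    by (auto simp: bump_def inner_diff_left)
  then show ?thesis
    by (simp only:) (intro smooth_flat smooth_diff smooth_add smooth_const smooth_cmult
        smooth_norm_squared smooth_power smooth_inner)
qed

lemma bump_nonneg: "0 \<le> bump m \<rho> t n x" and bump_le_1: "bump m \<rho> t n x \<le> 1"
  using flat_nonneg flat_le_fact[of 0] by (auto simp: bump_def)

lemma bump_outside:
  assumes "0 < \<rho>" "0 < t" "x \<notin> slab m \<rho> t n"
  shows "1 - ((norm (x - m))\<^sup>2 / \<rho>\<^sup>2 + ((x - m) \<bullet> n)\<^sup>2 / t\<^sup>2) \<le> 0"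
proof -
  consider "norm (x - m) > \<rho>" | "\<bar>(x - m) \<bullet> n\<bar> > t" using assms(3) by (force simp: slab_def)
  then show ?thesis
  proof cases
    case 1
    then have "\<rho>\<^sup>2 \<le> (norm (x - m))\<^sup>2" using assms by (intro power_mono) auto
    then have "1 \<le> (norm (x - m))\<^sup>2 / \<rho>\<^sup>2" using assms by simp
    then show ?thesis by (smt (verit) zero_le_divide_iff zero_le_power2)
  next
    case 2
    then have "t\<^sup>2 \<le> \<bar>(x - m) \<bullet> n\<bar>\<^sup>2" using assms by (intro power_mono) auto
    then have "1 \<le> ((x - m) \<bullet> n)\<^sup>2 / t\<^sup>2" using assms by simp
    then show ?thesis by (smt (verit) zero_le_divide_iff zero_le_power2)
  qed
qed

lemma bump_zero: "0 < \<rho> \<Longrightarrow> 0 < t \<Longrightarrow> x \<notin> slab m \<rho> t n \<Longrightarrow> bump m \<rho> t n x = 0"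
  unfolding bump_def by (intro flat_nonpos_arg bump_outside)

lemma bump_GDERIV:
  "GDERIV (bump m \<rho> t n) x :>
    - flat 2 (1 - ((norm (x - m))\<^sup>2 / \<rho>\<^sup>2 + ((x - m) \<bullet> n)\<^sup>2 / t\<^sup>2)) *\<^sub>R
      ((2 / \<rho>\<^sup>2) *\<^sub>R (x - m) + (2 * ((x - m) \<bullet> n) / t\<^sup>2) *\<^sub>R n)"
proof -
  define q where "q x = 1 - ((norm (x - m))\<^sup>2 / \<rho>\<^sup>2 + ((x - m) \<bullet> n)\<^sup>2 / t\<^sup>2)" for x
  have "((\<lambda>x. 1 - (c * ((x - m) \<bullet> (x - m)) + d * (((x - m) \<bullet> n) * ((x - m) \<bullet> n)))) has_derivative
      (\<lambda>h. - (c * (2 * ((x - m) \<bullet> h)) + d * (2 * ((x - m) \<bullet> n) * (h \<bullet> n))))) (at x)" for c d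
    by (auto intro!: derivative_eq_intros simp: inner_commute algebra_simps)
  from this[of "1 / \<rho>\<^sup>2" "1 / t\<^sup>2"]
  have "(q has_derivative (\<lambda>h. - ((1 / \<rho>\<^sup>2) * (2 * ((x - m) \<bullet> h)) + (1 / t\<^sup>2) * (2 * ((x - m) \<bullet> n) * (h \<bullet> n))))) (at x)"
    unfolding q_def[abs_def] power2_norm_eq_inner by (simp add: power2_eq_square)
  then have "(q has_derivative (\<lambda>h. h \<bullet> (- ((2 / \<rho>\<^sup>2) *\<^sub>R (x - m) + (2 * ((x - m) \<bullet> n) / t\<^sup>2) *\<^sub>R n)))) (at x)"
  proof (rule back_subst[of "\<lambda>D. (q has_derivative D) (at x)"], intro ext)
    fix h
    have eq: "- ((1 / \<rho>\<^sup>2) * (2 * a) + (1 / t\<^sup>2) * (2 * b * c)) = - (2 / \<rho>\<^sup>2 * a + 2 * b / t\<^sup>2 * c)" for a b c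
      by simp
    show "- ((1 / \<rho>\<^sup>2) * (2 * ((x - m) \<bullet> h)) + (1 / t\<^sup>2) * (2 * ((x - m) \<bullet> n) * (h \<bullet> n)))
        = h \<bullet> (- ((2 / \<rho>\<^sup>2) *\<^sub>R (x - m) + (2 * ((x - m) \<bullet> n) / t\<^sup>2) *\<^sub>R n))"
      unfolding inner_minus_right inner_add_right inner_scaleR_right inner_commute[of h "x - m"] eq ..
  qed
  then have "GDERIV q x :> (- ((2 / \<rho>\<^sup>2) *\<^sub>R (x - m) + (2 * ((x - m) \<bullet> n) / t\<^sup>2) *\<^sub>R n))"
    by (simp add: gderiv_def)
  note D = GDERIV_DERIV_compose[OF this flat_deriv[of 0]]
  show ?thesis
    unfolding bump_def[abs_def] q_def[symmetric] by (rule GDERIV_subst[OF D])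
      (simp add: numeral_2_eq_2[symmetric] scaleR_right_distrib scaleR_right_diff_distrib)
qed

lemma bump_grad:
  "grad (bump m \<rho> t n) x =
    - flat 2 (1 - ((norm (x - m))\<^sup>2 / \<rho>\<^sup>2 + ((x - m) \<bullet> n)\<^sup>2 / t\<^sup>2)) *\<^sub>R
      ((2 / \<rho>\<^sup>2) *\<^sub>R (x - m) + (2 * ((x - m) \<bullet> n) / t\<^sup>2) *\<^sub>R n)"
  by (rule GDERIV_grad[OF bump_GDERIV])

lemma bump_grad_zero: "0 < \<rho> \<Longrightarrow> 0 < t \<Longrightarrow> x \<notin> slab m \<rho> t n \<Longrightarrow> grad (bump m \<rho> t n) x = 0"
  unfolding bump_grad by (subst flat_nonpos_arg[OF bump_outside]) auto

text \<open>On the support both \<open>norm (x - m) / \<rho>\<close> and \<open>\<bar>(x - m) \<bullet> n\<bar> / t\<close> are at most one and \<open>flat 2\<close> is at most two,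
  so each of the two terms of the gradient is at most \<open>4 / t\<close>.\<close>

lemma bump_grad_bound:
  assumes t: "0 < t" "t \<le> \<rho>" and n: "norm n \<le> 1"
  shows "norm (grad (bump m \<rho> t n) x) \<le> 8 / t"
proof (cases "x \<in> slab m \<rho> t n")
  case True
  define s where "s = 1 - ((norm (x - m))\<^sup>2 / \<rho>\<^sup>2 + ((x - m) \<bullet> n)\<^sup>2 / t\<^sup>2)"
  have "norm ((2 / \<rho>\<^sup>2) *\<^sub>R (x - m)) \<le> 2 / \<rho>\<^sup>2 * \<rho>"
    using True by (simp add: slab_def divide_right_mono)
  also have "\<dots> = 2 / \<rho>" using t by (simp add: power2_eq_square)
  also have "\<dots> \<le> 2 / t" using t by (intro divide_left_mono) auto
  finally have 1: "norm ((2 / \<rho>\<^sup>2) *\<^sub>R (x - m)) \<le> 2 / t" .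
  have "norm ((2 * ((x - m) \<bullet> n) / t\<^sup>2) *\<^sub>R n) \<le> (2 * \<bar>(x - m) \<bullet> n\<bar> / t\<^sup>2) * 1"
    using n by (auto simp: abs_mult intro!: divide_right_mono mult_left_le)
  also have "\<dots> \<le> 2 * t / t\<^sup>2"
    using True by (simp add: slab_def divide_right_mono)
  also have "\<dots> = 2 / t" using t by (simp add: power2_eq_square)
  finally have 2: "norm ((2 * ((x - m) \<bullet> n) / t\<^sup>2) *\<^sub>R n) \<le> 2 / t" .
  have "norm (grad (bump m \<rho> t n) x) = flat 2 s * norm ((2 / \<rho>\<^sup>2) *\<^sub>R (x - m) + (2 * ((x - m) \<bullet> n) / t\<^sup>2) *\<^sub>R n)"
    unfolding bump_grad s_def[symmetric] by (simp add: flat_nonneg)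
  also have "\<dots> \<le> 2 * (2 / t + 2 / t)"
    using flat_le_fact[of 2 s] flat_nonneg[of 2 s] norm_triangle_le[OF add_mono[OF 1 2]] t
    by (intro mult_mono) (auto simp: fact_2)
  finally show ?thesis by simp
next
  case False
  then show ?thesis using t by (simp add: bump_grad_zero)
qed

lemma bump_ge:
  assumes "(norm (x - m))\<^sup>2 / \<rho>\<^sup>2 + ((x - m) \<bullet> n)\<^sup>2 / t\<^sup>2 \<le> 3/4"
  shows "exp (- 4) \<le> bump m \<rho> t n x"
  unfolding bump_def using assms by (intro flat_ge) (auto simp: field_simps)

text \<open>The bump decreases along \<open>n\<close>, at rate \<open>1 / t\<close> where the distance from the central
  hyperplane is comparable to \<open>t\<close>.\<close>

lemma bump_normal_derivative:
  assumes t: "0 < t" "0 < \<rho>" and n: "norm n = 1"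
  shows "0 \<le> (x - m) \<bullet> n \<Longrightarrow> grad (bump m \<rho> t n) x \<bullet> n \<le> 0"
    and "t / 4 \<le> (x - m) \<bullet> n \<Longrightarrow> (norm (x - m))\<^sup>2 / \<rho>\<^sup>2 + ((x - m) \<bullet> n)\<^sup>2 / t\<^sup>2 \<le> 3/4 \<Longrightarrow>
      exp (- 4) / (2 * t) \<le> - (grad (bump m \<rho> t n) x \<bullet> n)"
proof -
  define s where "s = 1 - ((norm (x - m))\<^sup>2 / \<rho>\<^sup>2 + ((x - m) \<bullet> n)\<^sup>2 / t\<^sup>2)"
  have nn: "n \<bullet> n = 1" using n by (simp add: dot_square_norm)
  have eq: "- (grad (bump m \<rho> t n) x \<bullet> n) = flat 2 s * (2 * ((x - m) \<bullet> n) / \<rho>\<^sup>2 + 2 * ((x - m) \<bullet> n) / t\<^sup>2)"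
    unfolding bump_grad s_def[symmetric] by (simp add: inner_add_left nn)
  show "grad (bump m \<rho> t n) x \<bullet> n \<le> 0" if "0 \<le> (x - m) \<bullet> n"
  proof -
    have "0 \<le> - (grad (bump m \<rho> t n) x \<bullet> n)"
      unfolding eq using that flat_nonneg[of 2 s] by (intro mult_nonneg_nonneg add_nonneg_nonneg) auto
    then show ?thesis by simp
  qed
  show "exp (- 4) / (2 * t) \<le> - (grad (bump m \<rho> t n) x \<bullet> n)"
    if a: "t / 4 \<le> (x - m) \<bullet> n" "(norm (x - m))\<^sup>2 / \<rho>\<^sup>2 + ((x - m) \<bullet> n)\<^sup>2 / t\<^sup>2 \<le> 3/4"
  proof -
    have "1/4 \<le> s" using a(2) by (simp add: s_def)
    moreover have "0 \<le> (norm (x - m))\<^sup>2 / \<rho>\<^sup>2 + ((x - m) \<bullet> n)\<^sup>2 / t\<^sup>2"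
      by (intro add_nonneg_nonneg divide_nonneg_nonneg) auto
    then have "s \<le> 1" unfolding s_def by linarith
    ultimately have f: "exp (- 4) \<le> flat 2 s" by (rule flat_ge)
    have "1 / (2 * t) = 2 * (t / 4) / t\<^sup>2" using t by (simp add: power2_eq_square)
    also have "\<dots> \<le> 2 * ((x - m) \<bullet> n) / t\<^sup>2" using a(1) by (intro divide_right_mono) auto
    also have "\<dots> \<le> 2 * ((x - m) \<bullet> n) / \<rho>\<^sup>2 + 2 * ((x - m) \<bullet> n) / t\<^sup>2" using a(1) t by simp
    finally have "exp (- 4) * (1 / (2 * t)) \<le> flat 2 s * (2 * ((x - m) \<bullet> n) / \<rho>\<^sup>2 + 2 * ((x - m) \<bullet> n) / t\<^sup>2)"
      using f t by (intro mult_mono) (auto simp: flat_nonneg)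
    then show ?thesis unfolding eq by simp
  qed
qed

lemma compact_slab: "compact (slab m \<rho> t n)"
proof -
  have "slab m \<rho> t n = cball m \<rho> \<inter> {x. \<bar>(x - m) \<bullet> n\<bar> \<le> t}"
    by (auto simp: slab_def dist_norm norm_minus_commute)
  moreover have "closed {x. \<bar>(x - m) \<bullet> n\<bar> \<le> t}"
    by (intro closed_Collect_le continuous_intros)
  ultimately show ?thesis by (simp add: compact_Int_closed)
qed

lemma slab_isotropic: "0 \<le> \<rho> \<Longrightarrow> slab m \<rho> \<rho> 0 = cball m \<rho>"
  by (auto simp: slab_def dist_norm norm_minus_commute)

section \<open>Volumes of thin cylinders\<close>

text \<open>An isometry \<open>f\<close> preserves volume: integrate the indicator of \<open>{(x, z). x \<in> B \<and> f z \<in> A}\<close>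
  over the product, \<open>B\<close> a ball around the origin, and translate both variables. The isometry is
  absorbed by the ball, which it leaves fixed.\<close>

lemma nn_integral_lborel_shift:
  fixes h :: "'a::euclidean_space \<Rightarrow> ennreal"
  assumes [measurable]: "h \<in> borel_measurable borel"
  shows "(\<integral>\<^sup>+x. h (c + x) \<partial>lborel) = (\<integral>\<^sup>+x. h x \<partial>lborel)"
proof -
  have "(\<integral>\<^sup>+x. h x \<partial>lborel) = (\<integral>\<^sup>+x. h x \<partial>distr lborel borel ((+) c))"
    by (simp add: lborel_distr_plus)
  also have "\<dots> = (\<integral>\<^sup>+x. h (c + x) \<partial>lborel)"
    by (subst nn_integral_distr) auto
  finally show ?thesis by simp
qed

lemma orthogonal_emeasure_vimage:
  fixes f :: "'a::euclidean_space \<Rightarrow> 'a"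
  assumes f: "orthogonal_transformation f" and A: "A \<in> sets borel"
  shows "emeasure lborel (f -` A) = emeasure lborel A"
proof -
  have lin: "linear f" using f by (rule orthogonal_transformation_linear)
  have "continuous_on UNIV f" using lin linear_continuous_on linear_conv_bounded_linear by blast
  then have fm[measurable]: "f \<in> borel_measurable borel" by (rule borel_measurable_continuous_onI)
  note A[measurable]
  define B where "B = ball (0::'a) 1"
  have B[measurable]: "B \<in> sets borel" by (simp add: B_def)
  have nf: "norm (f z) = norm z" for z using f by (rule orthogonal_transformation_norm)
  define F where "F x z = (indicator B x * indicator A (f z) :: ennreal)" for x z
  define G where "G x z = (indicator B (x - f z) * indicator A x :: ennreal)" for x z
  have L: "(\<integral>\<^sup>+x. (\<integral>\<^sup>+z. F x z \<partial>lborel) \<partial>lborel) = emeasure lborel B * emeasure lborel (f -` A)"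
  proof -
    have "(\<integral>\<^sup>+z. F x z \<partial>lborel) = indicator B x * emeasure lborel (f -` A)" for x
    proof -
      have "(\<integral>\<^sup>+z. F x z \<partial>lborel) = indicator B x * (\<integral>\<^sup>+z. indicator A (f z) \<partial>lborel)"
        unfolding F_def by (rule nn_integral_cmult) measurable
      also have "(\<lambda>z. indicator A (f z) :: ennreal) = indicator (f -` A)"
        by (auto simp: indicator_def)
      also have "(\<integral>\<^sup>+z. indicator (f -` A) z \<partial>lborel) = emeasure lborel (f -` A)"
        using measurable_sets[OF fm A] by (intro nn_integral_indicator) simp
      finally show ?thesis .
    qed
    then show ?thesis by (simp add: nn_integral_multc)
  qed
  have R: "(\<integral>\<^sup>+x. (\<integral>\<^sup>+z. G x z \<partial>lborel) \<partial>lborel) = emeasure lborel B * emeasure lborel A"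
  proof -
    have "(\<integral>\<^sup>+z. G x z \<partial>lborel) = emeasure lborel B * indicator A x" for x
    proof -
      obtain c where c: "f c = x" using orthogonal_transformation_surj[OF f] by (metis surjD)
      have "(\<integral>\<^sup>+z. G x z \<partial>lborel) = (\<integral>\<^sup>+z. G x (c + z) \<partial>lborel)"
        unfolding G_def by (rule nn_integral_lborel_shift[symmetric]) measurable
      also have "\<dots> = (\<integral>\<^sup>+z. indicator B z * indicator A x \<partial>lborel)"
        using nf c lin by (intro nn_integral_cong) (auto simp: G_def B_def linear_add indicator_def)
      also have "\<dots> = emeasure lborel B * indicator A x"
        by (simp add: nn_integral_multc)
      finally show ?thesis .
    qed
    then show ?thesis by (simp add: nn_integral_cmult)
  qed
  have Fm: "(\<lambda>(x, z). indicator B x * indicator A (f z + x) :: ennreal) \<in> borel_measurable (lborel \<Otimes>\<^sub>M lborel)"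
    by measurable
  have Gm: "(\<lambda>(x, z). G x z) \<in> borel_measurable (lborel \<Otimes>\<^sub>M lborel)"
    unfolding G_def by measurable
  have "(\<integral>\<^sup>+x. (\<integral>\<^sup>+z. F x z \<partial>lborel) \<partial>lborel)
      = (\<integral>\<^sup>+x. (\<integral>\<^sup>+z. indicator B x * indicator A (f z + x) \<partial>lborel) \<partial>lborel)"
  proof (rule nn_integral_cong)
    fix x :: 'a
    obtain c where c: "f c = x" using orthogonal_transformation_surj[OF f] by (metis surjD)
    have "(\<integral>\<^sup>+z. F x z \<partial>lborel) = (\<integral>\<^sup>+z. F x (c + z) \<partial>lborel)"
      unfolding F_def by (rule nn_integral_lborel_shift[symmetric]) measurable
    then show "(\<integral>\<^sup>+z. F x z \<partial>lborel) = (\<integral>\<^sup>+z. indicator B x * indicator A (f z + x) \<partial>lborel)"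
      using c lin by (simp add: F_def linear_add add.commute)
  qed
  also have "\<dots> = (\<integral>\<^sup>+z. (\<integral>\<^sup>+x. indicator B x * indicator A (f z + x) \<partial>lborel) \<partial>lborel)"
    by (rule lborel_pair.Fubini'[OF Fm, symmetric])
  also have "\<dots> = (\<integral>\<^sup>+z. (\<integral>\<^sup>+x. G x z \<partial>lborel) \<partial>lborel)"
  proof (rule nn_integral_cong)
    fix z :: 'a
    have "(\<integral>\<^sup>+x. G x z \<partial>lborel) = (\<integral>\<^sup>+x. G (f z + x) z \<partial>lborel)"
      unfolding G_def by (rule nn_integral_lborel_shift[symmetric]) measurable
    then show "(\<integral>\<^sup>+x. indicator B x * indicator A (f z + x) \<partial>lborel) = (\<integral>\<^sup>+x. G x z \<partial>lborel)"
      by (simp add: G_def)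
  qed
  also have "\<dots> = (\<integral>\<^sup>+x. (\<integral>\<^sup>+z. G x z \<partial>lborel) \<partial>lborel)"
    by (rule lborel_pair.Fubini'[OF Gm])
  finally have eq: "emeasure lborel B * emeasure lborel (f -` A) = emeasure lborel B * emeasure lborel A"
    unfolding L R .
  have "emeasure lborel B \<noteq> 0"
  proof -
    have "0 < measure lborel B" unfolding B_def by (rule content_ball_pos) simp
    then show ?thesis by (auto simp: measure_def)
  qed
  moreover have "emeasure lborel B \<noteq> \<infinity>"
    using emeasure_bounded_finite[of B] by (auto simp: B_def)
  ultimately show ?thesis using eq by (simp add: ennreal_mult_cancel_left)
qed

lemma measure_orthogonal_compact:
  fixes f :: "'a::euclidean_space \<Rightarrow> 'a"
  assumes f: "orthogonal_transformation f" and S: "compact S"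
  shows "measure lebesgue (f ` S) = measure lebesgue S" "compact (f ` S)"
proof -
  have "continuous_on S f"
    using orthogonal_transformation_linear[OF f] linear_continuous_on linear_conv_bounded_linear by blast
  then show c: "compact (f ` S)" using S by (rule compact_continuous_image)
  have "f -` (f ` S) = S" using orthogonal_transformation_inj[OF f] by (simp add: inj_vimage_image_eq)
  then have "emeasure lborel S = emeasure lborel (f ` S)"
    using orthogonal_emeasure_vimage[OF f borel_compact[OF c]] by simp
  then show "measure lebesgue (f ` S) = measure lebesgue S"
    using borel_compact[OF S] borel_compact[OF c] by (simp add: measure_def)
qed

text \<open>Which axis \<open>k\<close> is used does not matter; the rotation takes slabs to products of intervals.\<close>

lemma rotate_to_axis:
  fixes n m :: "real ^ 'd"
  assumes "norm n = 1"
  obtains f :: "real ^ 'd \<Rightarrow> real ^ 'd" and k where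
    "\<And>x. f x $ k = x \<bullet> n" "\<And>x. norm (f x) = norm x" "surj f" "linear f" "f n = axis k 1"
    "\<And>S. compact S \<Longrightarrow> compact ((\<lambda>x. f (x - m)) ` S)"
    "\<And>S. compact S \<Longrightarrow> measure lebesgue ((\<lambda>x. f (x - m)) ` S) = measure lebesgue S"
proof -
  define k :: 'd where "k = undefined"
  have "norm n = norm (axis k (1::real))" using assms by simp
  then obtain f :: "real ^ 'd \<Rightarrow> real ^ 'd" where f: "orthogonal_transformation f" "f n = axis k 1"
    using orthogonal_transformation_exists[of n "axis k 1"] by metis
  have im: "(\<lambda>x. f (x - m)) ` S = f ` ((+) (- m) ` S)" for S by (auto simp: image_image)
  show ?thesis
  proof (rule that[of f k])
    show "f x $ k = x \<bullet> n" for x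
    proof -
      have "f x $ k = f x \<bullet> f n" by (simp add: f(2) inner_axis)
      then show ?thesis using f(1) by (simp add: orthogonal_transformation_def)
    qed
    show "compact ((\<lambda>x. f (x - m)) ` S)" if "compact S" for S
      unfolding im by (intro measure_orthogonal_compact(2)[OF f(1)] compact_translation that)
    show "measure lebesgue ((\<lambda>x. f (x - m)) ` S) = measure lebesgue S" if "compact S" for S
      unfolding im measure_orthogonal_compact(1)[OF f(1) compact_translation[OF that]]
      by (rule measure_translation)
  qed (use f in \<open>auto simp: orthogonal_transformation_norm orthogonal_transformation_surj orthogonal_transformation_linear\<close>)
qed

lemma content_flat_box:
  fixes k :: "'d::finite"
  assumes "0 \<le> r" "a \<le> b"
  shows "measure lebesgue (cbox (\<chi> i. if i = k then a else - r) (\<chi> i. if i = k then b else r) :: (real ^ 'd) set)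
    = (b - a) * (2 * r) ^ (CARD('d) - 1)"
proof -
  let ?l = "(\<chi> i. if i = k then a else - r) :: real ^ 'd" and ?u = "(\<chi> i. if i = k then b else r) :: real ^ 'd"
  have "?l \<in> cbox ?l ?u" using assms by (auto simp: mem_box_cart)
  then have "measure lborel (cbox ?l ?u) = (\<Prod>i\<in>UNIV. ?u $ i - ?l $ i)"
    by (intro content_cbox_cart) blast
  also have "\<dots> = (?u $ k - ?l $ k) * (\<Prod>i\<in>UNIV - {k}. ?u $ i - ?l $ i)"
    by (simp add: prod.remove[of UNIV k])
  also have "(\<Prod>i\<in>UNIV - {k}. ?u $ i - ?l $ i) = (\<Prod>i\<in>UNIV - {k}. 2 * r)"
    by (intro prod.cong) auto
  also have "\<dots> = (2 * r) ^ (CARD('d) - 1)" by (simp add: card_Diff_singleton)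
  finally show ?thesis by simp
qed

lemma measure_thin_le:
  fixes n m :: "real ^ 'd"
  assumes n: "norm n = 1" and S: "compact S" and r: "0 \<le> r" "a \<le> b"
    and sub: "\<And>x. x \<in> S \<Longrightarrow> a \<le> (x - m) \<bullet> n \<and> (x - m) \<bullet> n \<le> b \<and> norm ((x - m) - ((x - m) \<bullet> n) *\<^sub>R n) \<le> r"
  shows "measure lebesgue S \<le> (b - a) * (2 * r) ^ (CARD('d) - 1)"
proof -
  obtain f and k :: 'd where f: "\<And>x. f x $ k = x \<bullet> n" "\<And>x. norm (f x) = norm x" "linear f" "f n = axis k 1"
    "compact ((\<lambda>x. f (x - m)) ` S)" "measure lebesgue ((\<lambda>x. f (x - m)) ` S) = measure lebesgue S"
    using rotate_to_axis[OF n, of m] S by metis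
  let ?F = "\<lambda>x. f (x - m)"
  have "?F ` S \<subseteq> cbox (\<chi> i. if i = k then a else - r) (\<chi> i. if i = k then b else r)"
  proof (rule image_subsetI)
    fix x assume x: "x \<in> S"
    let ?y = "x - m"
    have k: "f ?y $ k = ?y \<bullet> n" by (rule f(1))
    have i: "\<bar>f ?y $ i\<bar> \<le> r" if "i \<noteq> k" for i
    proof -
      have "f (?y - (?y \<bullet> n) *\<^sub>R n) = f ?y - (?y \<bullet> n) *\<^sub>R axis k 1"
        using f(3) by (simp add: linear_diff linear_scale f(4))
      then have "f ?y $ i = f (?y - (?y \<bullet> n) *\<^sub>R n) $ i" using that by (simp add: axis_def)
      also have "\<bar>\<dots>\<bar> \<le> norm (f (?y - (?y \<bullet> n) *\<^sub>R n))" by (rule component_le_norm_cart)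
      also have "\<dots> \<le> r" using sub[OF x] f(2) by simp
      finally show ?thesis .
    qed
    show "f ?y \<in> cbox (\<chi> i. if i = k then a else - r) (\<chi> i. if i = k then b else r)"
      using k i sub[OF x] by (auto simp: mem_box_cart abs_le_iff)
        (metis abs_le_iff minus_le_iff)
  qed
  then have "measure lebesgue (?F ` S) \<le> measure lebesgue (cbox (\<chi> i. if i = k then a else - r) (\<chi> i. if i = k then b else r))"
    using lmeasurable_compact[OF f(5)] by (intro measure_mono_fmeasurable fmeasurableD) auto
  then show ?thesis
    using content_flat_box[OF r, of k] f(6) by simp
qed

lemma measure_slab_le:
  fixes n m :: "real ^ 'd"
  assumes n: "norm n = 1" and "0 \<le> \<rho>" "0 \<le> t"
  shows "measure lebesgue (slab m \<rho> t n) \<le> 2 * t * (2 * \<rho>) ^ (CARD('d) - 1)"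
proof -
  have nn: "n \<bullet> n = 1" using n by (simp add: dot_square_norm)
  have "measure lebesgue (slab m \<rho> t n) \<le> (t - (- t)) * (2 * \<rho>) ^ (CARD('d) - 1)"
  proof (rule measure_thin_le[OF n compact_slab, where m = m])
    fix x assume x: "x \<in> slab m \<rho> t n"
    let ?y = "x - m"
    have "(norm (?y - (?y \<bullet> n) *\<^sub>R n))\<^sup>2 = (norm ?y)\<^sup>2 - (?y \<bullet> n)\<^sup>2"
      by (simp only: power2_norm_eq_inner[of "?y - _"] power2_norm_eq_inner[of ?y] inner_diff_left[of ?y]
          inner_diff_right[of _ ?y] inner_scaleR_left inner_scaleR_right nn inner_commute[of n ?y])
        (simp add: power2_eq_square)
    then have "(norm (?y - (?y \<bullet> n) *\<^sub>R n))\<^sup>2 \<le> (norm ?y)\<^sup>2"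
      using zero_le_power2[of "?y \<bullet> n"] by linarith
    then have "norm (?y - (?y \<bullet> n) *\<^sub>R n) \<le> norm ?y"
      by (rule power2_le_imp_le) simp
    then show "- t \<le> ?y \<bullet> n \<and> ?y \<bullet> n \<le> t \<and> norm (?y - (?y \<bullet> n) *\<^sub>R n) \<le> \<rho>"
      using x by (auto simp: slab_def)
  qed (use assms in auto)
  then show ?thesis by simp
qed

text \<open>After rotation the set contains a box: the normal coordinate ranges over \<open>{t/4..t/2}\<close>, the others over
  \<open>{-r..r}\<close> with \<open>r = \<rho> / (2 * CARD('d))\<close>. There the first quotient is at most \<open>1/2\<close> and the second at most \<open>1/4\<close>.\<close>

lemma measure_half_slab_ge:
  fixes n m :: "real ^ 'd"
  assumes n: "norm n = 1" and t: "0 < t" "t \<le> \<rho>"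
  defines "S \<equiv> {x. t / 4 \<le> (x - m) \<bullet> n \<and> (norm (x - m))\<^sup>2 / \<rho>\<^sup>2 + ((x - m) \<bullet> n)\<^sup>2 / t\<^sup>2 \<le> 3/4}"
  shows "t / 4 * (\<rho> / real CARD('d)) ^ (CARD('d) - 1) \<le> measure lebesgue S" "compact S"
proof -
  define r where "r = \<rho> / (2 * real CARD('d))"
  have cd: "0 < real CARD('d)" "1 \<le> real CARD('d)" by (auto simp: Suc_le_eq)
  have r: "0 < r" using t cd by (simp add: r_def)
  have \<rho>: "0 < \<rho>" using t by simp
  show Sc: "compact S"
  proof -
    have "S \<subseteq> slab m \<rho> t n"
    proof
      fix x assume "x \<in> S"
      then have "(norm (x - m))\<^sup>2 / \<rho>\<^sup>2 + ((x - m) \<bullet> n)\<^sup>2 / t\<^sup>2 \<le> 3/4" unfolding S_def by blast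
      then have "\<not> 1 - ((norm (x - m))\<^sup>2 / \<rho>\<^sup>2 + ((x - m) \<bullet> n)\<^sup>2 / t\<^sup>2) \<le> 0" by linarith
      then show "x \<in> slab m \<rho> t n" using bump_outside[OF \<rho> t(1)] by blast
    qed
    moreover have "closed S"
    proof -
      have "S = {x. t / 4 \<le> (x - m) \<bullet> n} \<inter> {x. (norm (x - m))\<^sup>2 / \<rho>\<^sup>2 + ((x - m) \<bullet> n)\<^sup>2 / t\<^sup>2 \<le> 3/4}"
        by (auto simp: S_def)
      then show ?thesis using t \<rho> by (auto intro!: closed_Int closed_Collect_le continuous_intros)
    qed
    ultimately show ?thesis using compact_slab by (metis Int_absorb1 compact_Int_closed)
  qed
  obtain f and k :: 'd where f: "\<And>x. f x $ k = x \<bullet> n" "\<And>x. norm (f x) = norm x" "surj f"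
    "compact ((\<lambda>x. f (x - m)) ` S)" "measure lebesgue ((\<lambda>x. f (x - m)) ` S) = measure lebesgue S"
    using rotate_to_axis[OF n, of m] Sc by metis
  define F where "F x = f (x - m)" for x
  have F: "F x $ k = (x - m) \<bullet> n" "norm (F x) = norm (x - m)" for x
    by (simp_all add: F_def f)
  have FS: "surj F"
  proof (rule surjI)
    show "F (m + inv f y) = y" for y by (simp add: F_def surj_f_inv_f[OF f(3)])
  qed
  let ?B = "cbox (\<chi> i. if i = k then t / 4 else - r) (\<chi> i. if i = k then t / 2 else r) :: (real ^ 'd) set"
  have "?B \<subseteq> F ` S"
  proof
    fix y assume y: "y \<in> ?B"
    obtain x where x: "y = F x" using FS by (auto simp: surj_def)
    have yk: "t / 4 \<le> y $ k" "y $ k \<le> t / 2" using y by (auto simp: mem_box_cart dest!: spec[of _ k])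
    have yi: "\<bar>y $ i\<bar> \<le> r" if "i \<noteq> k" for i using y that by (auto simp: mem_box_cart abs_le_iff dest!: spec[of _ i])
    have sq: "(y $ k)\<^sup>2 \<le> t\<^sup>2 / 4"
      using power_mono[OF yk(2), of 2] yk(1) t by (simp add: power_divide)
    have "(norm y)\<^sup>2 = (\<Sum>i\<in>UNIV. (y $ i)\<^sup>2)"
      by (simp add: norm_vec_def L2_set_def sum_nonneg)
    also have "\<dots> = (y $ k)\<^sup>2 + (\<Sum>i\<in>UNIV - {k}. (y $ i)\<^sup>2)"
      by (simp add: sum.remove[of UNIV k])
    also have "(\<Sum>i\<in>UNIV - {k}. (y $ i)\<^sup>2) \<le> (\<Sum>i\<in>UNIV - {k}. r\<^sup>2)"
      using yi by (intro sum_mono) (auto simp: abs_le_square_iff[symmetric] r less_imp_le intro: order_trans)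
    also have "\<dots> \<le> real CARD('d) * r\<^sup>2"
      by (auto intro!: mult_right_mono)
    also have "\<dots> = \<rho>\<^sup>2 / (4 * real CARD('d))" using cd by (simp add: r_def power2_eq_square)
    also have "\<dots> \<le> \<rho>\<^sup>2 / 4" using cd by (intro divide_left_mono) auto
    finally have ny: "(norm y)\<^sup>2 \<le> (y $ k)\<^sup>2 + \<rho>\<^sup>2 / 4" by simp
    have "t\<^sup>2 \<le> \<rho>\<^sup>2" using t by (intro power_mono) auto
    then have "(norm y)\<^sup>2 \<le> \<rho>\<^sup>2 / 2" using ny sq by simp
    then have "(norm y)\<^sup>2 / \<rho>\<^sup>2 \<le> 1/2" using \<rho> by (simp add: pos_divide_le_eq)
    moreover have "(y $ k)\<^sup>2 / t\<^sup>2 \<le> 1/4" using sq t by (simp add: pos_divide_le_eq)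
    ultimately have "(norm (x - m))\<^sup>2 / \<rho>\<^sup>2 + ((x - m) \<bullet> n)\<^sup>2 / t\<^sup>2 \<le> 1/2 + 1/4"
      unfolding x F by (rule add_mono)
    then have "x \<in> S" using yk unfolding S_def x F by simp
    then show "y \<in> F ` S" using x by blast
  qed
  then have "measure lebesgue ?B \<le> measure lebesgue (F ` S)"
    using lmeasurable_compact[OF f(4)] by (intro measure_mono_fmeasurable) (auto simp: F_def[abs_def])
  then show "t / 4 * (\<rho> / real CARD('d)) ^ (CARD('d) - 1) \<le> measure lebesgue S"
    using content_flat_box[of r "t/4" "t/2" k] r t f(5) by (simp add: r_def F_def[abs_def])
qed

subsection \<open>Surface measure of a facet\<close>

text \<open>If \<open>f\<close> is not measurable, the image measure may fail to be a measure and is then null by default.\<close>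

lemma measure_distr_le:
  assumes "emeasure M (space M) < \<infinity>"
  shows "measure (distr M N f) (space (distr M N f)) \<le> measure M (space M)"
proof -
  have "emeasure (distr M N f) (space N) \<le> emeasure M (f -` space N \<inter> space M)"
    unfolding distr_def by (subst emeasure_measure_of_conv) auto
  also have "\<dots> \<le> emeasure M (space M)"
    by (intro emeasure_mono) auto
  finally show ?thesis
    using assms by (simp add: measure_def enn2real_mono)
qed

text \<open>The cylinder of height one over the facet, whose volume is the surface measure, fits into a box after rotation.\<close>

lemma face_measure_le:
  fixes \<gamma> :: "(real ^ 'd) set"
  assumes \<gamma>: "compact \<gamma>" "m \<in> \<gamma>" and n: "norm n = 1" "\<And>x. x \<in> \<gamma> \<Longrightarrow> n \<bullet> (x - m) = 0"
  shows "measure (face_measure \<gamma>) (space (face_measure \<gamma>)) \<le> (2 * diameter \<gamma>) ^ (CARD('d) - 1)"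
proof -
  define N where "N = face_normal \<gamma>"
  have "n \<bullet> (z - x) = 0" if "x \<in> \<gamma>" "z \<in> \<gamma>" for x z
  proof -
    have "n \<bullet> (z - x) = n \<bullet> (z - m) - n \<bullet> (x - m)" by (simp add: inner_diff_right)
    then show ?thesis using n(2) that by simp
  qed
  then have "norm n = 1 \<and> (\<forall>x\<in>\<gamma>. \<forall>z\<in>\<gamma>. n \<bullet> (z - x) = 0)" using n(1) by blast
  then have N: "norm N = 1 \<and> (\<forall>x\<in>\<gamma>. \<forall>z\<in>\<gamma>. N \<bullet> (z - x) = 0)"
    unfolding N_def face_normal_def by (rule someI)
  then have NN: "N \<bullet> N = 1" by (simp add: dot_square_norm)
  define Z where "Z = {x + t *\<^sub>R N | x t. x \<in> \<gamma> \<and> 0 \<le> t \<and> t \<le> 1}"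
  have "Z = (\<lambda>(x, t). x + t *\<^sub>R N) ` (\<gamma> \<times> {0..1})" by (force simp: Z_def)
  then have Zc: "compact Z"
    using \<gamma>(1) by (auto intro!: compact_continuous_image compact_Times continuous_intros simp: case_prod_unfold)
  have b: "bounded \<gamma>" using \<gamma>(1) by (rule compact_imp_bounded)
  have "measure lebesgue Z \<le> (1 - 0) * (2 * diameter \<gamma>) ^ (CARD('d) - 1)"
  proof (rule measure_thin_le[OF conjunct1[OF N] Zc, where m = m])
    show "0 \<le> diameter \<gamma>" using b by (rule diameter_ge_0)
    fix z assume "z \<in> Z"
    then obtain x t where z: "z = x + t *\<^sub>R N" "x \<in> \<gamma>" "0 \<le> t" "t \<le> 1" by (auto simp: Z_def)
    have "N \<bullet> (x - m) = 0" using N \<gamma>(2) z(2) by blast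
    then have zN: "(z - m) \<bullet> N = t" using NN by (simp add: z(1) inner_simps inner_commute)
    have "norm (x - m) \<le> diameter \<gamma>" using diameter_bounded_bound[OF b z(2) \<gamma>(2)] by (simp add: dist_norm)
    then show "0 \<le> (z - m) \<bullet> N \<and> (z - m) \<bullet> N \<le> 1 \<and> norm ((z - m) - ((z - m) \<bullet> N) *\<^sub>R N) \<le> diameter \<gamma>"
      using z unfolding zN by (simp add: algebra_simps)
  qed auto
  moreover have "measure (face_measure \<gamma>) (space (face_measure \<gamma>)) \<le> measure (lebesgue_on Z) (space (lebesgue_on Z))"
    unfolding face_measure_def N_def[symmetric] Z_def[symmetric]
  proof (rule measure_distr_le)
    show "emeasure (lebesgue_on Z) (space (lebesgue_on Z)) < \<infinity>"
    proof -
      have "emeasure (lebesgue_on Z) Z = emeasure lebesgue Z"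
        using lmeasurable_compact[OF Zc] by (intro emeasure_restrict_space) (auto simp: fmeasurableD)
      then show ?thesis
        using lmeasurable_compact[OF Zc] by (simp only: space_restrict_space space_completion
            space_lborel space_borel Int_UNIV_right) (simp only: fmeasurable_def mem_Collect_eq infinity_ennreal_def)
    qed
  qed
  moreover have "measure (lebesgue_on Z) (space (lebesgue_on Z)) = measure lebesgue Z"
    using lmeasurable_compact[OF Zc] by (simp add: measure_restrict_space fmeasurableD)
  ultimately show ?thesis by simp
qed

section \<open>Affine functions on balls\<close>

text \<open>The small ball is placed where the value at \<open>m\<close> and the linear part have equal signs and so cannot cancel: it is
  reached from \<open>m\<close> along the gradient, forwards or backwards according to the sign of \<open>a\<close>.\<close>

lemma affine_large_on_ball:
  fixes g m :: "'a::euclidean_space"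
  assumes "0 < r"
  obtains y where "cball y (r / 8) \<subseteq> cball m (r / 2)"
    "\<And>x. x \<in> cball y (r / 8) \<Longrightarrow> \<bar>a\<bar> + norm g * (r / 8) \<le> \<bar>a + g \<bullet> (x - m)\<bar>"
proof -
  define s :: real where "s = (if 0 \<le> a then 1 else - 1)"
  have s: "s * s = 1" "\<bar>s\<bar> = 1" "s * a = \<bar>a\<bar>" by (auto simp: s_def)
  define u where "u = (if g = 0 then 0 else (s / norm g) *\<^sub>R g)"
  have nu: "norm u \<le> 1" using s by (simp add: u_def)
  have gu: "s * (g \<bullet> u) = norm g" using s by (auto simp: u_def dot_square_norm power2_eq_square)
  define y where "y = m + (r / 4) *\<^sub>R u"
  have ym: "norm (y - m) \<le> r / 4" using nu assms by (simp add: y_def mult_left_le)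
  show ?thesis
  proof (rule that[of y])
    show "cball y (r / 8) \<subseteq> cball m (r / 2)"
    proof
      fix x assume "x \<in> cball y (r / 8)"
      then have "norm (x - y) \<le> r / 8" by (simp add: dist_norm norm_minus_commute)
      then have "norm (x - m) \<le> r / 8 + r / 4"
        using ym norm_triangle_ineq[of "x - y" "y - m"] by simp
      then show "x \<in> cball m (r / 2)" using assms by (simp add: dist_norm norm_minus_commute)
    qed
    fix x assume "x \<in> cball y (r / 8)"
    then have xy: "norm (x - y) \<le> r / 8" by (simp add: dist_norm norm_minus_commute)
    have "\<bar>g \<bullet> (x - y)\<bar> \<le> norm g * (r / 8)"
      using Cauchy_Schwarz_ineq2[of g "x - y"] mult_left_mono[OF xy norm_ge_zero[of g]] by linarith
    then have b: "- (norm g * (r / 8)) \<le> s * (g \<bullet> (x - y))" using s by (auto simp: s_def abs_le_iff)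
    have "x - m = (x - y) + (r / 4) *\<^sub>R u" by (simp add: y_def)
    then have "s * (a + g \<bullet> (x - m)) = \<bar>a\<bar> + s * (g \<bullet> (x - y)) + (r / 4) * (s * (g \<bullet> u))"
      by (simp only: inner_add_right inner_scaleR_right distrib_left s(3)) (simp add: algebra_simps)
    then have "s * (a + g \<bullet> (x - m)) \<ge> \<bar>a\<bar> + norm g * (r / 8)" using b gu by (simp add: algebra_simps)
    moreover have "s * (a + g \<bullet> (x - m)) \<le> \<bar>a + g \<bullet> (x - m)\<bar>" by (auto simp: s_def)
    ultimately show "\<bar>a\<bar> + norm g * (r / 8) \<le> \<bar>a + g \<bullet> (x - m)\<bar>" by linarith
  qed
qed

section \<open>Square integrable functions\<close>

lemma l2_norm_sq: "(l2_norm M f)\<^sup>2 = (\<integral>x. (norm (f x))\<^sup>2 \<partial>M)"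
proof -
  have "0 \<le> (\<integral>x. f x \<bullet> f x \<partial>M)" by (rule Bochner_Integration.integral_nonneg) simp
  then show ?thesis by (simp add: l2_norm_def l2_inner_def power2_norm_eq_inner)
qed

lemma l2_norm_const_sq: "(l2_norm M (\<lambda>_. c :: real))\<^sup>2 = c\<^sup>2 * measure M (space M)"
  unfolding l2_norm_sq by (simp add: mult.commute)


lemma l2_norm_nonneg: "0 \<le> l2_norm M f"
  unfolding l2_norm_def l2_inner_def
  by (intro real_sqrt_ge_zero Bochner_Integration.integral_nonneg) simp

lemma L2_dominated:
  assumes "f \<in> L2 M" "g \<in> borel_measurable M" "AE x in M. norm (g x) \<le> c * norm (f x)"
  shows "g \<in> L2 M"
proof -
  have i: "integrable M (\<lambda>x. c\<^sup>2 * (norm (f x))\<^sup>2)" using assms(1) by (simp add: L2_def)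
  have "integrable M (\<lambda>x. (norm (g x))\<^sup>2)"
  proof (rule Bochner_Integration.integrable_bound[OF i])
    show "(\<lambda>x. (norm (g x))\<^sup>2) \<in> borel_measurable M" using assms(2) by measurable
    show "AE x in M. norm ((norm (g x))\<^sup>2) \<le> norm (c\<^sup>2 * (norm (f x))\<^sup>2)"
      using assms(3)
    proof eventually_elim
      case (elim x)
      then have "(norm (g x))\<^sup>2 \<le> (c * norm (f x))\<^sup>2" by (intro power_mono) auto
      then show ?case by (simp add: power_mult_distrib)
    qed
  qed
  then show ?thesis using assms(2) by (simp add: L2_def)
qed

lemma L2_inner_integrable:
  assumes "f \<in> L2 M" "g \<in> L2 M"
  shows "integrable M (\<lambda>x. f x \<bullet> g x)"
proof (rule Bochner_Integration.integrable_bound)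
  show "integrable M (\<lambda>x. (norm (f x))\<^sup>2 + (norm (g x))\<^sup>2)" using assms by (simp add: L2_def)
  show "(\<lambda>x. f x \<bullet> g x) \<in> borel_measurable M"
    using assms by (intro borel_measurable_inner) (auto simp: L2_def)
  have "\<bar>f x \<bullet> g x\<bar> \<le> (norm (f x))\<^sup>2 + (norm (g x))\<^sup>2" for x
  proof -
    have "\<bar>f x \<bullet> g x\<bar> \<le> norm (f x) * norm (g x)" by (rule Cauchy_Schwarz_ineq2)
    moreover have "2 * (norm (f x) * norm (g x)) \<le> (norm (f x))\<^sup>2 + (norm (g x))\<^sup>2"
      using sum_squares_bound[of "norm (f x)" "norm (g x)"] by (simp add: mult.assoc)
    moreover have "0 \<le> norm (f x) * norm (g x)" by simp
    ultimately show ?thesis by linarith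
  qed
  then show "AE x in M. norm (f x \<bullet> g x) \<le> norm ((norm (f x))\<^sup>2 + (norm (g x))\<^sup>2)" by simp
qed

lemma L2_mult_integrable:
  fixes f g :: "'a \<Rightarrow> real"
  shows "f \<in> L2 M \<Longrightarrow> g \<in> L2 M \<Longrightarrow> integrable M (\<lambda>x. f x * g x)"
  using L2_inner_integrable[of f M g] by simp

lemma L2_scaleR: "f \<in> L2 M \<Longrightarrow> (\<lambda>x. c *\<^sub>R f x) \<in> L2 M"
  by (rule L2_dominated[where c = "\<bar>c\<bar>"]) (auto simp: L2_def)

lemma L2_cmult: "f \<in> L2 M \<Longrightarrow> (\<lambda>x. c * f x :: real) \<in> L2 M"
  using L2_scaleR[of f M c] by simp

lemma L2_add:
  assumes "f \<in> L2 M" "g \<in> L2 M"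
  shows "(\<lambda>x. f x + g x) \<in> L2 M"
proof -
  have "integrable M (\<lambda>x. (norm (f x))\<^sup>2 + (norm (g x))\<^sup>2 + 2 * (f x \<bullet> g x))"
    using assms L2_inner_integrable[OF assms] by (simp add: L2_def)
  moreover have "(\<lambda>x. (norm (f x))\<^sup>2 + (norm (g x))\<^sup>2 + 2 * (f x \<bullet> g x)) = (\<lambda>x. (norm (f x + g x))\<^sup>2)"
    by (auto simp: power2_norm_eq_inner inner_add_left inner_add_right inner_commute)
  moreover have "(\<lambda>x. f x + g x) \<in> borel_measurable M"
    using assms by (intro borel_measurable_add) (auto simp: L2_def)
  ultimately show ?thesis by (simp add: L2_def)
qed

lemma L2_zero: "(\<lambda>x. 0) \<in> L2 M"
  by (simp add: L2_def)

lemma L2_diff: "f \<in> L2 M \<Longrightarrow> g \<in> L2 M \<Longrightarrow> (\<lambda>x. f x - g x) \<in> L2 M"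
  using L2_add[of f M "\<lambda>x. (- 1) *\<^sub>R g x"] L2_scaleR[of g M "- 1"] by simp

lemma L2_sum: "(\<And>i. i \<in> I \<Longrightarrow> f i \<in> L2 M) \<Longrightarrow> (\<lambda>x. \<Sum>i\<in>I. f i x) \<in> L2 M"
  by (induction I rule: infinite_finite_induct) (auto intro: L2_add L2_zero)

lemma L2_Cauchy_Schwarz:
  assumes "f \<in> L2 M" "g \<in> L2 M"
  shows "\<bar>\<integral>x. f x \<bullet> g x \<partial>M\<bar> \<le> l2_norm M f * l2_norm M g"
proof -
  define a b c where "a = (\<integral>x. (norm (f x))\<^sup>2 \<partial>M)" and "b = (\<integral>x. f x \<bullet> g x \<partial>M)"
    and "c = (\<integral>x. (norm (g x))\<^sup>2 \<partial>M)"
  have c0: "0 \<le> c" and a0: "0 \<le> a" by (auto simp: a_def c_def intro!: Bochner_Integration.integral_nonneg)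
  have q: "0 \<le> a + 2 * t * b + t\<^sup>2 * c" for t
  proof -
    have "0 \<le> (\<integral>x. (norm (f x + t *\<^sub>R g x))\<^sup>2 \<partial>M)" by (rule Bochner_Integration.integral_nonneg) simp
    also have "(\<lambda>x. (norm (f x + t *\<^sub>R g x))\<^sup>2)
        = (\<lambda>x. (norm (f x))\<^sup>2 + 2 * t * (f x \<bullet> g x) + t\<^sup>2 * (norm (g x))\<^sup>2)"
      by (rule ext, simp only: power2_norm_eq_inner inner_add_left inner_add_right inner_scaleR_left
          inner_scaleR_right inner_commute[of "g _" "f _"]) (simp add: power2_eq_square algebra_simps)
    also have "(\<integral>x. (norm (f x))\<^sup>2 + 2 * t * (f x \<bullet> g x) + t\<^sup>2 * (norm (g x))\<^sup>2 \<partial>M) = a + 2 * t * b + t\<^sup>2 * c"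
      unfolding a_def b_def c_def
      using assms L2_inner_integrable[OF assms] by (simp add: L2_def)
    finally show ?thesis .
  qed
  have "b\<^sup>2 \<le> a * c"
  proof (cases "c = 0")
    case True
    have "b = 0"
    proof (rule ccontr)
      assume "b \<noteq> 0"
      then show False using q[of "- (a + 1) / (2 * b)"] True by (simp add: field_simps)
    qed
    then show ?thesis using True by simp
  next
    case False
    then have "0 < c" using c0 by simp
    moreover have "0 \<le> a + 2 * (- b / c) * b + (- b / c)\<^sup>2 * c" by (rule q)
    ultimately have "0 \<le> a - b * b / c" by (simp add: power2_eq_square)
    then show ?thesis using \<open>0 < c\<close> by (simp add: pos_divide_le_eq power2_eq_square)
  qed
  then have "b\<^sup>2 \<le> (l2_norm M f * l2_norm M g)\<^sup>2"
    by (simp add: power_mult_distrib l2_norm_sq a_def c_def)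
  then have "\<bar>b\<bar> \<le> \<bar>l2_norm M f * l2_norm M g\<bar>" by (simp only: abs_le_square_iff)
  then show ?thesis by (simp add: b_def abs_mult l2_norm_nonneg)
qed

lemma L2_mult_Cauchy_Schwarz:
  fixes f g :: "'a \<Rightarrow> real"
  shows "f \<in> L2 M \<Longrightarrow> g \<in> L2 M \<Longrightarrow> \<bar>\<integral>x. f x * g x \<partial>M\<bar> \<le> l2_norm M f * l2_norm M g"
  using L2_Cauchy_Schwarz[of f M g] by simp

lemma integral_support_bound:
  fixes f :: "'a::euclidean_space \<Rightarrow> 'b::euclidean_space"
  assumes f: "f \<in> L2 (lebesgue_on \<Omega>)" and O: "\<Omega> \<in> sets lebesgue" and S: "S \<in> lmeasurable"
    and B: "\<And>x. norm (f x) \<le> B" "\<And>x. x \<notin> S \<Longrightarrow> f x = 0"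
  shows "(\<integral>x. (norm (f x))\<^sup>2 \<partial>lebesgue_on \<Omega>) \<le> B\<^sup>2 * measure lebesgue S"
proof -
  have i: "integrable lebesgue (\<lambda>x. if x \<in> \<Omega> then (norm (f x))\<^sup>2 else 0)"
    using f integrable_lebesgue_on_iff[OF O, of "\<lambda>x. (norm (f x))\<^sup>2"] by (simp add: L2_def)
  have "(\<integral>x. (norm (f x))\<^sup>2 \<partial>lebesgue_on \<Omega>) = (\<integral>x. (if x \<in> \<Omega> then (norm (f x))\<^sup>2 else 0) \<partial>lebesgue)"
    by (rule integral_lebesgue_on_eq[OF O])
  also have "\<dots> \<le> (\<integral>x. indicator S x * B\<^sup>2 \<partial>lebesgue)"
  proof (rule integral_mono[OF i])
    show "integrable lebesgue (\<lambda>x. indicator S x * B\<^sup>2)"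
      using S by (intro integrable_mult_left integrable_real_indicator) (auto simp: fmeasurable_def)
    show "(if x \<in> \<Omega> then (norm (f x))\<^sup>2 else 0) \<le> indicator S x * B\<^sup>2" for x
      using B(1)[of x] B(2)[of x] power_mono[OF B(1)[of x], of 2] by (auto simp: indicator_def)
  qed
  also have "\<dots> = B\<^sup>2 * measure lebesgue S" by (simp add: mult.commute)
  finally show ?thesis .
qed

text \<open>The Cauchy-Schwarz inequality, for the nonzero terms only.\<close>

lemma norm_sum_sq_le:
  fixes F :: "'i \<Rightarrow> 'b::real_normed_vector"
  assumes "finite Q" "card {q \<in> Q. F q \<noteq> 0} \<le> N"
  shows "(norm (\<Sum>q\<in>Q. F q))\<^sup>2 \<le> real N * (\<Sum>q\<in>Q. (norm (F q))\<^sup>2)"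
proof -
  let ?P = "{q \<in> Q. F q \<noteq> 0}"
  have "(\<Sum>q\<in>Q. F q) = (\<Sum>q\<in>?P. F q)"
    using assms(1) by (intro sum.mono_neutral_right) auto
  then have "(norm (\<Sum>q\<in>Q. F q))\<^sup>2 \<le> (\<Sum>q\<in>?P. 1 * norm (F q))\<^sup>2"
    using norm_sum[of F ?P] by (intro power_mono) auto
  also have "\<dots> \<le> (\<Sum>q\<in>?P. 1\<^sup>2) * (\<Sum>q\<in>?P. (norm (F q))\<^sup>2)"
    by (rule Cauchy_Schwarz_ineq_sum)
  also have "\<dots> \<le> real N * (\<Sum>q\<in>Q. (norm (F q))\<^sup>2)"
    using assms by (intro mult_mono sum_mono2 sum_nonneg) auto
  finally show ?thesis .
qed

section \<open>Families of localized test functions\<close>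

text \<open>Both parts of the estimator are tested with a sum of bumps \<open>F q\<close>, supported in \<open>S q\<close>, of which at most \<open>N\<close>
  overlap. The weight \<open>Z q\<close> is the contribution to the estimator that \<open>F q\<close> is meant to detect, and \<open>\<eta> q\<close> a scale
  below the scales \<open>\<hh> K\<close> of all elements that meet the support. The bounds \<open>BZ\<close> and \<open>DZ\<close> say that the energy of
  \<open>F q\<close> is of the order of \<open>Z q\<close>; then so are the energy of the sum and its pairing with elementwise data.\<close>

locale localized_family = simplicial_mesh +
  fixes Q :: "'q set" and F :: "'q \<Rightarrow> 'a \<Rightarrow> real" and S :: "'q \<Rightarrow> 'a set"
    and B D \<eta> Z :: "'q \<Rightarrow> real" and \<hh> :: "'a set \<Rightarrow> real" and N :: nat and c \<nu> \<kappa> :: real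
  assumes Q: "finite Q"
    and F: "\<And>q. q \<in> Q \<Longrightarrow> F q \<in> smooth_alg"
    and S: "\<And>q. q \<in> Q \<Longrightarrow> compact (S q)" "\<And>q. q \<in> Q \<Longrightarrow> S q \<subseteq> \<Omega>"
    and FS: "\<And>q x. q \<in> Q \<Longrightarrow> x \<notin> S q \<Longrightarrow> F q x = 0"
    and FB: "\<And>q x. q \<in> Q \<Longrightarrow> \<bar>F q x\<bar> \<le> B q" "\<And>q x. q \<in> Q \<Longrightarrow> norm (grad (F q) x) \<le> D q"
    and overlap: "\<And>K x. K \<in> T \<Longrightarrow> x \<in> interior K \<Longrightarrow> card {q \<in> Q. x \<in> S q} \<le> N"
    and \<eta>: "\<And>q. q \<in> Q \<Longrightarrow> 0 < \<eta> q" "\<And>q K x. q \<in> Q \<Longrightarrow> K \<in> T \<Longrightarrow> x \<in> interior K \<Longrightarrow> x \<in> S q \<Longrightarrow> \<eta> q \<le> \<hh> K"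
    and \<hh>: "\<And>K. K \<in> T \<Longrightarrow> 0 < \<hh> K"
    and Z: "\<And>q. q \<in> Q \<Longrightarrow> 0 \<le> Z q"
    and BZ: "\<And>q. q \<in> Q \<Longrightarrow> (B q)\<^sup>2 * measure lebesgue (S q) \<le> c * ((\<eta> q)\<^sup>2 * Z q)"
    and DZ: "\<And>q. q \<in> Q \<Longrightarrow> \<nu> * ((D q)\<^sup>2 * measure lebesgue (S q)) \<le> c * Z q"
    and \<kappa>\<eta>: "\<And>q. q \<in> Q \<Longrightarrow> \<kappa> * (\<eta> q)\<^sup>2 \<le> 1"
    and params: "0 < \<nu>" "0 < \<kappa>" "0 \<le> c"
begin

definition w :: "'a \<Rightarrow> real" where "w x = (\<Sum>q\<in>Q. F q x)"

lemma w_grad: "grad w x = (\<Sum>q\<in>Q. grad (F q) x)"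
proof (rule GDERIV_grad)
  have "(w has_derivative (\<lambda>h. \<Sum>q\<in>Q. h \<bullet> grad (F q) x)) (at x)"
    unfolding w_def using smooth_alg_grad(1)[OF F] by (auto intro!: has_derivative_sum simp: gderiv_def)
  then show "GDERIV w x :> (\<Sum>q\<in>Q. grad (F q) x)" by (simp add: gderiv_def inner_sum_right)
qed

lemma F_test: "q \<in> Q \<Longrightarrow> F q \<in> test_functions \<Omega>"
  using F S FS by (intro test_functionsI[of "F q" "S q"]) auto

lemma w_test: "w \<in> test_functions \<Omega>"
proof (rule test_functionsI[of w "\<Union>q\<in>Q. S q"])
  show "w \<in> smooth_alg" unfolding w_def using F by (intro smooth_sum)
  show "w x = 0" if "x \<notin> (\<Union>q\<in>Q. S q)" for x
    unfolding w_def using FS that by (intro sum.neutral) blast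
qed (use Q S in auto)

lemma F_grad_zero:
  assumes "q \<in> Q" "x \<notin> S q"
  shows "grad (F q) x = 0"
proof (rule GDERIV_grad)
  have "((\<lambda>_. 0) has_derivative (\<lambda>h. h \<bullet> 0)) (at x)" by simp
  then have "(F q has_derivative (\<lambda>h. h \<bullet> 0)) (at x)"
  proof (rule has_derivative_transform_within_open[where s = "- S q"])
    show "open (- S q)" using S(1)[OF assms(1)] compact_imp_closed by blast
  qed (use assms FS in auto)
  then show "GDERIV (F q) x :> 0" by (simp add: gderiv_def)
qed

lemma F_L2: "q \<in> Q \<Longrightarrow> F q \<in> L2 (lebesgue_on \<Omega>)" "q \<in> Q \<Longrightarrow> grad (F q) \<in> L2 (lebesgue_on \<Omega>)"
  using test_function_H10(3,4)[OF regular_domain(1) F_test] by auto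

lemma w_L2: "w \<in> L2 (lebesgue_on \<Omega>)" "grad w \<in> L2 (lebesgue_on \<Omega>)"
  using test_function_H10(3,4)[OF regular_domain(1) w_test] by auto

lemma overlap_card:
  assumes "K \<in> T" "x \<in> interior K" "\<And>q. q \<in> Q \<Longrightarrow> x \<notin> S q \<Longrightarrow> G q = 0"
  shows "card {q \<in> Q. G q \<noteq> 0} \<le> N"
proof -
  have "{q \<in> Q. G q \<noteq> 0} \<subseteq> {q \<in> Q. x \<in> S q}" using assms(3) by auto
  then have "card {q \<in> Q. G q \<noteq> 0} \<le> card {q \<in> Q. x \<in> S q}"
    using Q by (intro card_mono) auto
  then show ?thesis using overlap[OF assms(1,2)] by simp
qed

text \<open>Bounded overlap replaces orthogonality.\<close>

lemma sum_sq_integral: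
  fixes G :: "'q \<Rightarrow> 'a \<Rightarrow> 'b::euclidean_space"
  assumes "\<And>q. q \<in> Q \<Longrightarrow> G q \<in> L2 (lebesgue_on \<Omega>)" "\<And>q x. q \<in> Q \<Longrightarrow> x \<notin> S q \<Longrightarrow> G q x = 0"
  shows "(\<integral>x. (norm (\<Sum>q\<in>Q. G q x))\<^sup>2 \<partial>lebesgue_on \<Omega>)
    \<le> real N * (\<Sum>q\<in>Q. \<integral>x. (norm (G q x))\<^sup>2 \<partial>lebesgue_on \<Omega>)"
proof -
  have i: "integrable (lebesgue_on \<Omega>) (\<lambda>x. (norm (G q x))\<^sup>2)" if "q \<in> Q" for q
    using assms(1)[OF that] by (simp add: L2_def)
  have "(\<integral>x. (norm (\<Sum>q\<in>Q. G q x))\<^sup>2 \<partial>lebesgue_on \<Omega>)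
      \<le> (\<integral>x. real N * (\<Sum>q\<in>Q. (norm (G q x))\<^sup>2) \<partial>lebesgue_on \<Omega>)"
  proof (rule integral_mono_AE)
    show "integrable (lebesgue_on \<Omega>) (\<lambda>x. (norm (\<Sum>q\<in>Q. G q x))\<^sup>2)"
      using L2_sum[of Q G, OF assms(1)] by (simp add: L2_def)
    show "integrable (lebesgue_on \<Omega>) (\<lambda>x. real N * (\<Sum>q\<in>Q. (norm (G q x))\<^sup>2))"
      using i by (intro integrable_mult_right Bochner_Integration.integrable_sum)
    show "AE x in lebesgue_on \<Omega>. (norm (\<Sum>q\<in>Q. G q x))\<^sup>2 \<le> real N * (\<Sum>q\<in>Q. (norm (G q x))\<^sup>2)"
      using AE_interior_element unfolding AE_lebesgue_on_iff[OF element_sets(3)]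
    proof eventually_elim
      case (elim x)
      then show ?case
        using norm_sum_sq_le[OF Q overlap_card[of _ x "\<lambda>q. G q x"]] assms(2) by blast
    qed
  qed
  also have "\<dots> = real N * (\<Sum>q\<in>Q. \<integral>x. (norm (G q x))\<^sup>2 \<partial>lebesgue_on \<Omega>)"
    using i by (simp add: Bochner_Integration.integral_sum)
  finally show ?thesis .
qed

lemma F_sq: "q \<in> Q \<Longrightarrow> (\<integral>x. (norm (F q x))\<^sup>2 \<partial>lebesgue_on \<Omega>) \<le> c * ((\<eta> q)\<^sup>2 * Z q)"
  using integral_support_bound[OF F_L2(1) element_sets(3) lmeasurable_compact[OF S(1)], of q q "B q"]
    FB(1) FS BZ[of q] by fastforce

lemma F_grad_sq: "q \<in> Q \<Longrightarrow> \<nu> * (\<integral>x. (norm (grad (F q) x))\<^sup>2 \<partial>lebesgue_on \<Omega>) \<le> c * Z q"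
proof -
  assume q: "q \<in> Q"
  have "(\<integral>x. (norm (grad (F q) x))\<^sup>2 \<partial>lebesgue_on \<Omega>) \<le> (D q)\<^sup>2 * measure lebesgue (S q)"
    using FB(2)[OF q] F_grad_zero[OF q]
    by (intro integral_support_bound[OF F_L2(2)[OF q] element_sets(3) lmeasurable_compact[OF S(1)[OF q]]])
  then have "\<nu> * (\<integral>x. (norm (grad (F q) x))\<^sup>2 \<partial>lebesgue_on \<Omega>) \<le> \<nu> * ((D q)\<^sup>2 * measure lebesgue (S q))"
    using params by (intro mult_left_mono) auto
  then show ?thesis using DZ[OF q] by simp
qed

text \<open>The reaction term is absorbed by \<open>\<kappa> * (\<eta> q)\<^sup>2 \<le> 1\<close>, the diffusion term by \<open>DZ\<close>; hence the factor two.\<close>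

lemma w_energy:
  "\<nu> * (\<integral>x. (norm (grad w x))\<^sup>2 \<partial>lebesgue_on \<Omega>) + \<kappa> * (\<integral>x. (w x)\<^sup>2 \<partial>lebesgue_on \<Omega>)
    \<le> 2 * c * real N * (\<Sum>q\<in>Q. Z q)"
proof -
  have "\<nu> * (\<integral>x. (norm (grad w x))\<^sup>2 \<partial>lebesgue_on \<Omega>)
      \<le> \<nu> * (real N * (\<Sum>q\<in>Q. \<integral>x. (norm (grad (F q) x))\<^sup>2 \<partial>lebesgue_on \<Omega>))"
    unfolding w_grad using params F_L2(2) F_grad_zero by (intro mult_left_mono sum_sq_integral) auto
  also have "\<dots> = real N * (\<Sum>q\<in>Q. \<nu> * (\<integral>x. (norm (grad (F q) x))\<^sup>2 \<partial>lebesgue_on \<Omega>))"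
    by (simp add: sum_distrib_left mult_ac)
  also have "\<dots> \<le> real N * (\<Sum>q\<in>Q. c * Z q)"
    using F_grad_sq by (intro mult_left_mono sum_mono) auto
  finally have 1: "\<nu> * (\<integral>x. (norm (grad w x))\<^sup>2 \<partial>lebesgue_on \<Omega>) \<le> c * real N * (\<Sum>q\<in>Q. Z q)"
    by (simp add: sum_distrib_left mult_ac)
  have "(\<integral>x. (w x)\<^sup>2 \<partial>lebesgue_on \<Omega>) = (\<integral>x. (norm (\<Sum>q\<in>Q. F q x))\<^sup>2 \<partial>lebesgue_on \<Omega>)"
    by (simp add: w_def)
  also have "\<dots> \<le> real N * (\<Sum>q\<in>Q. \<integral>x. (norm (F q x))\<^sup>2 \<partial>lebesgue_on \<Omega>)"
    by (rule sum_sq_integral) (use F_L2 FS in auto)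
  finally have "\<kappa> * (\<integral>x. (w x)\<^sup>2 \<partial>lebesgue_on \<Omega>) \<le> \<kappa> * (real N * (\<Sum>q\<in>Q. \<integral>x. (norm (F q x))\<^sup>2 \<partial>lebesgue_on \<Omega>))"
    using params by (intro mult_left_mono) auto
  also have "\<dots> \<le> \<kappa> * (real N * (\<Sum>q\<in>Q. c * ((\<eta> q)\<^sup>2 * Z q)))"
    using params F_sq by (intro mult_left_mono sum_mono) auto
  also have "\<dots> = real N * (\<Sum>q\<in>Q. c * ((\<kappa> * (\<eta> q)\<^sup>2) * Z q))"
    by (simp add: sum_distrib_left mult_ac)
  also have "\<dots> \<le> real N * (\<Sum>q\<in>Q. c * (1 * Z q))"
    using params \<kappa>\<eta> Z by (intro mult_left_mono sum_mono mult_right_mono) auto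
  finally have 2: "\<kappa> * (\<integral>x. (w x)\<^sup>2 \<partial>lebesgue_on \<Omega>) \<le> c * real N * (\<Sum>q\<in>Q. Z q)"
    by (simp add: sum_distrib_left mult_ac)
  show ?thesis using 1 2 by simp
qed

lemma w_weighted: "(\<Sum>K\<in>T. (l2_norm (lebesgue_on K) w)\<^sup>2 / (\<hh> K)\<^sup>2) \<le> c * real N * (\<Sum>q\<in>Q. Z q)"
proof -
  have iF: "integrable (lebesgue_on K) (\<lambda>x. (F q x)\<^sup>2)" if "K \<in> T" "q \<in> Q" for K q
    using L2_element[OF that(1) F_L2(1)[OF that(2)]] by (simp add: L2_def)
  have "(l2_norm (lebesgue_on K) w)\<^sup>2 / (\<hh> K)\<^sup>2 \<le> real N * (\<Sum>q\<in>Q. (\<integral>x. (F q x)\<^sup>2 \<partial>lebesgue_on K) / (\<eta> q)\<^sup>2)"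
    if K: "K \<in> T" for K
  proof -
    have "(l2_norm (lebesgue_on K) w)\<^sup>2 / (\<hh> K)\<^sup>2 = (\<integral>x. (w x)\<^sup>2 / (\<hh> K)\<^sup>2 \<partial>lebesgue_on K)"
      by (simp add: l2_norm_sq)
    also have "\<dots> \<le> (\<integral>x. real N * (\<Sum>q\<in>Q. (F q x)\<^sup>2 / (\<eta> q)\<^sup>2) \<partial>lebesgue_on K)"
    proof (rule integral_mono_AE)
      show "integrable (lebesgue_on K) (\<lambda>x. (w x)\<^sup>2 / (\<hh> K)\<^sup>2)"
        using L2_element[OF K w_L2(1)] by (simp add: L2_def)
      show "integrable (lebesgue_on K) (\<lambda>x. real N * (\<Sum>q\<in>Q. (F q x)\<^sup>2 / (\<eta> q)\<^sup>2))"
        using iF[OF K] by (intro integrable_mult_right Bochner_Integration.integrable_sum integrable_divide)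
      show "AE x in lebesgue_on K. (w x)\<^sup>2 / (\<hh> K)\<^sup>2 \<le> real N * (\<Sum>q\<in>Q. (F q x)\<^sup>2 / (\<eta> q)\<^sup>2)"
        using AE_element_interior[OF K] unfolding AE_lebesgue_on_iff[OF element_sets(1)[OF K]]
      proof eventually_elim
        case (elim x)
        show ?case
        proof
          assume "x \<in> K"
          then have x: "x \<in> interior K" using elim by simp
          have "(w x)\<^sup>2 \<le> real N * (\<Sum>q\<in>Q. (F q x)\<^sup>2)"
            using norm_sum_sq_le[OF Q overlap_card[OF K x], of "\<lambda>q. F q x"] FS by (simp add: w_def)
          then have "(w x)\<^sup>2 / (\<hh> K)\<^sup>2 \<le> real N * (\<Sum>q\<in>Q. (F q x)\<^sup>2) / (\<hh> K)\<^sup>2"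
            by (rule divide_right_mono) simp
          also have "\<dots> = real N * (\<Sum>q\<in>Q. (F q x)\<^sup>2 / (\<hh> K)\<^sup>2)"
            by (simp add: sum_divide_distrib[symmetric])
          also have "\<dots> \<le> real N * (\<Sum>q\<in>Q. (F q x)\<^sup>2 / (\<eta> q)\<^sup>2)"
          proof (intro mult_left_mono sum_mono)
            fix q assume q: "q \<in> Q"
            show "(F q x)\<^sup>2 / (\<hh> K)\<^sup>2 \<le> (F q x)\<^sup>2 / (\<eta> q)\<^sup>2"
            proof (cases "x \<in> S q")
              case True
              then have "(\<eta> q)\<^sup>2 \<le> (\<hh> K)\<^sup>2" using \<eta>(1)[OF q] \<eta>(2)[OF q K x] by (intro power_mono) auto
              then show ?thesis using \<eta>(1)[OF q] \<hh>[OF K] by (intro divide_left_mono) auto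
            qed (use FS[OF q] in auto)
          qed auto
          finally show "(w x)\<^sup>2 / (\<hh> K)\<^sup>2 \<le> real N * (\<Sum>q\<in>Q. (F q x)\<^sup>2 / (\<eta> q)\<^sup>2)" .
        qed
      qed
    qed
    also have "\<dots> = real N * (\<Sum>q\<in>Q. (\<integral>x. (F q x)\<^sup>2 \<partial>lebesgue_on K) / (\<eta> q)\<^sup>2)"
      using iF[OF K] by (simp add: Bochner_Integration.integral_sum)
    finally show ?thesis .
  qed
  then have "(\<Sum>K\<in>T. (l2_norm (lebesgue_on K) w)\<^sup>2 / (\<hh> K)\<^sup>2)
      \<le> (\<Sum>K\<in>T. real N * (\<Sum>q\<in>Q. (\<integral>x. (F q x)\<^sup>2 \<partial>lebesgue_on K) / (\<eta> q)\<^sup>2))"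
    by (rule sum_mono)
  also have "\<dots> = real N * (\<Sum>q\<in>Q. (\<Sum>K\<in>T. \<integral>x. (F q x)\<^sup>2 \<partial>lebesgue_on K) / (\<eta> q)\<^sup>2)"
    by (simp add: sum_distrib_left sum_divide_distrib sum.swap[of _ T])
  also have "\<dots> = real N * (\<Sum>q\<in>Q. (\<integral>x. (norm (F q x))\<^sup>2 \<partial>lebesgue_on \<Omega>) / (\<eta> q)\<^sup>2)"
    using mesh_integral(2)[OF iF] by simp
  also have "\<dots> \<le> real N * (\<Sum>q\<in>Q. c * Z q)"
  proof (intro mult_left_mono sum_mono)
    fix q assume q: "q \<in> Q"
    show "(\<integral>x. (norm (F q x))\<^sup>2 \<partial>lebesgue_on \<Omega>) / (\<eta> q)\<^sup>2 \<le> c * Z q"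
      using F_sq[OF q] \<eta>(1)[OF q] by (simp add: pos_divide_le_eq mult_ac)
  qed auto
  finally show ?thesis by (simp add: sum_distrib_left mult_ac)
qed

lemma w_pairing:
  assumes r: "\<And>K. K \<in> T \<Longrightarrow> r K \<in> L2 (lebesgue_on K)"
  shows "\<bar>\<Sum>K\<in>T. \<integral>x. r K x * w x \<partial>lebesgue_on K\<bar>
    \<le> sqrt (\<Sum>K\<in>T. (\<hh> K)\<^sup>2 * (l2_norm (lebesgue_on K) (r K))\<^sup>2) * sqrt (c * real N * (\<Sum>q\<in>Q. Z q))"
proof -
  let ?a = "\<lambda>K. \<hh> K * l2_norm (lebesgue_on K) (r K)" and ?b = "\<lambda>K. l2_norm (lebesgue_on K) w / \<hh> K"
  have "\<bar>\<Sum>K\<in>T. \<integral>x. r K x * w x \<partial>lebesgue_on K\<bar> \<le> (\<Sum>K\<in>T. \<bar>\<integral>x. r K x * w x \<partial>lebesgue_on K\<bar>)"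
    by (rule sum_abs)
  also have "\<dots> \<le> (\<Sum>K\<in>T. ?a K * ?b K)"
  proof (rule sum_mono)
    fix K assume K: "K \<in> T"
    show "\<bar>\<integral>x. r K x * w x \<partial>lebesgue_on K\<bar> \<le> ?a K * ?b K"
      using L2_mult_Cauchy_Schwarz[OF r[OF K] L2_element[OF K w_L2(1)]] \<hh>[OF K] by simp
  qed
  also have "\<dots> \<le> sqrt ((\<Sum>K\<in>T. (?a K)\<^sup>2) * (\<Sum>K\<in>T. (?b K)\<^sup>2))"
    by (intro real_le_rsqrt Cauchy_Schwarz_ineq_sum)
  also have "\<dots> = sqrt (\<Sum>K\<in>T. (\<hh> K)\<^sup>2 * (l2_norm (lebesgue_on K) (r K))\<^sup>2)
      * sqrt (\<Sum>K\<in>T. (l2_norm (lebesgue_on K) w)\<^sup>2 / (\<hh> K)\<^sup>2)"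
    by (simp add: real_sqrt_mult power_mult_distrib power_divide)
  also have "\<dots> \<le> sqrt (\<Sum>K\<in>T. (\<hh> K)\<^sup>2 * (l2_norm (lebesgue_on K) (r K))\<^sup>2)
      * sqrt (c * real N * (\<Sum>q\<in>Q. Z q))"
    using w_weighted by (intro mult_left_mono) (auto intro!: sum_nonneg)
  finally show ?thesis .
qed

end

text \<open>Integration by parts against a constant.\<close>

lemma integral_const_grad:
  fixes \<phi> :: "'a::euclidean_space \<Rightarrow> real"
  assumes O: "open \<Omega>" and \<phi>: "\<phi> \<in> test_functions \<Omega>"
  shows "(\<integral>x. g \<bullet> grad \<phi> x \<partial>lebesgue_on \<Omega>) = 0"
proof -
  have "(\<integral>x. 1 * (grad \<phi> x \<bullet> g) \<partial>lebesgue_on \<Omega>) = - (\<integral>x. (0 \<bullet> g) * \<phi> x \<partial>lebesgue_on \<Omega>)"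
    by (rule lipschitz_integration_by_parts[OF O \<phi>, where L = 0 and v = "\<lambda>_. 1" and g = "\<lambda>_. 0"])
       (auto simp: lipschitz_on_def)
  then show ?thesis by (simp add: inner_commute)
qed

section \<open>The estimator is bounded by the residual\<close>

lemma quadratic_absorb:
  fixes Y :: real
  assumes "0 < c" "0 \<le> Y" "0 \<le> M" "c * Y \<le> M * sqrt Y"
  shows "Y \<le> M\<^sup>2 / c\<^sup>2"
proof (cases "Y = 0")
  case False
  then have sY: "0 < sqrt Y" using assms by simp
  have "c * sqrt Y * sqrt Y \<le> M * sqrt Y" using assms by (simp add: mult.assoc)
  then have "c * sqrt Y \<le> M" using sY by simp
  then have "sqrt Y \<le> M / c" using assms by (simp add: pos_le_divide_eq mult.commute)
  then have "(sqrt Y)\<^sup>2 \<le> (M / c)\<^sup>2" using sY by (intro power_mono) auto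
  then show ?thesis using assms by (simp add: power_divide)
qed simp

lemma integral_ge_on:
  fixes f :: "'a::euclidean_space \<Rightarrow> real"
  assumes S: "S \<in> sets lebesgue" and B: "B \<in> lmeasurable" "B \<subseteq> S" and f: "integrable (lebesgue_on S) f"
    and "\<And>x. x \<in> S \<Longrightarrow> 0 \<le> f x" "\<And>x. x \<in> B \<Longrightarrow> c \<le> f x"
  shows "c * measure lebesgue B \<le> integral\<^sup>L (lebesgue_on S) f"
proof -
  have "c * measure lebesgue B = (\<integral>x. indicator B x * c \<partial>lebesgue)" by (simp add: mult.commute)
  also have "\<dots> \<le> (\<integral>x. (if x \<in> S then f x else 0) \<partial>lebesgue)"
  proof (rule integral_mono)
    show "integrable lebesgue (\<lambda>x. indicator B x * c)"
      using B by (intro integrable_mult_left integrable_real_indicator) (auto simp: fmeasurable_def)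
    show "integrable lebesgue (\<lambda>x. if x \<in> S then f x else 0)"
      using f integrable_lebesgue_on_iff[OF S] by blast
    show "indicator B x * c \<le> (if x \<in> S then f x else 0)" for x
      using assms(5,6) B(2) by (auto simp: indicator_def)
  qed
  finally show ?thesis by (simp add: integral_lebesgue_on_eq[OF S])
qed

lemma integral_le_on:
  fixes f :: "'a::euclidean_space \<Rightarrow> real"
  assumes S: "S \<in> lmeasurable" and f: "integrable (lebesgue_on S) f" and "\<And>x. x \<in> S \<Longrightarrow> f x \<le> c"
  shows "integral\<^sup>L (lebesgue_on S) f \<le> c * measure lebesgue S"
proof -
  have SL: "S \<in> sets lebesgue" using S by (rule fmeasurableD)
  have "integral\<^sup>L (lebesgue_on S) f = (\<integral>x. (if x \<in> S then f x else 0) \<partial>lebesgue)"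
    by (rule integral_lebesgue_on_eq[OF SL])
  also have "\<dots> \<le> (\<integral>x. indicator S x * c \<partial>lebesgue)"
  proof (rule integral_mono)
    show "integrable lebesgue (\<lambda>x. indicator S x * c)"
      using S by (intro integrable_mult_left integrable_real_indicator) (auto simp: fmeasurable_def)
    show "integrable lebesgue (\<lambda>x. if x \<in> S then f x else 0)"
      using f integrable_lebesgue_on_iff[OF SL] by blast
    show "(if x \<in> S then f x else 0) \<le> indicator S x * c" for x
      using assms(3) by (auto simp: indicator_def)
  qed
  finally show ?thesis by (simp add: mult.commute)
qed

lemma L2_bounded:
  fixes f :: "'a::euclidean_space \<Rightarrow> 'b::euclidean_space"
  assumes S: "S \<in> lmeasurable" and f: "f \<in> borel_measurable (lebesgue_on S)" "\<And>x. x \<in> S \<Longrightarrow> norm (f x) \<le> M"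
  shows "f \<in> L2 (lebesgue_on S)"
proof -
  have fin: "finite_measure (lebesgue_on S)"
    using S by (intro finite_measureI) (auto simp: emeasure_restrict_space fmeasurable_def simp del: emeasure_completion)
  have "(\<lambda>x. M) \<in> L2 (lebesgue_on S)"
    using finite_measure.integrable_const[OF fin, of "M\<^sup>2"] by (simp add: L2_def)
  then show ?thesis
  proof (rule L2_dominated[OF _ f(1), where c = 1])
    show "AE x in lebesgue_on S. norm (f x) \<le> 1 * norm M"
      using f(2) by (intro AE_I2) (auto intro: order_trans[OF _ abs_ge_self])
  qed
qed

lemma continuous_compact_L2:
  fixes f :: "'a::euclidean_space \<Rightarrow> 'b::euclidean_space"
  assumes K: "compact K" and f: "continuous_on K f"
  shows "f \<in> L2 (lebesgue_on K)"
proof -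
  have "bounded (f ` K)" using compact_continuous_image[OF f K] by (rule compact_imp_bounded)
  then obtain M where "\<And>x. x \<in> K \<Longrightarrow> norm (f x) \<le> M" unfolding bounded_iff by blast
  moreover have "K \<in> sets lebesgue" using lmeasurable_compact[OF K] by (rule fmeasurableD)
  ultimately show ?thesis
    using f by (intro L2_bounded[OF lmeasurable_compact[OF K]] continuous_imp_measurable_on_sets_lebesgue)
qed

context simplicial_mesh
begin

lemma domain_lmeasurable: "\<Omega> \<in> lmeasurable"
  using regular_domain(1,2) by (intro bounded_set_imp_lmeasurable) auto

lemma pw_grad_L2: "pw_grad v \<in> L2 (lebesgue_on \<Omega>)"
  by (rule L2_bounded[OF domain_lmeasurable pw_grad_measurable pw_grad_bounded])

end

lemma hbar_mono: "diameter \<omega> \<le> diameter \<omega>' \<Longrightarrow> hbar \<nu> \<kappa> \<omega> \<le> hbar \<nu> \<kappa> \<omega>'"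
  unfolding hbar_def by (intro min.mono mult_right_mono) auto

lemma powr_minus_half: "0 < (x::real) \<Longrightarrow> x powr (-1/2) = 1 / sqrt x"
  using powr_minus_divide[of x "1/2"] powr_half_sqrt[of x] by simp

text \<open>With \<open>\<hh> = hbar \<nu> \<kappa> \<omega>\<close>, a function of size one that varies on the length \<open>\<hh> * sqrt \<nu>\<close> has diffusion energy density
  \<open>1 / \<hh>\<^sup>2\<close> and at most the same reaction energy density; this length is at most the diameter of \<open>\<omega>\<close>.\<close>

lemma hbar_facts:
  assumes "0 < \<nu>" "0 < \<kappa>" "0 < diameter \<omega>"
  shows "0 < hbar \<nu> \<kappa> \<omega>" "\<kappa> * (hbar \<nu> \<kappa> \<omega>)\<^sup>2 \<le> 1" "hbar \<nu> \<kappa> \<omega> * sqrt \<nu> \<le> diameter \<omega>"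
    "\<nu> * (hbar \<nu> \<kappa> \<omega>)\<^sup>2 \<le> (diameter \<omega>)\<^sup>2"
proof -
  have hb: "hbar \<nu> \<kappa> \<omega> = min (diameter \<omega> / sqrt \<nu>) (1 / sqrt \<kappa>)"
    unfolding hbar_def powr_minus_half[OF assms(1)] powr_minus_half[OF assms(2)] by simp
  show p: "0 < hbar \<nu> \<kappa> \<omega>" using assms by (simp add: hb)
  have "hbar \<nu> \<kappa> \<omega> \<le> 1 / sqrt \<kappa>" by (simp add: hb)
  then have "(hbar \<nu> \<kappa> \<omega>)\<^sup>2 \<le> (1 / sqrt \<kappa>)\<^sup>2" using p by (intro power_mono) auto
  then show "\<kappa> * (hbar \<nu> \<kappa> \<omega>)\<^sup>2 \<le> 1" using assms by (simp add: power_divide field_simps)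
  have "hbar \<nu> \<kappa> \<omega> \<le> diameter \<omega> / sqrt \<nu>" by (simp add: hb)
  then show s: "hbar \<nu> \<kappa> \<omega> * sqrt \<nu> \<le> diameter \<omega>" using assms by (simp add: pos_le_divide_eq)
  have "(hbar \<nu> \<kappa> \<omega> * sqrt \<nu>)\<^sup>2 \<le> (diameter \<omega>)\<^sup>2" using s p assms by (intro power_mono) auto
  then show "\<nu> * (hbar \<nu> \<kappa> \<omega>)\<^sup>2 \<le> (diameter \<omega>)\<^sup>2" using assms by (simp add: power_mult_distrib mult.commute)
qed

lemma measure_cball_eq:
  "0 \<le> r \<Longrightarrow> measure lebesgue (cball (c::'a::euclidean_space) r) = unit_ball_vol (real DIM('a)) * r ^ DIM('a)"
  using content_cball[of r c] by simp

text \<open>The energy of the bubbles on elements. Each is cut off at radius \<open>diameter K / (8 * \<sigma>)\<close>, so that its gradient is at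
  most \<open>64 * \<sigma> / diameter K\<close>; one more \<open>\<sigma> / diameter K\<close> comes from the gradient of the affine factor.\<close>

definition bubble_upper :: "nat \<Rightarrow> real \<Rightarrow> real"
  where "bubble_upper d \<sigma> = (65 * \<sigma>)\<^sup>2 * unit_ball_vol (real d)"

text \<open>The affine residual is large on a ball of radius \<open>diameter K / (64 * \<sigma>)\<close>, by \<open>affine_large_on_ball\<close>: its volume gives the
  power \<open>d\<close>, the squared size of the affine function the power two.\<close>

definition bubble_lower :: "nat \<Rightarrow> real \<Rightarrow> real"
  where "bubble_lower d \<sigma> = exp (- 4) * unit_ball_vol (real d) / (64 * \<sigma>) ^ (d + 2)"

definition element_const :: "nat \<Rightarrow> real \<Rightarrow> real"
  where "element_const d \<sigma> = unit_ball_vol (real d) * (4 * bubble_upper d \<sigma> / (bubble_lower d \<sigma>)\<^sup>2)"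

lemma bubble_constants_pos:
  assumes "1 \<le> \<sigma>"
  shows "0 < bubble_lower d \<sigma>" "0 < bubble_upper d \<sigma>" "0 < element_const d \<sigma>"
proof -
  show p: "0 < bubble_lower d \<sigma>" "0 < bubble_upper d \<sigma>"
    using assms by (auto simp: bubble_lower_def bubble_upper_def)
  show "0 < element_const d \<sigma>"
    unfolding element_const_def using p by (intro mult_pos_pos divide_pos_pos zero_less_power) auto
qed

text \<open>The number \<open>E\<close> bounds the full discrete residual, consisting of \<open>res\<close>, the oscillation \<open>osc\<close> and the jumps of the
  flux, in the norm dual to the energy norm. The residual \<open>res\<close> is affine so that it can be recovered from its values on a small ball.\<close>

locale residual_bound = regular_mesh \<Omega> T \<sigma>
  for \<Omega> :: "(real ^ 'd) set" and T :: "(real ^ 'd) set set" and \<sigma> +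
  fixes \<nu> \<kappa> E :: real and v :: "real ^ 'd \<Rightarrow> real" and res osc :: "(real ^ 'd) set \<Rightarrow> real ^ 'd \<Rightarrow> real"
  assumes params: "0 < \<nu>" "0 < \<kappa>" "0 \<le> E" and v: "v \<in> VT \<Omega> T"
    and res_affine: "\<And>K. K \<in> T \<Longrightarrow> \<exists>c g. AE x in lebesgue_on K. res K x = c + g \<bullet> x"
    and osc: "\<And>K. K \<in> T \<Longrightarrow> osc K \<in> L2 (lebesgue_on K)"
    and residual: "\<And>w. w \<in> test_functions \<Omega> \<Longrightarrow>
      \<bar>(\<Sum>K\<in>T. \<integral>x. (res K x + osc K x) * w x \<partial>lebesgue_on K)
        - \<nu> * (\<integral>x. pw_grad v x \<bullet> grad w x \<partial>lebesgue_on \<Omega>)\<bar>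
      \<le> E * sqrt (\<nu> * (\<integral>x. (norm (grad w x))\<^sup>2 \<partial>lebesgue_on \<Omega>) + \<kappa> * (\<integral>x. (w x)\<^sup>2 \<partial>lebesgue_on \<Omega>))"
begin

abbreviation "\<hh> \<equiv> hbar \<nu> \<kappa>"

definition "residual_sum = (\<Sum>K\<in>T. (\<hh> K)\<^sup>2 * (l2_norm (lebesgue_on K) (res K))\<^sup>2)"
definition "oscillation_sum = (\<Sum>K\<in>T. (\<hh> K)\<^sup>2 * (l2_norm (lebesgue_on K) (osc K))\<^sup>2)"

lemma oscillation_sum_nonneg: "0 \<le> oscillation_sum" and residual_sum_nonneg: "0 \<le> residual_sum"
  by (auto simp: oscillation_sum_def residual_sum_def intro!: sum_nonneg)

lemma element_lmeasurable: "K \<in> T \<Longrightarrow> K \<in> lmeasurable"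
  using full_simplex(1)[OF simplex_T] by (rule lmeasurable_compact)

lemma h_pos: "K \<in> T \<Longrightarrow> 0 < diameter K"
  by (rule element_inball)

lemma hbar_element:
  assumes "K \<in> T"
  shows "0 < \<hh> K" "\<kappa> * (\<hh> K)\<^sup>2 \<le> 1" "\<nu> * (\<hh> K)\<^sup>2 \<le> (diameter K)\<^sup>2"
  using hbar_facts[OF params(1,2) h_pos[OF assms]] by auto

lemma affine_L2:
  assumes "K \<in> T"
  shows "(\<lambda>x. a + g \<bullet> (x - z)) \<in> L2 (lebesgue_on K)"
  by (intro continuous_compact_L2 full_simplex(1)[OF simplex_T[OF assms]] continuous_intros)

lemma res_L2:
  assumes "K \<in> T"
  shows "res K \<in> L2 (lebesgue_on K)"
proof -
  obtain c g where ae: "AE x in lebesgue_on K. res K x = c + g \<bullet> x" using res_affine[OF assms] by blast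
  have A: "(\<lambda>x. c + g \<bullet> x) \<in> L2 (lebesgue_on K)" using affine_L2[OF assms, of c g 0] by simp
  have ae': "AE x in lebesgue_on K. c + g \<bullet> x = res K x" using ae by eventually_elim simp
  have "res K \<in> borel_measurable (lebesgue_on K)"
    using A by (intro measurable_lebesgue_on_AE[OF element_sets(1)[OF assms] _ ae']) (auto simp: L2_def)
  then show ?thesis
    using ae by (intro L2_dominated[OF A, where c = 1]) (auto elim: eventually_mono)
qed

text \<open>The element residual is tested with the sum of the residuals, each cut off to a ball
  inscribed in its element. The diffusion term drops out, as the discrete gradient is constant there.\<close>

lemma element_residual_bound: "residual_sum \<le> element_const CARD('d) \<sigma> * (E\<^sup>2 + oscillation_sum)"
proof -
  define dm where "dm = CARD('d)"
  define vol where "vol = unit_ball_vol (real dm)"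
  define c1 where "c1 = bubble_upper dm \<sigma>"
  define c0 where "c0 = bubble_lower dm \<sigma>"
  have vol_pos: "0 < vol" by (simp add: vol_def)
  have c01: "0 < c0" "0 < c1"
    using bubble_constants_pos \<sigma> by (simp_all add: c0_def c1_def)
  note c0_eq = c0_def[unfolded bubble_lower_def, folded vol_def]
    and c1_eq = c1_def[unfolded bubble_upper_def, folded vol_def]
  have measure_ball: "measure lebesgue (cball x r) = vol * r ^ dm" if "0 \<le> r" for x :: "real ^ 'd" and r
    using measure_cball_eq[OF that, of x] by (simp add: vol_def dm_def)
  have "\<forall>K\<in>T. \<exists>z c g. cball z (diameter K / (4 * \<sigma>)) \<subseteq> K \<and> (AE x in lebesgue_on K. res K x = c + g \<bullet> x)"
    using element_inball res_affine by metis
  then obtain z c g where zcg: "\<And>K. K \<in> T \<Longrightarrow> cball (z K) (diameter K / (4 * \<sigma>)) \<subseteq> K"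
    "\<And>K. K \<in> T \<Longrightarrow> AE x in lebesgue_on K. res K x = c K + g K \<bullet> x"
    by metis
  define a where "a K = c K + g K \<bullet> z K" for K
  define A where "A K x = a K + g K \<bullet> (x - z K)" for K x
  have resA: "AE x in lebesgue_on K. res K x = A K x" if "K \<in> T" for K
    using zcg(2)[OF that] by eventually_elim (simp add: A_def a_def inner_diff_right)
  \<comment> \<open>Half the radius of the inscribed ball keeps the support in the interior. The number \<open>s K\<close> is the size of the
    residual on \<open>K\<close>, up to constants.\<close>
  define r where "r K = diameter K / (8 * \<sigma>)" for K :: "(real ^ 'd) set"
  define s where "s K = \<bar>a K\<bar> + norm (g K) * diameter K" for K
  have r: "0 < r K" "r K \<le> diameter K" if "K \<in> T" for K
    using h_pos[OF that] \<sigma> by (auto simp: r_def field_simps)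
  have s0: "0 \<le> s K" if "K \<in> T" for K using h_pos[OF that] by (simp add: s_def)
  define \<phi> where "\<phi> K = bump (z K) (r K) (r K) 0" for K
  define F where "F K x = (\<hh> K)\<^sup>2 * (A K x * \<phi> K x)" for K x
  define S where "S K = cball (z K) (r K)" for K
  define Z where "Z K = (\<hh> K)\<^sup>2 * (s K)\<^sup>2 * diameter K ^ dm" for K
  have Z0: "0 \<le> Z K" if "K \<in> T" for K using h_pos[OF that] by (auto simp: Z_def)
  have SK: "S K \<subseteq> interior K" if "K \<in> T" for K
  proof -
    have "S K \<subseteq> ball (z K) (diameter K / (4 * \<sigma>))"
      using h_pos[OF that] \<sigma> by (auto simp: S_def r_def field_simps)
    also have "\<dots> \<subseteq> interior K" using zcg(1)[OF that] by (intro interior_maximal) auto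
    finally show ?thesis .
  qed
  have SK': "S K \<subseteq> K" if "K \<in> T" for K using SK[OF that] interior_subset by blast
  have \<phi>0: "\<phi> K x = 0" "grad (\<phi> K) x = 0" if "K \<in> T" "x \<notin> S K" for K x
    using bump_zero[OF r(1)[OF that(1)] r(1)[OF that(1)], of x "z K" 0]
      bump_grad_zero[OF r(1)[OF that(1)] r(1)[OF that(1)], of x "z K" 0]
      that slab_isotropic[of "r K" "z K"] r(1)[OF that(1)] by (auto simp: \<phi>_def S_def)
  have A_smooth: "A K \<in> smooth_alg" for K
  proof -
    have "A K = (\<lambda>x. a K - g K \<bullet> z K + x \<bullet> g K)" by (auto simp: A_def inner_diff_right inner_commute)
    then show ?thesis by (simp only:) (intro smooth_add smooth_const smooth_inner)
  qed
  have A_bound: "\<bar>A K x\<bar> \<le> s K" if "norm (x - z K) \<le> diameter K" for K x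
  proof -
    have "\<bar>g K \<bullet> (x - z K)\<bar> \<le> norm (g K) * diameter K"
      using Cauchy_Schwarz_ineq2[of "g K" "x - z K"] mult_left_mono[OF that norm_ge_zero[of "g K"]] by linarith
    then show ?thesis by (simp add: A_def s_def)
  qed
  have zK: "z K \<in> K" if "K \<in> T" for K
    using zcg(1)[OF that] h_pos[OF that] \<sigma> by auto
  have K_ball: "norm (x - z K) \<le> diameter K" if "K \<in> T" "x \<in> K" for K x
    using diameter_bounded_bound[OF compact_imp_bounded[OF full_simplex(1)[OF simplex_T[OF that(1)]]] that(2) zK[OF that(1)]]
    by (simp add: dist_norm)
  have A_on_S: "\<bar>A K x\<bar> \<le> s K" if "K \<in> T" "x \<in> S K" for K x
    using A_bound K_ball that SK' by blast
  have F_grad: "grad (F K) x = (\<hh> K)\<^sup>2 *\<^sub>R (A K x *\<^sub>R grad (\<phi> K) x + \<phi> K x *\<^sub>R g K)" for K x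
  proof (rule GDERIV_grad)
    have "GDERIV (A K) x :> g K"
      unfolding gderiv_def A_def by (auto intro!: derivative_eq_intros simp: inner_commute)
    moreover have "GDERIV (\<phi> K) x :> grad (\<phi> K) x"
      unfolding \<phi>_def by (rule smooth_alg_grad(1)[OF bump_smooth])
    ultimately show "GDERIV (F K) x :> (\<hh> K)\<^sup>2 *\<^sub>R (A K x *\<^sub>R grad (\<phi> K) x + \<phi> K x *\<^sub>R g K)"
      unfolding gderiv_def F_def[abs_def]
      by (auto intro!: derivative_eq_intros simp: inner_add_right algebra_simps)
  qed
  define B where "B K = (\<hh> K)\<^sup>2 * s K" for K
  define D where "D K = (\<hh> K)\<^sup>2 * s K * (65 * \<sigma>) / diameter K" for K
  have \<phi>1: "0 \<le> \<phi> K x" "\<phi> K x \<le> 1" for K x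
    by (simp_all add: \<phi>_def bump_nonneg bump_le_1)
  have FB: "\<bar>F K x\<bar> \<le> B K" if K: "K \<in> T" for K x
  proof (cases "x \<in> S K")
    case True
    have "\<bar>A K x\<bar> * \<bar>\<phi> K x\<bar> \<le> s K * 1"
      using A_on_S[OF K True] \<phi>1[of K x] s0[OF K] by (intro mult_mono) auto
    then show ?thesis by (simp add: F_def B_def abs_mult mult_left_mono)
  qed (use \<phi>0 K s0[OF K] in \<open>auto simp: F_def B_def\<close>)
  have FD: "norm (grad (F K) x) \<le> D K" if K: "K \<in> T" for K x
  proof (cases "x \<in> S K")
    case True
    have "norm (grad (\<phi> K) x) \<le> 8 / r K"
      unfolding \<phi>_def using r[OF K] by (intro bump_grad_bound) auto
    then have "norm (A K x *\<^sub>R grad (\<phi> K) x) \<le> s K * (8 / r K)"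
      using A_on_S[OF K True] s0[OF K] unfolding norm_scaleR by (intro mult_mono) auto
    also have "\<dots> = 64 * \<sigma> * s K / diameter K" using \<sigma> by (simp add: r_def)
    finally have 1: "norm (A K x *\<^sub>R grad (\<phi> K) x) \<le> 64 * \<sigma> * s K / diameter K" .
    have "norm (\<phi> K x *\<^sub>R g K) \<le> norm (g K)" using \<phi>1[of K x] by (simp add: mult_left_le_one_le)
    also have "\<dots> \<le> s K / diameter K" using h_pos[OF K] by (simp add: s_def pos_le_divide_eq)
    also have "\<dots> \<le> \<sigma> * s K / diameter K"
      using \<sigma> s0[OF K] h_pos[OF K] by (intro divide_right_mono) (auto simp: mult_le_cancel_right1)
    finally have 2: "norm (\<phi> K x *\<^sub>R g K) \<le> \<sigma> * s K / diameter K" .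
    have "norm (A K x *\<^sub>R grad (\<phi> K) x + \<phi> K x *\<^sub>R g K) \<le> 65 * \<sigma> * s K / diameter K"
      using norm_triangle_le[OF add_mono[OF 1 2]] by (simp add: add_divide_distrib[symmetric])
    then have "(\<hh> K)\<^sup>2 * norm (A K x *\<^sub>R grad (\<phi> K) x + \<phi> K x *\<^sub>R g K) \<le> (\<hh> K)\<^sup>2 * (65 * \<sigma> * s K / diameter K)"
      by (rule mult_left_mono) simp
    then show ?thesis by (simp add: F_grad D_def mult_ac)
  next
    case False
    then show ?thesis using \<phi>0[OF K False] s0[OF K] h_pos[OF K] \<sigma> by (simp add: F_grad D_def)
  qed
  have mS: "measure lebesgue (S K) \<le> vol * diameter K ^ dm" if K: "K \<in> T" for K
    unfolding S_def measure_ball[OF less_imp_le[OF r(1)[OF K]]]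
    using r[OF K] vol_pos by (intro mult_left_mono power_mono) auto
  interpret fam: localized_family \<Omega> T T F S B D \<hh> Z \<hh> 1 c1 \<nu> \<kappa>
  proof unfold_locales
    show "F K \<in> smooth_alg" for K
      unfolding F_def \<phi>_def by (intro smooth_cmult smooth_mult A_smooth bump_smooth)
    show "compact (S K)" for K by (simp add: S_def)
    show "S K \<subseteq> \<Omega>" if "K \<in> T" for K using SK[OF that] interior_element_subset[OF that] by blast
    show "F K x = 0" if "K \<in> T" "x \<notin> S K" for K x using \<phi>0[OF that] by (simp add: F_def)
    show "card {q \<in> T. x \<in> S q} \<le> 1" if "K \<in> T" "x \<in> interior K" for K x
    proof -
      have "{q \<in> T. x \<in> S q} \<subseteq> {K}"
        using interior_elements_disjoint[OF that(1) _ that(2)] SK' by auto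
      then have "card {q \<in> T. x \<in> S q} \<le> card {K}" by (intro card_mono) auto
      then show ?thesis by simp
    qed
    show "\<hh> q \<le> \<hh> K" if "q \<in> T" "K \<in> T" "x \<in> interior K" "x \<in> S q" for q K x
      using interior_elements_disjoint[OF that(2,1,3)] that(4) SK'[OF that(1)] by auto
    show "(B K)\<^sup>2 * measure lebesgue (S K) \<le> c1 * ((\<hh> K)\<^sup>2 * Z K)" if K: "K \<in> T" for K
    proof -
      have "(B K)\<^sup>2 * measure lebesgue (S K) \<le> (B K)\<^sup>2 * (vol * diameter K ^ dm)"
        using mS[OF K] by (intro mult_left_mono) auto
      also have "\<dots> = vol * ((\<hh> K)\<^sup>2 * Z K)" by (simp add: B_def Z_def power_mult_distrib power2_eq_square)
      also have "\<dots> \<le> c1 * ((\<hh> K)\<^sup>2 * Z K)"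
        using \<sigma> vol_pos Z0[OF K] one_le_power[of "65 * \<sigma>" 2] by (intro mult_right_mono) (auto simp: c1_eq)
      finally show ?thesis .
    qed
    show "\<nu> * ((D K)\<^sup>2 * measure lebesgue (S K)) \<le> c1 * Z K" if K: "K \<in> T" for K
    proof -
      have "\<nu> * ((D K)\<^sup>2 * measure lebesgue (S K)) \<le> \<nu> * ((D K)\<^sup>2 * (vol * diameter K ^ dm))"
        using mS[OF K] params by (intro mult_left_mono) auto
      also have "\<dots> = (c1 * Z K) * (\<nu> * (\<hh> K)\<^sup>2 / (diameter K)\<^sup>2)"
        by (simp add: D_def Z_def c1_eq power_mult_distrib power_divide power2_eq_square)
      also have "\<dots> \<le> (c1 * Z K) * 1"
        using hbar_element(3)[OF K] h_pos[OF K] c01 Z0[OF K] by (intro mult_left_mono) auto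
      finally show ?thesis by simp
    qed
  qed (use finite_T FB FD hbar_element params c01 Z0 in auto)
  define Y where "Y = (\<Sum>K\<in>T. Z K)"
  have Y0: "0 \<le> Y" unfolding Y_def by (rule sum_nonneg[OF Z0])
  have en: "E * sqrt (\<nu> * (\<integral>x. (norm (grad fam.w x))\<^sup>2 \<partial>lebesgue_on \<Omega>) + \<kappa> * (\<integral>x. (fam.w x)\<^sup>2 \<partial>lebesgue_on \<Omega>))
      \<le> E * (sqrt (2 * c1) * sqrt Y)"
    using fam.w_energy params(3) by (intro mult_left_mono) (simp_all add: Y_def real_sqrt_mult[symmetric])
  have grad0: "(\<integral>x. pw_grad v x \<bullet> grad fam.w x \<partial>lebesgue_on \<Omega>) = 0"
  proof -
    have "(\<integral>x. pw_grad v x \<bullet> grad fam.w x \<partial>lebesgue_on \<Omega>) = (\<integral>x. (\<Sum>K\<in>T. pw_grad v x \<bullet> grad (F K) x) \<partial>lebesgue_on \<Omega>)"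
      by (simp add: fam.w_grad inner_sum_right)
    also have "\<dots> = (\<Sum>K\<in>T. \<integral>x. pw_grad v x \<bullet> grad (F K) x \<partial>lebesgue_on \<Omega>)"
      by (intro Bochner_Integration.integral_sum L2_inner_integrable[OF pw_grad_L2] fam.F_L2(2))
    also have "\<dots> = (\<Sum>K\<in>T. \<integral>x. elem_grad v K \<bullet> grad (F K) x \<partial>lebesgue_on \<Omega>)"
    proof (intro sum.cong Bochner_Integration.integral_cong refl)
      fix K x assume K: "K \<in> T"
      show "pw_grad v x \<bullet> grad (F K) x = elem_grad v K \<bullet> grad (F K) x"
        using pw_grad_eq[OF K, of x v] SK[OF K] fam.F_grad_zero[OF K, of x] by (cases "x \<in> S K") auto
    qed
    also have "\<dots> = 0"
      by (intro sum.neutral ballI integral_const_grad[OF regular_domain(1)] fam.F_test)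
    finally show ?thesis .
  qed
  have w_int: "integrable (lebesgue_on K) (\<lambda>x. res K x * fam.w x)" "integrable (lebesgue_on K) (\<lambda>x. osc K x * fam.w x)"
    if "K \<in> T" for K
    using L2_mult_integrable[OF res_L2[OF that] L2_element[OF that fam.w_L2(1)]]
      L2_mult_integrable[OF osc[OF that] L2_element[OF that fam.w_L2(1)]] by auto
  have "(\<Sum>K\<in>T. \<integral>x. (res K x + osc K x) * fam.w x \<partial>lebesgue_on K)
      = (\<Sum>K\<in>T. \<integral>x. res K x * fam.w x \<partial>lebesgue_on K) + (\<Sum>K\<in>T. \<integral>x. osc K x * fam.w x \<partial>lebesgue_on K)"
    using w_int by (simp add: distrib_right sum.distrib)
  moreover have "\<bar>\<Sum>K\<in>T. \<integral>x. osc K x * fam.w x \<partial>lebesgue_on K\<bar> \<le> sqrt oscillation_sum * (sqrt c1 * sqrt Y)"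
    using fam.w_pairing[of osc, OF osc] by (simp add: oscillation_sum_def Y_def real_sqrt_mult)
  moreover note residual[OF fam.w_test] en
  ultimately have up: "(\<Sum>K\<in>T. \<integral>x. res K x * fam.w x \<partial>lebesgue_on K) \<le> E * (sqrt (2 * c1) * sqrt Y) + sqrt oscillation_sum * (sqrt c1 * sqrt Y)"
    unfolding grad0 by linarith
  have low: "c0 * Z K \<le> (\<integral>x. res K x * fam.w x \<partial>lebesgue_on K)" if K: "K \<in> T" for K
  proof -
    let ?f = "\<lambda>x. A K x * F K x"
    have AL: "A K \<in> L2 (lebesgue_on K)" unfolding A_def by (rule affine_L2[OF K])
    have fi: "integrable (lebesgue_on K) ?f"
      by (rule L2_mult_integrable[OF AL L2_element[OF K fam.F_L2(1)[OF K]]])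
    have ae: "AE x in lebesgue_on K. ?f x = res K x * fam.w x"
    proof -
      have "AE x in lebesgue_on K. x \<in> interior K"
        using AE_element_interior[OF K] unfolding AE_lebesgue_on_iff[OF element_sets(1)[OF K]]
        by eventually_elim simp
      with resA[OF K] show ?thesis
      proof eventually_elim
        case (elim x)
        have "F K' x = 0" if "K' \<in> T - {K}" for K'
          using fam.FS[of K' x] that interior_elements_disjoint[OF K _ elim(2), of K'] SK'[of K'] by blast
        then have "fam.w x = F K x" unfolding fam.w_def using K finite_T by (simp add: sum.remove[of T K])
        then show ?case using elim by simp
      qed
    qed
    have eq: "(\<integral>x. res K x * fam.w x \<partial>lebesgue_on K) = (\<integral>x. ?f x \<partial>lebesgue_on K)"
      by (rule integral_lebesgue_on_cong_AE(1)[OF element_sets(1)[OF K] borel_measurable_integrable[OF fi] ae])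
    obtain y where y: "cball y (r K / 8) \<subseteq> cball (z K) (r K / 2)"
      "\<And>x. x \<in> cball y (r K / 8) \<Longrightarrow> \<bar>a K\<bar> + norm (g K) * (r K / 8) \<le> \<bar>a K + g K \<bullet> (x - z K)\<bar>"
      using affine_large_on_ball[OF r(1)[OF K]] by metis
    have f0: "0 \<le> ?f x" for x
    proof -
      have "?f x = (\<hh> K)\<^sup>2 * ((A K x)\<^sup>2 * \<phi> K x)" by (simp add: F_def power2_eq_square)
      then show ?thesis using \<phi>1[of K x] by simp
    qed
    \<comment> \<open>On the small ball the bump is at least \<open>exp (- 4)\<close> and the residual comparable to its maximum \<open>s K\<close>.\<close>
    have fl: "(\<hh> K)\<^sup>2 * ((s K / (64 * \<sigma>))\<^sup>2 * exp (- 4)) \<le> ?f x" if x: "x \<in> cball y (r K / 8)" for x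
    proof -
      have "x \<in> cball (z K) (r K / 2)" using x y(1) by blast
      then have "norm (x - z K) \<le> r K / 2" by (simp add: dist_norm norm_minus_commute)
      then have "(norm (x - z K))\<^sup>2 \<le> (r K / 2)\<^sup>2" by (intro power_mono) auto
      moreover have "(r K / 2)\<^sup>2 = 1/4 * (r K)\<^sup>2" by (simp add: power_divide)
      ultimately have "(norm (x - z K))\<^sup>2 \<le> 3/4 * (r K)\<^sup>2"
        using zero_le_power2[of "r K"] by linarith
      then have "(norm (x - z K))\<^sup>2 / (r K)\<^sup>2 \<le> 3/4"
        using r[OF K] by (simp add: pos_divide_le_eq)
      then have e: "exp (- 4) \<le> \<phi> K x" unfolding \<phi>_def by (intro bump_ge) simp
      have "\<bar>a K\<bar> / (64 * \<sigma>) \<le> \<bar>a K\<bar>" using \<sigma> by (simp add: pos_divide_le_eq mult_le_cancel_left1)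
      then have "s K / (64 * \<sigma>) \<le> \<bar>a K\<bar> + norm (g K) * (r K / 8)"
        by (simp add: s_def r_def add_divide_distrib)
      also have "\<dots> \<le> \<bar>A K x\<bar>" using y(2)[OF x] by (simp add: A_def)
      finally have "(s K / (64 * \<sigma>))\<^sup>2 \<le> \<bar>A K x\<bar>\<^sup>2" using s0[OF K] \<sigma> by (intro power_mono) auto
      then have "(s K / (64 * \<sigma>))\<^sup>2 * exp (- 4) \<le> (A K x)\<^sup>2 * \<phi> K x"
        using e by (intro mult_mono) auto
      then have "(\<hh> K)\<^sup>2 * ((s K / (64 * \<sigma>))\<^sup>2 * exp (- 4)) \<le> (\<hh> K)\<^sup>2 * ((A K x)\<^sup>2 * \<phi> K x)"
        by (rule mult_left_mono) simp
      then show ?thesis by (simp add: F_def power2_eq_square mult_ac)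
    qed
    have "cball y (r K / 8) \<subseteq> K"
    proof -
      have "cball (z K) (r K / 2) \<subseteq> S K" using r[OF K] by (simp add: S_def subset_cball)
      then show ?thesis using y(1) SK'[OF K] by blast
    qed
    then have "(\<hh> K)\<^sup>2 * ((s K / (64 * \<sigma>))\<^sup>2 * exp (- 4)) * measure lebesgue (cball y (r K / 8)) \<le> (\<integral>x. ?f x \<partial>lebesgue_on K)"
      by (intro integral_ge_on[OF element_sets(1)[OF K] _ _ fi f0 fl]) auto
    also have "(\<hh> K)\<^sup>2 * ((s K / (64 * \<sigma>))\<^sup>2 * exp (- 4)) * measure lebesgue (cball y (r K / 8)) = c0 * Z K"
    proof -
      have "r K / 8 = diameter K / (64 * \<sigma>)" by (simp add: r_def)
      then have "measure lebesgue (cball y (r K / 8)) = vol * (diameter K ^ dm / (64 * \<sigma>) ^ dm)"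
        using r(1)[OF K] measure_ball[of "r K / 8" y] by (simp add: power_divide)
      then show ?thesis by (simp add: c0_eq Z_def power_divide power_add power2_eq_square mult_ac)
    qed
    finally show ?thesis unfolding eq .
  qed
  have "c0 * Y \<le> (\<Sum>K\<in>T. \<integral>x. res K x * fam.w x \<partial>lebesgue_on K)"
    unfolding Y_def sum_distrib_left using low by (intro sum_mono)
  also note up
  also have "E * (sqrt (2 * c1) * sqrt Y) + sqrt oscillation_sum * (sqrt c1 * sqrt Y) = (sqrt c1 * (sqrt 2 * E + sqrt oscillation_sum)) * sqrt Y"
    by (simp add: real_sqrt_mult algebra_simps)
  finally have "c0 * Y \<le> (sqrt c1 * (sqrt 2 * E + sqrt oscillation_sum)) * sqrt Y" .
  then have "Y \<le> (sqrt c1 * (sqrt 2 * E + sqrt oscillation_sum))\<^sup>2 / c0\<^sup>2"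
    using c01 Y0 params oscillation_sum_nonneg by (intro quadratic_absorb) auto
  also have "(sqrt c1 * (sqrt 2 * E + sqrt oscillation_sum))\<^sup>2 = c1 * (sqrt 2 * E + sqrt oscillation_sum)\<^sup>2"
    using c01 by (simp add: power_mult_distrib)
  also have "\<dots> / c0\<^sup>2 \<le> c1 * (4 * (E\<^sup>2 + oscillation_sum)) / c0\<^sup>2"
  proof -
    have "(sqrt 2 * E + sqrt oscillation_sum)\<^sup>2 \<le> 2 * ((sqrt 2 * E)\<^sup>2 + (sqrt oscillation_sum)\<^sup>2)"
      using sum_squares_bound[of "sqrt 2 * E" "sqrt oscillation_sum"] by (simp add: power2_sum)
    also have "\<dots> \<le> 4 * (E\<^sup>2 + oscillation_sum)" using oscillation_sum_nonneg by (simp add: power_mult_distrib)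
    finally show ?thesis using c01 by (intro divide_right_mono mult_left_mono) auto
  qed
  also have "c1 * (4 * (E\<^sup>2 + oscillation_sum)) / c0\<^sup>2 = (4 * c1 / c0\<^sup>2) * (E\<^sup>2 + oscillation_sum)"
    by (simp only: times_divide_eq_left times_divide_eq_right mult_ac)
  finally have Yb: "Y \<le> (4 * c1 / c0\<^sup>2) * (E\<^sup>2 + oscillation_sum)" .
  \<comment> \<open>Conversely the weights \<open>Z K\<close> dominate the estimator.\<close>
  have "residual_sum \<le> (\<Sum>K\<in>T. vol * Z K)"
    unfolding residual_sum_def
  proof (rule sum_mono)
    fix K assume K: "K \<in> T"
    have AL: "A K \<in> L2 (lebesgue_on K)" unfolding A_def by (rule affine_L2[OF K])
    have Ai: "integrable (lebesgue_on K) (\<lambda>x. (norm (A K x))\<^sup>2)" using AL by (simp add: L2_def)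
    have "AE x in lebesgue_on K. (norm (A K x))\<^sup>2 = (norm (res K x))\<^sup>2"
      using resA[OF K] by eventually_elim simp
    then have "(l2_norm (lebesgue_on K) (res K))\<^sup>2 = (\<integral>x. (norm (A K x))\<^sup>2 \<partial>lebesgue_on K)"
      unfolding l2_norm_sq
      by (rule integral_lebesgue_on_cong_AE(1)[OF element_sets(1)[OF K] borel_measurable_integrable[OF Ai]])
    also have "\<dots> \<le> (s K)\<^sup>2 * measure lebesgue K"
    proof (rule integral_le_on[OF element_lmeasurable[OF K] Ai])
      show "(norm (A K x))\<^sup>2 \<le> (s K)\<^sup>2" if "x \<in> K" for x
        using A_bound[OF K_ball[OF K that]] s0[OF K] by (intro power_mono) auto
    qed
    also have "\<dots> \<le> (s K)\<^sup>2 * (vol * diameter K ^ dm)"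
    proof (rule mult_left_mono)
      have "K \<subseteq> cball (z K) (diameter K)" using K_ball[OF K] by (auto simp: dist_norm norm_minus_commute)
      then have "measure lebesgue K \<le> measure lebesgue (cball (z K) (diameter K))"
        by (intro measure_mono_fmeasurable element_sets(1)[OF K]) auto
      then show "measure lebesgue K \<le> vol * diameter K ^ dm"
        using h_pos[OF K] measure_ball[of "diameter K" "z K"] by simp
    qed simp
    finally have "(\<hh> K)\<^sup>2 * (l2_norm (lebesgue_on K) (res K))\<^sup>2 \<le> (\<hh> K)\<^sup>2 * ((s K)\<^sup>2 * (vol * diameter K ^ dm))"
      by (rule mult_left_mono) simp
    then show "(\<hh> K)\<^sup>2 * (l2_norm (lebesgue_on K) (res K))\<^sup>2 \<le> vol * Z K" by (simp add: Z_def mult_ac)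
  qed
  also have "\<dots> = vol * Y" by (simp add: Y_def sum_distrib_left)
  also have "\<dots> \<le> vol * ((4 * c1 / c0\<^sup>2) * (E\<^sup>2 + oscillation_sum))" using Yb vol_pos by (intro mult_left_mono) auto
  finally show ?thesis
    by (simp add: element_const_def c0_def c1_def vol_def dm_def mult.assoc)
qed

end

text \<open>The ratio of facet diameter to bump radius; it is twice the ratio for \<open>patch_radius\<close>, which leaves the support in
  an open subset of the patch.\<close>

definition face_scale :: "nat \<Rightarrow> real \<Rightarrow> real"
  where "face_scale d \<sigma> = 4 * \<sigma> * real d"

text \<open>The flux of a bump through the facet, see \<open>face_bump_flux\<close>, relative to the power \<open>diameter \<gamma> ^ (d - 1)\<close>.\<close>

definition jump_lower :: "nat \<Rightarrow> real \<Rightarrow> real"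
  where "jump_lower d \<sigma> = exp (- 4) / (4 * (face_scale d \<sigma> * real d) ^ (d - 1))"

text \<open>The square of the constant in \<open>norm (grad \<phi>) \<le> 8 * face_scale d \<sigma> / (\<hh> * sqrt \<nu>)\<close>.\<close>

definition jump_upper :: "nat \<Rightarrow> real \<Rightarrow> real"
  where "jump_upper d \<sigma> = 64 * (face_scale d \<sigma>)\<^sup>2"

text \<open>The number \<open>2 * (d + 1)\<close> bounds the overlap: an element meets the patches of its \<open>d + 1\<close> facets, each of which is used
  from both sides.\<close>

definition jump_const :: "nat \<Rightarrow> real \<Rightarrow> real"
  where "jump_const d \<sigma> = 4 * jump_upper d \<sigma> * real (2 * (d + 1)) / (jump_lower d \<sigma>)\<^sup>2"

definition estimator_const :: "nat \<Rightarrow> real \<Rightarrow> real"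
  where "estimator_const d \<sigma> = element_const d \<sigma> + 2 ^ (d - 1) * (jump_const d \<sigma> * (1 + element_const d \<sigma>))"

lemma jump_constants_pos:
  assumes "1 \<le> \<sigma>" "2 \<le> d"
  shows "1 \<le> face_scale d \<sigma>" "2 \<le> face_scale d \<sigma>" "0 < jump_lower d \<sigma>" "0 < jump_upper d \<sigma>" "0 < jump_const d \<sigma>"
    "0 < estimator_const d \<sigma>"
proof -
  have "1 * 2 \<le> \<sigma> * real d" using assms by (intro mult_mono) auto
  then show f: "1 \<le> face_scale d \<sigma>" "2 \<le> face_scale d \<sigma>" by (auto simp: face_scale_def)
  show l: "0 < jump_lower d \<sigma>" "0 < jump_upper d \<sigma>" using f assms by (auto simp: jump_lower_def jump_upper_def)
  show j: "0 < jump_const d \<sigma>"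
    unfolding jump_const_def using l by (intro mult_pos_pos divide_pos_pos zero_less_power) auto
  show "0 < estimator_const d \<sigma>"
    unfolding estimator_const_def using j bubble_constants_pos(3)[OF assms(1), of d]
    by (intro add_pos_pos mult_pos_pos) auto
qed

context residual_bound
begin

abbreviation "J \<equiv> flux_jump T \<nu> v"

definition face_bump_radius :: "(real ^ 'd) set \<Rightarrow> real"
  where "face_bump_radius \<gamma> = diameter \<gamma> / face_scale CARD('d) \<sigma>"

text \<open>Proportional to the layer width \<open>\<hh> * sqrt \<nu>\<close>, which is at most the diameter of the facet.\<close>

definition face_bump_width :: "(real ^ 'd) set \<Rightarrow> real"
  where "face_bump_width \<gamma> = \<hh> \<gamma> * sqrt \<nu> / face_scale CARD('d) \<sigma>"

definition face_bump :: "(real ^ 'd) set \<Rightarrow> (real ^ 'd) set \<Rightarrow> real ^ 'd \<Rightarrow> real"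
  where "face_bump K \<gamma> = bump (facet_center \<gamma>) (face_bump_radius \<gamma>) (face_bump_width \<gamma>) (outer_normal K \<gamma>)"

definition face_slab :: "(real ^ 'd) set \<Rightarrow> (real ^ 'd) set \<Rightarrow> (real ^ 'd) set"
  where "face_slab K \<gamma> = slab (facet_center \<gamma>) (face_bump_radius \<gamma>) (face_bump_width \<gamma>) (outer_normal K \<gamma>)"

lemma scale_ge: "1 \<le> face_scale CARD('d) \<sigma>" "2 \<le> face_scale CARD('d) \<sigma>"
  using jump_constants_pos[OF \<sigma>, of "CARD('d)"] dim by auto

lemma hbar_face:
  assumes "K \<in> T" "\<gamma> \<in> faces K"
  shows "0 < \<hh> \<gamma>" "\<kappa> * (\<hh> \<gamma>)\<^sup>2 \<le> 1" "\<hh> \<gamma> * sqrt \<nu> \<le> diameter \<gamma>" "\<hh> \<gamma> \<le> \<hh> K"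
  using hbar_facts[OF params(1,2) face_facts(6)[OF assms]] hbar_mono[OF face_facts(7)[OF assms]] by auto

lemma face_bump_size:
  assumes "K \<in> T" "\<gamma> \<in> faces K"
  shows "0 < face_bump_width \<gamma>" "face_bump_width \<gamma> \<le> face_bump_radius \<gamma>" "0 < face_bump_radius \<gamma>"
    "face_bump_radius \<gamma> < patch_radius \<gamma>"
proof -
  show w: "0 < face_bump_width \<gamma>" "face_bump_width \<gamma> \<le> face_bump_radius \<gamma>"
    using hbar_face[OF assms] scale_ge params
    by (auto simp: face_bump_width_def face_bump_radius_def intro!: divide_right_mono)
  then show "0 < face_bump_radius \<gamma>" by simp
  show "face_bump_radius \<gamma> < patch_radius \<gamma>"
    using face_facts(6)[OF assms] \<sigma> dim
    by (simp add: face_bump_radius_def patch_radius_def face_scale_def) (simp add: field_simps)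
qed

lemma face_slab_patch:
  assumes K: "K \<in> T" and \<gamma>: "\<gamma> \<in> faces K \<inter> interior_faces T" and x: "x \<in> face_slab K \<gamma>"
  shows "outer_normal K \<gamma> \<bullet> (x - facet_center \<gamma>) \<le> 0 \<Longrightarrow> x \<in> K"
    "0 \<le> outer_normal K \<gamma> \<bullet> (x - facet_center \<gamma>) \<Longrightarrow> x \<in> neighbour T K \<gamma>"
proof -
  have "norm (x - facet_center \<gamma>) \<le> patch_radius \<gamma>"
    using x face_bump_size(4)[OF K, of \<gamma>] \<gamma> by (auto simp: face_slab_def slab_def)
  from face_patch[OF K \<gamma> this]
  show "outer_normal K \<gamma> \<bullet> (x - facet_center \<gamma>) \<le> 0 \<Longrightarrow> x \<in> K"
    "0 \<le> outer_normal K \<gamma> \<bullet> (x - facet_center \<gamma>) \<Longrightarrow> x \<in> neighbour T K \<gamma>" by auto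
qed

text \<open>The ball of radius \<open>patch_radius \<gamma>\<close> is covered by the two elements at the facet, so it lies in the interior of the
  closure of the domain.\<close>

lemma face_slab_domain:
  assumes K: "K \<in> T" and \<gamma>: "\<gamma> \<in> faces K \<inter> interior_faces T"
  shows "face_slab K \<gamma> \<subseteq> \<Omega>"
proof -
  have "ball (facet_center \<gamma>) (patch_radius \<gamma>) \<subseteq> K \<union> neighbour T K \<gamma>"
  proof
    fix x assume "x \<in> ball (facet_center \<gamma>) (patch_radius \<gamma>)"
    then have "norm (x - facet_center \<gamma>) \<le> patch_radius \<gamma>" by (simp add: dist_norm norm_minus_commute)
    from face_patch[OF K \<gamma> this] show "x \<in> K \<union> neighbour T K \<gamma>" by (metis UnI1 UnI2 linear)
  qed
  also have "\<dots> \<subseteq> closure \<Omega>" using K neighbour_facts(1)[OF K \<gamma>] Union_T by blast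
  finally have "ball (facet_center \<gamma>) (patch_radius \<gamma>) \<subseteq> \<Omega>"
    using regular_domain(3) interior_maximal open_ball by metis
  moreover have "face_slab K \<gamma> \<subseteq> ball (facet_center \<gamma>) (patch_radius \<gamma>)"
    using face_bump_size(4)[OF K, of \<gamma>] \<gamma> by (auto simp: face_slab_def slab_def dist_norm norm_minus_commute)
  ultimately show ?thesis by blast
qed

lemma face_bump_test:
  assumes K: "K \<in> T" and \<gamma>: "\<gamma> \<in> faces K \<inter> interior_faces T"
  shows "face_bump K \<gamma> \<in> test_functions \<Omega>"
  using face_bump_size[OF K, of \<gamma>] \<gamma> face_slab_domain[OF K \<gamma>]
  by (intro test_functionsI[of _ "face_slab K \<gamma>"])
     (auto simp: face_bump_def face_slab_def bump_smooth compact_slab intro!: bump_zero)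

lemma face_slab_measure:
  assumes K: "K \<in> T" and \<gamma>: "\<gamma> \<in> faces K"
  shows "measure lebesgue (face_slab K \<gamma>) \<le> \<hh> \<gamma> * sqrt \<nu> * diameter \<gamma> ^ (CARD('d) - 1)"
proof -
  note s = face_bump_size[OF K \<gamma>]
  have "measure lebesgue (face_slab K \<gamma>) \<le> 2 * face_bump_width \<gamma> * (2 * face_bump_radius \<gamma>) ^ (CARD('d) - 1)"
    unfolding face_slab_def using s face_facts(1)[OF K \<gamma>] by (intro measure_slab_le) auto
  also have "\<dots> \<le> \<hh> \<gamma> * sqrt \<nu> * diameter \<gamma> ^ (CARD('d) - 1)"
  proof (rule mult_mono[OF _ power_mono])
    have a: "2 * (y / face_scale CARD('d) \<sigma>) \<le> y" if "0 \<le> y" for y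
      using scale_ge that mult_left_mono[OF scale_ge(2) that] by (simp add: pos_divide_le_eq mult.commute)
    show "2 * face_bump_width \<gamma> \<le> \<hh> \<gamma> * sqrt \<nu>"
      using a[of "\<hh> \<gamma> * sqrt \<nu>"] hbar_face[OF K \<gamma>] params by (simp add: face_bump_width_def)
    show "2 * face_bump_radius \<gamma> \<le> diameter \<gamma>"
      using a[of "diameter \<gamma>"] face_facts(6)[OF K \<gamma>] by (simp add: face_bump_radius_def)
  qed (use s hbar_face[OF K \<gamma>] params in auto)
  finally show ?thesis .
qed

text \<open>Across the facet the discrete gradient jumps by a multiple of the normal, so testing with the bump
  yields the jump times the integral of the normal derivative of the bump over one side of the facet.\<close>

lemma face_bump_flux:
  assumes K: "K \<in> T" and \<gamma>: "\<gamma> \<in> faces K \<inter> interior_faces T"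
  shows "J K \<gamma> * (exp (- 4) / 8 * (face_bump_radius \<gamma> / real CARD('d)) ^ (CARD('d) - 1)) * (2 * J K \<gamma>)
    \<le> J K \<gamma> * (\<nu> * (\<integral>x. pw_grad v x \<bullet> grad (face_bump K \<gamma>) x \<partial>lebesgue_on \<Omega>))"
proof -
  have \<gamma>': "\<gamma> \<in> faces K" using \<gamma> by simp
  define n m t \<rho> \<phi> where "n = outer_normal K \<gamma>" and "m = facet_center \<gamma>" and "t = face_bump_width \<gamma>"
    and "\<rho> = face_bump_radius \<gamma>" and "\<phi> = face_bump K \<gamma>"
  define K' where "K' = neighbour T K \<gamma>"
  define j where "j = (elem_grad v K - elem_grad v K') \<bullet> n"
  note nb = neighbour_facts[OF K \<gamma>, folded K'_def]
  have n: "norm n = 1" using face_facts(1)[OF K \<gamma>'] by (simp add: n_def)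
  have t: "0 < t" "t \<le> \<rho>" "0 < \<rho>" using face_bump_size[OF K \<gamma>'] by (auto simp: t_def \<rho>_def)
  have \<phi>_eq: "\<phi> = bump m \<rho> t n" by (simp add: \<phi>_def face_bump_def m_def \<rho>_def t_def n_def)
  have S_eq: "face_slab K \<gamma> = slab m \<rho> t n" by (simp add: face_slab_def m_def \<rho>_def t_def n_def)
  have jump: "elem_grad v K' = elem_grad v K - j *\<^sub>R n" and \<nu>j: "\<nu> * j = 2 * J K \<gamma>"
    using gradient_jump[OF v K \<gamma>, folded K'_def n_def] by (simp_all add: j_def algebra_simps)
  have \<phi>t: "\<phi> \<in> test_functions \<Omega>" unfolding \<phi>_def by (rule face_bump_test[OF K \<gamma>])
  have gL: "grad \<phi> \<in> L2 (lebesgue_on \<Omega>)" by (rule test_function_H10(4)[OF regular_domain(1) \<phi>t])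
  \<comment> \<open>The discrete gradient is \<open>elem_grad v K\<close> minus \<open>j *\<^sub>R n\<close> on the outer side. The constant part integrates to zero
    against the gradient of \<open>\<phi>\<close>, and \<open>- P\<close> is nonnegative.\<close>
  define P where "P x = (if 0 < (x - m) \<bullet> n then grad \<phi> x \<bullet> n else 0)" for x
  have Pi: "integrable (lebesgue_on \<Omega>) P"
  proof -
    have "P \<in> L2 (lebesgue_on \<Omega>)"
    proof (rule L2_dominated[OF gL, where c = 1])
      have "open {x. 0 < (x - m) \<bullet> n}" by (intro open_Collect_less continuous_intros)
      then have "{x. 0 < (x - m) \<bullet> n} \<in> sets lebesgue" by auto
      then have "(\<lambda>x. indicator {x. 0 < (x - m) \<bullet> n} x * (grad \<phi> x \<bullet> n)) \<in> borel_measurable lebesgue"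
        by (intro borel_measurable_times borel_measurable_indicator continuous_lebesgue_measurable
            continuous_intros test_functions_grad(2)[OF \<phi>t])
      moreover have "(\<lambda>x. indicator {x. 0 < (x - m) \<bullet> n} x * (grad \<phi> x \<bullet> n)) = P"
        by (auto simp: P_def indicator_def)
      ultimately show "P \<in> borel_measurable (lebesgue_on \<Omega>)" by (simp add: measurable_restrict_space1)
      show "AE x in lebesgue_on \<Omega>. norm (P x) \<le> 1 * norm (grad \<phi> x)"
        using Cauchy_Schwarz_ineq2[of "grad \<phi> _" n] n by (intro AE_I2) (auto simp: P_def)
    qed
    moreover have "(\<lambda>x. 1::real) \<in> L2 (lebesgue_on \<Omega>)"
      by (rule L2_bounded[OF domain_lmeasurable, of _ 1]) auto
    ultimately show ?thesis using L2_mult_integrable[of P _ "\<lambda>x. 1"] by simp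
  qed
  have ci: "integrable (lebesgue_on \<Omega>) (\<lambda>x. elem_grad v K \<bullet> grad \<phi> x)"
    by (rule L2_inner_integrable[OF _ gL]) (rule L2_bounded[OF domain_lmeasurable, of _ "norm (elem_grad v K)"], auto)
  have ae: "AE x in lebesgue_on \<Omega>. elem_grad v K \<bullet> grad \<phi> x - j * P x = pw_grad v x \<bullet> grad \<phi> x"
    using AE_interior_element unfolding AE_lebesgue_on_iff[OF element_sets(3)]
  proof eventually_elim
    case (elim x)
    show ?case
    proof
      assume "x \<in> \<Omega>"
      then obtain K0 where K0: "K0 \<in> T" "x \<in> interior K0" using elim by auto
      show "elem_grad v K \<bullet> grad \<phi> x - j * P x = pw_grad v x \<bullet> grad \<phi> x"
      proof (cases "x \<in> slab m \<rho> t n")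
        case False
        then have "grad \<phi> x = 0" unfolding \<phi>_eq using t by (intro bump_grad_zero)
        then show ?thesis by (simp add: P_def)
      next
        case True
        note side = face_slab_patch[OF K \<gamma>, unfolded S_eq, OF True, folded K'_def n_def m_def]
        show ?thesis
        proof (cases "0 < (x - m) \<bullet> n")
          case True
          then have "x \<in> K'" using side(2) by (simp add: inner_commute)
          then have "K0 = K'" using interior_elements_disjoint[OF K0(1) nb(1) K0(2)] by blast
          then have "pw_grad v x = elem_grad v K - j *\<^sub>R n" using pw_grad_eq[OF K0] jump by simp
          then have "pw_grad v x \<bullet> grad \<phi> x = elem_grad v K \<bullet> grad \<phi> x - j * (grad \<phi> x \<bullet> n)"
            by (simp add: inner_diff_left inner_commute[of n "grad \<phi> x"])
          then show ?thesis using True by (simp add: P_def)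
        next
          case False
          then have "x \<in> K" using side(1) by (simp add: inner_commute)
          then have "K0 = K" using interior_elements_disjoint[OF K0(1) K K0(2)] by blast
          then have "pw_grad v x = elem_grad v K" using pw_grad_eq[OF K0] by simp
          then show ?thesis using False by (simp add: P_def)
        qed
      qed
    qed
  qed
  have "(\<integral>x. pw_grad v x \<bullet> grad \<phi> x \<partial>lebesgue_on \<Omega>) = (\<integral>x. elem_grad v K \<bullet> grad \<phi> x - j * P x \<partial>lebesgue_on \<Omega>)"
    by (rule integral_lebesgue_on_cong_AE(1)[OF element_sets(3) _ ae])
       (use ci Pi in \<open>intro borel_measurable_integrable Bochner_Integration.integrable_diff integrable_mult_right\<close>)
  also have "\<dots> = (\<integral>x. elem_grad v K \<bullet> grad \<phi> x \<partial>lebesgue_on \<Omega>) - j * (\<integral>x. P x \<partial>lebesgue_on \<Omega>)"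
    using ci Pi by simp
  also have "(\<integral>x. elem_grad v K \<bullet> grad \<phi> x \<partial>lebesgue_on \<Omega>) = 0"
    by (rule integral_const_grad[OF regular_domain(1) \<phi>t])
  finally have eq: "J K \<gamma> * (\<nu> * (\<integral>x. pw_grad v x \<bullet> grad \<phi> x \<partial>lebesgue_on \<Omega>))
      = 2 * (J K \<gamma>)\<^sup>2 * (\<integral>x. - P x \<partial>lebesgue_on \<Omega>)"
    using \<nu>j by (simp add: power2_eq_square mult.assoc[symmetric])
  \<comment> \<open>A part of the outer half of the bump on which it falls at a rate of order \<open>1 / t\<close>.\<close>
  define L where "L = {x. t / 4 \<le> (x - m) \<bullet> n \<and> (norm (x - m))\<^sup>2 / \<rho>\<^sup>2 + ((x - m) \<bullet> n)\<^sup>2 / t\<^sup>2 \<le> 3/4}"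
  have Lm: "t / 4 * (\<rho> / real CARD('d)) ^ (CARD('d) - 1) \<le> measure lebesgue L" "compact L"
    unfolding L_def using measure_half_slab_ge[OF n t(1,2), of m] by auto
  have "exp (- 4) / 8 * (\<rho> / real CARD('d)) ^ (CARD('d) - 1) = exp (- 4) / (2 * t) * (t / 4 * (\<rho> / real CARD('d)) ^ (CARD('d) - 1))"
    using t by simp
  also have "\<dots> \<le> exp (- 4) / (2 * t) * measure lebesgue L"
    using Lm(1) t by (intro mult_left_mono) auto
  also have "\<dots> \<le> (\<integral>x. - P x \<partial>lebesgue_on \<Omega>)"
  proof (rule integral_ge_on[OF element_sets(3) lmeasurable_compact[OF Lm(2)]])
    show "integrable (lebesgue_on \<Omega>) (\<lambda>x. - P x)" using Pi by simp
    show "0 \<le> - P x" for x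
      using bump_normal_derivative(1)[OF t(1,3) n, of x m] by (auto simp: P_def \<phi>_eq)
    show "exp (- 4) / (2 * t) \<le> - P x" if "x \<in> L" for x
    proof -
      have x: "t / 4 \<le> (x - m) \<bullet> n" "(norm (x - m))\<^sup>2 / \<rho>\<^sup>2 + ((x - m) \<bullet> n)\<^sup>2 / t\<^sup>2 \<le> 3/4"
        using that unfolding L_def by blast+
      then have "exp (- 4) / (2 * t) \<le> - (grad \<phi> x \<bullet> n)"
        unfolding \<phi>_eq by (rule bump_normal_derivative(2)[OF t(1,3) n])
      moreover have "0 < (x - m) \<bullet> n" using x(1) t by linarith
      ultimately show ?thesis by (simp add: P_def)
    qed
    show "L \<subseteq> \<Omega>"
    proof
      fix x assume "x \<in> L"
      then have "(norm (x - m))\<^sup>2 / \<rho>\<^sup>2 + ((x - m) \<bullet> n)\<^sup>2 / t\<^sup>2 \<le> 3/4" unfolding L_def by blast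
      then have "\<not> 1 - ((norm (x - m))\<^sup>2 / \<rho>\<^sup>2 + ((x - m) \<bullet> n)\<^sup>2 / t\<^sup>2) \<le> 0" by linarith
      then have "x \<in> slab m \<rho> t n" using bump_outside[OF t(3,1)] by blast
      then show "x \<in> \<Omega>" using face_slab_domain[OF K \<gamma>] S_eq by blast
    qed
  qed
  finally have "2 * (J K \<gamma>)\<^sup>2 * (exp (- 4) / 8 * (\<rho> / real CARD('d)) ^ (CARD('d) - 1)) \<le> 2 * (J K \<gamma>)\<^sup>2 * (\<integral>x. - P x \<partial>lebesgue_on \<Omega>)"
    by (rule mult_left_mono) simp
  then show ?thesis
    unfolding \<phi>_def[symmetric] eq \<rho>_def[symmetric] by (simp add: power2_eq_square mult_ac)
qed

text \<open>The jump part of the estimator, with the surface measure of each facet replaced by a power of its diameter.\<close>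

definition "jump_sum = (\<Sum>K\<in>T. \<Sum>\<gamma>\<in>faces K \<inter> interior_faces T.
    \<hh> \<gamma> * (J K \<gamma>)\<^sup>2 * diameter \<gamma> ^ (CARD('d) - 1) / sqrt \<nu>)"

text \<open>The jumps are tested with the sum of the facet bumps, scaled by \<open>\<hh> / sqrt \<nu>\<close> times the jump. With the width
  \<open>\<hh> * sqrt \<nu>\<close> of the bumps the energy of each is of the order of its contribution to the estimator. The element
  residuals, which the bumps also see, are bounded already.\<close>

lemma jump_bound: "jump_sum \<le> jump_const CARD('d) \<sigma> * (E\<^sup>2 + residual_sum + oscillation_sum)"
proof -
  define d where "d = CARD('d)"
  define sc where "sc = face_scale d \<sigma>"
  define c2 where "c2 = jump_upper d \<sigma>"
  define c3 where "c3 = jump_lower d \<sigma>"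
  define N where "N = 2 * (d + 1)"
  have d2: "2 \<le> d" using dim by (simp add: d_def)
  have cpos: "0 < c2" "0 < c3" "1 \<le> sc" using jump_constants_pos[OF \<sigma> d2] by (auto simp: c2_def c3_def sc_def)
  have s\<nu>: "0 < sqrt \<nu>" "sqrt \<nu> * sqrt \<nu> = \<nu>" using params by auto
  \<comment> \<open>The estimator counts every interior facet once from each side, and so does the family.\<close>
  define Q where "Q = Sigma T (\<lambda>K. faces K \<inter> interior_faces T)"
  have QD: "fst q \<in> T" "snd q \<in> faces (fst q) \<inter> interior_faces T" "snd q \<in> faces (fst q)" if "q \<in> Q" for q
    using that by (auto simp: Q_def)
  have finF: "finite (faces K \<inter> interior_faces T)" if "K \<in> T" for K
    using faces_finite(1)[OF simplex_T[OF that]] by simp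
  have Qfin: "finite Q" unfolding Q_def using finite_T finF by (intro finite_SigmaI) auto
  define jq hq Hq where "jq q = J (fst q) (snd q)" and "hq q = \<hh> (snd q)" and "Hq q = diameter (snd q) ^ (d - 1)" for q
  define F where "F q x = (hq q / sqrt \<nu> * jq q) * face_bump (fst q) (snd q) x" for q x
  define S where "S q = face_slab (fst q) (snd q)" for q
  define B where "B q = hq q / sqrt \<nu> * \<bar>jq q\<bar>" for q
  define D where "D q = 8 * sc * \<bar>jq q\<bar> / \<nu>" for q
  define Z where "Z q = hq q * (jq q)\<^sup>2 * Hq q / sqrt \<nu>" for q
  have hq: "0 < hq q" "\<kappa> * (hq q)\<^sup>2 \<le> 1" if "q \<in> Q" for q
    using hbar_face[OF QD(1,3)[OF that]] by (auto simp: hq_def)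
  have Hq: "0 \<le> Hq q" if "q \<in> Q" for q
    using face_facts(6)[OF QD(1,3)[OF that]] by (simp add: Hq_def)
  have Z0: "0 \<le> Z q" if "q \<in> Q" for q using hq[OF that] Hq[OF that] s\<nu> by (simp add: Z_def)
  have mS: "measure lebesgue (S q) \<le> hq q * sqrt \<nu> * Hq q" if "q \<in> Q" for q
    using face_slab_measure[OF QD(1,3)[OF that]] by (simp add: S_def hq_def Hq_def d_def)
  have bump0: "face_bump (fst q) (snd q) x = 0" if "q \<in> Q" "x \<notin> S q" for q x
    unfolding face_bump_def using face_bump_size[OF QD(1,3)[OF that(1)]] that(2)
    by (intro bump_zero) (auto simp: S_def face_slab_def)
  have F_grad: "grad (F q) x = (hq q / sqrt \<nu> * jq q) *\<^sub>R grad (face_bump (fst q) (snd q)) x" for q x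
  proof (rule GDERIV_grad)
    have "GDERIV (face_bump (fst q) (snd q)) x :> grad (face_bump (fst q) (snd q)) x"
      unfolding face_bump_def by (rule smooth_alg_grad(1)[OF bump_smooth])
    then show "GDERIV (F q) x :> (hq q / sqrt \<nu> * jq q) *\<^sub>R grad (face_bump (fst q) (snd q)) x"
      unfolding gderiv_def F_def[abs_def] inner_scaleR_right by (rule has_derivative_mult_right)
  qed
  interpret fam: localized_family \<Omega> T Q F S B D hq Z \<hh> N c2 \<nu> \<kappa>
  proof unfold_locales
    show "finite Q" by (rule Qfin)
    show "F q \<in> smooth_alg" for q
      unfolding F_def face_bump_def by (intro smooth_cmult bump_smooth)
    show "compact (S q)" for q by (simp add: S_def face_slab_def compact_slab)
    show "S q \<subseteq> \<Omega>" if "q \<in> Q" for q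
      unfolding S_def by (rule face_slab_domain[OF QD(1,2)[OF that]])
    show "F q x = 0" if "q \<in> Q" "x \<notin> S q" for q x using bump0[OF that] by (simp add: F_def)
    show "\<bar>F q x\<bar> \<le> B q" if "q \<in> Q" for q x
    proof -
      have "0 \<le> face_bump (fst q) (snd q) x" by (simp add: face_bump_def bump_nonneg)
      then have "\<bar>F q x\<bar> = B q * face_bump (fst q) (snd q) x"
        using hq[OF that] s\<nu> by (simp add: F_def B_def abs_mult)
      also have "\<dots> \<le> B q * 1"
        using hq[OF that] s\<nu> bump_le_1 by (intro mult_left_mono) (auto simp: B_def face_bump_def)
      finally show ?thesis by simp
    qed
    show "norm (grad (F q) x) \<le> D q" if q: "q \<in> Q" for q x
    proof -
      note sz = face_bump_size[OF QD(1,3)[OF q]]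
      have "norm (grad (face_bump (fst q) (snd q)) x) \<le> 8 / face_bump_width (snd q)"
        unfolding face_bump_def using sz face_facts(1)[OF QD(1,3)[OF q]] by (intro bump_grad_bound) auto
      then have "norm (grad (F q) x) \<le> B q * (8 / face_bump_width (snd q))"
        unfolding F_grad norm_scaleR using hq[OF q] s\<nu>
        by (intro mult_mono) (auto simp: B_def abs_mult)
      also have "\<dots> = D q"
        using hq[OF q] s\<nu> cpos by (simp add: B_def D_def face_bump_width_def hq_def[symmetric] d_def[symmetric] sc_def[symmetric])
      finally show ?thesis .
    qed
    show "card {q \<in> Q. x \<in> S q} \<le> N" if K: "K \<in> T" and x: "x \<in> interior K" for K x
    proof -
      \<comment> \<open>A slab that contains an interior point of \<open>K\<close> belongs to a facet of \<open>K\<close>, seen from \<open>K\<close> or from its neighbour.\<close>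
      have sub: "{q \<in> Q. x \<in> S q} \<subseteq> Pair K ` faces K \<union> (\<lambda>\<gamma>. (neighbour T K \<gamma>, \<gamma>)) ` faces K"
      proof
        fix q assume "q \<in> {q \<in> Q. x \<in> S q}"
        then obtain K' \<gamma> where q: "q = (K', \<gamma>)" "K' \<in> T" "\<gamma> \<in> faces K' \<inter> interior_faces T" "x \<in> face_slab K' \<gamma>"
          by (auto simp: Q_def S_def)
        note nb = neighbour_facts[OF q(2,3)]
        have "x \<in> K' \<or> x \<in> neighbour T K' \<gamma>"
          using face_slab_patch[OF q(2,3,4)] by (meson linear)
        then show "q \<in> Pair K ` faces K \<union> (\<lambda>\<gamma>. (neighbour T K \<gamma>, \<gamma>)) ` faces K"
        proof
          assume "x \<in> K'"
          then have "K = K'" using interior_elements_disjoint[OF K q(2) x] by blast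
          then show ?thesis using q by blast
        next
          assume "x \<in> neighbour T K' \<gamma>"
          then have KK: "K = neighbour T K' \<gamma>" using interior_elements_disjoint[OF K nb(1) x] by blast
          then have g: "\<gamma> \<in> faces K \<inter> interior_faces T" using nb(3) q(3) by blast
          have "neighbour T K \<gamma> = K'"
            using neighbour_facts(5)[OF K g q(2)] nb(2) q(3) KK by blast
          then show ?thesis using q(1) g by blast
        qed
      qed
      have fF: "finite (faces K)" and cF: "card (faces K) \<le> d + 1"
        using faces_finite[OF simplex_T[OF K]] by (auto simp: d_def)
      have "card {q \<in> Q. x \<in> S q} \<le> card (Pair K ` faces K \<union> (\<lambda>\<gamma>. (neighbour T K \<gamma>, \<gamma>)) ` faces K)"
        using fF by (intro card_mono[OF _ sub]) auto
      also have "\<dots> \<le> card (Pair K ` faces K) + card ((\<lambda>\<gamma>. (neighbour T K \<gamma>, \<gamma>)) ` faces K)"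
        by (rule card_Un_le)
      also have "\<dots> \<le> card (faces K) + card (faces K)"
        using fF by (intro add_mono card_image_le)
      finally show ?thesis using cF by (simp add: N_def)
    qed
    show "hq q \<le> \<hh> K" if q: "q \<in> Q" and K: "K \<in> T" and x: "x \<in> interior K" "x \<in> S q" for q K x
    proof -
      note nb = neighbour_facts[OF QD(1,2)[OF q]]
      have "x \<in> fst q \<or> x \<in> neighbour T (fst q) (snd q)"
        using face_slab_patch[OF QD(1,2)[OF q]] x(2) unfolding S_def by (meson linear)
      then have "K = fst q \<or> K = neighbour T (fst q) (snd q)"
        using interior_elements_disjoint[OF K _ x(1)] QD(1)[OF q] nb(1) by blast
      then have "snd q \<in> faces K" using QD(3)[OF q] nb(3) by blast
      then show ?thesis using hbar_face(4)[OF K] by (simp add: hq_def)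
    qed
    show "(B q)\<^sup>2 * measure lebesgue (S q) \<le> c2 * ((hq q)\<^sup>2 * Z q)" if q: "q \<in> Q" for q
    proof -
      have "(B q)\<^sup>2 * measure lebesgue (S q) \<le> (B q)\<^sup>2 * (hq q * sqrt \<nu> * Hq q)"
        using mS[OF q] by (intro mult_left_mono) auto
      also have "\<dots> = (hq q)\<^sup>2 * (hq q * (jq q)\<^sup>2 * Hq q) * (sqrt \<nu> / \<nu>)"
        using params by (simp add: B_def power_mult_distrib power_divide)
      also have "sqrt \<nu> / \<nu> = 1 / sqrt \<nu>" using s\<nu> params by (simp add: field_simps)
      also have "(hq q)\<^sup>2 * (hq q * (jq q)\<^sup>2 * Hq q) * (1 / sqrt \<nu>) = (hq q)\<^sup>2 * Z q"
        by (simp add: Z_def)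
      also have "\<dots> \<le> c2 * ((hq q)\<^sup>2 * Z q)"
      proof -
        have "1 \<le> c2" using one_le_power[OF cpos(3), of 2] unfolding c2_def jump_upper_def sc_def by linarith
        then show ?thesis using mult_right_mono[of 1 c2 "(hq q)\<^sup>2 * Z q"] Z0[OF q] by simp
      qed
      finally show ?thesis .
    qed
    show "\<nu> * ((D q)\<^sup>2 * measure lebesgue (S q)) \<le> c2 * Z q" if q: "q \<in> Q" for q
    proof -
      have "\<nu> * ((D q)\<^sup>2 * measure lebesgue (S q)) \<le> \<nu> * ((D q)\<^sup>2 * (hq q * sqrt \<nu> * Hq q))"
        using mS[OF q] params by (intro mult_left_mono) auto
      also have "\<dots> = 64 * sc\<^sup>2 * (hq q * (jq q)\<^sup>2 * Hq q) * (sqrt \<nu> / \<nu>)"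
        using params by (simp add: D_def power_mult_distrib power_divide power2_eq_square)
      also have "sqrt \<nu> / \<nu> = 1 / sqrt \<nu>" using s\<nu> params by (simp add: field_simps)
      finally show ?thesis by (simp add: Z_def c2_def jump_upper_def sc_def)
    qed
    show "0 < \<hh> K" if "K \<in> T" for K by (rule hbar_element(1)[OF that])
  qed (use hq Z0 params cpos in auto)
  define X where "X = (\<Sum>q\<in>Q. Z q)"
  have jump_sum: "jump_sum = X"
    unfolding jump_sum_def X_def Q_def using finite_T finF
    by (subst sum.Sigma) (auto simp: Z_def hq_def jq_def Hq_def d_def intro!: sum.cong)
  have X0: "0 \<le> X" unfolding X_def by (rule sum_nonneg[OF Z0])
  have low: "c3 * X \<le> \<nu> * (\<integral>x. pw_grad v x \<bullet> grad fam.w x \<partial>lebesgue_on \<Omega>)"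
  proof -
    have "(\<integral>x. pw_grad v x \<bullet> grad fam.w x \<partial>lebesgue_on \<Omega>) = (\<integral>x. (\<Sum>q\<in>Q. pw_grad v x \<bullet> grad (F q) x) \<partial>lebesgue_on \<Omega>)"
      by (simp add: fam.w_grad inner_sum_right)
    also have "\<dots> = (\<Sum>q\<in>Q. \<integral>x. pw_grad v x \<bullet> grad (F q) x \<partial>lebesgue_on \<Omega>)"
      by (intro Bochner_Integration.integral_sum L2_inner_integrable[OF pw_grad_L2] fam.F_L2(2))
    finally have eq: "\<nu> * (\<integral>x. pw_grad v x \<bullet> grad fam.w x \<partial>lebesgue_on \<Omega>)
        = (\<Sum>q\<in>Q. \<nu> * (\<integral>x. pw_grad v x \<bullet> grad (F q) x \<partial>lebesgue_on \<Omega>))"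
      by (simp add: sum_distrib_left)
    have "c3 * Z q \<le> \<nu> * (\<integral>x. pw_grad v x \<bullet> grad (F q) x \<partial>lebesgue_on \<Omega>)" if q: "q \<in> Q" for q
    proof -
      let ?I = "\<nu> * (\<integral>x. pw_grad v x \<bullet> grad (face_bump (fst q) (snd q)) x \<partial>lebesgue_on \<Omega>)"
      have r: "face_bump_radius (snd q) / real d = diameter (snd q) / (sc * real d)"
        by (simp add: face_bump_radius_def sc_def d_def)
      have "c3 * Z q = hq q / sqrt \<nu> * (jq q * (exp (- 4) / 8 * (face_bump_radius (snd q) / real d) ^ (d - 1)) * (2 * jq q))"
        unfolding r by (simp add: c3_def jump_lower_def Z_def Hq_def sc_def[symmetric] power_divide power2_eq_square)
        (simp add: mult_ac)
      also have "\<dots> \<le> hq q / sqrt \<nu> * (jq q * ?I)"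
        using face_bump_flux[OF QD(1,2)[OF q]] hq[OF q] s\<nu>
        by (intro mult_left_mono) (auto simp: jq_def d_def)
      also have "\<dots> = \<nu> * (\<integral>x. pw_grad v x \<bullet> grad (F q) x \<partial>lebesgue_on \<Omega>)"
        by (simp add: F_grad)
      finally show ?thesis .
    qed
    then show ?thesis unfolding eq X_def sum_distrib_left by (intro sum_mono)
  qed
  define W where "W = (\<Sum>K\<in>T. (\<hh> K)\<^sup>2 * (l2_norm (lebesgue_on K) (\<lambda>x. res K x + osc K x))\<^sup>2)"
  have ro: "(\<lambda>x. res K x + osc K x) \<in> L2 (lebesgue_on K)" if "K \<in> T" for K
    by (rule L2_add[OF res_L2[OF that] osc[OF that]])
  have W0: "0 \<le> W" unfolding W_def by (intro sum_nonneg) simp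
  have Wb: "W \<le> 2 * (residual_sum + oscillation_sum)"
  proof -
    have "(\<hh> K)\<^sup>2 * (l2_norm (lebesgue_on K) (\<lambda>x. res K x + osc K x))\<^sup>2
        \<le> 2 * ((\<hh> K)\<^sup>2 * (l2_norm (lebesgue_on K) (res K))\<^sup>2 + (\<hh> K)\<^sup>2 * (l2_norm (lebesgue_on K) (osc K))\<^sup>2)"
      if K: "K \<in> T" for K
    proof -
      have i: "integrable (lebesgue_on K) (\<lambda>x. (norm (res K x))\<^sup>2)" "integrable (lebesgue_on K) (\<lambda>x. (norm (osc K x))\<^sup>2)"
        "integrable (lebesgue_on K) (\<lambda>x. (norm (res K x + osc K x))\<^sup>2)"
        using res_L2[OF K] osc[OF K] ro[OF K] by (auto simp: L2_def)
      have "(l2_norm (lebesgue_on K) (\<lambda>x. res K x + osc K x))\<^sup>2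
          \<le> (\<integral>x. 2 * (norm (res K x))\<^sup>2 + 2 * (norm (osc K x))\<^sup>2 \<partial>lebesgue_on K)"
        unfolding l2_norm_sq
      proof (rule integral_mono[OF i(3)])
        show "integrable (lebesgue_on K) (\<lambda>x. 2 * (norm (res K x))\<^sup>2 + 2 * (norm (osc K x))\<^sup>2)"
          using i by (intro Bochner_Integration.integrable_add integrable_mult_right)
        show "(norm (res K x + osc K x))\<^sup>2 \<le> 2 * (norm (res K x))\<^sup>2 + 2 * (norm (osc K x))\<^sup>2" for x
          using sum_squares_bound[of "res K x" "osc K x"] by (simp add: power2_sum)
      qed
      also have "\<dots> = 2 * ((l2_norm (lebesgue_on K) (res K))\<^sup>2 + (l2_norm (lebesgue_on K) (osc K))\<^sup>2)"
        using i by (simp add: l2_norm_sq)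
      finally have "(\<hh> K)\<^sup>2 * (l2_norm (lebesgue_on K) (\<lambda>x. res K x + osc K x))\<^sup>2
          \<le> (\<hh> K)\<^sup>2 * (2 * ((l2_norm (lebesgue_on K) (res K))\<^sup>2 + (l2_norm (lebesgue_on K) (osc K))\<^sup>2))"
        by (rule mult_left_mono) simp
      then show ?thesis by (simp add: algebra_simps)
    qed
    then have "W \<le> (\<Sum>K\<in>T. 2 * ((\<hh> K)\<^sup>2 * (l2_norm (lebesgue_on K) (res K))\<^sup>2 + (\<hh> K)\<^sup>2 * (l2_norm (lebesgue_on K) (osc K))\<^sup>2))"
      unfolding W_def by (rule sum_mono)
    then show ?thesis by (simp add: residual_sum_def oscillation_sum_def sum_distrib_left sum.distrib)
  qed
  define cN where "cN = c2 * real N"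
  have cN: "0 < cN" using cpos by (simp add: cN_def N_def)
  have "E * sqrt (\<nu> * (\<integral>x. (norm (grad fam.w x))\<^sup>2 \<partial>lebesgue_on \<Omega>) + \<kappa> * (\<integral>x. (fam.w x)\<^sup>2 \<partial>lebesgue_on \<Omega>))
      \<le> E * (sqrt 2 * (sqrt cN * sqrt X))"
    using fam.w_energy params(3) by (intro mult_left_mono) (simp_all add: X_def cN_def real_sqrt_mult[symmetric] mult.assoc)
  moreover have "\<bar>\<Sum>K\<in>T. \<integral>x. (res K x + osc K x) * fam.w x \<partial>lebesgue_on K\<bar> \<le> sqrt W * (sqrt cN * sqrt X)"
    using fam.w_pairing[of "\<lambda>K x. res K x + osc K x", OF ro] unfolding W_def X_def cN_def real_sqrt_mult .
  moreover note residual[OF fam.w_test] low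
  ultimately have "c3 * X \<le> E * (sqrt 2 * (sqrt cN * sqrt X)) + sqrt W * (sqrt cN * sqrt X)"
    by linarith
  then have "c3 * X \<le> (sqrt cN * (sqrt 2 * E + sqrt W)) * sqrt X" by (simp add: algebra_simps)
  then have "X \<le> (sqrt cN * (sqrt 2 * E + sqrt W))\<^sup>2 / c3\<^sup>2"
    using cpos X0 params W0 cN by (intro quadratic_absorb) auto
  also have "(sqrt cN * (sqrt 2 * E + sqrt W))\<^sup>2 = cN * (sqrt 2 * E + sqrt W)\<^sup>2"
    using cN by (simp add: power_mult_distrib)
  also have "\<dots> / c3\<^sup>2 \<le> cN * (4 * (E\<^sup>2 + residual_sum + oscillation_sum)) / c3\<^sup>2"
  proof -
    have "(sqrt 2 * E + sqrt W)\<^sup>2 \<le> 2 * ((sqrt 2 * E)\<^sup>2 + (sqrt W)\<^sup>2)"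
      using sum_squares_bound[of "sqrt 2 * E" "sqrt W"] by (simp add: power2_sum)
    also have "\<dots> \<le> 4 * (E\<^sup>2 + residual_sum + oscillation_sum)" using Wb W0 by (simp add: power_mult_distrib)
    finally show ?thesis using cN by (intro divide_right_mono mult_left_mono) auto
  qed
  also have "\<dots> = jump_const d \<sigma> * (E\<^sup>2 + residual_sum + oscillation_sum)"
    by (simp add: jump_const_def cN_def c2_def c3_def N_def)
  finally show ?thesis unfolding jump_sum d_def .
qed

lemma face_measure_bound:
  assumes K: "K \<in> T" and \<gamma>: "\<gamma> \<in> faces K"
  shows "measure (face_measure \<gamma>) (space (face_measure \<gamma>)) \<le> (2 * diameter \<gamma>) ^ (CARD('d) - 1)"
proof (rule face_measure_le)
  note f = face_facts[OF K \<gamma>]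
  show "compact \<gamma>"
    using \<gamma> full_simplex(1,2)[OF simplex_T[OF K]] by (auto simp: faces_def facet_of_def intro: face_of_imp_compact)
  show "facet_center \<gamma> \<in> \<gamma>" "norm (outer_normal K \<gamma>) = 1" by (rule f(2), rule f(1))
  show "outer_normal K \<gamma> \<bullet> (x - facet_center \<gamma>) = 0" if "x \<in> \<gamma>" for x by (rule f(3)[OF that])
qed

lemma estimator_bound: "(estimator T \<nu> \<kappa> res v)\<^sup>2 \<le> estimator_const CARD('d) \<sigma> * (E\<^sup>2 + (osc_norm T \<nu> \<kappa> osc)\<^sup>2)"
proof -
  define d where "d = CARD('d)"
  let ?j = "\<lambda>K \<gamma>. \<nu> powr (-1/2) * \<hh> \<gamma> * (l2_norm (face_measure \<gamma>) (\<lambda>_. J K \<gamma>))\<^sup>2"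
  have hn: "0 \<le> \<hh> \<gamma>" if "K \<in> T" "\<gamma> \<in> faces K" for K \<gamma> using hbar_face(1)[OF that] by simp
  have j0: "0 \<le> ?j K \<gamma>" if "K \<in> T" "\<gamma> \<in> faces K" for K \<gamma> using hn[OF that] by simp
  have osc_eq: "(osc_norm T \<nu> \<kappa> osc)\<^sup>2 = oscillation_sum"
    using oscillation_sum_nonneg by (simp add: osc_norm_def oscillation_sum_def[symmetric])
  have "(estimator T \<nu> \<kappa> res v)\<^sup>2 = (\<Sum>K\<in>T. (\<hh> K)\<^sup>2 * (l2_norm (lebesgue_on K) (res K))\<^sup>2
      + (\<Sum>\<gamma>\<in>faces K \<inter> interior_faces T. ?j K \<gamma>))"
    unfolding estimator_def using j0 by (intro real_sqrt_pow2 sum_nonneg add_nonneg_nonneg) auto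
  also have "\<dots> = residual_sum + (\<Sum>K\<in>T. \<Sum>\<gamma>\<in>faces K \<inter> interior_faces T. ?j K \<gamma>)"
    by (simp add: sum.distrib residual_sum_def)
  also have "(\<Sum>K\<in>T. \<Sum>\<gamma>\<in>faces K \<inter> interior_faces T. ?j K \<gamma>)
      \<le> (\<Sum>K\<in>T. \<Sum>\<gamma>\<in>faces K \<inter> interior_faces T. 2 ^ (d - 1) * (\<hh> \<gamma> * (J K \<gamma>)\<^sup>2 * diameter \<gamma> ^ (d - 1) / sqrt \<nu>))"
  proof (intro sum_mono)
    fix K \<gamma> assume K: "K \<in> T" and \<gamma>: "\<gamma> \<in> faces K \<inter> interior_faces T"
    have "?j K \<gamma> = (1 / sqrt \<nu>) * \<hh> \<gamma> * ((J K \<gamma>)\<^sup>2 * measure (face_measure \<gamma>) (space (face_measure \<gamma>)))"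
      unfolding l2_norm_const_sq powr_minus_half[OF params(1)] ..
    also have "\<dots> \<le> (1 / sqrt \<nu>) * \<hh> \<gamma> * ((J K \<gamma>)\<^sup>2 * (2 * diameter \<gamma>) ^ (d - 1))"
      using face_measure_bound[OF K, of \<gamma>] \<gamma> hn[OF K, of \<gamma>] params by (intro mult_left_mono) (auto simp: d_def)
    finally show "?j K \<gamma> \<le> 2 ^ (d - 1) * (\<hh> \<gamma> * (J K \<gamma>)\<^sup>2 * diameter \<gamma> ^ (d - 1) / sqrt \<nu>)"
      by (simp add: power_mult_distrib mult_ac)
  qed
  also have "\<dots> = 2 ^ (d - 1) * jump_sum" by (simp add: jump_sum_def d_def sum_distrib_left)
  also have "\<dots> \<le> 2 ^ (d - 1) * (jump_const d \<sigma> * (E\<^sup>2 + residual_sum + oscillation_sum))"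
    using jump_bound by (simp add: d_def)
  also have "residual_sum + 2 ^ (d - 1) * (jump_const d \<sigma> * (E\<^sup>2 + residual_sum + oscillation_sum))
      \<le> element_const d \<sigma> * (E\<^sup>2 + oscillation_sum) + 2 ^ (d - 1) * (jump_const d \<sigma> * ((1 + element_const d \<sigma>) * (E\<^sup>2 + oscillation_sum)))"
    using element_residual_bound jump_constants_pos(5)[OF \<sigma>, of d] dim
    by (intro add_mono mult_left_mono) (auto simp: d_def algebra_simps)
  also have "\<dots> = estimator_const d \<sigma> * (E\<^sup>2 + oscillation_sum)"
    by (simp add: estimator_const_def algebra_simps)
  finally show ?thesis by (simp add: osc_eq d_def)
qed

end

section \<open>Projection onto affine functions\<close>

lemma L2_compact_integrable:
  fixes f :: "'a::euclidean_space \<Rightarrow> real"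
  assumes K: "compact K" and f: "f \<in> L2 (lebesgue_on K)"
  shows "integrable (lebesgue_on K) f" "integrable (lebesgue_on K) (\<lambda>x. f x *\<^sub>R x)"
proof -
  show i: "integrable (lebesgue_on K) f"
    using L2_mult_integrable[OF f continuous_compact_L2[OF K, of "\<lambda>_. 1"]] by simp
  obtain M where M: "\<And>x. x \<in> K \<Longrightarrow> norm x \<le> M"
    using compact_imp_bounded[OF K] unfolding bounded_iff by blast
  have K': "K \<in> sets lebesgue" using lmeasurable_compact[OF K] by (rule fmeasurableD)
  have i': "integrable (lebesgue_on K) (\<lambda>x. M * f x)" using i by (rule integrable_mult_right)
  show "integrable (lebesgue_on K) (\<lambda>x. f x *\<^sub>R x)"
  proof (rule Bochner_Integration.integrable_bound[OF i'])
    have "(\<lambda>x. x) \<in> borel_measurable (lebesgue_on K)"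
      using continuous_imp_measurable_on_sets_lebesgue[OF continuous_on_id K'] by simp
    then show "(\<lambda>x. f x *\<^sub>R x) \<in> borel_measurable (lebesgue_on K)"
      using i by (intro borel_measurable_scaleR) auto
    show "AE x in lebesgue_on K. norm (f x *\<^sub>R x) \<le> norm (M * f x)"
    proof (rule AE_I2)
      fix x assume "x \<in> space (lebesgue_on K)"
      then have "norm x \<le> M" using M by simp
      then have "\<bar>f x\<bar> * norm x \<le> \<bar>f x\<bar> * \<bar>M\<bar>" by (intro mult_left_mono) auto
      then show "norm (f x *\<^sub>R x) \<le> norm (M * f x)" by (simp add: abs_mult mult.commute)
    qed
  qed
qed

text \<open>An affine function is bounded away from zero on some ball unless it vanishes.\<close>

lemma affine_zero_if_null:
  fixes g :: "'a::euclidean_space"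
  assumes K: "compact K" "interior K \<noteq> {}" and z: "(\<integral>x. (c + g \<bullet> x)\<^sup>2 \<partial>lebesgue_on K) = 0"
  shows "c = 0" "g = 0"
proof -
  obtain m r where r: "0 < r" "cball m r \<subseteq> K"
    using K(2) by (meson all_not_in_conv mem_interior_cball)
  define a where "a = c + g \<bullet> m"
  have eq: "c + g \<bullet> x = a + g \<bullet> (x - m)" for x by (simp add: a_def inner_diff_right)
  obtain y where y: "cball y (r / 8) \<subseteq> cball m (r / 2)"
    "\<And>x. x \<in> cball y (r / 8) \<Longrightarrow> \<bar>a\<bar> + norm g * (r / 8) \<le> \<bar>a + g \<bullet> (x - m)\<bar>"
    using affine_large_on_ball[OF r(1), of m a g] by metis
  have K': "K \<in> sets lebesgue" using lmeasurable_compact[OF K(1)] by (rule fmeasurableD)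
  have "(\<lambda>x. c + g \<bullet> x) \<in> L2 (lebesgue_on K)"
    by (intro continuous_compact_L2 K continuous_intros)
  then have i: "integrable (lebesgue_on K) (\<lambda>x. (c + g \<bullet> x)\<^sup>2)" by (simp add: L2_def)
  have "cball m (r / 2) \<subseteq> cball m r" using r(1) by (intro subset_cball) simp
  then have "cball y (r / 8) \<subseteq> K" using y(1) r(2) by blast
  then have "(\<bar>a\<bar> + norm g * (r / 8))\<^sup>2 * measure lebesgue (cball y (r / 8)) \<le> (\<integral>x. (c + g \<bullet> x)\<^sup>2 \<partial>lebesgue_on K)"
  proof (intro integral_ge_on[OF K' _ _ i])
    show "(\<bar>a\<bar> + norm g * (r / 8))\<^sup>2 \<le> (c + g \<bullet> x)\<^sup>2" if "x \<in> cball y (r / 8)" for x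
      using power_mono[OF y(2)[OF that], of 2] r(1) unfolding eq by simp
  qed auto
  moreover have "0 < measure lebesgue (cball y (r / 8))" using r(1) by (subst measure_cball_eq) auto
  ultimately have "\<not> 0 < (\<bar>a\<bar> + norm g * (r / 8))\<^sup>2"
    using z mult_pos_pos[of "(\<bar>a\<bar> + norm g * (r / 8))\<^sup>2" "measure lebesgue (cball y (r / 8))"] by linarith
  then have "\<bar>a\<bar> + norm g * (r / 8) = 0" by simp
  then have "a = 0" "norm g * (r / 8) = 0" using r(1) by (auto simp: add_nonneg_eq_0_iff)
  then show "g = 0" using r(1) by simp
  with \<open>a = 0\<close> show "c = 0" by (simp add: a_def)
qed

text \<open>The normal equations for the projection form a square linear system whose kernel is trivial,
  since an affine function orthogonal to all affine functions has norm zero.\<close>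

lemma proj_P1_in_P1:
  fixes f :: "'a::euclidean_space \<Rightarrow> real"
  assumes K: "compact K" "interior K \<noteq> {}" and f: "f \<in> L2 (lebesgue_on K)"
  shows "proj_P1 K f \<in> P1"
proof -
  define q where "q c g x = c + g \<bullet> x" for c and g x :: 'a
  have qL: "q c g \<in> L2 (lebesgue_on K)" for c g
    unfolding q_def by (intro continuous_compact_L2 K continuous_intros)
  have mom: "(\<integral>x. h x * q c g x \<partial>lebesgue_on K)
      = c * (\<integral>x. h x \<partial>lebesgue_on K) + g \<bullet> (\<integral>x. h x *\<^sub>R x \<partial>lebesgue_on K)"
    if h: "h \<in> L2 (lebesgue_on K)" for h c g
  proof -
    note i = L2_compact_integrable[OF K(1) h]
    have "(\<integral>x. h x * q c g x \<partial>lebesgue_on K) = (\<integral>x. c * h x + g \<bullet> (h x *\<^sub>R x) \<partial>lebesgue_on K)"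
      by (simp add: q_def algebra_simps)
    also have "\<dots> = (\<integral>x. c * h x \<partial>lebesgue_on K) + (\<integral>x. g \<bullet> (h x *\<^sub>R x) \<partial>lebesgue_on K)"
      by (rule Bochner_Integration.integral_add) (use i in \<open>auto simp del: inner_scaleR_right\<close>)
    also have "(\<integral>x. g \<bullet> (h x *\<^sub>R x) \<partial>lebesgue_on K) = g \<bullet> (\<integral>x. h x *\<^sub>R x \<partial>lebesgue_on K)"
      by (rule integral_inner_right) (use i in auto)
    finally show ?thesis by simp
  qed
  define L :: "real \<times> 'a \<Rightarrow> real \<times> 'a" where
    "L = (\<lambda>(c, g). (\<integral>x. q c g x \<partial>lebesgue_on K, \<integral>x. q c g x *\<^sub>R x \<partial>lebesgue_on K))"
  have q_int: "integrable (lebesgue_on K) (q c g)" "integrable (lebesgue_on K) (\<lambda>x. q c g x *\<^sub>R x)" for c g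
    using L2_compact_integrable[OF K(1) qL] by auto
  have qadd: "q (c + c') (g + g') = (\<lambda>x. q c g x + q c' g' x)" and qscale: "q (s * c) (s *\<^sub>R g) = (\<lambda>x. s * q c g x)" for c c' g g' s
    by (simp_all add: q_def fun_eq_iff inner_add_left algebra_simps)
  have lin: "linear L"
  proof (rule linearI)
    show "L (a + b) = L a + L b" for a b
      using q_int by (cases a; cases b) (simp add: L_def qadd scaleR_add_left)
    show "L (s *\<^sub>R a) = s *\<^sub>R L a" for s a
      by (cases a) (simp add: L_def qscale scaleR_scaleR[symmetric] del: scaleR_scaleR)
  qed
  have inj: "inj L"
    unfolding linear_injective_0[OF lin]
  proof (intro allI impI)
    fix p assume p0: "L p = 0"
    obtain c g where p: "p = (c, g)" by (cases p)
    have "(\<integral>x. q c g x * q c g x \<partial>lebesgue_on K) = 0"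
      using mom[OF qL, of c g c g] p0 by (simp add: L_def p zero_prod_def)
    then have "(\<integral>x. (c + g \<bullet> x)\<^sup>2 \<partial>lebesgue_on K) = 0" by (simp add: q_def power2_eq_square)
    from affine_zero_if_null[OF K this] show "p = 0" by (simp add: p zero_prod_def)
  qed
  have "surj L" by (rule linear_injective_imp_surjective[OF lin inj refl])
  then obtain p where "L p = (\<integral>x. f x \<partial>lebesgue_on K, \<integral>x. f x *\<^sub>R x \<partial>lebesgue_on K)"
    by (metis surj_def)
  then obtain c0 g0 where cg: "(\<integral>x. q c0 g0 x \<partial>lebesgue_on K) = (\<integral>x. f x \<partial>lebesgue_on K)"
    "(\<integral>x. q c0 g0 x *\<^sub>R x \<partial>lebesgue_on K) = (\<integral>x. f x *\<^sub>R x \<partial>lebesgue_on K)"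
    by (cases p) (auto simp: L_def)
  have inner_eq: "l2_inner (lebesgue_on K) (\<lambda>x. f x - q c g x) (q c' g')
      = (\<integral>x. f x * q c' g' x \<partial>lebesgue_on K) - (\<integral>x. q c g x * q c' g' x \<partial>lebesgue_on K)" for c g c' g'
    using L2_mult_integrable[OF f qL[of c' g']] L2_mult_integrable[OF qL[of c g] qL[of c' g']]
    by (simp add: l2_inner_def left_diff_distrib)
  have P1q: "r \<in> P1 \<longleftrightarrow> (\<exists>c g. r = q c g)" for r :: "'a \<Rightarrow> real"
    by (auto simp: P1_def q_def fun_eq_iff)
  have "\<exists>!r. r \<in> P1 \<and> (\<forall>s\<in>P1. l2_inner (lebesgue_on K) (\<lambda>x. f x - r x) s = 0)"
  proof (rule ex1I[of _ "q c0 g0"])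
    show "q c0 g0 \<in> P1 \<and> (\<forall>s\<in>P1. l2_inner (lebesgue_on K) (\<lambda>x. f x - q c0 g0 x) s = 0)"
      unfolding Ball_def P1q using cg mom[OF f] mom[OF qL[of c0 g0]] by (auto simp: inner_eq)
    fix r assume r: "r \<in> P1 \<and> (\<forall>s\<in>P1. l2_inner (lebesgue_on K) (\<lambda>x. f x - r x) s = 0)"
    then obtain c g where r_eq: "r = q c g" using P1q by blast
    have same: "(\<integral>x. q c g x * q c' g' x \<partial>lebesgue_on K) = (\<integral>x. q c0 g0 x * q c' g' x \<partial>lebesgue_on K)" for c' g'
    proof -
      have "l2_inner (lebesgue_on K) (\<lambda>x. f x - q c g x) (q c' g') = 0" using r r_eq P1q by blast
      then show ?thesis using cg mom[OF f, of c' g'] mom[OF qL[of c0 g0], of c' g'] by (simp add: inner_eq)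
    qed
    have d: "q (c - c0) (g - g0) x = q c g x - q c0 g0 x" for x by (simp add: q_def inner_diff_left)
    have "(\<integral>x. q (c - c0) (g - g0) x * q (c - c0) (g - g0) x \<partial>lebesgue_on K)
        = (\<integral>x. q c g x * q (c - c0) (g - g0) x - q c0 g0 x * q (c - c0) (g - g0) x \<partial>lebesgue_on K)"
      by (simp add: d left_diff_distrib)
    also have "\<dots> = 0"
      using L2_mult_integrable[OF qL qL] same by simp
    finally have "(\<integral>x. ((c - c0) + (g - g0) \<bullet> x)\<^sup>2 \<partial>lebesgue_on K) = 0" by (simp add: q_def power2_eq_square)
    from affine_zero_if_null[OF K this] show "r = q c0 g0" by (simp add: r_eq)
  qed
  from theI'[OF this] show ?thesis unfolding proj_P1_def by blast
qed

section \<open>The residual of a perturbed convection-diffusion equation\<close>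

lemma Ck_uminus: "Ck k f \<Longrightarrow> Ck k (\<lambda>x. - f x)"
proof (induction k arbitrary: f)
  case (Suc k)
  have "frechet_derivative (\<lambda>x. - f x) (at x) = (\<lambda>h. - frechet_derivative f (at x) h)" for x
  proof -
    have "(f has_derivative frechet_derivative f (at x)) (at x)"
      using Suc.prems by (simp add: differentiable_on_def frechet_derivative_works[symmetric])
    then have "((\<lambda>x. - f x) has_derivative (\<lambda>h. - frechet_derivative f (at x) h)) (at x)"
      by (rule has_derivative_minus)
    then show ?thesis using frechet_derivative_at by metis
  qed
  then show ?case using Suc by (auto simp: differentiable_on_def intro!: differentiable_minus)
qed (auto intro: continuous_intros)

lemma test_functions_uminus: "w \<in> test_functions \<Omega> \<Longrightarrow> (\<lambda>x. - w x) \<in> test_functions \<Omega>"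
  unfolding test_functions_def mem_Collect_eq neg_equal_0_iff_equal using Ck_uminus by blast

lemma is_weak_grad_diff:
  assumes O: "open \<Omega>" and v: "is_weak_grad \<Omega> v g" and w: "is_weak_grad \<Omega> w h"
  shows "is_weak_grad \<Omega> (\<lambda>x. v x - w x) (\<lambda>x. g x - h x)"
proof -
  have L: "locally_integrable \<Omega> v" "locally_integrable \<Omega> w" "locally_integrable \<Omega> g" "locally_integrable \<Omega> h"
    using v w by (auto simp: is_weak_grad_def)
  have Li: "locally_integrable \<Omega> (\<lambda>x. g x \<bullet> e)" "locally_integrable \<Omega> (\<lambda>x. h x \<bullet> e)" for e
    using L by (auto simp: locally_integrable_def)
  have "(\<integral>x. (v x - w x) * (grad \<phi> x \<bullet> e) \<partial>lebesgue_on \<Omega>) = - (\<integral>x. ((g x - h x) \<bullet> e) * \<phi> x \<partial>lebesgue_on \<Omega>)"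
    if \<phi>: "\<phi> \<in> test_functions \<Omega>" and e: "e \<in> Basis" for \<phi> e
  proof -
    obtain C where C: "compact C" "C \<subseteq> \<Omega>" "\<And>x. x \<notin> C \<Longrightarrow> \<phi> x = 0" "\<And>x. x \<notin> C \<Longrightarrow> grad \<phi> x = 0"
      using test_functionsE[OF \<phi>] by metis
    have c: "continuous_on UNIV (\<lambda>x. grad \<phi> x \<bullet> e)" "continuous_on UNIV \<phi>"
      using test_functions_grad[OF \<phi>] by (auto intro: continuous_intros)
    have z: "grad \<phi> x \<bullet> e = 0" if "x \<notin> C" for x using C(4)[OF that] by simp
    note i = locally_integrable_test[OF L(1) O C(1,2) c(1) z] locally_integrable_test[OF L(2) O C(1,2) c(1) z]
      locally_integrable_test[OF Li(1) O C(1,2) c(2) C(3), of e] locally_integrable_test[OF Li(2) O C(1,2) c(2) C(3), of e]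
    have "(\<integral>x. v x * (grad \<phi> x \<bullet> e) \<partial>lebesgue_on \<Omega>) = - (\<integral>x. (g x \<bullet> e) * \<phi> x \<partial>lebesgue_on \<Omega>)"
      "(\<integral>x. w x * (grad \<phi> x \<bullet> e) \<partial>lebesgue_on \<Omega>) = - (\<integral>x. (h x \<bullet> e) * \<phi> x \<partial>lebesgue_on \<Omega>)"
      using v w \<phi> e by (auto simp: is_weak_grad_def)
    then show ?thesis using i by (simp add: inner_diff_left left_diff_distrib)
  qed
  moreover have "locally_integrable \<Omega> (\<lambda>x. v x - w x)" "locally_integrable \<Omega> (\<lambda>x. g x - h x)"
    using L by (auto simp: locally_integrable_def)
  ultimately show ?thesis by (simp add: is_weak_grad_def)
qed

lemma H10_facts:
  assumes O: "open \<Omega>" and v: "v \<in> H10 \<Omega>"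
  shows "v \<in> L2 (lebesgue_on \<Omega>)" "wgrad \<Omega> v \<in> L2 (lebesgue_on \<Omega>)" "is_weak_grad \<Omega> v (wgrad \<Omega> v)"
proof -
  show "v \<in> L2 (lebesgue_on \<Omega>)" using v by (simp add: H10_def H1_def)
  obtain g where g: "g \<in> L2 (lebesgue_on \<Omega>)" "is_weak_grad \<Omega> v g" using v by (auto simp: H10_def H1_def)
  show "is_weak_grad \<Omega> v (wgrad \<Omega> v)" by (rule wgrad_is_weak_grad[OF g(2)])
  have ae: "AE x in lebesgue_on \<Omega>. g x = wgrad \<Omega> v x"
    using wgrad_AE[OF O g(2)] by eventually_elim simp
  have OL: "\<Omega> \<in> sets lebesgue" using O by auto
  have "wgrad \<Omega> v \<in> borel_measurable (lebesgue_on \<Omega>)"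
    using g(1) by (intro measurable_lebesgue_on_AE[OF OL _ ae]) (simp add: L2_def)
  then show "wgrad \<Omega> v \<in> L2 (lebesgue_on \<Omega>)"
    using ae by (intro L2_dominated[OF g(1), where c = 1]) (auto elim: eventually_mono)
qed

lemma convection_field_bounded:
  assumes "convection_field \<Omega> (b :: 'a::euclidean_space \<Rightarrow> 'a)"
  shows "b \<in> borel_measurable (lebesgue_on \<Omega>)" "\<exists>M. AE x in lebesgue_on \<Omega>. norm (b x) \<le> M"
proof -
  have c: "(\<lambda>x. b x \<bullet> e) \<in> Linf (lebesgue_on \<Omega>)" if "e \<in> Basis" for e
    using assms that by (auto simp: convection_field_def W1inf_def)
  have "(\<lambda>x. \<Sum>e\<in>Basis. (b x \<bullet> e) *\<^sub>R e) \<in> borel_measurable (lebesgue_on \<Omega>)"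
    using c by (intro borel_measurable_sum borel_measurable_scaleR) (auto simp: Linf_def)
  then show "b \<in> borel_measurable (lebesgue_on \<Omega>)" by (simp add: euclidean_representation)
  have "\<exists>M. AE x in lebesgue_on \<Omega>. \<bar>b x \<bullet> e\<bar> \<le> M" if e: "e \<in> Basis" for e
  proof -
    let ?s = "esssup (lebesgue_on \<Omega>) (\<lambda>x. ereal (norm (b x \<bullet> e)))"
    have fin: "?s < \<infinity>" using c[OF e] by (simp add: Linf_def linf_norm_def)
    have "AE x in lebesgue_on \<Omega>. ereal (norm (b x \<bullet> e)) \<le> ?s" by (rule esssup_AE)
    then have "AE x in lebesgue_on \<Omega>. \<bar>b x \<bullet> e\<bar> \<le> real_of_ereal ?s"
    proof eventually_elim
      case (elim x)
      then show ?case using fin by (cases ?s) auto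
    qed
    then show ?thesis by blast
  qed
  then obtain M where M: "\<And>e. e \<in> Basis \<Longrightarrow> AE x in lebesgue_on \<Omega>. \<bar>b x \<bullet> e\<bar> \<le> M e" by metis
  then have "AE x in lebesgue_on \<Omega>. \<forall>e\<in>Basis. \<bar>b x \<bullet> e\<bar> \<le> M e" by (intro AE_finite_allI) auto
  then have "AE x in lebesgue_on \<Omega>. norm (b x) \<le> (\<Sum>e\<in>Basis. M e)"
    by eventually_elim (rule order_trans[OF norm_le_l1], auto intro: sum_mono)
  then show "\<exists>M. AE x in lebesgue_on \<Omega>. norm (b x) \<le> M" by blast
qed

lemma convection_L2:
  assumes b: "convection_field \<Omega> (b :: 'a::euclidean_space \<Rightarrow> 'a)" and H: "H \<in> L2 (lebesgue_on \<Omega>)"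
  shows "(\<lambda>x. b x \<bullet> H x) \<in> L2 (lebesgue_on \<Omega>)"
proof -
  obtain M where M: "AE x in lebesgue_on \<Omega>. norm (b x) \<le> M" using convection_field_bounded(2)[OF b] by blast
  show ?thesis
  proof (rule L2_dominated[OF H, where c = M])
    show "(\<lambda>x. b x \<bullet> H x) \<in> borel_measurable (lebesgue_on \<Omega>)"
      using convection_field_bounded(1)[OF b] H by (intro borel_measurable_inner) (auto simp: L2_def)
    show "AE x in lebesgue_on \<Omega>. norm (b x \<bullet> H x) \<le> M * norm (H x)"
      using M
    proof eventually_elim
      case (elim x)
      have "norm (b x \<bullet> H x) \<le> norm (b x) * norm (H x)" using Cauchy_Schwarz_ineq2 by simp
      also have "\<dots> \<le> M * norm (H x)" using elim by (intro mult_right_mono) auto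
      finally show ?case .
    qed
  qed
qed

text \<open>The function \<open>e\<close>, with weak gradient \<open>H\<close>, stands for the error of a finite element approximation.\<close>

locale convection_error = simplicial_mesh +
  fixes \<nu> \<kappa> :: real and b :: "'a \<Rightarrow> 'a" and e :: "'a \<Rightarrow> real" and H :: "'a \<Rightarrow> 'a"
  assumes nonempty: "\<Omega> \<noteq> {}" and params: "0 < \<nu>" "0 < \<kappa>" and b: "convection_field \<Omega> b"
    and e: "e \<in> L2 (lebesgue_on \<Omega>)" "is_weak_grad \<Omega> e H" and H: "H \<in> L2 (lebesgue_on \<Omega>)"
begin

abbreviation "M\<^sub>\<Omega> \<equiv> lebesgue_on \<Omega>"

lemma energy_norm_eq:
  assumes "is_weak_grad \<Omega> v g" "g \<in> L2 M\<^sub>\<Omega>"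
  shows "energy_norm \<Omega> \<nu> \<kappa> v = sqrt (\<nu> * (l2_norm M\<^sub>\<Omega> g)\<^sup>2 + \<kappa> * (l2_norm M\<^sub>\<Omega> v)\<^sup>2)"
proof -
  have "AE x in M\<^sub>\<Omega>. (norm (g x))\<^sup>2 = (norm (wgrad \<Omega> v x))\<^sup>2"
    using wgrad_AE[OF regular_domain(1) assms(1)] by eventually_elim simp
  then have "(\<integral>x. (norm (wgrad \<Omega> v x))\<^sup>2 \<partial>M\<^sub>\<Omega>) = (\<integral>x. (norm (g x))\<^sup>2 \<partial>M\<^sub>\<Omega>)"
    using assms(2) by (intro integral_lebesgue_on_cong_AE(1)[OF element_sets(3)])
      (auto simp: L2_def intro: borel_measurable_integrable)
  then show ?thesis unfolding energy_norm_def l2_norm_sq by simp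
qed

lemma test_energy:
  assumes "w \<in> test_functions \<Omega>"
  shows "energy_norm \<Omega> \<nu> \<kappa> w = sqrt (\<nu> * (\<integral>x. (norm (grad w x))\<^sup>2 \<partial>M\<^sub>\<Omega>) + \<kappa> * (\<integral>x. (w x)\<^sup>2 \<partial>M\<^sub>\<Omega>))"
  using energy_norm_eq[OF test_function_weak_grad[OF regular_domain(1) assms] test_function_H10(4)[OF regular_domain(1) assms]]
  by (simp add: l2_norm_sq)

lemma l2_le_energy: "sqrt \<kappa> * l2_norm M\<^sub>\<Omega> v \<le> energy_norm \<Omega> \<nu> \<kappa> v"
proof -
  have "sqrt \<kappa> * l2_norm M\<^sub>\<Omega> v = sqrt (\<kappa> * (l2_norm M\<^sub>\<Omega> v)\<^sup>2)"
    using params l2_norm_nonneg[of M\<^sub>\<Omega> v] by (simp add: real_sqrt_mult)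
  also have "\<dots> \<le> energy_norm \<Omega> \<nu> \<kappa> v" unfolding energy_norm_def using params by simp
  finally show ?thesis .
qed

lemma energy_nonneg: "0 \<le> energy_norm \<Omega> \<nu> \<kappa> v"
  using params by (simp add: energy_norm_def)

lemma bH: "(\<lambda>x. b x \<bullet> H x) \<in> L2 M\<^sub>\<Omega>"
  by (rule convection_L2[OF b H])

lemma wgrad_e: "AE x in M\<^sub>\<Omega>. wgrad \<Omega> e x = H x"
  by (rule wgrad_AE[OF regular_domain(1) e(2)])

definition "conv w = (\<integral>x. (b x \<bullet> H x) * w x \<partial>M\<^sub>\<Omega>)"

lemma conv_eq: "l2_inner M\<^sub>\<Omega> (\<lambda>x. b x \<bullet> wgrad \<Omega> e x) w = conv w" if w: "w \<in> L2 M\<^sub>\<Omega>"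
proof -
  have ae: "AE x in M\<^sub>\<Omega>. (b x \<bullet> H x) * w x = (b x \<bullet> wgrad \<Omega> e x) \<bullet> w x"
    using wgrad_e by eventually_elim simp
  show ?thesis
    unfolding l2_inner_def conv_def
    by (rule integral_lebesgue_on_cong_AE(1)[OF element_sets(3) borel_measurable_integrable[OF L2_mult_integrable[OF bH w]] ae])
qed

definition "dual_norm = dual_conv_norm \<Omega> \<nu> \<kappa> b e"

text \<open>As the convection field is bounded, the quotients are bounded, so the supremum in the dual norm is an upper bound and
  not a default value.\<close>

lemma dual_upper:
  assumes "\<phi> \<in> H10 \<Omega>" "\<not> (AE x in M\<^sub>\<Omega>. \<phi> x = 0)"
  shows "conv \<phi> / energy_norm \<Omega> \<nu> \<kappa> \<phi> \<le> dual_norm"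
proof -
  let ?S = "{\<phi> \<in> H10 \<Omega>. \<not> (AE x in M\<^sub>\<Omega>. \<phi> x = 0)}"
  let ?r = "\<lambda>\<phi>. l2_inner M\<^sub>\<Omega> (\<lambda>x. b x \<bullet> wgrad \<Omega> e x) \<phi> / energy_norm \<Omega> \<nu> \<kappa> \<phi>"
  have "bdd_above (?r ` ?S)"
  proof (rule bdd_aboveI2)
    fix \<phi> assume "\<phi> \<in> ?S"
    then have \<phi>: "\<phi> \<in> L2 M\<^sub>\<Omega>" using H10_facts(1)[OF regular_domain(1)] by blast
    let ?B = "l2_norm M\<^sub>\<Omega> (\<lambda>x. b x \<bullet> H x) / sqrt \<kappa>"
    have B0: "0 \<le> ?B" by (intro divide_nonneg_nonneg l2_norm_nonneg) (use params in simp)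
    show "?r \<phi> \<le> ?B"
    proof (cases "energy_norm \<Omega> \<nu> \<kappa> \<phi> = 0")
      case False
      then have pos: "0 < energy_norm \<Omega> \<nu> \<kappa> \<phi>" using energy_nonneg[of \<phi>] by simp
      have "conv \<phi> \<le> l2_norm M\<^sub>\<Omega> (\<lambda>x. b x \<bullet> H x) * l2_norm M\<^sub>\<Omega> \<phi>"
        using L2_mult_Cauchy_Schwarz[OF bH \<phi>] unfolding conv_def by linarith
      also have "\<dots> = ?B * (sqrt \<kappa> * l2_norm M\<^sub>\<Omega> \<phi>)" using params by simp
      also have "\<dots> \<le> ?B * energy_norm \<Omega> \<nu> \<kappa> \<phi>" by (rule mult_left_mono[OF l2_le_energy B0])
      finally show ?thesis using pos by (simp add: conv_eq[OF \<phi>] pos_divide_le_eq)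
    qed (use B0 in simp)
  qed
  then have "?r \<phi> \<le> dual_norm" unfolding dual_norm_def dual_conv_norm_def using assms by (intro cSUP_upper) auto
  then show ?thesis using conv_eq[OF H10_facts(1)[OF regular_domain(1) assms(1)]] by simp
qed

text \<open>The supremum in the dual norm ranges over a nonempty set, which its sign depends on.\<close>

lemma exists_test: "\<exists>w\<in>test_functions \<Omega>. \<not> (AE x in M\<^sub>\<Omega>. w x = 0)"
proof -
  obtain x0 r where r: "0 < r" "cball x0 r \<subseteq> \<Omega>"
    using nonempty regular_domain(1) open_contains_cball by blast
  let ?w = "bump x0 r r 0"
  have sl: "slab x0 r r 0 = cball x0 r" using r(1) by (intro slab_isotropic) simp
  have w: "?w \<in> test_functions \<Omega>"
  proof (rule test_functionsI[OF bump_smooth compact_cball r(2)])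
    show "?w x = 0" if "x \<notin> cball x0 r" for x
      using bump_zero[OF r(1) r(1), of x x0 0] that unfolding sl by blast
  qed
  have i: "integrable M\<^sub>\<Omega> (\<lambda>x. (?w x)\<^sup>2)"
    using test_function_H10(3)[OF regular_domain(1) w] by (simp add: L2_def)
  have "cball x0 (r / 2) \<subseteq> \<Omega>" using r subset_cball[of "r/2" r x0] by auto
  then have "(exp (- 4))\<^sup>2 * measure lebesgue (cball x0 (r / 2)) \<le> (\<integral>x. (?w x)\<^sup>2 \<partial>M\<^sub>\<Omega>)"
  proof (intro integral_ge_on[OF element_sets(3) _ _ i])
    show "(exp (- 4))\<^sup>2 \<le> (?w x)\<^sup>2" if "x \<in> cball x0 (r / 2)" for x
    proof (rule power_mono[OF bump_ge])
      have "norm (x - x0) \<le> r / 2" using that by (simp add: dist_norm norm_minus_commute)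
      then have "(norm (x - x0))\<^sup>2 \<le> (r / 2)\<^sup>2" by (intro power_mono) auto
      moreover have "(r / 2)\<^sup>2 = 1/4 * r\<^sup>2" by (simp add: power_divide)
      ultimately have "(norm (x - x0))\<^sup>2 \<le> 3/4 * r\<^sup>2" using zero_le_power2[of r] by linarith
      then show "(norm (x - x0))\<^sup>2 / r\<^sup>2 + ((x - x0) \<bullet> 0)\<^sup>2 / r\<^sup>2 \<le> 3/4" using r(1) by (simp add: pos_divide_le_eq)
    qed simp
  qed auto
  moreover have "0 < measure lebesgue (cball x0 (r / 2))" using r(1) by (subst measure_cball_eq) auto
  ultimately have pos: "0 < (\<integral>x. (?w x)\<^sup>2 \<partial>M\<^sub>\<Omega>)"
    by (metis exp_gt_zero less_le_trans mult_pos_pos zero_less_power)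
  have "\<not> (AE x in M\<^sub>\<Omega>. ?w x = 0)"
  proof
    assume "AE x in M\<^sub>\<Omega>. ?w x = 0"
    then have "AE x in M\<^sub>\<Omega>. (?w x)\<^sup>2 = 0" by eventually_elim simp
    then show False using pos integral_eq_zero_AE[of "\<lambda>x. (?w x)\<^sup>2" M\<^sub>\<Omega>] by simp
  qed
  then show ?thesis using w by blast
qed

lemma conv_uminus: "conv (\<lambda>x. - w x) = - conv w"
  by (simp add: conv_def)

lemma energy_uminus_test:
  assumes w: "w \<in> test_functions \<Omega>"
  shows "energy_norm \<Omega> \<nu> \<kappa> (\<lambda>x. - w x) = energy_norm \<Omega> \<nu> \<kappa> w"
proof -
  have "grad (\<lambda>x. - w x) x = - grad w x" for x
    using GDERIV_grad[OF GDERIV_minus[OF test_functions_grad(1)[OF w]]] .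
  then show ?thesis unfolding test_energy[OF w] test_energy[OF test_functions_uminus[OF w]] by simp
qed

text \<open>The quotients of \<open>w\<close> and \<open>- w\<close> have opposite signs.\<close>

lemma dual_nonneg: "0 \<le> dual_norm"
proof -
  obtain w where w: "w \<in> test_functions \<Omega>" "\<not> (AE x in M\<^sub>\<Omega>. w x = 0)" using exists_test by blast
  have "conv w / energy_norm \<Omega> \<nu> \<kappa> w \<le> dual_norm"
    by (rule dual_upper[OF test_function_H10(1)[OF regular_domain(1) w(1)] w(2)])
  moreover have "conv (\<lambda>x. - w x) / energy_norm \<Omega> \<nu> \<kappa> (\<lambda>x. - w x) \<le> dual_norm"
    by (rule dual_upper[OF test_function_H10(1)[OF regular_domain(1) test_functions_uminus[OF w(1)]]]) (use w(2) in simp)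
  ultimately show ?thesis unfolding conv_uminus energy_uminus_test[OF w(1)] by simp
qed

lemma conv_bound:
  assumes w: "w \<in> test_functions \<Omega>"
  shows "\<bar>conv w\<bar> \<le> dual_norm * energy_norm \<Omega> \<nu> \<kappa> w"
proof (cases "AE x in M\<^sub>\<Omega>. w x = 0")
  case True
  then have "AE x in M\<^sub>\<Omega>. (b x \<bullet> H x) * w x = 0" by eventually_elim simp
  then have "conv w = 0" unfolding conv_def by (rule integral_eq_zero_AE)
  then show ?thesis using dual_nonneg energy_nonneg[of w] by simp
next
  case False
  note wL = test_function_H10(3)[OF regular_domain(1) w]
  have "0 < energy_norm \<Omega> \<nu> \<kappa> w"
  proof -
    have "(l2_norm M\<^sub>\<Omega> w)\<^sup>2 \<noteq> 0"
    proof
      assume "(l2_norm M\<^sub>\<Omega> w)\<^sup>2 = 0"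
      then have "(\<integral>x. (w x)\<^sup>2 \<partial>M\<^sub>\<Omega>) = 0" by (simp add: l2_norm_sq)
      then have "AE x in M\<^sub>\<Omega>. (w x)\<^sup>2 = 0"
        using integral_nonneg_eq_0_iff_AE[of M\<^sub>\<Omega> "\<lambda>x. (w x)\<^sup>2"] wL by (simp add: L2_def)
      then show False using False by simp
    qed
    then have "0 < l2_norm M\<^sub>\<Omega> w" using l2_norm_nonneg[of M\<^sub>\<Omega> w] by simp
    then have "0 < sqrt \<kappa> * l2_norm M\<^sub>\<Omega> w" using params by simp
    then show ?thesis using l2_le_energy[of w] by linarith
  qed
  moreover have "conv w / energy_norm \<Omega> \<nu> \<kappa> w \<le> dual_norm"
    by (rule dual_upper[OF test_function_H10(1)[OF regular_domain(1) w] False])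
  moreover have "(- conv w) / energy_norm \<Omega> \<nu> \<kappa> w \<le> dual_norm"
    using dual_upper[OF test_function_H10(1)[OF regular_domain(1) test_functions_uminus[OF w]]] False
    unfolding conv_uminus energy_uminus_test[OF w] neg_equal_0_iff_equal by blast
  ultimately have "conv w \<le> dual_norm * energy_norm \<Omega> \<nu> \<kappa> w" "- conv w \<le> dual_norm * energy_norm \<Omega> \<nu> \<kappa> w"
    using pos_divide_le_eq by blast+
  then show ?thesis by (rule abs_leI)
qed

lemma R_norm_eq: "R_norm \<Omega> \<nu> \<kappa> b e = energy_norm \<Omega> \<nu> \<kappa> e + dual_norm"
  by (simp add: R_norm_def dual_norm_def)

lemma R_norm_nonneg: "0 \<le> R_norm \<Omega> \<nu> \<kappa> b e"
  using energy_nonneg[of e] dual_nonneg by (simp add: R_norm_eq)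

lemma l2_le_R_norm: "l2_norm M\<^sub>\<Omega> e \<le> R_norm \<Omega> \<nu> \<kappa> b e / sqrt \<kappa>"
proof -
  have "sqrt \<kappa> * l2_norm M\<^sub>\<Omega> e \<le> R_norm \<Omega> \<nu> \<kappa> b e"
    using l2_le_energy[of e] dual_nonneg by (simp add: R_norm_eq)
  then show ?thesis using params by (simp add: pos_le_divide_eq mult.commute)
qed

text \<open>The Cauchy-Schwarz inequality for the diffusion and reaction terms together, the dual norm for convection, and
  \<open>sqrt \<kappa>\<close> times the \<open>L2\<close> norm below the energy norm for the data \<open>d\<close>. The sign \<open>s\<close> tells the adjoint equation
  from the state equation.\<close>

lemma error_functional_bound:
  assumes w: "w \<in> test_functions \<Omega>" and d: "d \<in> L2 M\<^sub>\<Omega>" and s: "\<bar>s\<bar> = 1"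
  shows "\<bar>\<nu> * (\<integral>x. H x \<bullet> grad w x \<partial>M\<^sub>\<Omega>) + s * conv w + \<kappa> * (\<integral>x. e x * w x \<partial>M\<^sub>\<Omega>) - (\<integral>x. d x * w x \<partial>M\<^sub>\<Omega>)\<bar>
    \<le> (R_norm \<Omega> \<nu> \<kappa> b e + l2_norm M\<^sub>\<Omega> d / sqrt \<kappa>)
      * sqrt (\<nu> * (\<integral>x. (norm (grad w x))\<^sup>2 \<partial>M\<^sub>\<Omega>) + \<kappa> * (\<integral>x. (w x)\<^sup>2 \<partial>M\<^sub>\<Omega>))"
proof -
  note wL = test_function_H10(3,4)[OF regular_domain(1) w]
  define EW where "EW = energy_norm \<Omega> \<nu> \<kappa> w"
  have EW: "EW = sqrt (\<nu> * (l2_norm M\<^sub>\<Omega> (grad w))\<^sup>2 + \<kappa> * (l2_norm M\<^sub>\<Omega> w)\<^sup>2)"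
    unfolding EW_def test_energy[OF w] l2_norm_sq by simp
  have EE: "energy_norm \<Omega> \<nu> \<kappa> e = sqrt (\<nu> * (l2_norm M\<^sub>\<Omega> H)\<^sup>2 + \<kappa> * (l2_norm M\<^sub>\<Omega> e)\<^sup>2)"
    by (rule energy_norm_eq[OF e(2) H])
  define h1 h2 w1 w2 where "h1 = l2_norm M\<^sub>\<Omega> H" and "h2 = l2_norm M\<^sub>\<Omega> e" and "w1 = l2_norm M\<^sub>\<Omega> (grad w)" and "w2 = l2_norm M\<^sub>\<Omega> w"
  have nn: "0 \<le> h1" "0 \<le> h2" "0 \<le> w1" "0 \<le> w2" by (auto simp: h1_def h2_def w1_def w2_def l2_norm_nonneg)
  have 1: "\<bar>\<nu> * (\<integral>x. H x \<bullet> grad w x \<partial>M\<^sub>\<Omega>) + \<kappa> * (\<integral>x. e x * w x \<partial>M\<^sub>\<Omega>)\<bar> \<le> energy_norm \<Omega> \<nu> \<kappa> e * EW"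
  proof -
    have "\<bar>\<nu> * (\<integral>x. H x \<bullet> grad w x \<partial>M\<^sub>\<Omega>)\<bar> \<le> \<nu> * (h1 * w1)"
      using L2_Cauchy_Schwarz[OF H wL(2)] params by (simp add: abs_mult h1_def w1_def)
    moreover have "\<bar>\<kappa> * (\<integral>x. e x * w x \<partial>M\<^sub>\<Omega>)\<bar> \<le> \<kappa> * (h2 * w2)"
      using L2_mult_Cauchy_Schwarz[OF e(1) wL(1)] params by (simp add: abs_mult h2_def w2_def)
    ultimately have "\<bar>\<nu> * (\<integral>x. H x \<bullet> grad w x \<partial>M\<^sub>\<Omega>) + \<kappa> * (\<integral>x. e x * w x \<partial>M\<^sub>\<Omega>)\<bar> \<le> \<nu> * (h1 * w1) + \<kappa> * (h2 * w2)"
      by linarith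
    also have "\<dots> \<le> sqrt (\<nu> * h1\<^sup>2 + \<kappa> * h2\<^sup>2) * sqrt (\<nu> * w1\<^sup>2 + \<kappa> * w2\<^sup>2)"
    proof -
      have "(\<nu> * (h1 * w1) + \<kappa> * (h2 * w2))\<^sup>2 \<le> (\<nu> * h1\<^sup>2 + \<kappa> * h2\<^sup>2) * (\<nu> * w1\<^sup>2 + \<kappa> * w2\<^sup>2)"
      proof -
        have "(\<nu> * h1\<^sup>2 + \<kappa> * h2\<^sup>2) * (\<nu> * w1\<^sup>2 + \<kappa> * w2\<^sup>2) - (\<nu> * (h1 * w1) + \<kappa> * (h2 * w2))\<^sup>2
            = \<nu> * \<kappa> * (h1 * w2 - h2 * w1)\<^sup>2"
          by (simp add: power2_eq_square algebra_simps)
        moreover have "0 \<le> \<nu> * \<kappa> * (h1 * w2 - h2 * w1)\<^sup>2" using params by simp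
        ultimately show ?thesis by linarith
      qed
      then show ?thesis unfolding real_sqrt_mult[symmetric] by (rule real_le_rsqrt)
    qed
    finally show ?thesis by (simp add: EE EW h1_def h2_def w1_def w2_def)
  qed
  have "\<bar>s * conv w\<bar> = \<bar>conv w\<bar>" using s by (simp add: abs_mult)
  then have 2: "\<bar>s * conv w\<bar> \<le> dual_norm * EW" using conv_bound[OF w] by (simp add: EW_def)
  have 3: "\<bar>\<integral>x. d x * w x \<partial>M\<^sub>\<Omega>\<bar> \<le> l2_norm M\<^sub>\<Omega> d / sqrt \<kappa> * EW"
  proof -
    have "\<bar>\<integral>x. d x * w x \<partial>M\<^sub>\<Omega>\<bar> \<le> l2_norm M\<^sub>\<Omega> d * l2_norm M\<^sub>\<Omega> w" by (rule L2_mult_Cauchy_Schwarz[OF d wL(1)])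
    also have "\<dots> = l2_norm M\<^sub>\<Omega> d / sqrt \<kappa> * (sqrt \<kappa> * l2_norm M\<^sub>\<Omega> w)" using params by simp
    also have "\<dots> \<le> l2_norm M\<^sub>\<Omega> d / sqrt \<kappa> * EW"
      unfolding EW_def using params l2_norm_nonneg[of M\<^sub>\<Omega> d] by (intro mult_left_mono l2_le_energy) auto
    finally show ?thesis .
  qed
  have "(R_norm \<Omega> \<nu> \<kappa> b e + l2_norm M\<^sub>\<Omega> d / sqrt \<kappa>) * EW
      = energy_norm \<Omega> \<nu> \<kappa> e * EW + dual_norm * EW + l2_norm M\<^sub>\<Omega> d / sqrt \<kappa> * EW"
    by (simp add: R_norm_eq algebra_simps)
  then show ?thesis unfolding test_energy[OF w, symmetric] EW_def[symmetric] using 1 2 3 by linarith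
qed

end

section \<open>Weak forms on test functions\<close>

lemma form_on_test:
  assumes O: "open \<Omega>" and b: "convection_field \<Omega> b" and y: "y \<in> H10 \<Omega>" and w: "w \<in> test_functions \<Omega>"
  shows "form_B \<Omega> \<nu> \<kappa> b y w = \<nu> * (\<integral>x. wgrad \<Omega> y x \<bullet> grad w x \<partial>lebesgue_on \<Omega>)
      + 1 * (\<integral>x. (b x \<bullet> wgrad \<Omega> y x) * w x \<partial>lebesgue_on \<Omega>) + \<kappa> * (\<integral>x. y x * w x \<partial>lebesgue_on \<Omega>)"
    and "form_B_adj \<Omega> \<nu> \<kappa> b y w = \<nu> * (\<integral>x. wgrad \<Omega> y x \<bullet> grad w x \<partial>lebesgue_on \<Omega>)
      + (- 1) * (\<integral>x. (b x \<bullet> wgrad \<Omega> y x) * w x \<partial>lebesgue_on \<Omega>) + \<kappa> * (\<integral>x. y x * w x \<partial>lebesgue_on \<Omega>)"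
proof -
  note yL = H10_facts(1,2)[OF O y] and wL = test_function_H10(3,4)[OF O w]
  have OL: "\<Omega> \<in> sets lebesgue" using O by auto
  have ae: "AE x in lebesgue_on \<Omega>. wgrad \<Omega> y x \<bullet> grad w x = wgrad \<Omega> y x \<bullet> wgrad \<Omega> w x"
    using test_function_H10(2)[OF O w] by eventually_elim simp
  have g: "(\<integral>x. wgrad \<Omega> y x \<bullet> wgrad \<Omega> w x \<partial>lebesgue_on \<Omega>) = (\<integral>x. wgrad \<Omega> y x \<bullet> grad w x \<partial>lebesgue_on \<Omega>)"
    by (rule integral_lebesgue_on_cong_AE(1)[OF OL borel_measurable_integrable[OF L2_inner_integrable[OF yL(2) wL(2)]] ae])
  note i = L2_mult_integrable[OF convection_L2[OF b yL(2)] wL(1)] L2_mult_integrable[OF yL(1) wL(1)]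
  show "form_B \<Omega> \<nu> \<kappa> b y w = \<nu> * (\<integral>x. wgrad \<Omega> y x \<bullet> grad w x \<partial>lebesgue_on \<Omega>)
      + 1 * (\<integral>x. (b x \<bullet> wgrad \<Omega> y x) * w x \<partial>lebesgue_on \<Omega>) + \<kappa> * (\<integral>x. y x * w x \<partial>lebesgue_on \<Omega>)"
    using i by (simp add: form_B_def l2_inner_def g distrib_right mult.assoc)
  show "form_B_adj \<Omega> \<nu> \<kappa> b y w = \<nu> * (\<integral>x. wgrad \<Omega> y x \<bullet> grad w x \<partial>lebesgue_on \<Omega>)
      + (- 1) * (\<integral>x. (b x \<bullet> wgrad \<Omega> y x) * w x \<partial>lebesgue_on \<Omega>) + \<kappa> * (\<integral>x. y x * w x \<partial>lebesgue_on \<Omega>)"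
    using i by (simp add: form_B_adj_def l2_inner_def g left_diff_distrib mult.assoc)
qed

context simplicial_mesh
begin

lemma VT_L2:
  assumes v: "v \<in> VT \<Omega> T"
  shows "v \<in> L2 (lebesgue_on \<Omega>)"
proof -
  have K: "compact (closure \<Omega>)" using regular_domain(2) by simp
  have L: "v \<in> L2 (lebesgue_on (closure \<Omega>))"
    using v by (intro continuous_compact_L2[OF K]) (simp add: VT_def)
  have "closure \<Omega> \<in> sets lebesgue" by auto
  then have "integrable (lebesgue_on \<Omega>) (\<lambda>x. (norm (v x))\<^sup>2)"
    using L by (intro integrable_lebesgue_on_subset[OF _ element_sets(3) _ closure_subset]) (auto simp: L2_def)
  moreover have "v \<in> borel_measurable (lebesgue_on \<Omega>)"
    using L measurable_restrict_mono[OF _ closure_subset] by (auto simp: L2_def)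
  ultimately show ?thesis by (simp add: L2_def)
qed

text \<open>The exact equation, tested with \<open>w\<close>, turns the discrete residual into a functional of the error. The data of the exact
  and of the discrete problem are \<open>F\<close> and \<open>Fh\<close>.\<close>

lemma residual_identity:
  assumes b: "convection_field \<Omega> b" and y: "y \<in> H10 \<Omega>" and v: "v \<in> VT \<Omega> T" and w: "w \<in> test_functions \<Omega>"
    and F: "F \<in> L2 (lebesgue_on \<Omega>)" "Fh \<in> L2 (lebesgue_on \<Omega>)"
    and eq: "\<nu> * (\<integral>x. wgrad \<Omega> y x \<bullet> grad w x \<partial>lebesgue_on \<Omega>) + s * (\<integral>x. (b x \<bullet> wgrad \<Omega> y x) * w x \<partial>lebesgue_on \<Omega>)
      + \<kappa> * (\<integral>x. y x * w x \<partial>lebesgue_on \<Omega>) = (\<integral>x. F x * w x \<partial>lebesgue_on \<Omega>)"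
    and res: "\<And>K x. K \<in> T \<Longrightarrow> res K x + osc K x = Fh x - s * (b x \<bullet> elem_grad v K) - \<kappa> * v x"
  shows "(\<Sum>K\<in>T. \<integral>x. (res K x + osc K x) * w x \<partial>lebesgue_on K) - \<nu> * (\<integral>x. pw_grad v x \<bullet> grad w x \<partial>lebesgue_on \<Omega>)
    = \<nu> * (\<integral>x. (wgrad \<Omega> y x - pw_grad v x) \<bullet> grad w x \<partial>lebesgue_on \<Omega>)
      + s * (\<integral>x. (b x \<bullet> (wgrad \<Omega> y x - pw_grad v x)) * w x \<partial>lebesgue_on \<Omega>)
      + \<kappa> * (\<integral>x. (y x - v x) * w x \<partial>lebesgue_on \<Omega>) - (\<integral>x. (F x - Fh x) * w x \<partial>lebesgue_on \<Omega>)"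
proof -
  let ?M = "lebesgue_on \<Omega>"
  note yL = H10_facts(1,2)[OF regular_domain(1) y] and wL = test_function_H10(3,4)[OF regular_domain(1) w]
  note vL = VT_L2[OF v]
  define r where "r x = Fh x * w x - s * ((b x \<bullet> pw_grad v x) * w x) - \<kappa> * (v x * w x)" for x
  note i = L2_mult_integrable[OF F(1) wL(1)] L2_mult_integrable[OF F(2) wL(1)]
    L2_mult_integrable[OF convection_L2[OF b pw_grad_L2] wL(1), of v] L2_mult_integrable[OF vL wL(1)]
    L2_mult_integrable[OF convection_L2[OF b yL(2)] wL(1)] L2_mult_integrable[OF yL(1) wL(1)]
    L2_inner_integrable[OF yL(2) wL(2)] L2_inner_integrable[OF pw_grad_L2 wL(2), of v]
  have ri: "integrable ?M r"
    unfolding r_def using i by (intro Bochner_Integration.integrable_diff integrable_mult_right)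
  have "(\<integral>x. (res K x + osc K x) * w x \<partial>lebesgue_on K) = (\<integral>x. r x \<partial>lebesgue_on K)" if K: "K \<in> T" for K
  proof -
    have "AE x in lebesgue_on K. r x = (res K x + osc K x) * w x"
      using AE_element_interior[OF K] unfolding AE_lebesgue_on_iff[OF element_sets(1)[OF K]]
    proof eventually_elim
      case (elim x)
      then show ?case
        using pw_grad_eq[OF K, of x v] unfolding res[OF K] by (simp add: r_def algebra_simps)
    qed
    then show ?thesis
      using integrable_element[OF K ri]
      by (intro integral_lebesgue_on_cong_AE(1)[OF element_sets(1)[OF K]]) auto
  qed
  then have "(\<Sum>K\<in>T. \<integral>x. (res K x + osc K x) * w x \<partial>lebesgue_on K) = (\<Sum>K\<in>T. \<integral>x. r x \<partial>lebesgue_on K)"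
    by (intro sum.cong) auto
  also have "\<dots> = (\<integral>x. r x \<partial>?M)"
    using mesh_integral(2)[OF integrable_element[OF _ ri]] by simp
  also have "\<dots> = (\<integral>x. Fh x * w x \<partial>?M) - s * (\<integral>x. (b x \<bullet> pw_grad v x) * w x \<partial>?M) - \<kappa> * (\<integral>x. v x * w x \<partial>?M)"
    unfolding r_def using i by (simp add: Bochner_Integration.integral_diff)
  finally have 1: "(\<Sum>K\<in>T. \<integral>x. (res K x + osc K x) * w x \<partial>lebesgue_on K)
      = (\<integral>x. Fh x * w x \<partial>?M) - s * (\<integral>x. (b x \<bullet> pw_grad v x) * w x \<partial>?M) - \<kappa> * (\<integral>x. v x * w x \<partial>?M)" .
  have 2: "(\<integral>x. (wgrad \<Omega> y x - pw_grad v x) \<bullet> grad w x \<partial>?M)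
      = (\<integral>x. wgrad \<Omega> y x \<bullet> grad w x \<partial>?M) - (\<integral>x. pw_grad v x \<bullet> grad w x \<partial>?M)"
    using i by (simp add: inner_diff_left)
  have 3: "(\<integral>x. (b x \<bullet> (wgrad \<Omega> y x - pw_grad v x)) * w x \<partial>?M)
      = (\<integral>x. (b x \<bullet> wgrad \<Omega> y x) * w x \<partial>?M) - (\<integral>x. (b x \<bullet> pw_grad v x) * w x \<partial>?M)"
    using i by (simp add: inner_diff_right left_diff_distrib)
  have 4: "(\<integral>x. (y x - v x) * w x \<partial>?M) = (\<integral>x. y x * w x \<partial>?M) - (\<integral>x. v x * w x \<partial>?M)"
    "(\<integral>x. (F x - Fh x) * w x \<partial>?M) = (\<integral>x. F x * w x \<partial>?M) - (\<integral>x. Fh x * w x \<partial>?M)"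
    using i by (simp_all add: left_diff_distrib)
  show ?thesis unfolding 1 2 3 4 using eq by (simp add: algebra_simps)
qed

lemma convection_error_exists:
  assumes "\<Omega> \<noteq> {}" "0 < \<nu>" "0 < \<kappa>" "convection_field \<Omega> b" "y \<in> H10 \<Omega>" "v \<in> VT \<Omega> T"
  shows "convection_error \<Omega> T \<nu> \<kappa> b (\<lambda>x. y x - v x) (\<lambda>x. wgrad \<Omega> y x - pw_grad v x)"
proof unfold_locales
  show "(\<lambda>x. y x - v x) \<in> L2 (lebesgue_on \<Omega>)"
    by (rule L2_diff[OF H10_facts(1)[OF regular_domain(1) assms(5)] VT_L2[OF assms(6)]])
  show "(\<lambda>x. wgrad \<Omega> y x - pw_grad v x) \<in> L2 (lebesgue_on \<Omega>)"
    by (rule L2_diff[OF H10_facts(2)[OF regular_domain(1) assms(5)] pw_grad_L2])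
  show "is_weak_grad \<Omega> (\<lambda>x. y x - v x) (\<lambda>x. wgrad \<Omega> y x - pw_grad v x)"
    by (rule is_weak_grad_diff[OF regular_domain(1) H10_facts(3)[OF regular_domain(1) assms(5)] VT_weak_grad[OF assms(6)]])
qed (use assms in auto)

lemma proj_affine:
  assumes K: "K \<in> T" and f: "f \<in> L2 (lebesgue_on K)"
  obtains c g where "\<And>x. proj_P1 K f x = c + g \<bullet> x"
  using proj_P1_in_P1[OF full_simplex(1,3)[OF simplex_T[OF K]] f] by (auto simp: P1_def)

lemma affine_element_L2: "K \<in> T \<Longrightarrow> (\<lambda>x. c + g \<bullet> x) \<in> L2 (lebesgue_on K)"
  by (intro continuous_compact_L2 full_simplex(1)[OF simplex_T] continuous_intros)

lemma proj_L2:
  assumes K: "K \<in> T" and f: "f \<in> L2 (lebesgue_on K)"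
  shows "proj_P1 K f \<in> L2 (lebesgue_on K)"
proof -
  obtain c g where "\<And>x. proj_P1 K f x = c + g \<bullet> x" using proj_affine[OF K f] by blast
  then have "proj_P1 K f = (\<lambda>x. c + g \<bullet> x)" by auto
  then show ?thesis using affine_element_L2[OF K] by simp
qed

lemma convection_element_L2:
  assumes "convection_field \<Omega> b" "K \<in> T"
  shows "(\<lambda>x. b x \<bullet> g) \<in> L2 (lebesgue_on K)"
proof -
  have "(\<lambda>x. g) \<in> L2 (lebesgue_on \<Omega>)" by (rule L2_bounded[OF domain_lmeasurable, of _ "norm g"]) auto
  from L2_element[OF assms(2) convection_L2[OF assms(1) this]] show ?thesis .
qed

end

section \<open>The control estimator\<close>

text \<open>The pointwise projection \<open>P\<close> is itself admissible. It satisfies \<open>(P - z) * (P - u) \<le> 0\<close> for \<open>z = - p / \<theta>\<close>, so the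
  variational inequality tested with it says \<open>- \<theta> * \<integral> (P - u)\<^sup>2 \<ge> 0\<close>.\<close>

lemma optimal_control_projection:
  assumes O: "\<Omega> \<in> lmeasurable" and \<theta>: "0 < \<theta>" "lo < hi" and p: "p \<in> L2 (lebesgue_on \<Omega>)" and u: "u \<in> Uad \<Omega> lo hi"
    and vi: "\<And>u'. u' \<in> Uad \<Omega> lo hi \<Longrightarrow> 0 \<le> l2_inner (lebesgue_on \<Omega>) (\<lambda>x. p x + \<theta> * u x) (\<lambda>x. u' x - u x)"
  shows "AE x in lebesgue_on \<Omega>. u x = proj_box lo hi (\<lambda>z. - (1 / \<theta>) * p z) x"
proof -
  define P where "P = proj_box lo hi (\<lambda>z. - (1 / \<theta>) * p z)"
  have Pm: "P \<in> borel_measurable (lebesgue_on \<Omega>)"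
    unfolding P_def proj_box_def[abs_def] using p by (auto simp: L2_def)
  have Pb: "lo \<le> P x" "P x \<le> hi" for x using \<theta> by (auto simp: P_def proj_box_def)
  have PL: "P \<in> L2 (lebesgue_on \<Omega>)"
  proof (rule L2_bounded[OF O Pm])
    show "norm (P x) \<le> \<bar>lo\<bar> + \<bar>hi\<bar>" for x using Pb[of x] by auto
  qed
  have PU: "P \<in> Uad \<Omega> lo hi" using PL Pb by (simp add: Uad_def)
  have uL: "u \<in> L2 (lebesgue_on \<Omega>)" and ub: "AE x in lebesgue_on \<Omega>. lo \<le> u x \<and> u x \<le> hi"
    using u by (auto simp: Uad_def)
  have dL: "(\<lambda>x. P x - u x) \<in> L2 (lebesgue_on \<Omega>)" by (rule L2_diff[OF PL uL])
  have di: "integrable (lebesgue_on \<Omega>) (\<lambda>x. (P x - u x)\<^sup>2)" using dL by (simp add: L2_def)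
  have "0 \<le> (\<integral>x. (p x + \<theta> * u x) * (P x - u x) \<partial>lebesgue_on \<Omega>)"
    using vi[OF PU] by (simp add: l2_inner_def)
  also have "\<dots> \<le> (\<integral>x. - \<theta> * (P x - u x)\<^sup>2 \<partial>lebesgue_on \<Omega>)"
  proof (rule integral_mono_AE)
    show "integrable (lebesgue_on \<Omega>) (\<lambda>x. (p x + \<theta> * u x) * (P x - u x))"
      by (rule L2_mult_integrable[OF L2_add[OF p L2_cmult[OF uL]] dL])
    show "integrable (lebesgue_on \<Omega>) (\<lambda>x. - \<theta> * (P x - u x)\<^sup>2)"
      using di by (rule integrable_mult_right)
    show "AE x in lebesgue_on \<Omega>. (p x + \<theta> * u x) * (P x - u x) \<le> - \<theta> * (P x - u x)\<^sup>2"
      using ub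
    proof eventually_elim
      case (elim x)
      define z where "z = - (1 / \<theta>) * p x"
      have pz: "p x = - \<theta> * z" using \<theta> by (simp add: z_def)
      have Px: "P x = min hi (max lo z)" by (simp add: P_def proj_box_def z_def)
      have "(P x - z) * (P x - u x) \<le> 0"
        using elim \<theta> unfolding Px by (auto simp: min_def max_def mult_le_0_iff)
      then have "\<theta> * ((P x - z) * (P x - u x)) \<le> 0" using \<theta> by (simp add: mult_le_0_iff)
      then show ?case by (simp add: pz power2_eq_square algebra_simps)
    qed
  qed
  finally have "\<theta> * (\<integral>x. (P x - u x)\<^sup>2 \<partial>lebesgue_on \<Omega>) \<le> 0" by simp
  then have "(\<integral>x. (P x - u x)\<^sup>2 \<partial>lebesgue_on \<Omega>) \<le> 0" using \<theta> by (simp add: mult_le_0_iff)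
  moreover have "0 \<le> (\<integral>x. (P x - u x)\<^sup>2 \<partial>lebesgue_on \<Omega>)" by simp
  ultimately have "(\<integral>x. (P x - u x)\<^sup>2 \<partial>lebesgue_on \<Omega>) = 0" by linarith
  then have "AE x in lebesgue_on \<Omega>. (P x - u x)\<^sup>2 = 0"
    using integral_nonneg_eq_0_iff_AE[OF di] by simp
  then show ?thesis unfolding P_def by eventually_elim simp
qed

text \<open>The discrete control is compared with the exact one, which is the projection of \<open>- p / \<theta>\<close>; the projection onto an
  interval is 1-Lipschitz.\<close>

lemma eta_ct_bound:
  assumes O: "\<Omega> \<in> lmeasurable" and \<theta>: "0 < \<theta>" "lo < hi"
    and L: "p \<in> L2 (lebesgue_on \<Omega>)" "pT \<in> L2 (lebesgue_on \<Omega>)" "uT \<in> L2 (lebesgue_on \<Omega>)" and u: "u \<in> Uad \<Omega> lo hi"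
    and vi: "\<And>u'. u' \<in> Uad \<Omega> lo hi \<Longrightarrow> 0 \<le> l2_inner (lebesgue_on \<Omega>) (\<lambda>x. p x + \<theta> * u x) (\<lambda>x. u' x - u x)"
  shows "(eta_ct \<Omega> \<theta> lo hi pT uT)\<^sup>2
    \<le> 2 * (l2_norm (lebesgue_on \<Omega>) (\<lambda>x. u x - uT x))\<^sup>2 + 2 / \<theta>\<^sup>2 * (l2_norm (lebesgue_on \<Omega>) (\<lambda>x. p x - pT x))\<^sup>2"
proof -
  let ?M = "lebesgue_on \<Omega>"
  define P where "P = proj_box lo hi (\<lambda>z. - (1 / \<theta>) * pT z)"
  have uL: "u \<in> L2 ?M" using u by (simp add: Uad_def)
  have Pm: "P \<in> borel_measurable ?M"
    unfolding P_def proj_box_def[abs_def] using L by (auto simp: L2_def)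
  have PL: "P \<in> L2 ?M"
  proof (rule L2_bounded[OF O Pm])
    show "norm (P x) \<le> \<bar>lo\<bar> + \<bar>hi\<bar>" for x using \<theta> by (auto simp: P_def proj_box_def)
  qed
  have i: "integrable ?M (\<lambda>x. (norm (u x - uT x))\<^sup>2)" "integrable ?M (\<lambda>x. (norm (p x - pT x))\<^sup>2)"
    "integrable ?M (\<lambda>x. (norm (uT x - P x))\<^sup>2)"
    using L2_diff[OF uL L(3)] L2_diff[OF L(1,2)] L2_diff[OF L(3) PL] by (auto simp: L2_def)
  have "(eta_ct \<Omega> \<theta> lo hi pT uT)\<^sup>2 = (\<integral>x. (norm (uT x - P x))\<^sup>2 \<partial>?M)"
    unfolding eta_ct_def l2_norm_sq P_def ..
  also have "\<dots> \<le> (\<integral>x. 2 * (norm (u x - uT x))\<^sup>2 + 2 / \<theta>\<^sup>2 * (norm (p x - pT x))\<^sup>2 \<partial>?M)"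
  proof (rule integral_mono_AE[OF i(3)])
    show "integrable ?M (\<lambda>x. 2 * (norm (u x - uT x))\<^sup>2 + 2 / \<theta>\<^sup>2 * (norm (p x - pT x))\<^sup>2)"
      using i by (intro Bochner_Integration.integrable_add integrable_mult_right)
    show "AE x in ?M. (norm (uT x - P x))\<^sup>2 \<le> 2 * (norm (u x - uT x))\<^sup>2 + 2 / \<theta>\<^sup>2 * (norm (p x - pT x))\<^sup>2"
    proof -
      have "AE x in ?M. u x = proj_box lo hi (\<lambda>z. - (1 / \<theta>) * p z) x"
        by (rule optimal_control_projection[OF O \<theta> L(1) u vi])
      then show ?thesis
      proof eventually_elim
      case (elim x)
      have "\<bar>u x - P x\<bar> \<le> \<bar>- (1 / \<theta>) * p x - (- (1 / \<theta>) * pT x)\<bar>"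
        unfolding elim P_def proj_box_def by (auto simp: min_def max_def)
      also have "\<dots> = \<bar>(1 / \<theta>) * (p x - pT x)\<bar>"
        by (simp only: right_diff_distrib abs_minus_commute mult_minus_left)
      also have "\<dots> = (1 / \<theta>) * \<bar>p x - pT x\<bar>" using \<theta> by (simp add: abs_mult)
      finally have "\<bar>uT x - P x\<bar> \<le> \<bar>u x - uT x\<bar> + (1 / \<theta>) * \<bar>p x - pT x\<bar>" by linarith
      then have "\<bar>uT x - P x\<bar>\<^sup>2 \<le> (\<bar>u x - uT x\<bar> + (1 / \<theta>) * \<bar>p x - pT x\<bar>)\<^sup>2" by (intro power_mono) auto
      also have "\<dots> \<le> 2 * \<bar>u x - uT x\<bar>\<^sup>2 + 2 * ((1 / \<theta>) * \<bar>p x - pT x\<bar>)\<^sup>2"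
        using sum_squares_bound[of "\<bar>u x - uT x\<bar>" "(1 / \<theta>) * \<bar>p x - pT x\<bar>"] unfolding power2_sum by linarith
      also have "\<dots> = 2 * (norm (u x - uT x))\<^sup>2 + 2 / \<theta>\<^sup>2 * (norm (p x - pT x))\<^sup>2"
        by (simp add: power_mult_distrib power_divide)
      finally show ?case by simp
      qed
    qed
  qed
  also have "\<dots> = 2 * (l2_norm ?M (\<lambda>x. u x - uT x))\<^sup>2 + 2 / \<theta>\<^sup>2 * (l2_norm ?M (\<lambda>x. p x - pT x))\<^sup>2"
    unfolding l2_norm_sq by (subst Bochner_Integration.integral_add) (use i in auto)
  finally show ?thesis .
qed

section \<open>Efficiency of the estimators\<close>

text \<open>State and adjoint equation at once, for \<open>s = 1\<close> and \<open>s = - 1\<close>. The second conclusion allows the error of one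
  equation to be inserted as data error into the other.\<close>

lemma estimator_efficiency:
  fixes \<Omega> :: "(real ^ 'd) set"
  assumes mesh: "regular_mesh \<Omega> T \<sigma>" and ne: "\<Omega> \<noteq> {}" and params: "0 < \<nu>" "0 < \<kappa>" and b: "convection_field \<Omega> b"
    and y: "y \<in> H10 \<Omega>" and v: "v \<in> VT \<Omega> T"
    and F: "F \<in> L2 (lebesgue_on \<Omega>)" "Fh \<in> L2 (lebesgue_on \<Omega>)" and s: "\<bar>s\<bar> = 1"
    and eq: "\<And>w. w \<in> test_functions \<Omega> \<Longrightarrow>
      \<nu> * (\<integral>x. wgrad \<Omega> y x \<bullet> grad w x \<partial>lebesgue_on \<Omega>) + s * (\<integral>x. (b x \<bullet> wgrad \<Omega> y x) * w x \<partial>lebesgue_on \<Omega>)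
      + \<kappa> * (\<integral>x. y x * w x \<partial>lebesgue_on \<Omega>) = (\<integral>x. F x * w x \<partial>lebesgue_on \<Omega>)"
    and res: "\<And>K x. K \<in> T \<Longrightarrow> res K x + osc K x = Fh x - s * (b x \<bullet> elem_grad v K) - \<kappa> * v x"
    and res_affine: "\<And>K. K \<in> T \<Longrightarrow> \<exists>c g. AE x in lebesgue_on K. res K x = c + g \<bullet> x"
    and osc: "\<And>K. K \<in> T \<Longrightarrow> osc K \<in> L2 (lebesgue_on K)"
  shows "(estimator T \<nu> \<kappa> res v)\<^sup>2 \<le> 2 * estimator_const CARD('d) \<sigma> *
    ((R_norm \<Omega> \<nu> \<kappa> b (\<lambda>x. y x - v x))\<^sup>2 + (l2_norm (lebesgue_on \<Omega>) (\<lambda>x. F x - Fh x))\<^sup>2 / \<kappa>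
      + (osc_norm T \<nu> \<kappa> osc)\<^sup>2)"
    and "(l2_norm (lebesgue_on \<Omega>) (\<lambda>x. y x - v x))\<^sup>2 \<le> (R_norm \<Omega> \<nu> \<kappa> b (\<lambda>x. y x - v x))\<^sup>2 / \<kappa>"
proof -
  interpret regular_mesh \<Omega> T \<sigma> by (rule mesh)
  interpret err: convection_error \<Omega> T \<nu> \<kappa> b "\<lambda>x. y x - v x" "\<lambda>x. wgrad \<Omega> y x - pw_grad v x"
    by (rule convection_error_exists[OF ne params b y v])
  define R where "R = R_norm \<Omega> \<nu> \<kappa> b (\<lambda>x. y x - v x)"
  define N where "N = l2_norm (lebesgue_on \<Omega>) (\<lambda>x. F x - Fh x)"
  have R0: "0 \<le> R" unfolding R_def by (rule err.R_norm_nonneg)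
  have N0: "0 \<le> N / sqrt \<kappa>" unfolding N_def using params by (intro divide_nonneg_nonneg l2_norm_nonneg) auto
  have dL: "(\<lambda>x. F x - Fh x) \<in> L2 (lebesgue_on \<Omega>)" by (rule L2_diff[OF F])
  interpret rb: residual_bound \<Omega> T \<sigma> \<nu> \<kappa> "R + N / sqrt \<kappa>" v res osc
  proof unfold_locales
    fix w assume w: "w \<in> test_functions \<Omega>"
    show "\<bar>(\<Sum>K\<in>T. \<integral>x. (res K x + osc K x) * w x \<partial>lebesgue_on K)
        - \<nu> * (\<integral>x. pw_grad v x \<bullet> grad w x \<partial>lebesgue_on \<Omega>)\<bar>
      \<le> (R + N / sqrt \<kappa>) * sqrt (\<nu> * (\<integral>x. (norm (grad w x))\<^sup>2 \<partial>lebesgue_on \<Omega>) + \<kappa> * (\<integral>x. (w x)\<^sup>2 \<partial>lebesgue_on \<Omega>))"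
      using err.error_functional_bound[OF w dL s]
      unfolding residual_identity[where res = res and osc = osc, OF b y v w F eq[OF w] res, simplified] err.conv_def R_def N_def .
  qed (use params R0 N0 v res_affine osc in auto)
  have C: "0 \<le> estimator_const CARD('d) \<sigma>"
    using jump_constants_pos(6)[OF \<sigma>, of "CARD('d)"] dim by simp
  have "(R + N / sqrt \<kappa>)\<^sup>2 \<le> 2 * (R\<^sup>2 + N\<^sup>2 / \<kappa>)"
    using sum_squares_bound[of R "N / sqrt \<kappa>"] params by (simp add: power2_sum power_divide)
  then have "(R + N / sqrt \<kappa>)\<^sup>2 + (osc_norm T \<nu> \<kappa> osc)\<^sup>2 \<le> 2 * (R\<^sup>2 + N\<^sup>2 / \<kappa> + (osc_norm T \<nu> \<kappa> osc)\<^sup>2)"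
    using add_mono[of _ _ "(osc_norm T \<nu> \<kappa> osc)\<^sup>2" "2 * (osc_norm T \<nu> \<kappa> osc)\<^sup>2"]
    by (simp add: distrib_left)
  from order_trans[OF rb.estimator_bound mult_left_mono[OF this C]]
  show "(estimator T \<nu> \<kappa> res v)\<^sup>2 \<le> 2 * estimator_const CARD('d) \<sigma> *
    ((R_norm \<Omega> \<nu> \<kappa> b (\<lambda>x. y x - v x))\<^sup>2 + (l2_norm (lebesgue_on \<Omega>) (\<lambda>x. F x - Fh x))\<^sup>2 / \<kappa>
      + (osc_norm T \<nu> \<kappa> osc)\<^sup>2)"
    unfolding R_def N_def by (simp only: mult_ac)
  have "(l2_norm (lebesgue_on \<Omega>) (\<lambda>x. y x - v x))\<^sup>2 \<le> (R / sqrt \<kappa>)\<^sup>2"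
    using err.l2_le_R_norm l2_norm_nonneg unfolding R_def by (intro power_mono)
  then show "(l2_norm (lebesgue_on \<Omega>) (\<lambda>x. y x - v x))\<^sup>2 \<le> (R_norm \<Omega> \<nu> \<kappa> b (\<lambda>x. y x - v x))\<^sup>2 / \<kappa>"
    using params by (simp add: R_def power_divide)
qed

lemma inball_diameter_nonneg:
  fixes K :: "'a::euclidean_space set"
  assumes "bounded K" "K \<noteq> {}"
  shows "0 \<le> inball_diameter K"
proof -
  let ?S = "{2 * r | r. 0 \<le> r \<and> (\<exists>x. cball x r \<subseteq> K)}"
  obtain x where "x \<in> K" using assms(2) by auto
  then have "cball x 0 \<subseteq> K" by simp
  then have "2 * 0 \<in> ?S" by blast
  moreover have "bdd_above ?S"
  proof (rule bdd_aboveI)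
    fix t assume "t \<in> ?S"
    then obtain r x where "t = 2 * r" "0 \<le> r" "cball x r \<subseteq> K" by blast
    then show "t \<le> diameter K"
      using diameter_subset[OF \<open>cball x r \<subseteq> K\<close> assms(1)] by (simp add: diameter_cball)
  qed
  ultimately have "2 * 0 \<le> Sup ?S" by (rule cSup_upper)
  then show ?thesis by (simp add: inball_diameter_def)
qed

lemma mesh_family_regular:
  fixes \<Omega> :: "(real ^ 'd) set"
  assumes "2 \<le> CARD('d)" "polytopal_lipschitz_domain \<Omega>" "mesh_family \<Omega> T0 TT"
  obtains \<sigma> where "1 \<le> \<sigma>" "\<And>T. T \<in> TT \<Longrightarrow> regular_mesh \<Omega> T \<sigma>"
proof -
  obtain \<sigma>0 where \<sigma>0: "\<And>T K. T \<in> TT \<Longrightarrow> K \<in> T \<Longrightarrow> diameter K \<le> \<sigma>0 * inball_diameter K"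
    using assms(3) by (auto simp: mesh_family_def shape_regular_def)
  show ?thesis
  proof (rule that[of "max 1 \<sigma>0"])
    fix T assume T: "T \<in> TT"
    then have m: "mesh \<Omega> T" using assms(3) by (simp add: mesh_family_def)
    show "regular_mesh \<Omega> T (max 1 \<sigma>0)"
    proof unfold_locales
      show "open \<Omega>" "bounded \<Omega>" using assms(2) by (auto simp: polytopal_lipschitz_domain_def)
      show "interior (closure \<Omega>) = \<Omega>" by (rule polytopal_lipschitz_domain_regular[OF assms(2)])
      fix K assume K: "K \<in> T"
      have s: "int DIM(real ^ 'd) simplex K" using m K by (simp add: mesh_def)
      have "0 \<le> inball_diameter K"
        using full_simplex(1,3)[OF s] interior_subset by (intro inball_diameter_nonneg) (auto intro: compact_imp_bounded)
      then show "diameter K \<le> max 1 \<sigma>0 * inball_diameter K"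
        using order_trans[OF \<sigma>0[OF T K] mult_right_mono[of \<sigma>0 "max 1 \<sigma>0"]] by simp
    qed (use m assms(1) in auto)
  qed simp
qed

theorem theorem5p2:
  fixes \<Omega> :: "(real ^ 'd) set"
    and T0 :: "(real ^ 'd) set set" and TT :: "(real ^ 'd) set set set"
    and \<kappa> \<theta> lo hi C :: real
  assumes "CARD('d) = 2 \<or> CARD('d) = 3"
    and "polytopal_lipschitz_domain \<Omega>"
    and "mesh_family \<Omega> T0 TT"
    and "\<kappa> > 0" and "\<theta> > 0" and "lo < hi" and "C > 0"
  shows "\<exists>C2>0. \<forall>T\<in>TT. \<forall>\<nu> b f yd s s' \<tau>K \<tau>\<gamma> \<tau>K' \<tau>\<gamma>' y p u yT pT uT.
      0 < \<nu> \<and> \<nu> < 1 \<and> convection_field \<Omega> b \<and>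
      f \<in> L2 (lebesgue_on \<Omega>) \<and> yd \<in> L2 (lebesgue_on \<Omega>) \<and>
      stab_params s C T b \<tau>K \<tau>\<gamma> \<and> stab_params s' C T b \<tau>K' \<tau>\<gamma>' \<and>
      os_solution \<Omega> \<nu> \<kappa> b f yd \<theta> lo hi y p u \<and>
      ds_unique_solution s s' \<Omega> T \<nu> \<kappa> b f yd \<theta> lo hi \<tau>K \<tau>\<gamma> \<tau>K' \<tau>\<gamma>' yT pT uT \<longrightarrow>
      (estimator T \<nu> \<kappa> (res_state \<kappa> b f yT uT) yT)\<^sup>2
        + (estimator T \<nu> \<kappa> (res_adjoint \<kappa> b yd yT pT) pT)\<^sup>2
        + (eta_ct \<Omega> \<theta> lo hi pT uT)\<^sup>2
      \<le> C2 * ((R_norm \<Omega> \<nu> \<kappa> b (\<lambda>x. y x - yT x))\<^sup>2 + (R_norm \<Omega> \<nu> \<kappa> b (\<lambda>x. p x - pT x))\<^sup>2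
        + (l2_norm (lebesgue_on \<Omega>) (\<lambda>x. u x - uT x))\<^sup>2
        + (osc_norm T \<nu> \<kappa> (osc_state b f yT))\<^sup>2 + (osc_norm T \<nu> \<kappa> (osc_adjoint b yd pT))\<^sup>2)"
proof -
  have d2: "2 \<le> CARD('d)" using assms(1) by auto
  obtain \<sigma> where regular: "1 \<le> \<sigma>" "\<And>T. T \<in> TT \<Longrightarrow> regular_mesh \<Omega> T \<sigma>"
    using mesh_family_regular[OF d2 assms(2,3)] by blast
  define c where "c = estimator_const CARD('d) \<sigma>"
  have c: "0 < c" using jump_constants_pos(6)[OF regular(1) d2] by (simp add: c_def)
  \<comment> \<open>The summands \<open>1\<close>, \<open>1 / \<kappa>\<close>, \<open>1 / \<kappa>\<^sup>2\<close> account for the errors themselves, for the control as data of the state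
    equation, and for the state as data of the adjoint equation; the rest is the control estimator.\<close>
  define C2 where "C2 = 2 * c * (1 + 1 / \<kappa> + 1 / \<kappa>\<^sup>2) + 2 + 2 / (\<theta>\<^sup>2 * \<kappa>)"
  have ne: "\<Omega> \<noteq> {}" using assms(2) by (simp add: polytopal_lipschitz_domain_def)
  show ?thesis
  proof (intro exI[of _ C2] conjI ballI allI impI)
    show "0 < C2" unfolding C2_def using c assms(4,5) by (intro add_pos_pos mult_pos_pos) auto
    fix T \<nu> b f yd s s' \<tau>K \<tau>\<gamma> \<tau>K' \<tau>\<gamma>' y p u yT pT uT
    assume T: "T \<in> TT" and A: "0 < \<nu> \<and> \<nu> < 1 \<and> convection_field \<Omega> b \<and>
      f \<in> L2 (lebesgue_on \<Omega>) \<and> yd \<in> L2 (lebesgue_on \<Omega>) \<and>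
      stab_params s C T b \<tau>K \<tau>\<gamma> \<and> stab_params s' C T b \<tau>K' \<tau>\<gamma>' \<and>
      os_solution \<Omega> \<nu> \<kappa> b f yd \<theta> lo hi y p u \<and>
      ds_unique_solution s s' \<Omega> T \<nu> \<kappa> b f yd \<theta> lo hi \<tau>K \<tau>\<gamma> \<tau>K' \<tau>\<gamma>' yT pT uT"
    interpret regular_mesh \<Omega> T \<sigma> by (rule regular(2)[OF T])
    let ?M = "lebesgue_on \<Omega>"
    from A have \<nu>: "0 < \<nu>" and b: "convection_field \<Omega> b" and f: "f \<in> L2 ?M" and yd: "yd \<in> L2 ?M"
      and os: "os_solution \<Omega> \<nu> \<kappa> b f yd \<theta> lo hi y p u"
      and ds: "ds_solution s s' \<Omega> T \<nu> \<kappa> b f yd \<theta> lo hi \<tau>K \<tau>\<gamma> \<tau>K' \<tau>\<gamma>' yT pT uT"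
      unfolding ds_unique_solution_def by blast+
    have y: "y \<in> H10 \<Omega>" and p: "p \<in> H10 \<Omega>" and u: "u \<in> Uad \<Omega> lo hi"
      and st: "\<And>w. w \<in> H10 \<Omega> \<Longrightarrow> form_B \<Omega> \<nu> \<kappa> b y w = l2_inner ?M (\<lambda>x. f x + u x) w"
      and ad: "\<And>w. w \<in> H10 \<Omega> \<Longrightarrow> form_B_adj \<Omega> \<nu> \<kappa> b p w = l2_inner ?M (\<lambda>x. y x - yd x) w"
      and vi: "\<And>u'. u' \<in> Uad \<Omega> lo hi \<Longrightarrow> 0 \<le> l2_inner ?M (\<lambda>x. p x + \<theta> * u x) (\<lambda>x. u' x - u x)"
      using os unfolding os_solution_def by blast+
    have yT: "yT \<in> VT \<Omega> T" and pT: "pT \<in> VT \<Omega> T" and uT: "uT \<in> UadT \<Omega> T lo hi"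
      using ds unfolding ds_solution_def by blast+
    have uL: "u \<in> L2 ?M" and uTL: "uT \<in> L2 ?M" using u uT by (auto simp: Uad_def UadT_def)
    have yTL: "yT \<in> L2 ?M" and pTL: "pT \<in> L2 ?M" using VT_L2 yT pT by auto
    have yL: "y \<in> L2 ?M" and pL: "p \<in> L2 ?M" using H10_facts(1)[OF regular_domain(1)] y p by auto
    have st_test: "\<nu> * (\<integral>x. wgrad \<Omega> y x \<bullet> grad w x \<partial>?M) + 1 * (\<integral>x. (b x \<bullet> wgrad \<Omega> y x) * w x \<partial>?M)
        + \<kappa> * (\<integral>x. y x * w x \<partial>?M) = (\<integral>x. (f x + u x) * w x \<partial>?M)" if w: "w \<in> test_functions \<Omega>" for w
      using st[OF test_function_H10(1)[OF regular_domain(1) w]] form_on_test(1)[OF regular_domain(1) b y w]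
      by (simp add: l2_inner_def)
    have ad_test: "\<nu> * (\<integral>x. wgrad \<Omega> p x \<bullet> grad w x \<partial>?M) + (- 1) * (\<integral>x. (b x \<bullet> wgrad \<Omega> p x) * w x \<partial>?M)
        + \<kappa> * (\<integral>x. p x * w x \<partial>?M) = (\<integral>x. (y x - yd x) * w x \<partial>?M)" if w: "w \<in> test_functions \<Omega>" for w
      using ad[OF test_function_H10(1)[OF regular_domain(1) w]] form_on_test(2)[OF regular_domain(1) b p w]
      by (simp add: l2_inner_def)
    have bL: "(\<lambda>z. b z \<bullet> g) \<in> L2 (lebesgue_on K)" if "K \<in> T" for K g
      by (rule convection_element_L2[OF b that])
    have st_affine: "\<exists>c g. AE x in lebesgue_on K. res_state \<kappa> b f yT uT K x = c + g \<bullet> x" if K: "K \<in> T" for K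
    proof -
      obtain c1 g1 where 1: "\<And>x. proj_P1 K f x = c1 + g1 \<bullet> x" using proj_affine[OF K L2_element[OF K f]] by blast
      obtain c2 g2 where 2: "\<And>x. proj_P1 K (\<lambda>z. b z \<bullet> elem_grad yT K) x = c2 + g2 \<bullet> x" using proj_affine[OF K bL[OF K]] by blast
      obtain c3 where 3: "\<And>x. x \<in> K \<Longrightarrow> yT x = c3 + elem_grad yT K \<bullet> x" using VT_elem_grad[OF yT K] by blast
      obtain c4 where "AE x in lebesgue_on K. uT x = c4" using uT K by (auto simp: UadT_def)
      then have "AE x in lebesgue_on K. res_state \<kappa> b f yT uT K x
          = (c1 + c4 - c2 - \<kappa> * c3) + (g1 - g2 - \<kappa> *\<^sub>R elem_grad yT K) \<bullet> x"
        unfolding AE_lebesgue_on_iff[OF element_sets(1)[OF K]]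
        by eventually_elim (auto simp: res_state_def 1 2 3 inner_diff_left algebra_simps)
      then show ?thesis by blast
    qed
    have ad_affine: "\<exists>c g. AE x in lebesgue_on K. res_adjoint \<kappa> b yd yT pT K x = c + g \<bullet> x" if K: "K \<in> T" for K
    proof -
      obtain c1 g1 where 1: "\<And>x. proj_P1 K yd x = c1 + g1 \<bullet> x" using proj_affine[OF K L2_element[OF K yd]] by blast
      obtain c2 g2 where 2: "\<And>x. proj_P1 K (\<lambda>z. b z \<bullet> elem_grad pT K) x = c2 + g2 \<bullet> x" using proj_affine[OF K bL[OF K]] by blast
      obtain c3 where 3: "\<And>x. x \<in> K \<Longrightarrow> yT x = c3 + elem_grad yT K \<bullet> x" using VT_elem_grad[OF yT K] by blast
      obtain c4 where 4: "\<And>x. x \<in> K \<Longrightarrow> pT x = c4 + elem_grad pT K \<bullet> x" using VT_elem_grad[OF pT K] by blast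
      have "res_adjoint \<kappa> b yd yT pT K x
          = (c3 - c1 + c2 - \<kappa> * c4) + (elem_grad yT K - g1 + g2 - \<kappa> *\<^sub>R elem_grad pT K) \<bullet> x" if "x \<in> K" for x
        using that by (simp add: res_adjoint_def 1 2 3 4 inner_diff_left inner_add_left algebra_simps)
      then have "AE x in lebesgue_on K. res_adjoint \<kappa> b yd yT pT K x
          = (c3 - c1 + c2 - \<kappa> * c4) + (elem_grad yT K - g1 + g2 - \<kappa> *\<^sub>R elem_grad pT K) \<bullet> x"
        by (intro AE_I2) simp
      then show ?thesis by blast
    qed
    have st_osc: "osc_state b f yT K \<in> L2 (lebesgue_on K)" if K: "K \<in> T" for K
      unfolding osc_state_def[abs_def]
      by (intro L2_diff L2_element[OF K f] proj_L2[OF K] bL[OF K])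
    have ad_osc: "osc_adjoint b yd pT K \<in> L2 (lebesgue_on K)" if K: "K \<in> T" for K
    proof -
      have "osc_adjoint b yd pT K = (\<lambda>x. (b x \<bullet> elem_grad pT K - proj_P1 K (\<lambda>z. b z \<bullet> elem_grad pT K) x) - (yd x - proj_P1 K yd x))"
        by (auto simp: osc_adjoint_def)
      then show ?thesis
        by (simp only:) (intro L2_diff L2_element[OF K yd] proj_L2[OF K] bL[OF K])
    qed
    have st_est: "(estimator T \<nu> \<kappa> (res_state \<kappa> b f yT uT) yT)\<^sup>2 \<le> 2 * c *
        ((R_norm \<Omega> \<nu> \<kappa> b (\<lambda>x. y x - yT x))\<^sup>2 + (l2_norm ?M (\<lambda>x. (f x + u x) - (f x + uT x)))\<^sup>2 / \<kappa>
          + (osc_norm T \<nu> \<kappa> (osc_state b f yT))\<^sup>2)"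
      and y_err: "(l2_norm ?M (\<lambda>x. y x - yT x))\<^sup>2 \<le> (R_norm \<Omega> \<nu> \<kappa> b (\<lambda>x. y x - yT x))\<^sup>2 / \<kappa>"
      unfolding c_def
      by (rule estimator_efficiency[OF regular(2)[OF T] ne \<nu> assms(4) b y yT L2_add[OF f uL] L2_add[OF f uTL] _ st_test _ st_affine st_osc];
          simp add: res_state_def osc_state_def)+
    have ad_est: "(estimator T \<nu> \<kappa> (res_adjoint \<kappa> b yd yT pT) pT)\<^sup>2 \<le> 2 * c *
        ((R_norm \<Omega> \<nu> \<kappa> b (\<lambda>x. p x - pT x))\<^sup>2 + (l2_norm ?M (\<lambda>x. (y x - yd x) - (yT x - yd x)))\<^sup>2 / \<kappa>
          + (osc_norm T \<nu> \<kappa> (osc_adjoint b yd pT))\<^sup>2)"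
      and p_err: "(l2_norm ?M (\<lambda>x. p x - pT x))\<^sup>2 \<le> (R_norm \<Omega> \<nu> \<kappa> b (\<lambda>x. p x - pT x))\<^sup>2 / \<kappa>"
      unfolding c_def
      by (rule estimator_efficiency[OF regular(2)[OF T] ne \<nu> assms(4) b p pT L2_diff[OF yL yd] L2_diff[OF yTL yd] _ ad_test _ ad_affine ad_osc];
          simp add: res_adjoint_def osc_adjoint_def)+
    have ct: "(eta_ct \<Omega> \<theta> lo hi pT uT)\<^sup>2
        \<le> 2 * (l2_norm ?M (\<lambda>x. u x - uT x))\<^sup>2 + 2 / \<theta>\<^sup>2 * (l2_norm ?M (\<lambda>x. p x - pT x))\<^sup>2"
      by (rule eta_ct_bound[OF domain_lmeasurable assms(5,6) pL pTL uTL u vi])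
    define Ry Rp U E O1 O2 where "Ry = (R_norm \<Omega> \<nu> \<kappa> b (\<lambda>x. y x - yT x))\<^sup>2"
      and "Rp = (R_norm \<Omega> \<nu> \<kappa> b (\<lambda>x. p x - pT x))\<^sup>2" and "U = (l2_norm ?M (\<lambda>x. u x - uT x))\<^sup>2"
      and "E = (l2_norm ?M (\<lambda>x. y x - yT x))\<^sup>2"
      and "O1 = (osc_norm T \<nu> \<kappa> (osc_state b f yT))\<^sup>2" and "O2 = (osc_norm T \<nu> \<kappa> (osc_adjoint b yd pT))\<^sup>2"
    have nn: "0 \<le> Ry" "0 \<le> Rp" "0 \<le> U" "0 \<le> O1" "0 \<le> O2" by (auto simp: Ry_def Rp_def U_def O1_def O2_def)
    have \<kappa>: "0 < \<kappa>" by (rule assms(4))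
    have 1: "(estimator T \<nu> \<kappa> (res_state \<kappa> b f yT uT) yT)\<^sup>2 \<le> 2 * c * (Ry + U / \<kappa> + O1)"
      using st_est by (simp add: Ry_def U_def O1_def)
    have "E / \<kappa> \<le> Ry / \<kappa>\<^sup>2"
      using divide_right_mono[OF y_err, of \<kappa>] \<kappa> by (simp add: E_def Ry_def power2_eq_square)
    then have "2 * c * (Rp + E / \<kappa> + O2) \<le> 2 * c * (Rp + Ry / \<kappa>\<^sup>2 + O2)"
      using c by (intro mult_left_mono) auto
    then have 2: "(estimator T \<nu> \<kappa> (res_adjoint \<kappa> b yd yT pT) pT)\<^sup>2 \<le> 2 * c * (Rp + Ry / \<kappa>\<^sup>2 + O2)"
      using ad_est by (simp add: Rp_def E_def O2_def)
    have "2 / \<theta>\<^sup>2 * (l2_norm ?M (\<lambda>x. p x - pT x))\<^sup>2 \<le> 2 / \<theta>\<^sup>2 * (Rp / \<kappa>)"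
      unfolding Rp_def using p_err by (intro mult_left_mono) auto
    then have 3: "(eta_ct \<Omega> \<theta> lo hi pT uT)\<^sup>2 \<le> 2 * U + 2 / (\<theta>\<^sup>2 * \<kappa>) * Rp"
      using ct by (simp add: U_def)
    define k where "k = 1 + 1 / \<kappa> + 1 / \<kappa>\<^sup>2"
    have k: "1 \<le> k" "1 / \<kappa> \<le> k" "1 + 1 / \<kappa>\<^sup>2 \<le> k" using \<kappa> by (auto simp: k_def)
    have "(Ry + U / \<kappa> + O1) + (Rp + Ry / \<kappa>\<^sup>2 + O2) = (1 + 1 / \<kappa>\<^sup>2) * Ry + 1 * Rp + (1 / \<kappa>) * U + 1 * O1 + 1 * O2"
      by (simp add: algebra_simps)
    also have "\<dots> \<le> k * Ry + k * Rp + k * U + k * O1 + k * O2"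
      using k nn by (intro add_mono mult_right_mono) auto
    finally have "2 * c * ((Ry + U / \<kappa> + O1) + (Rp + Ry / \<kappa>\<^sup>2 + O2)) \<le> 2 * c * (k * Ry + k * Rp + k * U + k * O1 + k * O2)"
      using c by (intro mult_left_mono) auto
    then have 4: "2 * c * (Ry + U / \<kappa> + O1) + 2 * c * (Rp + Ry / \<kappa>\<^sup>2 + O2) \<le> 2 * c * k * (Ry + Rp + U + O1 + O2)"
      by (simp add: algebra_simps)
    have "2 * U + 2 / (\<theta>\<^sup>2 * \<kappa>) * Rp \<le> 2 * (Ry + Rp + U + O1 + O2) + 2 / (\<theta>\<^sup>2 * \<kappa>) * (Ry + Rp + U + O1 + O2)"
      using nn \<kappa> assms(5) by (intro add_mono mult_left_mono) auto
    then have "(estimator T \<nu> \<kappa> (res_state \<kappa> b f yT uT) yT)\<^sup>2 + (estimator T \<nu> \<kappa> (res_adjoint \<kappa> b yd yT pT) pT)\<^sup>2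
        + (eta_ct \<Omega> \<theta> lo hi pT uT)\<^sup>2
        \<le> 2 * c * k * (Ry + Rp + U + O1 + O2) + (2 * (Ry + Rp + U + O1 + O2) + 2 / (\<theta>\<^sup>2 * \<kappa>) * (Ry + Rp + U + O1 + O2))"
      using 1 2 3 4 by linarith
    also have "\<dots> = C2 * (Ry + Rp + U + O1 + O2)"
      by (simp only: C2_def k_def distrib_right add.assoc)
    finally show "(estimator T \<nu> \<kappa> (res_state \<kappa> b f yT uT) yT)\<^sup>2
        + (estimator T \<nu> \<kappa> (res_adjoint \<kappa> b yd yT pT) pT)\<^sup>2
        + (eta_ct \<Omega> \<theta> lo hi pT uT)\<^sup>2
      \<le> C2 * ((R_norm \<Omega> \<nu> \<kappa> b (\<lambda>x. y x - yT x))\<^sup>2 + (R_norm \<Omega> \<nu> \<kappa> b (\<lambda>x. p x - pT x))\<^sup>2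
        + (l2_norm (lebesgue_on \<Omega>) (\<lambda>x. u x - uT x))\<^sup>2
        + (osc_norm T \<nu> \<kappa> (osc_state b f yT))\<^sup>2 + (osc_norm T \<nu> \<kappa> (osc_adjoint b yd pT))\<^sup>2)"
      unfolding Ry_def Rp_def U_def O1_def O2_def .
  qed
qed

end
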